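(* Let $V_0$ be a real-valued, locally integrable function on $\mathbb{R}$ with period $L>0$, let $\Delta_{V_0}$ be its discriminant and $\mathcal{T}_{V_0}$ its isospectral torus. Let $V$ be a real-valued function in $L^1_{\mathrm{loc,unif}}(\mathbb{R})$ and $H=-\frac{d^2}{dx^2}+V$. Then $\Delta_{V_0}(H)=S_L+S_{-L}$ if and only if $V\in\mathcal{T}_{V_0}$.
   Context: $L^1_{\mathrm{loc,unif}}$ is the set of $V$ with $\sup_x\int_{x-1}^{x+1}|V(y)|\,dy<\infty$; then $H=-\frac{d^2}{dx^2}+V$ is defined as a self-adjoint operator on $L^2(\mathbb{R})$ via quadratic forms (form domain $H^1(\mathbb{R})$), bounded below. For a locally integrable potential $W$ and $E\in\mathbb{C}$, let $u_D(x,E)$, $u_N(x,E)$ be the absolutely continuous solutions of $-u''+Wu=Eu$ with $u_D(0)=0,u_D'(0)=1$ and $u_N(0)=1,u_N'(0)=0$. For $L$-periodic $W$, the discriminant is the entire function $\Delta_W(E)=u_N(L,E)+u_D'(L,E)$. The isospectral torus $\mathcal{T}_{V_0}$ is the set of $L$-periodic potentials $W$ with $\Delta_W=\Delta_{V_0}$. $\Delta_{V_0}(H)$ is defined by the functional calculus. $(S_yu)(x)=u(x-y)$. *)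

theory Defs
  imports "HOL-Analysis.Analysis"
begin

definition int0 :: "(real \<Rightarrow> complex) \<Rightarrow> real \<Rightarrow> complex" where
  "int0 f x = interval_lebesgue_integral lebesgue (ereal 0) (ereal x) f"

definition sq_int :: "(real \<Rightarrow> complex) \<Rightarrow> bool" where
  "sq_int f \<longleftrightarrow> f \<in> borel_measurable lebesgue \<and> integrable lebesgue (\<lambda>x. (cmod (f x))^2)"

definition inner_L2 :: "(real \<Rightarrow> complex) \<Rightarrow> (real \<Rightarrow> complex) \<Rightarrow> complex" where
  "inner_L2 f g = (\<integral>x. cnj (f x) * g x \<partial>lebesgue)"

definition H1 :: "(real \<Rightarrow> complex) \<Rightarrow> (real \<Rightarrow> complex) \<Rightarrow> bool" where
  "H1 u u' \<longleftrightarrow> continuous_on UNIV u \<and> sq_int u \<and> sq_int u' \<and>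
     (\<forall>x. u x = u 0 + int0 u' x)"

definition loc_int :: "(real \<Rightarrow> real) \<Rightarrow> bool" where
  "loc_int W \<longleftrightarrow> (\<forall>a b. set_integrable lebesgue {a..b} W)"

definition L1_loc_unif :: "(real \<Rightarrow> real) \<Rightarrow> bool" where
  "L1_loc_unif V \<longleftrightarrow> loc_int V \<and>
     (\<exists>C. \<forall>x. (LINT y:{x-1..x+1}|lebesgue. \<bar>V y\<bar>) \<le> C)"

text \<open>The quadratic form q(phi,u) = <phi',u'> + <phi, V u> on H^1, and the
  weak equation (H - z) u = f: u in the form domain and
  q(phi,u) - z <phi,u> = <phi,f> for all phi in the form domain.
  This is exactly u \<in> dom(H) with (H - z) u = f for the operator associated
  with the closed, lower bounded form q, i.e. u = (H - z)^{-1} f.\<close>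
definition resolvent_sol ::
  "(real \<Rightarrow> real) \<Rightarrow> complex \<Rightarrow> (real \<Rightarrow> complex) \<Rightarrow> (real \<Rightarrow> complex) \<Rightarrow> (real \<Rightarrow> complex) \<Rightarrow> bool" where
  "resolvent_sol V z f u u' \<longleftrightarrow> H1 u u' \<and>
     (\<forall>\<phi> \<phi>'. H1 \<phi> \<phi>' \<longrightarrow>
        (\<integral>x. cnj (\<phi>' x) * u' x \<partial>lebesgue)
        + (\<integral>x. complex_of_real (V x) * cnj (\<phi> x) * u x \<partial>lebesgue)
        - z * (\<integral>x. cnj (\<phi> x) * u x \<partial>lebesgue)
        = (\<integral>x. cnj (\<phi> x) * f x \<partial>lebesgue))"

text \<open>Spectral measure mu_f of H for the vector f: the finite Borel measure
  on R with  int 1/(l - z) d mu_f(l) = <f, (H - z)^{-1} f>  for all non-real z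
  (a finite Borel measure is determined by its Borel transform).\<close>
definition spec_meas :: "(real \<Rightarrow> real) \<Rightarrow> (real \<Rightarrow> complex) \<Rightarrow> real measure \<Rightarrow> bool" where
  "spec_meas V f \<mu> \<longleftrightarrow> sets \<mu> = sets borel \<and> finite_measure \<mu> \<and>
     (\<forall>z. Im z \<noteq> 0 \<longrightarrow> (\<forall>u u'. resolvent_sol V z f u u' \<longrightarrow>
        (\<integral>l. 1 / (complex_of_real l - z) \<partial>\<mu>) = inner_L2 f u))"

text \<open>Functional calculus: F(H) = B for an everywhere defined bounded operator B
  on L^2. By the spectral theorem, dom F(H) = {f. int |F|^2 d mu_f < inf} and
  <f, F(H) f> = int F d mu_f; since B is everywhere defined and the space is
  complex, equality of operators is equivalent to dom F(H) = L^2 together with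
  equality of the quadratic forms (polarization).\<close>
definition fcalc_eq ::
  "(real \<Rightarrow> real) \<Rightarrow> (complex \<Rightarrow> complex) \<Rightarrow> ((real \<Rightarrow> complex) \<Rightarrow> (real \<Rightarrow> complex)) \<Rightarrow> bool" where
  "fcalc_eq V F B \<longleftrightarrow> (\<forall>f. sq_int f \<longrightarrow> (\<forall>\<mu>. spec_meas V f \<mu> \<longrightarrow>
      integrable \<mu> (\<lambda>l. (cmod (F (complex_of_real l)))^2) \<and>
      (\<integral>l. F (complex_of_real l) \<partial>\<mu>) = inner_L2 f (B f)))"

definition shift :: "real \<Rightarrow> (real \<Rightarrow> complex) \<Rightarrow> (real \<Rightarrow> complex)" where
  "shift y u = (\<lambda>x. u (x - y))"

text \<open>u, u' solve -u'' + W u = E u in the absolutely continuous sense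
  (u and u' absolutely continuous, written in integrated form).\<close>
definition solves :: "(real \<Rightarrow> real) \<Rightarrow> complex \<Rightarrow> (real \<Rightarrow> complex) \<Rightarrow> (real \<Rightarrow> complex) \<Rightarrow> bool" where
  "solves W E u u' \<longleftrightarrow> continuous_on UNIV u \<and> continuous_on UNIV u' \<and>
     (\<forall>x. u x = u 0 + int0 u' x) \<and>
     (\<forall>x. u' x = u' 0 + int0 (\<lambda>t. (complex_of_real (W t) - E) * u t) x)"

definition fundsol :: "(real \<Rightarrow> real) \<Rightarrow> complex \<Rightarrow> complex \<Rightarrow> complex \<Rightarrow> (real \<Rightarrow> complex) \<times> (real \<Rightarrow> complex)" where
  "fundsol W E a b = (THE p. solves W E (fst p) (snd p) \<and> fst p 0 = a \<and> snd p 0 = b)"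

definition u_N :: "(real \<Rightarrow> real) \<Rightarrow> real \<Rightarrow> complex \<Rightarrow> complex" where
  "u_N W x E = fst (fundsol W E 1 0) x"

definition u_D' :: "(real \<Rightarrow> real) \<Rightarrow> real \<Rightarrow> complex \<Rightarrow> complex" where
  "u_D' W x E = snd (fundsol W E 0 1) x"

definition discr :: "(real \<Rightarrow> real) \<Rightarrow> real \<Rightarrow> complex \<Rightarrow> complex" where
  "discr W L E = u_N W L E + u_D' W L E"

text \<open>Isospectral torus: real, locally integrable, L-periodic (as elements of
  L^1_loc, i.e. almost everywhere) potentials with the same discriminant.\<close>
definition iso_torus :: "(real \<Rightarrow> real) \<Rightarrow> real \<Rightarrow> (real \<Rightarrow> real) set" where
  "iso_torus V0 L = {W. loc_int W \<and> (AE x in lebesgue. W (x + L) = W x) \<and> discr W L = discr V0 L}"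

end

(* Let T = S_L + S_{-L} and R(z) = (H - z)^{-1}.

   Suppose Delta_{V0}(H) = T. Polarizing the identity of quadratic forms along the spectral measures
   of a f + b R(z) f shows that T commutes with R(z). Testing this on compactly supported elements of
   the domain gives V(x) = V(x - L) almost everywhere.

   If V is L-periodic, the monodromy matrix has determinant 1, so homogeneous solutions satisfy
   u(x + L) + u(x - L) = Delta_V(z) u(x), and (T - Delta_V(z)) R(z) is a local operator that stays
   bounded up to the real axis. Hence |Delta_V| <= 2 almost everywhere for every spectral measure mu_f,
   and <f, T R(z) f> - int Delta_V(l) / (l - z) d mu_f(l) is an entire function of size O(1/|Im z|),
   so it vanishes. Thus Delta_V(H) = T.

   Finally Delta_V(H) = Delta_{V0}(H) forces Delta_V = Delta_{V0} almost everywhere for every spectral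
   measure. For f supported in a single period the traces of the powers of the monodromy matrix are
   orthogonal in L^2(mu_f), so mu_f has no atoms, and the identity theorem applies.

   Spectral measures exist because the moments of the Cayley transform are Fourier coefficients of a
   measure on the circle (Fejer densities and Helly's selection theorem). *)
theory Submission
  imports Defs "HOL-Probability.Helly_Selection" "HOL-Complex_Analysis.Complex_Analysis"
begin

section \<open>Locally absolutely continuous functions\<close>

text \<open>\<open>fcalc_eq\<close> constrains only diagonal forms, and only through whatever
  spectral measures exist; without \<open>spec_meas_exists\<close> it could hold vacuously and
  nothing would follow from it. No spectral theorem is invoked: every spectral statement is one
  about Borel transforms of \<open>\<mu>\<close> and matrix elements of \<open>R z\<close>. Two
  obstacles shape the converse. \<open>R z f\<close> may blow up at the spectrum, but
  \<open>defect f z x\<close> comes from an initial value problem on \<open>{x - L..x + L}\<close>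
  and keeps its meaning at real \<open>z\<close>. And \<open>\<Delta>(z)\<close> may grow, so
  \<open>\<Delta>(z) <f, R(z) f>\<close> need not be of size O(1/|Im z|); it is cancelled by the
  integral of the difference quotient \<open>(\<Delta>(l) - \<Delta>(z)) / (l - z)\<close>, which
  contains the same term. In the last step, equality almost everywhere says nothing if
  \<open>\<mu>\<close> sits on countably many points, where distinct entire functions can agree;
  excluding atoms closes this gap. As \<open>V\<close> is only locally integrable, equations are
  kept in integrated form, second derivatives exist almost everywhere only, and Gronwall estimates
  replace smoothness.\<close>

definition locint :: "(real \<Rightarrow> 'b::euclidean_space) \<Rightarrow> bool" where
  "locint f \<longleftrightarrow> (\<forall>a b. f absolutely_integrable_on {a..b})"

text \<open>\<open>g\<close> is carried along as an explicit derivative of \<open>u\<close>,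
  determined only up to null sets. The integrated form over \<open>a \<le> b\<close> avoids both
  pointwise differentiability and oriented integrals.\<close>

definition acd :: "(real \<Rightarrow> 'b::euclidean_space) \<Rightarrow> (real \<Rightarrow> 'b) \<Rightarrow> bool" where
  "acd u g \<longleftrightarrow> locint g \<and> (\<forall>a b. a \<le> b \<longrightarrow> u b - u a = integral {a..b} g)"

text \<open>Sigma-finiteness of the completed measure makes Fubini and Tonelli available, through
  \<open>leb2\<close>, for Lebesgue measurable functions, with no passage to Borel
  representatives.\<close>

lemma sigma_finite_lebesgue: "sigma_finite_measure (lebesgue :: real measure)"
proof
  show "\<exists>A. countable A \<and> A \<subseteq> sets (lebesgue :: real measure) \<and> \<Union>A = space lebesgue
    \<and> (\<forall>a\<in>A. emeasure lebesgue a \<noteq> \<infinity>)"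
  proof (intro exI[of _ "range (\<lambda>n::nat. {- real n .. real n})"] conjI)
    show "\<Union>(range (\<lambda>n::nat. {- real n .. real n})) = space (lebesgue :: real measure)"
    proof -
      have "\<exists>n::nat. - real n \<le> x \<and> x \<le> real n" for x
      proof -
        obtain n where "\<bar>x\<bar> \<le> real n" using real_arch_simple by blast
        then show ?thesis by (intro exI[of _ n]) auto
      qed
      then show ?thesis by auto
    qed
  qed auto
qed

interpretation leb: sigma_finite_measure "lebesgue :: real measure"
  by (rule sigma_finite_lebesgue)

interpretation leb2: pair_sigma_finite "lebesgue :: real measure" "lebesgue :: real measure" ..

lemma id_lebesgue_measurable: "(\<lambda>x::real. x) \<in> borel_measurable lebesgue"
  by (rule measurable_completion) simp

lemma indicator_lebesgue_measurable:
  fixes f :: "real \<Rightarrow> 'b::euclidean_space"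
  assumes "A \<in> sets lebesgue" "f \<in> borel_measurable lebesgue"
  shows "(\<lambda>x. indicator A x *\<^sub>R f x) \<in> borel_measurable lebesgue"
  using assms by (intro borel_measurable_scaleR borel_measurable_indicator)

lemma locintD: "locint f \<Longrightarrow> f absolutely_integrable_on {a..b}"
  by (simp add: locint_def)

lemma locint_integrable: "locint f \<Longrightarrow> f integrable_on {a..b}"
  using locintD absolutely_integrable_on_def by blast

lemma locint_integrable_indicator:
  "locint f \<Longrightarrow> integrable lebesgue (\<lambda>x. indicator {a..b} x *\<^sub>R f x)"
  using locintD[of f a b] by (simp add: set_integrable_def)

lemma locint_measurable:
  fixes f :: "real \<Rightarrow> 'b::euclidean_space"
  assumes "locint f" shows "f \<in> borel_measurable lebesgue"
proof (rule borel_measurable_LIMSEQ_metric)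
  show "(\<lambda>x. indicator {- real i..real i} x *\<^sub>R f x) \<in> borel_measurable lebesgue" for i
    using borel_measurable_integrable[OF locint_integrable_indicator[OF assms]] .
  fix x
  obtain n where n: "\<bar>x\<bar> \<le> real n" using real_arch_simple by blast
  have "\<forall>\<^sub>F i in sequentially. indicator {- real i..real i} x *\<^sub>R f x = f x"
    using eventually_ge_at_top[of n]
  proof eventually_elim
    case (elim i)
    then have "real n \<le> real i" by simp
    then show ?case using n by (auto simp: indicator_def)
  qed
  then show "(\<lambda>i. indicator {- real i..real i} x *\<^sub>R f x) \<longlonglongrightarrow> f x"
    by (rule tendsto_eventually)
qed

lemma locint_bound:
  fixes f :: "real \<Rightarrow> 'b::euclidean_space" and h :: "real \<Rightarrow> real"
  assumes "f \<in> borel_measurable lebesgue" "locint h" "\<And>x. norm (f x) \<le> h x"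
  shows "locint f"
  unfolding locint_def set_integrable_def
proof (intro allI)
  fix a b
  show "integrable lebesgue (\<lambda>x. indicator {a..b} x *\<^sub>R f x)"
  proof (rule Bochner_Integration.integrable_bound[OF locint_integrable_indicator[OF assms(2), of a b]])
    show "(\<lambda>x. indicator {a..b} x *\<^sub>R f x) \<in> borel_measurable lebesgue"
      by (rule indicator_lebesgue_measurable[OF _ assms(1)]) simp
  qed (auto simp: indicator_def intro!: AE_I2 order_trans[OF assms(3)])
qed

lemma locint_norm: "locint f \<Longrightarrow> locint (\<lambda>x. norm (f x))"
  unfolding locint_def using absolutely_integrable_norm by (force simp: o_def)

lemma locint_continuous:
  fixes f :: "real \<Rightarrow> 'b::euclidean_space"
  assumes "continuous_on UNIV f" shows "locint f"
  unfolding locint_def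
  using assms absolutely_integrable_continuous_real continuous_on_subset by blast

lemma locint_const [simp]: "locint (\<lambda>x. c)"
  by (rule locint_continuous) simp

lemma locint_add: "locint f \<Longrightarrow> locint g \<Longrightarrow> locint (\<lambda>x. f x + g x)"
  unfolding locint_def by (auto intro: set_integral_add)

lemma locint_diff: "locint f \<Longrightarrow> locint g \<Longrightarrow> locint (\<lambda>x. f x - g x)"
  unfolding locint_def by (auto intro: set_integral_diff)

lemma locint_linear:
  "bounded_linear h \<Longrightarrow> locint f \<Longrightarrow> locint (\<lambda>x. h (f x))"
  unfolding locint_def using absolutely_integrable_linear by (fastforce simp: o_def)

lemma locint_cont_mult:
  fixes f c :: "real \<Rightarrow> 'b::{euclidean_space,real_normed_algebra}"
  assumes "continuous_on UNIV c" "locint f" shows "locint (\<lambda>x. c x * f x)"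
  unfolding locint_def
proof (intro allI)
  fix a b
  show "(\<lambda>x. c x * f x) absolutely_integrable_on {a..b}"
  proof (rule absolutely_integrable_bounded_measurable_product[of "(*)" c "{a..b}" f])
    show "bilinear ((*) :: 'b \<Rightarrow> 'b \<Rightarrow> 'b)"
      by (simp add: bilinear_conv_bounded_bilinear bounded_bilinear_mult)
    have c: "continuous_on {a..b} c" using assms(1) continuous_on_subset by blast
    show "c \<in> borel_measurable (lebesgue_on {a..b})"
      using c by (intro continuous_imp_measurable_on_sets_lebesgue) auto
    show "bounded (c ` {a..b})"
      using c by (intro compact_imp_bounded compact_continuous_image) auto
  qed (use assms locintD in auto)
qed

lemma locint_mult_cont:
  fixes f c :: "real \<Rightarrow> 'b::{euclidean_space,real_normed_field}"
  assumes "continuous_on UNIV c" "locint f" shows "locint (\<lambda>x. f x * c x)"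
  using locint_cont_mult[OF assms] by (simp add: mult.commute)

lemma locint_shift:
  fixes f :: "real \<Rightarrow> 'b::euclidean_space"
  assumes "locint f" shows "locint (\<lambda>x. f (x + c))"
  unfolding locint_def set_integrable_def
proof (intro allI)
  fix a b
  have "integrable lebesgue (\<lambda>x. indicator {a+c..b+c} (c + 1 * x) *\<^sub>R f (c + 1 * x))"
    using lebesgue_integrable_real_affine[OF locint_integrable_indicator[OF assms], of 1] by simp
  then show "integrable lebesgue (\<lambda>x. indicator {a..b} x *\<^sub>R f (x + c))"
    by (rule Bochner_Integration.integrable_cong[THEN iffD1, rotated -1]) (auto simp: indicator_def
      add.commute)
qed

lemma integral_shift_interval:
  fixes f :: "real \<Rightarrow> 'b::euclidean_space"
  assumes "locint f"
  shows "integral {a..b} (\<lambda>x. f (x + c)) = integral {a+c..b+c} f"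
proof -
  have "integral {a..b} (\<lambda>x. f (x + c)) = (LINT x|lebesgue. indicator {a..b} x *\<^sub>R f (x + c))"
    using set_lebesgue_integral_eq_integral(2)[OF locintD[OF locint_shift[OF assms]], of a b]
    by (simp add: set_lebesgue_integral_def)
  also have "\<dots> = (LINT x|lebesgue. indicator {a+c..b+c} (c + 1 * x) *\<^sub>R f (c + 1 * x))"
    by (rule Bochner_Integration.integral_cong) (auto simp: indicator_def add.commute)
  also have "\<dots> = (LINT x|lebesgue. indicator {a+c..b+c} x *\<^sub>R f x)"
    using lebesgue_integral_real_affine[of 1 "\<lambda>x. indicator {a+c..b+c} x *\<^sub>R f x" c] by simp
  also have "\<dots> = integral {a+c..b+c} f"
    using set_lebesgue_integral_eq_integral(2)[OF locintD[OF assms], of "a+c" "b+c"]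
    by (simp add: set_lebesgue_integral_def)
  finally show ?thesis .
qed

lemma integral_locint_split:
  "locint f \<Longrightarrow> a \<le> b \<Longrightarrow> b \<le> c \<Longrightarrow> integral {a..c} f = integral {a..b} f + integral {b..c} f"
  using Henstock_Kurzweil_Integration.integral_combine[OF _ _ locint_integrable, of a b c f] by simp

lemma acd_locint: "acd u g \<Longrightarrow> locint g"
  by (simp add: acd_def)

lemma acdD: "acd u g \<Longrightarrow> a \<le> b \<Longrightarrow> u b - u a = integral {a..b} g"
  by (simp add: acd_def)

lemma acd_continuous:
  assumes "acd u g" shows "continuous_on UNIV u"
proof -
  have "continuous_on {-n<..<n} u" for n :: real
  proof -
    have "continuous_on {-n..n} (\<lambda>x. u (-n) + integral {-n..x} g)"
      by (intro continuous_intros indefinite_integral_continuous_1 locint_integrable acd_locint[OF assms])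
    then have "continuous_on {-n..n} u"
      by (rule continuous_on_eq) (use acdD[OF assms] in \<open>force simp: algebra_simps\<close>)
    then show ?thesis by (rule continuous_on_subset) auto
  qed
  then have "continuous_on (\<Union>n\<in>UNIV. {-n<..<n}) u"
    by (intro continuous_on_open_UN) auto
  moreover have "(\<Union>n\<in>(UNIV::real set). {-n<..<n}) = UNIV"
  proof -
    have "x \<in> (\<Union>n\<in>(UNIV::real set). {-n<..<n})" for x
      by (rule UN_I[of "\<bar>x\<bar>+1"]) auto
    then show ?thesis by blast
  qed
  ultimately show ?thesis by simp
qed

lemma acdI0:
  assumes "locint g" "\<And>x. 0 \<le> x \<Longrightarrow> u x - u 0 = integral {0..x} g"
    "\<And>x. x \<le> 0 \<Longrightarrow> u 0 - u x = integral {x..0} g"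
  shows "acd u g"
  unfolding acd_def
proof (intro conjI allI impI assms(1))
  fix a b :: real assume ab: "a \<le> b"
  consider "0 \<le> a" | "a \<le> 0" "0 \<le> b" | "b \<le> 0" by linarith
  then show "u b - u a = integral {a..b} g"
  proof cases
    case 1
    with ab have "integral {0..b} g = integral {0..a} g + integral {a..b} g"
      by (intro integral_locint_split assms(1)) auto
    with 1 ab assms(2)[of a] assms(2)[of b] show ?thesis by (simp add: algebra_simps)
  next
    case 2
    then have "integral {a..b} g = integral {a..0} g + integral {0..b} g"
      by (intro integral_locint_split assms(1)) auto
    with 2 ab assms(3)[of a] assms(2)[of b] show ?thesis by (simp add: algebra_simps)
  next
    case 3
    with ab have "integral {a..0} g = integral {a..b} g + integral {b..0} g"
      by (intro integral_locint_split assms(1)) auto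
    with 3 ab assms(3)[of a] assms(3)[of b] show ?thesis by (simp add: algebra_simps)
  qed
qed

text \<open>\<open>int0\<close> is oriented and integrates over open intervals. Endpoints are null,
  so on either side of 0 it becomes a gauge integral over a closed interval; this connects the given
  definitions to \<open>acd\<close>.\<close>

lemma int0_eq:
  assumes "locint f"
  shows "int0 f x = (if 0 \<le> x then integral {0..x} f else - integral {x..0} f)"
proof -
  have s: "(LINT t:{a<..<b}|lebesgue. f t) = integral {a..b} f" for a b
  proof -
    have "(LINT t:{a<..<b}|lebesgue. f t) = (LINT t:{a..b}|lebesgue. f t)"
      unfolding set_lebesgue_integral_def
    proof (rule integral_cong_AE)
      have "AE x in lebesgue. x \<noteq> a" "AE x in lebesgue. x \<noteq> b"
        by (auto intro!: AE_completion AE_lborel_singleton)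
      then show "AE x in lebesgue. indicat_real {a<..<b} x *\<^sub>R f x = indicat_real {a..b} x *\<^sub>R f x"
        by eventually_elim (auto simp: indicator_def)
    qed (auto intro!: indicator_lebesgue_measurable locint_measurable[OF assms])
    then show ?thesis
      using set_lebesgue_integral_eq_integral(2)[OF locintD[OF assms]] by metis
  qed
  show ?thesis
    unfolding int0_def interval_lebesgue_integral_def by (simp add: s)
qed

lemma acd_int0_iff:
  fixes u g :: "real \<Rightarrow> complex"
  assumes "locint g"
  shows "acd u g \<longleftrightarrow> (\<forall>x. u x = u 0 + int0 g x)"
proof
  assume a: "acd u g"
  show "\<forall>x. u x = u 0 + int0 g x"
  proof
    fix x show "u x = u 0 + int0 g x"
      using acdD[OF a, of 0 x] acdD[OF a, of x 0] by (auto simp: int0_eq[OF assms] algebra_simps)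
  qed
next
  assume *: "\<forall>x. u x = u 0 + int0 g x"
  show "acd u g"
  proof (rule acdI0[OF assms])
    show "u x - u 0 = integral {0..x} g" if "0 \<le> x" for x
      using *[rule_format, of x] that by (simp add: int0_eq[OF assms])
    show "u 0 - u x = integral {x..0} g" if "x \<le> 0" for x
      using *[rule_format, of x] that
      by (cases "x = 0") (auto simp: int0_eq[OF assms])
  qed
qed

lemma acd_linear:
  assumes "acd u g" "bounded_linear h"
  shows "acd (\<lambda>x. h (u x)) (\<lambda>x. h (g x))"
  unfolding acd_def
proof (intro conjI allI impI)
  show "locint (\<lambda>x. h (g x))" using locint_linear assms acd_locint by blast
  fix a b :: real assume ab: "a \<le> b"
  have "integral {a..b} (h \<circ> g) = h (integral {a..b} g)"
    by (rule integral_linear[OF locint_integrable[OF acd_locint[OF assms(1)]] assms(2)])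
  then show "h (u b) - h (u a) = integral {a..b} (\<lambda>x. h (g x))"
    using acdD[OF assms(1) ab] assms(2)
    by (simp add: o_def linear_diff[OF bounded_linear.linear[OF assms(2)], symmetric])
qed

lemma acd_add: "acd u g \<Longrightarrow> acd v h \<Longrightarrow> acd (\<lambda>x. u x + v x) (\<lambda>x. g x + h x)"
  unfolding acd_def
  by (auto simp: locint_add Henstock_Kurzweil_Integration.integral_add locint_integrable algebra_simps)

lemma acd_diff: "acd u g \<Longrightarrow> acd v h \<Longrightarrow> acd (\<lambda>x. u x - v x) (\<lambda>x. g x - h x)"
  unfolding acd_def
  by (auto simp: locint_diff Henstock_Kurzweil_Integration.integral_diff locint_integrable algebra_simps)

lemma acd_cmult:
  fixes u :: "real \<Rightarrow> 'b::{euclidean_space,real_normed_algebra}"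
  shows "acd u g \<Longrightarrow> acd (\<lambda>x. c * u x) (\<lambda>x. c * g x)"
  using acd_linear[OF _ bounded_linear_mult_right] by blast

lemma acd_cnj: "acd u g \<Longrightarrow> acd (\<lambda>x. cnj (u x)) (\<lambda>x. cnj (g x))"
  using acd_linear[OF _ bounded_linear_cnj] by blast

lemma acd_const [simp]: "acd (\<lambda>x. c) (\<lambda>x. 0)"
  by (simp add: acd_def)

lemma acd_shift: "acd u g \<Longrightarrow> acd (\<lambda>x. u (x + c)) (\<lambda>x. g (x + c))"
  unfolding acd_def by (auto simp: locint_shift integral_shift_interval)

lemma acd_cong_AE:
  assumes "acd u g" "AE x in lebesgue. g x = h x"
  shows "acd u h"
proof -
  have "negligible {x. g x \<noteq> h x}"
    using assms(2) by (simp add: eventually_ae_filter_negligible) (metis (mono_tags, lifting) mem_Collect_eq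
      negligible_subset subsetI)
  then obtain N where N: "negligible N" "\<And>x. x \<notin> N \<Longrightarrow> h x = g x" by fastforce
  have l: "locint h"
    unfolding locint_def
    using absolutely_integrable_spike[OF locintD[OF acd_locint[OF assms(1)]] N(1)] N(2) by blast
  show ?thesis unfolding acd_def
  proof (intro conjI l allI impI)
    fix a b :: real assume "a \<le> b"
    then show "u b - u a = integral {a..b} h"
      using acdD[OF assms(1)] integral_spike[OF N(1), of "{a..b}" h g] N(2) by fastforce
  qed
qed

text \<open>By Lebesgue differentiation the averages over \<open>{x..x + h}\<close> tend to
  \<open>f x\<close> for almost every \<open>x\<close>, and here every average is zero.\<close>

lemma locint_integral_zero_AE:
  fixes f :: "real \<Rightarrow> 'b::euclidean_space"
  assumes "locint f" "\<And>a b. a \<le> b \<Longrightarrow> integral {a..b} f = 0"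
  shows "AE x in lebesgue. f x = 0"
proof -
  obtain N where N: "negligible N" "\<And>x e. \<lbrakk>x \<notin> N; 0 < e\<rbrakk> \<Longrightarrow>
               \<exists>d>0. \<forall>h. 0 < h \<and> h < d \<longrightarrow>
                         norm(integral (cbox x (x + h *\<^sub>R One)) f /\<^sub>R h ^ DIM(real) - f x) < e"
    using integrable_ccontinuous_explicit[of f] locint_integrable[OF assms(1)] by (auto simp: cbox_interval)
  have "f x = 0" if xN: "x \<notin> N" for x
  proof (rule ccontr)
    assume "f x \<noteq> 0"
    then obtain d where d: "d > 0" "\<forall>h. 0 < h \<and> h < d \<longrightarrow>
                         norm(integral (cbox x (x + h *\<^sub>R One)) f /\<^sub>R h ^ DIM(real) - f x) < norm (f x)"
      using N(2)[OF xN, of "norm (f x)"] by (auto simp only: zero_less_norm_iff)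
    have "norm(integral (cbox x (x + (d/2) *\<^sub>R One)) f /\<^sub>R (d/2) ^ DIM(real) - f x) < norm (f x)"
      using d(1) d(2)[rule_format, of "d/2"] by simp
    moreover have "integral (cbox x (x + (d/2) *\<^sub>R One)) f = 0"
      using assms(2)[of x "x + d/2"] d(1) by (simp add: cbox_interval)
    ultimately show False by simp
  qed
  then show ?thesis
    using N(1) by (auto simp: eventually_ae_filter_negligible)
qed

lemma acd_AE_unique:
  assumes "acd u g" "acd u h" shows "AE x in lebesgue. g x = h x"
proof -
  have "AE x in lebesgue. g x - h x = 0"
  proof (rule locint_integral_zero_AE)
    show "locint (\<lambda>x. g x - h x)" using assms acd_locint locint_diff by blast
    show "integral {a..b} (\<lambda>x. g x - h x) = 0" if "a \<le> b" for a b
      using acdD[OF acd_diff[OF assms] that] by simp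
  qed
  then show ?thesis by simp
qed

text \<open>The set where \<open>u\<close> and \<open>v\<close> differ is open, and a nonempty open
  set is not negligible. This is how identities between square integrable functions become pointwise
  ones later.\<close>

lemma AE_eq_continuous_imp_eq:
  fixes u v :: "real \<Rightarrow> 'b::euclidean_space"
  assumes "continuous_on UNIV u" "continuous_on UNIV v" "AE x in lebesgue. u x = v x"
  shows "u = v"
proof (rule ccontr)
  assume "u \<noteq> v"
  have o: "open {x. u x \<noteq> v x}"
    by (intro open_Collect_neq assms)
  have "negligible {x. u x \<noteq> v x}"
    using assms(3) by (simp add: eventually_ae_filter_negligible) (metis (mono_tags, lifting) mem_Collect_eq
      negligible_subset subsetI)
  then show False using open_not_negligible[OF o] \<open>u \<noteq> v\<close> by auto
qed

lemma acd_continuous_unique: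
  assumes "acd u g" "acd u h" "continuous_on UNIV g" "continuous_on UNIV h"
  shows "g = h"
  by (rule AE_eq_continuous_imp_eq[OF assms(3,4) acd_AE_unique[OF assms(1,2)]])

lemma acd_has_vector_derivative:
  fixes u :: "real \<Rightarrow> 'b::euclidean_space"
  assumes "\<And>x. (u has_vector_derivative g x) (at x)" "continuous_on UNIV g"
  shows "acd u g"
  unfolding acd_def
proof (intro conjI allI impI)
  show "locint g" by (rule locint_continuous[OF assms(2)])
  fix a b :: real assume "a \<le> b"
  then have "(g has_integral (u b - u a)) {a..b}"
    by (intro fundamental_theorem_of_calculus has_vector_derivative_at_within[OF assms(1)])
  then show "u b - u a = integral {a..b} g" by (simp add: integral_unique)
qed

lemma leb2_measurable_le: "{p. fst p \<le> snd p} \<in> sets (lebesgue \<Otimes>\<^sub>M (lebesgue :: real measure))"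
proof -
  have "{p \<in> space (lebesgue \<Otimes>\<^sub>M (lebesgue :: real measure)). fst p \<le> snd p} \<in> sets (lebesgue \<Otimes>\<^sub>M lebesgue)"
  proof (rule borel_measurable_le)
    show "(fst :: real \<times> real \<Rightarrow> real) \<in> borel_measurable (lebesgue \<Otimes>\<^sub>M lebesgue)"
      by (rule measurable_compose[OF measurable_fst id_lebesgue_measurable])
    show "(snd :: real \<times> real \<Rightarrow> real) \<in> borel_measurable (lebesgue \<Otimes>\<^sub>M lebesgue)"
      by (rule measurable_compose[OF measurable_snd id_lebesgue_measurable])
  qed
  then show ?thesis by (simp add: space_pair_measure)
qed

lemma integrable_pair_mult:
  fixes f g :: "real \<Rightarrow> 'b::{euclidean_space,real_normed_field}"
  assumes "integrable lebesgue f" "integrable lebesgue g"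
  shows "integrable (lebesgue \<Otimes>\<^sub>M lebesgue) (\<lambda>(s,t). f s * g t)"
proof (rule leb2.Fubini_integrable)
  have [measurable]: "f \<in> borel_measurable lebesgue" "g \<in> borel_measurable lebesgue" using assms by auto
  show "(\<lambda>(s,t). f s * g t) \<in> borel_measurable (lebesgue \<Otimes>\<^sub>M lebesgue)"
    unfolding case_prod_unfold by measurable
  have "integrable lebesgue (\<lambda>s. norm (f s) * (\<integral>t. norm (g t) \<partial>lebesgue))"
    using assms(1) by (intro integrable_mult_left integrable_norm)
  then show "integrable lebesgue (\<lambda>s. \<integral>t. norm (case (s, t) of (s, t) \<Rightarrow> f s * g t) \<partial>lebesgue)"
    by (simp add: norm_mult)
  show "AE s in lebesgue. integrable lebesgue (\<lambda>t. case (s, t) of (s, t) \<Rightarrow> f s * g t)"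
    using assms(2) by (intro AE_I2) simp
qed

lemma locint_lebesgue_integral:
  fixes f :: "real \<Rightarrow> 'b::euclidean_space"
  assumes "locint f"
  shows "(LINT x|lebesgue. indicator {a..b} x *\<^sub>R f x) = integral {a..b} f"
  using set_lebesgue_integral_eq_integral(2)[OF locintD[OF assms], of a b]
  by (simp add: set_lebesgue_integral_def)

text \<open>Integrate \<open>f s * g t\<close> over the square on \<open>{a..b}\<close> and split
  along the diagonal. Fubini, with the inner variable chosen differently on the two triangles, gives
  the integrals of \<open>(u t - u a) * g t\<close> and of \<open>f s * (v s - v a)\<close>.\<close>

lemma acd_mult:
  fixes u v :: "real \<Rightarrow> 'b::{euclidean_space,real_normed_field}"
  assumes u: "acd u f" and v: "acd v g"
  shows "acd (\<lambda>x. u x * v x) (\<lambda>x. f x * v x + u x * g x)"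
  unfolding acd_def
proof (intro conjI allI impI)
  have lf: "locint f" and lg: "locint g" using assms acd_locint by auto
  have cu: "continuous_on UNIV u" and cv: "continuous_on UNIV v" using assms acd_continuous by auto
  have l1: "locint (\<lambda>x. f x * v x)" using locint_mult_cont[OF cv lf] .
  have l2: "locint (\<lambda>x. u x * g x)" using locint_cont_mult[OF cu lg] .
  show "locint (\<lambda>x. f x * v x + u x * g x)" using l1 l2 by (rule locint_add)
  fix a b :: real assume ab: "a \<le> b"
  define F where "F x = indicat_real {a..b} x *\<^sub>R f x" for x
  define G where "G x = indicat_real {a..b} x *\<^sub>R g x" for x
  have F: "integrable lebesgue F" and G: "integrable lebesgue G"
    unfolding F_def G_def using locint_integrable_indicator lf lg by auto
  have [measurable]: "F \<in> borel_measurable lebesgue" "G \<in> borel_measurable lebesgue" using F G by auto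
  let ?A = "{p. fst p \<le> snd p} :: (real \<times> real) set"
  have A[measurable]: "?A \<in> sets (lebesgue \<Otimes>\<^sub>M lebesgue)" by (rule leb2_measurable_le)
  have FG: "integrable (lebesgue \<Otimes>\<^sub>M lebesgue) (\<lambda>(s,t). F s * G t)"
    by (rule integrable_pair_mult[OF F G])
  have FG1: "integrable (lebesgue \<Otimes>\<^sub>M lebesgue) (\<lambda>(s,t). indicator ?A (s,t) *\<^sub>R (F s * G t))"
    using integrable_mult_indicator[OF A FG] by (simp add: case_prod_unfold)
  have FG2: "integrable (lebesgue \<Otimes>\<^sub>M lebesgue) (\<lambda>(s,t). indicator (-?A) (s,t) *\<^sub>R (F s * G t))"
  proof -
    have "-?A \<in> sets (lebesgue \<Otimes>\<^sub>M lebesgue)"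
      using sets.compl_sets[OF A] by (simp add: space_pair_measure Compl_eq_Diff_UNIV)
    from integrable_mult_indicator[OF this FG] show ?thesis by (simp add: case_prod_unfold)
  qed
  have ub: "u b - u a = (\<integral>s. F s \<partial>lebesgue)" and vb: "v b - v a = (\<integral>t. G t \<partial>lebesgue)"
    unfolding F_def G_def using acdD[OF u ab] acdD[OF v ab]
      by (simp_all add: locint_lebesgue_integral lf lg)
  have "(u b - u a) * (v b - v a) = (\<integral>s. (\<integral>t. F s * G t \<partial>lebesgue) \<partial>lebesgue)"
    unfolding ub vb by simp
  also have "\<dots> = (\<integral>p. (\<lambda>(s,t). F s * G t) p \<partial>(lebesgue \<Otimes>\<^sub>M lebesgue))"
    using leb2.integral_fst[OF FG] by simp
  also have "\<dots> = (\<integral>p. (\<lambda>(s,t). indicator ?A (s,t) *\<^sub>R (F s * G t)) p + (\<lambda>(s,t). indicator (-?A) (s,t) *\<^sub>R (F s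
    * G t)) p \<partial>(lebesgue \<Otimes>\<^sub>M lebesgue))"
    by (rule Bochner_Integration.integral_cong) (auto simp: indicator_def)
  also have "\<dots> = (\<integral>p. (\<lambda>(s,t). indicator ?A (s,t) *\<^sub>R (F s * G t)) p \<partial>(lebesgue \<Otimes>\<^sub>M lebesgue))
      + (\<integral>p. (\<lambda>(s,t). indicator (-?A) (s,t) *\<^sub>R (F s * G t)) p \<partial>(lebesgue \<Otimes>\<^sub>M lebesgue))"
    by (rule Bochner_Integration.integral_add[OF FG1 FG2])
  also have "(\<integral>p. (\<lambda>(s,t). indicator ?A (s,t) *\<^sub>R (F s * G t)) p \<partial>(lebesgue \<Otimes>\<^sub>M lebesgue))
     = (\<integral>t. (\<integral>s. indicator ?A (s,t) *\<^sub>R (F s * G t) \<partial>lebesgue) \<partial>lebesgue)"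
    using leb2.integral_snd[OF FG1] by simp
  also have "\<dots> = (\<integral>t. indicator {a..b} t *\<^sub>R ((u t - u a) * g t) \<partial>lebesgue)"
  proof (rule Bochner_Integration.integral_cong[OF refl])
    fix t :: real
    have "(\<integral>s. indicator ?A (s,t) *\<^sub>R (F s * G t) \<partial>lebesgue) = (\<integral>s. (indicator {..t} s *\<^sub>R F s)
      * G t \<partial>lebesgue)"
      by (rule Bochner_Integration.integral_cong) (auto simp: indicator_def)
    also have "\<dots> = (\<integral>s. (indicator {..t} s *\<^sub>R F s) \<partial>lebesgue) * G t"
      by (rule integral_mult_left_zero)
    also have "\<dots> = indicator {a..b} t *\<^sub>R ((u t - u a) * g t)"
    proof (cases "t \<in> {a..b}")
      case True
      have "(\<integral>s. (indicator {..t} s *\<^sub>R F s) \<partial>lebesgue) = (\<integral>s. indicator {a..t} s *\<^sub>R f s \<partial>lebesgue)"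
        using True by (intro Bochner_Integration.integral_cong) (auto simp: indicator_def F_def)
      also have "\<dots> = u t - u a" using acdD[OF u, of a t] True by (simp add: locint_lebesgue_integral lf)
      finally show ?thesis using True by (simp add: G_def)
    qed (simp add: G_def)
    finally show "(\<integral>s. indicator ?A (s,t) *\<^sub>R (F s * G t) \<partial>lebesgue) = indicator {a..b} t *\<^sub>R ((u t - u a)
      * g t)" .
  qed
  also have "\<dots> = integral {a..b} (\<lambda>t. (u t - u a) * g t)"
    by (intro locint_lebesgue_integral locint_cont_mult lg continuous_intros cu)
  also have "(\<integral>p. (\<lambda>(s,t). indicator (-?A) (s,t) *\<^sub>R (F s * G t)) p \<partial>(lebesgue \<Otimes>\<^sub>M lebesgue))
     = (\<integral>s. (\<integral>t. indicator (-?A) (s,t) *\<^sub>R (F s * G t) \<partial>lebesgue) \<partial>lebesgue)"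
    using leb2.integral_fst[OF FG2] by simp
  also have "\<dots> = (\<integral>s. indicator {a..b} s *\<^sub>R (f s * (v s - v a)) \<partial>lebesgue)"
  proof (rule Bochner_Integration.integral_cong[OF refl])
    fix s :: real
    have "(\<integral>t. indicator (-?A) (s,t) *\<^sub>R (F s * G t) \<partial>lebesgue)
      = (\<integral>t. F s * (indicator {..<s} t *\<^sub>R G t) \<partial>lebesgue)"
      by (rule Bochner_Integration.integral_cong) (auto simp: indicator_def)
    also have "\<dots> = F s * (\<integral>t. (indicator {..<s} t *\<^sub>R G t) \<partial>lebesgue)"
      by (rule integral_mult_right_zero)
    also have "\<dots> = indicator {a..b} s *\<^sub>R (f s * (v s - v a))"
    proof (cases "s \<in> {a..b}")
      case True
      have "(\<integral>t. (indicator {..<s} t *\<^sub>R G t) \<partial>lebesgue) = (\<integral>t. indicator {a..s} t *\<^sub>R g t \<partial>lebesgue)"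
      proof (rule integral_cong_AE)
        have "AE t in lebesgue. t \<noteq> s" by (auto intro!: AE_completion AE_lborel_singleton)
        then show "AE t in lebesgue. indicator {..<s} t *\<^sub>R G t = indicator {a..s} t *\<^sub>R g t"
          by eventually_elim (use True in \<open>auto simp: indicator_def G_def\<close>)
      qed (auto intro!: indicator_lebesgue_measurable locint_measurable[OF lg])
      also have "\<dots> = v s - v a" using acdD[OF v, of a s] True by (simp add: locint_lebesgue_integral lg)
      finally show ?thesis using True by (simp add: F_def)
    qed (simp add: F_def)
    finally show "(\<integral>t. indicator (-?A) (s,t) *\<^sub>R (F s * G t) \<partial>lebesgue) = indicator {a..b} s *\<^sub>R (f s * (v s
      - v a))" .
  qed
  also have "\<dots> = integral {a..b} (\<lambda>s. f s * (v s - v a))"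
    by (intro locint_lebesgue_integral locint_mult_cont lf continuous_intros cv)
  also have "integral {a..b} (\<lambda>t. (u t - u a) * g t) = integral {a..b} (\<lambda>t. u t * g t) - u a * (v b - v a)"
    unfolding acdD[OF v ab] left_diff_distrib
    by (subst Henstock_Kurzweil_Integration.integral_diff)
       (auto intro!: locint_integrable l2 lg locint_cont_mult continuous_intros)
  also have "integral {a..b} (\<lambda>s. f s * (v s - v a)) = integral {a..b} (\<lambda>t. f t * v t) - (u b - u a) * v a"
    unfolding acdD[OF u ab] right_diff_distrib
    by (subst Henstock_Kurzweil_Integration.integral_diff)
       (auto intro!: locint_integrable l1 lf locint_mult_cont continuous_intros)
  finally show "u b * v b - u a * v a = integral {a..b} (\<lambda>x. f x * v x + u x * g x)"
    by (subst Henstock_Kurzweil_Integration.integral_add[OF locint_integrable[OF l1] locint_integrable[OF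
      l2]])
       (simp add: algebra_simps)
qed

section \<open>Linear second-order equations with locally integrable coefficients\<close>

definition prim :: "real \<Rightarrow> (real \<Rightarrow> 'b::euclidean_space) \<Rightarrow> real \<Rightarrow> 'b" where
  "prim c f x = (if c \<le> x then integral {c..x} f else - integral {x..c} f)"

lemma prim_self [simp]: "prim c f c = 0" by (simp add: prim_def)

lemma acd_prim:
  fixes f :: "real \<Rightarrow> 'b::euclidean_space"
  assumes "locint f" shows "acd (prim c f) f"
  unfolding acd_def
proof (intro conjI allI impI assms)
  fix a b :: real assume ab: "a \<le> b"
  consider "c \<le> a" | "a < c" "c \<le> b" | "b < c" by linarith
  then show "prim c f b - prim c f a = integral {a..b} f"
  proof cases
    case 1
    with integral_locint_split[OF assms, of c a b] ab show ?thesis by (simp add: prim_def)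
  next
    case 2
    with integral_locint_split[OF assms, of a c b] ab show ?thesis by (simp add: prim_def)
  next
    case 3
    with integral_locint_split[OF assms, of a b c] ab show ?thesis by (simp add: prim_def)
  qed
qed

lemma norm_integral_le:
  fixes f :: "real \<Rightarrow> 'b::euclidean_space"
  assumes "locint f" "locint h" "\<And>t. t \<in> {a..b} \<Longrightarrow> norm (f t) \<le> h t"
  shows "norm (integral {a..b} f) \<le> integral {a..b} h"
  by (rule integral_norm_bound_integral) (use assms locint_integrable in auto)

lemma integral_le_locint:
  fixes f h :: "real \<Rightarrow> real"
  assumes "locint f" "locint h" "\<And>t. t \<in> {a..b} \<Longrightarrow> f t \<le> h t"
  shows "integral {a..b} f \<le> integral {a..b} h"
  by (rule integral_le) (use assms locint_integrable in auto)

lemma integral_mono_set: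
  fixes h :: "real \<Rightarrow> real"
  assumes "locint h" "\<And>t. 0 \<le> h t" "{a..b} \<subseteq> {c..d}"
  shows "integral {a..b} h \<le> integral {c..d} h"
  by (rule integral_subset_le) (use assms locint_integrable in auto)

section \<open>Exponentials of primitives and Gronwall inequalities\<close>

lemma acd_power:
  fixes K :: "real \<Rightarrow> real"
  assumes "acd K k"
  shows "acd (\<lambda>x. K x ^ Suc n) (\<lambda>x. real (Suc n) * K x ^ n * k x)"
proof (induction n)
  case 0
  then show ?case using assms by simp
next
  case (Suc n)
  show ?case
    using acd_mult[OF assms Suc] by (simp add: algebra_simps)
qed

text \<open>The product rule gives the chain rule for powers, hence for partial sums of the
  exponential series; dominated convergence with majorant
  \<open>exp \<bar>K x\<bar> * norm (k x)\<close> passes to the limit.\<close>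

lemma acd_exp:
  fixes K :: "real \<Rightarrow> real"
  assumes "acd K k"
  shows "acd (\<lambda>x. exp (K x)) (\<lambda>x. exp (K x) * k x)"
  unfolding acd_def
proof (intro conjI allI impI)
  have cK: "continuous_on UNIV K" and lk: "locint k" using assms acd_continuous acd_locint by auto
  show l: "locint (\<lambda>x. exp (K x) * k x)"
    by (intro locint_cont_mult continuous_intros cK lk)
  fix a b :: real assume ab: "a \<le> b"
  define S where "S N x = (\<Sum>n<N. K x ^ n / fact n) * k x" for N x
  have acdS: "acd (\<lambda>x. \<Sum>n<Suc N. K x ^ n / fact n) (S N)" for N
  proof (induction N)
    case 0
    then show ?case by (simp add: S_def[abs_def])
  next
    case (Suc N)
    have e: "S (Suc N) = (\<lambda>x. S N x + (1 / fact (Suc N)) * (real (Suc N) * K x ^ N * k x))"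
    proof
      fix x
      have "(1 / fact (Suc N)) * (real (Suc N) * K x ^ N * k x) = K x ^ N / fact N * k x"
        by (simp add: field_simps del: of_nat_Suc)
      then show "S (Suc N) x = S N x + (1 / fact (Suc N)) * (real (Suc N) * K x ^ N * k x)"
        by (simp add: S_def algebra_simps)
    qed
    have "acd (\<lambda>x. (\<Sum>n<Suc N. K x ^ n / fact n) + (1 / fact (Suc N)) * K x ^ Suc N) (S (Suc N))"
      unfolding e by (intro acd_add Suc acd_cmult acd_power assms)
    then show ?case by simp
  qed
  have "(\<lambda>N. integral {a..b} (S N)) \<longlonglongrightarrow> integral {a..b} (\<lambda>x. exp (K x) * k x)"
  proof (rule dominated_convergence(2))
    show "S N integrable_on {a..b}" for N using locint_integrable acd_locint acdS by blast
    show "(\<lambda>x. exp \<bar>K x\<bar> * norm (k x)) integrable_on {a..b}"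
      by (intro locint_integrable locint_cont_mult locint_norm lk continuous_intros cK)
    show "norm (S N x) \<le> exp \<bar>K x\<bar> * norm (k x)" for N x
    proof -
      have "\<bar>\<Sum>n<N. K x ^ n / fact n\<bar> \<le> (\<Sum>n<N. \<bar>K x\<bar> ^ n / fact n)"
        by (rule order_trans[OF sum_abs]) (simp add: power_abs)
      also have "\<dots> \<le> exp \<bar>K x\<bar>"
      proof -
        have "(\<Sum>n<N. \<bar>K x\<bar> ^ n /\<^sub>R fact n) \<le> (\<Sum>n. \<bar>K x\<bar> ^ n /\<^sub>R fact n)"
          by (rule sum_le_suminf[OF summable_exp_generic]) auto
        then show ?thesis by (simp add: exp_def divide_inverse_commute)
      qed
      finally show ?thesis unfolding S_def by (simp add: abs_mult mult_right_mono)
    qed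
    show "(\<lambda>N. S N x) \<longlonglongrightarrow> exp (K x) * k x" for x
    proof -
      have "(\<lambda>n. K x ^ n /\<^sub>R fact n) sums exp (K x)" by (rule exp_converges)
      then have "(\<lambda>N. \<Sum>n<N. K x ^ n / fact n) \<longlonglongrightarrow> exp (K x)"
        by (simp add: sums_def divide_inverse_commute)
      then show ?thesis unfolding S_def by (intro tendsto_intros)
    qed
  qed
  moreover have "(\<lambda>N. integral {a..b} (S N)) \<longlonglongrightarrow> exp (K b) - exp (K a)"
  proof -
    have "(\<lambda>N. \<Sum>n<Suc N. K x ^ n / fact n) \<longlonglongrightarrow> exp (K x)" for x
    proof -
      have "(\<lambda>n. K x ^ n /\<^sub>R fact n) sums exp (K x)" by (rule exp_converges)
      then have "(\<lambda>N. \<Sum>n<N. K x ^ n / fact n) \<longlonglongrightarrow> exp (K x)"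
        by (simp add: sums_def divide_inverse_commute)
      then show ?thesis by (rule LIMSEQ_Suc)
    qed
    then have "(\<lambda>N. (\<Sum>n<Suc N. K b ^ n / fact n) - (\<Sum>n<Suc N. K a ^ n / fact n)) \<longlonglongrightarrow> exp (K b) - exp (K a)"
      by (intro tendsto_diff)
    then show ?thesis using acdD[OF acdS ab] by simp
  qed
  ultimately show "exp (K b) - exp (K a) = integral {a..b} (\<lambda>x. exp (K x) * k x)"
    using LIMSEQ_unique by blast
qed

text \<open>Integrating factor: with \<open>Z\<close> the right-hand side of the hypothesis,
  \<open>W = exp (- K) * Z\<close> has derivative \<open>- exp (- K) * k * (Z - y) \<le> 0\<close>,
  so \<open>W\<close> stays below its initial value \<open>c\<close>.\<close>

lemma gronwall_forward:
  fixes y k :: "real \<Rightarrow> real"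
  assumes y: "continuous_on UNIV y" and k: "locint k" "\<And>t. 0 \<le> k t"
    and le: "\<And>t. t \<in> {a..b} \<Longrightarrow> y t \<le> c + integral {a..t} (\<lambda>s. k s * y s)"
    and x: "x \<in> {a..b}"
  shows "y x \<le> c * exp (integral {a..x} k)"
proof -
  define K where "K = prim a k"
  define Z where "Z t = c + prim a (\<lambda>s. k s * y s) t" for t
  have lky: "locint (\<lambda>s. k s * y s)" by (rule locint_mult_cont[OF y k(1)])
  have K: "acd K k" unfolding K_def by (rule acd_prim[OF k(1)])
  have Z: "acd Z (\<lambda>s. k s * y s)"
    unfolding Z_def using acd_add[OF acd_const acd_prim[OF lky]] by simp
  have mK: "acd (\<lambda>x. - K x) (\<lambda>x. - k x)"
    using acd_linear[OF K bounded_linear_minus[OF bounded_linear_ident]] .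
  define W where "W t = exp (- K t) * Z t" for t
  have W: "acd W (\<lambda>t. exp (- K t) * (- k t) * Z t + exp (- K t) * (k t * y t))"
    unfolding W_def by (rule acd_mult[OF acd_exp[OF mK] Z])
  have yZ: "y t \<le> Z t" if "t \<in> {a..b}" for t
    using le[OF that] that by (auto simp: Z_def prim_def)
  have "W x - W a \<le> integral {a..x} (\<lambda>_. 0)"
  proof (subst acdD[OF W])
    show "a \<le> x" using x by simp
    show "integral {a..x} (\<lambda>t. exp (- K t) * (- k t) * Z t + exp (- K t) * (k t * y t))
      \<le> integral {a..x} (\<lambda>_. 0)"
    proof (rule integral_le_locint)
      fix t assume t: "t \<in> {a..x}"
      have "exp (- K t) * (- k t) * Z t + exp (- K t) * (k t * y t) = - (exp (- K t) * k t * (Z t - y t))"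
        by (simp add: algebra_simps)
      also have "\<dots> \<le> 0" using yZ[of t] t x k(2)[of t] by simp
      finally show "exp (- K t) * (- k t) * Z t + exp (- K t) * (k t * y t) \<le> 0" .
    qed (use W acd_locint in auto)
  qed
  then have "W x \<le> c" by (simp add: W_def Z_def K_def)
  then have "Z x \<le> c * exp (K x)"
    unfolding W_def by (simp add: exp_minus field_simps)
  then show ?thesis using yZ[OF x] x by (simp add: K_def prim_def)
qed

text \<open>The mirror image: \<open>Z\<close> now integrates up to \<open>b\<close>, and
  \<open>exp (K) * Z\<close> is nondecreasing with final value \<open>c\<close>.\<close>

lemma gronwall_backward:
  fixes y k :: "real \<Rightarrow> real"
  assumes y: "continuous_on UNIV y" and k: "locint k" "\<And>t. 0 \<le> k t"
    and le: "\<And>t. t \<in> {a..b} \<Longrightarrow> y t \<le> c + integral {t..b} (\<lambda>s. k s * y s)"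
    and x: "x \<in> {a..b}"
  shows "y x \<le> c * exp (integral {x..b} k)"
proof -
  define K where "K = prim b k"
  define Z where "Z t = c - prim b (\<lambda>s. k s * y s) t" for t
  have lky: "locint (\<lambda>s. k s * y s)" by (rule locint_mult_cont[OF y k(1)])
  have K: "acd K k" unfolding K_def by (rule acd_prim[OF k(1)])
  have Z: "acd Z (\<lambda>s. 0 - k s * y s)"
    unfolding Z_def using acd_diff[OF acd_const acd_prim[OF lky]] by simp
  define W where "W t = exp (K t) * Z t" for t
  have W: "acd W (\<lambda>t. exp (K t) * k t * Z t + exp (K t) * (0 - k t * y t))"
    unfolding W_def by (rule acd_mult[OF acd_exp[OF K] Z])
  have pb: "prim b g t = - integral {t..b} g" if "t \<le> b" for g :: "real \<Rightarrow> real" and t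
    using that by (auto simp: prim_def)
  have yZ: "y t \<le> Z t" if "t \<in> {a..b}" for t
    using le[OF that] that by (auto simp: Z_def pb)
  have "integral {x..b} (\<lambda>_. 0) \<le> W b - W x"
  proof (subst acdD[OF W])
    show "x \<le> b" using x by simp
    show "integral {x..b} (\<lambda>_. 0) \<le> integral {x..b} (\<lambda>t. exp (K t) * k t * Z t + exp (K t) * (0 - k t
      * y t))"
    proof (rule integral_le_locint)
      fix t assume t: "t \<in> {x..b}"
      have "exp (K t) * k t * Z t + exp (K t) * (0 - k t * y t) = exp (K t) * k t * (Z t - y t)"
        by (simp add: algebra_simps)
      also have "\<dots> \<ge> 0" using yZ[of t] t x k(2)[of t] by simp
      finally show "0 \<le> exp (K t) * k t * Z t + exp (K t) * (0 - k t * y t)" .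
    qed (use W acd_locint in auto)
  qed
  then have "W x \<le> c" by (simp add: W_def Z_def K_def)
  then have "Z x \<le> c * exp (- K x)"
    unfolding W_def by (simp add: exp_minus field_simps)
  then show ?thesis using yZ[OF x] x by (simp add: K_def pb)
qed

text \<open>The first-order system of \<open>-u'' + q u = f\<close>. With \<open>q = V - z\<close>
  this is the differential form of \<open>(H - z) u = f\<close>, which fixes the sign of the
  source.\<close>

definition ode :: "(real \<Rightarrow> complex) \<Rightarrow> (real \<Rightarrow> complex) \<Rightarrow> (real \<Rightarrow> complex) \<Rightarrow> (real \<Rightarrow> complex) \<Rightarrow> bool" where
  "ode q f u u' \<longleftrightarrow> acd u u' \<and> acd u' (\<lambda>t. q t * u t - f t)"

text \<open>The increment of \<open>u\<close> is controlled by \<open>u'\<close>, and that of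
  \<open>u'\<close> by \<open>q * u\<close> and \<open>f\<close>, so \<open>cmod u + cmod u'\<close>
  obeys a Gronwall inequality with kernel \<open>1 + cmod q\<close>. It is run from
  \<open>x0\<close> towards \<open>x\<close>, in whichever direction that is.\<close>

lemma ode_bound:
  assumes o: "ode q f u u'" and q: "locint q" and f: "locint f" and x: "x0 \<in> {a..b}" "x \<in> {a..b}"
  shows "cmod (u x) + cmod (u' x) \<le> (cmod (u x0) + cmod (u' x0) + integral {a..b} (\<lambda>t. cmod (f t)))
     * exp (integral {a..b} (\<lambda>t. 1 + cmod (q t)))"
proof -
  have u: "acd u u'" and u': "acd u' (\<lambda>t. q t * u t - f t)" using o by (auto simp: ode_def)
  have cu: "continuous_on UNIV u" and cu': "continuous_on UNIV u'" using u u' acd_continuous by auto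
  define y where "y t = cmod (u t) + cmod (u' t)" for t
  define k where "k t = 1 + cmod (q t)" for t
  define c where "c = cmod (u x0) + cmod (u' x0) + integral {a..b} (\<lambda>t. cmod (f t))"
  have y: "continuous_on UNIV y" unfolding y_def by (intro continuous_intros cu cu')
  have k: "locint k" "\<And>t. 0 \<le> k t" unfolding k_def by (auto intro!: locint_add locint_norm q)
  have lf: "locint (\<lambda>t. cmod (f t))" by (rule locint_norm[OF f])
  have c0: "0 \<le> c" unfolding c_def by (intro add_nonneg_nonneg integral_nonneg locint_integrable lf) auto
  have lky: "locint (\<lambda>s. k s * y s)" by (rule locint_mult_cont[OF y k(1)])
  have lq: "locint (\<lambda>t. cmod (q t) * cmod (u t))" 
    using locint_mult_cont[OF continuous_on_norm[OF cu] locint_norm[OF q]] .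
  have lu': "locint (\<lambda>t. cmod (u' t))" by (intro locint_continuous continuous_intros cu')
  \<comment> \<open>\<open>s\<close> is the starting end and \<open>t\<close> the other end of
    \<open>{l..r}\<close>, in either order, so a single estimate feeds both Gronwall lemmas.\<close>
  have inc: "cmod (u t) + cmod (u' t) \<le> (cmod (u s) + cmod (u' s)) + integral {a..b} (\<lambda>t. cmod (f t))
    + integral {l..r} (\<lambda>s. k s * y s)"
    if lr: "a \<le> l" "l \<le> r" "r \<le> b" and ts: "(t = l \<and> s = r) \<or> (t = r \<and> s = l)" for l r t s
  proof -
    have 1: "cmod (u r - u l) \<le> integral {l..r} (\<lambda>t. cmod (u' t))"
      unfolding acdD[OF u lr(2)]
      by (rule norm_integral_le) (auto intro!: locint_continuous cu' lu')
    have 2: "cmod (u' r - u' l) \<le> integral {l..r} (\<lambda>t. cmod (q t) * cmod (u t) + cmod (f t))"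
      unfolding acdD[OF u' lr(2)]
      by (rule norm_integral_le)
         (auto intro!: acd_locint[OF u'] locint_add lq lf order_trans[OF norm_triangle_ineq4] simp:
           norm_mult)
    have "integral {l..r} (\<lambda>t. cmod (u' t)) + integral {l..r} (\<lambda>t. cmod (q t) * cmod (u t) + cmod (f t))
      = integral {l..r} (\<lambda>t. cmod (u' t) + cmod (q t) * cmod (u t)) + integral {l..r} (\<lambda>t. cmod (f t))"
      by (simp add: Henstock_Kurzweil_Integration.integral_add locint_integrable locint_add lq lf lu')
    moreover have "integral {l..r} (\<lambda>t. cmod (u' t) + cmod (q t) * cmod (u t)) \<le> integral {l..r} (\<lambda>s. k s
      * y s)"
      by (rule integral_le_locint[OF locint_add[OF lu' lq] lky]) (simp add: k_def y_def algebra_simps)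
    moreover have "integral {l..r} (\<lambda>t. cmod (f t)) \<le> integral {a..b} (\<lambda>t. cmod (f t))"
      by (rule integral_mono_set) (use lf lr in auto)
    moreover have "cmod (u t) \<le> cmod (u s) + cmod (u r - u l)" "cmod (u' t) \<le> cmod (u' s) + cmod (u' r
      - u' l)"
      using ts norm_triangle_ineq2[of "u t" "u s"] norm_triangle_ineq2[of "u' t" "u' s"]
      by (auto simp: norm_minus_commute)
    ultimately show ?thesis using 1 2 by linarith
  qed
  have "y x \<le> c * exp (integral {a..b} k)"
  proof (cases "x0 \<le> x")
    case True
    have "y x \<le> c * exp (integral {x0..x} k)"
    proof (rule gronwall_forward[OF y k, of x0 b])
      show "y t \<le> c + integral {x0..t} (\<lambda>s. k s * y s)" if "t \<in> {x0..b}" for t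
        using inc[of x0 t t x0] that x by (simp add: y_def c_def)
    qed (use x True in auto)
    also have "\<dots> \<le> c * exp (integral {a..b} k)"
      by (intro mult_left_mono c0) (use integral_mono_set[OF k] x in auto)
    finally show ?thesis .
  next
    case False
    have "y x \<le> c * exp (integral {x..x0} k)"
    proof (rule gronwall_backward[OF y k, of a x0])
      show "y t \<le> c + integral {t..x0} (\<lambda>s. k s * y s)" if "t \<in> {a..x0}" for t
        using inc[of t x0 t x0] that x by (simp add: y_def c_def)
    qed (use x False in auto)
    also have "\<dots> \<le> c * exp (integral {a..b} k)"
      by (intro mult_left_mono c0) (use integral_mono_set[OF k] x in auto)
    finally show ?thesis .
  qed
  then show ?thesis by (simp add: y_def c_def k_def[abs_def])
qed

lemma ode_lin:
  assumes "ode q f u u'" "ode q g v v'"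
  shows "ode q (\<lambda>t. a * f t + b * g t) (\<lambda>t. a * u t + b * v t) (\<lambda>t. a * u' t + b * v' t)"
proof -
  have "acd (\<lambda>t. a * u t + b * v t) (\<lambda>t. a * u' t + b * v' t)"
    using assms unfolding ode_def by (intro acd_add acd_cmult) auto
  moreover have "acd (\<lambda>t. a * u' t + b * v' t) (\<lambda>t. a * (q t * u t - f t) + b * (q t * v t - g t))"
    using assms unfolding ode_def by (intro acd_add acd_cmult) auto
  ultimately show ?thesis unfolding ode_def by (simp add: algebra_simps)
qed

lemma ode_diff:
  assumes "ode q f u u'" "ode q g v v'"
  shows "ode q (\<lambda>t. f t - g t) (\<lambda>t. u t - v t) (\<lambda>t. u' t - v' t)"
  using ode_lin[OF assms, of 1 "-1"] by simp

text \<open>The difference is a homogeneous solution with zero Cauchy data at \<open>c\<close>, for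
  which the right-hand side of \<open>ode_bound\<close> is zero.\<close>

lemma ode_unique:
  assumes "ode q f u u'" "ode q f v v'" "locint q" "u c = v c" "u' c = v' c"
  shows "u = v" "u' = v'"
proof -
  have o: "ode q (\<lambda>_. 0) (\<lambda>t. u t - v t) (\<lambda>t. u' t - v' t)"
    using ode_diff[OF assms(1,2)] by simp
  have "cmod (u x - v x) + cmod (u' x - v' x) \<le> 0" for x
    using ode_bound[OF o assms(3) locint_const, of c "min c x" "max c x" x] assms(4,5) by simp
  then have "u x = v x \<and> u' x = v' x" for x
    by (smt (verit) norm_ge_zero norm_eq_zero right_minus_eq)
  then show "u = v" "u' = v'" by auto
qed

lemma ode_zero: "ode q (\<lambda>_. 0) u u' \<Longrightarrow> locint q \<Longrightarrow> u c = 0 \<Longrightarrow> u' c = 0 \<Longrightarrow> u = (\<lambda>_. 0) \<and> u' = (\<lambda>_. 0)"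
  using ode_unique[of q "\<lambda>_. 0" u u' "\<lambda>_. 0" "\<lambda>_. 0" c] by (simp add: ode_def)

section \<open>Global existence of solutions by a weighted contraction\<close>

lemma prim_exp_bound:
  fixes k :: "real \<Rightarrow> real"
  assumes k: "locint k" "\<And>t. 0 \<le> k t" and K: "K = prim c k"
  shows "\<bar>prim c (\<lambda>t. exp (2 * \<bar>K t\<bar>) * k t) x\<bar> \<le> exp (2 * \<bar>K x\<bar>) / 2"
proof -
  have aK: "acd K k" unfolding K by (rule acd_prim[OF k(1)])
  have cK: "continuous_on UNIV K" using aK acd_continuous by auto
  have l: "locint (\<lambda>t. exp (2 * \<bar>K t\<bar>) * k t)"
    by (intro locint_cont_mult k continuous_intros cK)
  have Kpos: "0 \<le> K t" if "c \<le> t" for t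
    using that k by (auto simp: K prim_def intro!: integral_nonneg locint_integrable)
  have Kneg: "K t \<le> 0" if "t \<le> c" for t
  proof -
    have "0 \<le> integral {t..c} k" using k by (auto intro!: integral_nonneg locint_integrable)
    then show ?thesis using that by (cases "t = c") (auto simp: K prim_def)
  qed
  show ?thesis
  proof (cases "c \<le> x")
    case True
    \<comment> \<open>On this side of \<open>c\<close> the integrand is the derivative of
      \<open>exp (2 * K x) / 2\<close>. The 2 in the exponent thus produces the factor 1/2, which
      later serves as the contraction constant.\<close>
    have "acd (\<lambda>x. exp (2 * K x)) (\<lambda>x. exp (2 * K x) * (2 * k x))"
      by (rule acd_exp[OF acd_cmult[OF aK]])
    from acd_cmult[OF this, of "1/2"] have a: "acd (\<lambda>x. exp (2 * K x) / 2) (\<lambda>x. exp (2 * K x) * k x)"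
      by (simp add: mult_ac)
    have "prim c (\<lambda>t. exp (2 * \<bar>K t\<bar>) * k t) x = integral {c..x} (\<lambda>t. exp (2 * \<bar>K t\<bar>) * k t)"
      using True by (simp add: prim_def)
    also have "\<dots> = integral {c..x} (\<lambda>t. exp (2 * K t) * k t)"
      using Kpos by (intro Henstock_Kurzweil_Integration.integral_cong) auto
    also have "\<dots> = exp (2 * K x) / 2 - 1/2"
      using acdD[OF a True] by (simp add: K)
    finally have "prim c (\<lambda>t. exp (2 * \<bar>K t\<bar>) * k t) x = exp (2 * K x) / 2 - 1/2" .
    moreover have "1 \<le> exp (2 * K x)" using Kpos[OF True] by simp
    moreover have "\<bar>K x\<bar> = K x" using Kpos[OF True] by simp
    ultimately show ?thesis by simp
  next
    case False
    have "acd (\<lambda>x. exp ((-2) * K x)) (\<lambda>x. exp ((-2) * K x) * ((-2) * k x))"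
      by (rule acd_exp[OF acd_cmult[OF aK]])
    from acd_cmult[OF this, of "-1/2"] have a: "acd (\<lambda>x. - exp ((-2) * K x) / 2) (\<lambda>x. exp ((-2) * K x)
      * k x)"
      by (simp add: mult_ac)
    have "prim c (\<lambda>t. exp (2 * \<bar>K t\<bar>) * k t) x = - integral {x..c} (\<lambda>t. exp (2 * \<bar>K t\<bar>) * k t)"
      using False by (simp add: prim_def)
    also have "integral {x..c} (\<lambda>t. exp (2 * \<bar>K t\<bar>) * k t) = integral {x..c} (\<lambda>t. exp ((-2) * K t) * k t)"
      using Kneg by (intro Henstock_Kurzweil_Integration.integral_cong) auto
    also have "\<dots> = - 1/2 + exp ((-2) * K x) / 2"
      using acdD[OF a, of x c] False by (simp add: K)
    finally have "prim c (\<lambda>t. exp (2 * \<bar>K t\<bar>) * k t) x = 1/2 - exp (-2 * K x) / 2" by simp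
    moreover have "1 \<le> exp (-2 * K x)" using Kneg[of x] False by simp
    moreover have "\<bar>K x\<bar> = - K x" using Kneg[of x] False by simp
    ultimately show ?thesis by simp
  qed
qed

lemma norm_prim_le:
  fixes f :: "real \<Rightarrow> 'b::euclidean_space"
  assumes "locint f" "locint h" "\<And>t. norm (f t) \<le> h t"
  shows "norm (prim c f x) \<le> \<bar>prim c h x\<bar>"
proof -
  have *: "norm (integral {a..b} f) \<le> \<bar>integral {a..b} h\<bar>" for a b
    using norm_integral_le[OF assms(1,2), of a b] assms(3) by (smt (verit))
  then show ?thesis by (auto simp: prim_def)
qed

lemma prim_cmult: "prim c (\<lambda>t. d * f t) x = d * prim c f x" for f :: "real \<Rightarrow> real"
  by (simp add: prim_def)

lemma prim_add: "locint f \<Longrightarrow> locint g \<Longrightarrow> prim c (\<lambda>t. f t + g t) x = prim c f x + prim c g x"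
  by (simp add: prim_def Henstock_Kurzweil_Integration.integral_add locint_integrable)

lemma prim_diff: "locint f \<Longrightarrow> locint g \<Longrightarrow> prim c (\<lambda>t. f t - g t) x = prim c f x - prim c g x"
  by (simp add: prim_def Henstock_Kurzweil_Integration.integral_diff locint_integrable)

lemma abs_prim_nonneg_add:
  fixes g h :: "real \<Rightarrow> real"
  assumes "locint g" "locint h" "\<And>t. 0 \<le> g t" "\<And>t. 0 \<le> h t"
  shows "\<bar>prim c g x\<bar> + \<bar>prim c h x\<bar> = \<bar>prim c (\<lambda>t. g t + h t) x\<bar>"
proof -
  have *: "0 \<le> integral {a..b} g" "0 \<le> integral {a..b} h" for a b
    using assms by (auto intro!: integral_nonneg locint_integrable)
  show ?thesis
    using *[of c x] *[of x c] unfolding prim_add[OF assms(1,2)] by (auto simp: prim_def)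
qed

lemma cmod_fst_le: "norm (fst p) \<le> norm p" and cmod_snd_le: "norm (snd p) \<le> norm p"
  by (metis norm_fst_le prod.collapse, metis norm_snd_le prod.collapse)

text \<open>A contraction for the sup norm with weight \<open>exp (- 2 \<bar>K\<bar>)\<close>, where \<open>K\<close> is a primitive of
  \<open>1 + \<bar>q\<bar> + \<bar>f\<bar>\<close>: it has a global fixed point on the line.\<close>

theorem ode_exists:
  assumes q: "locint q" and f: "locint f"
  obtains u u' where "ode q f u u'" "u c = \<alpha>" "u' c = \<beta>"
proof -
  \<comment> \<open>The summand \<open>1 + cmod (q t)\<close> is what the contraction estimate
    needs; \<open>cmod (f t)\<close> lets the weight absorb the inhomogeneity too, so that bounded
    functions are mapped to bounded functions.\<close>
  define k where "k t = (1 + cmod (q t)) + cmod (f t)" for t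
  define K where "K = prim c k"
  define e where "e t = exp (2 * \<bar>K t\<bar>)" for t
  have k: "locint k" "\<And>t. 0 \<le> k t"
    unfolding k_def by (auto intro!: locint_add locint_norm q f)
  have cK: "continuous_on UNIV K" unfolding K_def by (rule acd_continuous[OF acd_prim[OF k(1)]])
  have ce: "continuous_on UNIV e" unfolding e_def by (intro continuous_intros cK)
  have epos: "0 < e t" and e1: "1 \<le> e t" for t by (simp_all add: e_def)
  have lek: "locint (\<lambda>t. e t * k t)" by (rule locint_cont_mult[OF ce k(1)])
  have bnd: "\<bar>prim c (\<lambda>t. e t * k t) x\<bar> \<le> e x / 2" for x
    unfolding e_def by (rule prim_exp_bound[OF k K_def])
  \<comment> \<open>A bounded continuous pair \<open>y\<close> encodes the unknowns as
    \<open>(u, u') = e * y\<close>. \<open>P\<close> below is the Picard operator in these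
    variables, and its fixed point is multiplied by \<open>e\<close> again at the end.\<close>
  define G where "G y = (\<lambda>t. e t *\<^sub>R snd (y t))" for y :: "real \<Rightarrow> complex \<times> complex"
  define F where "F y = (\<lambda>t. q t * (e t *\<^sub>R fst (y t)) - f t)" for y :: "real \<Rightarrow> complex \<times> complex"
  define P where "P y x = ((\<alpha> + prim c (G y) x) /\<^sub>R e x, (\<beta> + prim c (F y) x) /\<^sub>R e x)"
    for y :: "real \<Rightarrow> complex \<times> complex" and x
  have lG: "locint (G y)" and lF: "locint (F y)" if "continuous_on UNIV y" for y
  proof -
    show "locint (G y)" unfolding G_def by (intro locint_continuous continuous_intros ce that)
    show "locint (F y)" unfolding F_def
      by (intro locint_diff f locint_mult_cont q continuous_intros ce that)
  qed
  have P: "P y \<in> bcontfun" if y: "y \<in> bcontfun" for y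
  proof -
    have cy: "continuous_on UNIV y" using y by (simp add: bcontfun_def)
    obtain B where B: "\<And>t. norm (y t) \<le> B" using y by (auto simp: bcontfun_def bounded_iff)
    \<comment> \<open>Taking \<open>M\<close> at least 1 allows \<open>cmod (f t)\<close> to be
      bounded by \<open>e t * M * cmod (f t)\<close>.\<close>
    define M where "M = max B 1"
    have M: "norm (y t) \<le> M" "1 \<le> M" "0 \<le> M" for t using B[of t] by (auto simp: M_def)
    have "continuous_on UNIV (P y)"
      unfolding P_def
      by (intro continuous_intros ce acd_continuous[OF acd_prim] lG lF cy)
        (use epos in \<open>auto simp: less_le\<close>)
    moreover have "norm (P y x) \<le> (cmod \<alpha> + M / 2) + (cmod \<beta> + M / 2)" for x
    proof -
      have lM: "locint (\<lambda>t. M * (e t * k t))" by (intro locint_cont_mult continuous_intros lek)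
      have bM: "\<bar>prim c (\<lambda>t. M * (e t * k t)) x\<bar> \<le> M * (e x / 2)"
        unfolding prim_cmult abs_mult using mult_left_mono[OF bnd[of x] M(3)] M(3) by simp
      have 1: "norm (G y t) \<le> M * (e t * k t)" for t
      proof -
        have "norm (G y t) = e t * cmod (snd (y t))" using epos[of t] by (simp add: G_def)
        also have "\<dots> \<le> e t * (M * k t)"
        proof (intro mult_left_mono)
          have "cmod (snd (y t)) \<le> M" using cmod_snd_le[of "y t"] M(1)[of t] by linarith
          also have "M \<le> M * k t" using M by (intro mult_left_le_one_le[THEN order_trans] | simp add: k_def
            algebra_simps)+
          finally show "cmod (snd (y t)) \<le> M * k t" .
        qed (use epos[of t] in simp)
        finally show ?thesis by (simp add: mult_ac)
      qed
      have 2: "norm (F y t) \<le> M * (e t * k t)" for t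
      proof -
        have "norm (F y t) \<le> cmod (q t) * (e t * cmod (fst (y t))) + cmod (f t)"
          unfolding F_def using epos[of t] by (intro order_trans[OF norm_triangle_ineq4])
            (simp add: norm_mult)
        also have "\<dots> \<le> cmod (q t) * (e t * M) + (e t * M) * cmod (f t)"
        proof (intro add_mono mult_left_mono)
          show "cmod (fst (y t)) \<le> M" using cmod_fst_le[of "y t"] M(1)[of t] by linarith
          have "1 * 1 \<le> e t * M" using M e1[of t] by (intro mult_mono) auto
          then show "cmod (f t) \<le> e t * M * cmod (f t)"
            by (metis mult_1 mult_right_mono norm_ge_zero)
        qed (use epos[of t] in auto)
        also have "\<dots> = (e t * M) * (cmod (q t) + cmod (f t))" by (simp add: algebra_simps)
        also have "\<dots> \<le> (e t * M) * k t" using epos[of t] M by (intro mult_left_mono) (auto simp: k_def)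
        finally show ?thesis by (simp add: mult_ac)
      qed
      have g: "norm ((\<gamma> + prim c g x) /\<^sub>R e x) \<le> cmod \<gamma> + M / 2"
        if g: "locint g" "\<And>t. norm (g t) \<le> M * (e t * k t)" for \<gamma> :: complex and g
      proof -
        have "norm (\<gamma> + prim c g x) \<le> cmod \<gamma> + M * (e x / 2)"
          using norm_prim_le[OF g(1) lM g(2), of c x] bM norm_triangle_ineq[of \<gamma> "prim c g x"] by linarith
        also have "\<dots> \<le> e x * (cmod \<gamma> + M / 2)" using e1[of x]
          by (simp add: algebra_simps mult_left_le_one_le mult_le_cancel_left1 mult_le_cancel_right1)
        finally have h: "norm (\<gamma> + prim c g x) \<le> e x * (cmod \<gamma> + M / 2)" .
        have "norm ((\<gamma> + prim c g x) /\<^sub>R e x) = norm (\<gamma> + prim c g x) / e x"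
          using epos[of x] by (simp add: divide_inverse_commute del: scaleR_add_right)
        then show ?thesis using h epos[of x] by (simp only: pos_divide_le_eq mult.commute)
      qed
      have "norm (P y x) \<le> norm ((\<alpha> + prim c (G y) x) /\<^sub>R e x) + norm ((\<beta> + prim c (F y) x) /\<^sub>R e x)"
        unfolding P_def by (rule norm_Pair_le)
      also have "\<dots> \<le> (cmod \<alpha> + M / 2) + (cmod \<beta> + M / 2)"
        by (intro add_mono g lG lF cy 1 2)
      finally show ?thesis .
    qed
    ultimately show ?thesis unfolding bcontfun_def bounded_iff by blast
  qed
  define \<Phi> where "\<Phi> y = Bcontfun (P (apply_bcontfun y))" for y
  have app: "apply_bcontfun (\<Phi> y) = P (apply_bcontfun y)" for y
    unfolding \<Phi>_def by (rule Bcontfun_inverse[OF P[OF apply_bcontfun]])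
  have "\<exists>!y. \<Phi> y = y"
  proof (rule banach_fix_type[where c = "1/2"])
    show "\<forall>y z. dist (\<Phi> y) (\<Phi> z) \<le> 1/2 * dist y z"
    proof (intro allI dist_bound)
      fix y z :: "real \<Rightarrow>\<^sub>C (complex \<times> complex)" and x
      define D where "D = dist y z"
      have D0: "0 \<le> D" by (simp add: D_def)
      have cy: "continuous_on UNIV (apply_bcontfun y)" and cz: "continuous_on UNIV (apply_bcontfun z)"
        by (auto intro: continuous_on_apply_bcontfun)
      have d: "norm (apply_bcontfun y t - apply_bcontfun z t) \<le> D" for t
        using dist_bounded[of y t z] by (simp add: D_def dist_norm)
      have df: "cmod (fst (apply_bcontfun y t) - fst (apply_bcontfun z t)) \<le> D" for t
        using d[of t] cmod_fst_le[of "apply_bcontfun y t - apply_bcontfun z t"] by simp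
      have ds: "cmod (snd (apply_bcontfun y t) - snd (apply_bcontfun z t)) \<le> D" for t
        using d[of t] cmod_snd_le[of "apply_bcontfun y t - apply_bcontfun z t"] by simp
      have le: "locint (\<lambda>t. e t * 1)" by (intro locint_continuous continuous_intros ce)
      have leq: "locint (\<lambda>t. e t * cmod (q t))" by (intro locint_cont_mult ce locint_norm q)
      have lDe: "locint (\<lambda>t. D * (e t * 1))" and lDeq: "locint (\<lambda>t. D * (e t * cmod (q t)))"
        by (intro locint_cont_mult continuous_intros le leq)+
      have 1: "norm (prim c (G y) x - prim c (G z) x) \<le> \<bar>prim c (\<lambda>t. D * (e t * 1)) x\<bar>"
        unfolding prim_diff[OF lG[OF cy] lG[OF cz], symmetric]
      proof (rule norm_prim_le[OF locint_diff[OF lG[OF cy] lG[OF cz]] lDe])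
        fix t
        have "G y t - G z t = e t *\<^sub>R (snd (apply_bcontfun y t) - snd (apply_bcontfun z t))"
          by (simp add: G_def scaleR_diff_right)
        then show "norm (G y t - G z t) \<le> D * (e t * 1)"
          using ds[of t] epos[of t] by (simp add: mult.commute mult_left_mono)
      qed
      have 2: "norm (prim c (F y) x - prim c (F z) x) \<le> \<bar>prim c (\<lambda>t. D * (e t * cmod (q t))) x\<bar>"
        unfolding prim_diff[OF lF[OF cy] lF[OF cz], symmetric]
      proof (rule norm_prim_le[OF locint_diff[OF lF[OF cy] lF[OF cz]] lDeq])
        fix t
        have "F y t - F z t = q t * (e t *\<^sub>R (fst (apply_bcontfun y t) - fst (apply_bcontfun z t)))"
          by (simp add: F_def scaleR_diff_right algebra_simps)
        then have "norm (F y t - F z t) = (e t * cmod (q t)) * cmod (fst (apply_bcontfun y t)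
          - fst (apply_bcontfun z t))"
          using epos[of t] by (simp add: norm_mult)
        also have "\<dots> \<le> (e t * cmod (q t)) * D"
          by (intro mult_left_mono df) (use epos[of t] in simp)
        finally show "norm (F y t - F z t) \<le> D * (e t * cmod (q t))" by (simp add: mult.commute)
      qed
      \<comment> \<open>The two components are recombined under one primitive of
        \<open>D * (e t * k t)\<close>. Bounding each by \<open>D * (e x / 2)\<close> and adding
        would give the factor 1 instead of 1/2.\<close>
      have "\<bar>prim c (\<lambda>t. D * (e t * 1)) x\<bar> + \<bar>prim c (\<lambda>t. D * (e t * cmod (q t))) x\<bar>
        = \<bar>prim c (\<lambda>t. D * (e t * 1) + D * (e t * cmod (q t))) x\<bar>"
        by (rule abs_prim_nonneg_add[OF lDe lDeq]) (use D0 epos in \<open>auto simp: less_le\<close>)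
      also have "\<dots> = norm (prim c (\<lambda>t. D * (e t * 1) + D * (e t * cmod (q t))) x)" by simp
      also have "\<dots> \<le> \<bar>prim c (\<lambda>t. D * (e t * k t)) x\<bar>"
      proof (rule norm_prim_le)
        show "norm (D * (e t * 1) + D * (e t * cmod (q t))) \<le> D * (e t * k t)" for t
        proof -
          have "D * (e t * 1) + D * (e t * cmod (q t)) = (D * e t) * (1 + cmod (q t))"
            by (simp add: algebra_simps)
          moreover have "\<dots> \<le> (D * e t) * k t"
            using D0 epos[of t] by (intro mult_left_mono) (auto simp: k_def)
          moreover have "0 \<le> (D * e t) * (1 + cmod (q t))" using D0 epos[of t] by simp
          ultimately show ?thesis by (simp add: mult_ac)
        qed
        show "locint (\<lambda>t. D * (e t * k t))" by (intro locint_cont_mult continuous_intros lek)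
      qed (intro locint_add lDe lDeq)
      also have "\<dots> \<le> D * (e x / 2)"
        unfolding prim_cmult abs_mult using mult_left_mono[OF bnd[of x] D0] D0 by simp
      finally have 3: "norm (prim c (G y) x - prim c (G z) x) + norm (prim c (F y) x - prim c (F z) x)
        \<le> D * (e x / 2)"
        using 1 2 by linarith
      have "dist (apply_bcontfun (\<Phi> y) x) (apply_bcontfun (\<Phi> z) x)
         = norm ((prim c (G y) x - prim c (G z) x) /\<^sub>R e x, (prim c (F y) x - prim c (F z) x) /\<^sub>R e x)"
        by (simp add: app dist_norm P_def scaleR_diff_right[symmetric])
      also have "\<dots> \<le> norm ((prim c (G y) x - prim c (G z) x) /\<^sub>R e x) + norm ((prim c (F y) x
        - prim c (F z) x) /\<^sub>R e x)"
        by (rule norm_Pair_le)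
      also have "\<dots> = (norm (prim c (G y) x - prim c (G z) x) + norm (prim c (F y) x
        - prim c (F z) x)) / e x"
        using epos[of x] by (simp add: divide_inverse_commute distrib_left)
      also have "\<dots> \<le> 1 / 2 * D"
        using 3 epos[of x] by (simp add: divide_le_eq algebra_simps)
      finally show "dist (apply_bcontfun (\<Phi> y) x) (apply_bcontfun (\<Phi> z) x) \<le> 1/2 * dist y z"
        by (simp add: D_def)
    qed
  qed auto
  then obtain y where "\<Phi> y = y" by blast
  then have y: "apply_bcontfun y = P (apply_bcontfun y)" using app by metis
  have cy: "continuous_on UNIV (apply_bcontfun y)" by (auto intro: continuous_on_apply_bcontfun)
  define u where "u t = e t *\<^sub>R fst (apply_bcontfun y t)" for t
  define u' where "u' t = e t *\<^sub>R snd (apply_bcontfun y t)" for t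
  have Ge: "G y = u'" by (simp add: G_def u'_def[abs_def])
  have Fe: "F y = (\<lambda>t. q t * u t - f t)" by (simp add: F_def u_def[abs_def])
  have u: "u x = \<alpha> + prim c u' x" and u': "u' x = \<beta> + prim c (\<lambda>t. q t * u t - f t) x" for x
    using arg_cong[OF fun_cong[OF y, of x], of fst] arg_cong[OF fun_cong[OF y, of x], of snd] epos[of x]
    unfolding P_def Ge Fe by (simp_all add: u_def u'_def)
  have "acd (\<lambda>x. \<alpha> + prim c u' x) (\<lambda>x. 0 + u' x)"
    using lG[OF cy] unfolding Ge by (intro acd_add acd_const acd_prim)
  then have "acd u u'" using u by (metis (no_types, lifting) add_0 ext)
  moreover have "acd (\<lambda>x. \<beta> + prim c (\<lambda>t. q t * u t - f t) x) (\<lambda>x. 0 + (q x * u x - f x))"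
    using lF[OF cy] unfolding Fe by (intro acd_add acd_const acd_prim)
  then have "acd u' (\<lambda>t. q t * u t - f t)"
    using u' by (metis (no_types, lifting) add_0 ext)
  ultimately have "ode q f u u'" by (simp add: ode_def)
  moreover have "u c = \<alpha>" "u' c = \<beta>" using u[of c] u'[of c] by simp_all
  ultimately show ?thesis using that by blast
qed

section \<open>Square integrable functions\<close>

definition nrm2 :: "(real \<Rightarrow> complex) \<Rightarrow> real" where
  "nrm2 f = (\<integral>x. (cmod (f x))\<^sup>2 \<partial>lebesgue)"

lemma nrm2_nonneg [simp]: "0 \<le> nrm2 f"
  by (simp add: nrm2_def)

lemma sq_int_measurable: "sq_int f \<Longrightarrow> f \<in> borel_measurable lebesgue"
  by (simp add: sq_int_def)

lemma sq_int_integrable: "sq_int f \<Longrightarrow> integrable lebesgue (\<lambda>x. (cmod (f x))\<^sup>2)"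
  by (simp add: sq_int_def)

lemma sq_int_bound:
  assumes "f \<in> borel_measurable lebesgue" "integrable lebesgue h" "\<And>x. (cmod (f x))\<^sup>2 \<le> h x"
  shows "sq_int f"
  unfolding sq_int_def
proof
  show "integrable lebesgue (\<lambda>x. (cmod (f x))\<^sup>2)"
  proof (rule Bochner_Integration.integrable_bound[OF assms(2)])
    show "AE x in lebesgue. norm ((cmod (f x))\<^sup>2) \<le> norm (h x)"
      by (rule AE_I2) (use assms(3) in \<open>auto intro: order_trans[OF _ abs_ge_self]\<close>)
  qed (use assms(1) in measurable)
qed (rule assms(1))

lemma borel_measurable_cnj [measurable]:
  "f \<in> borel_measurable M \<Longrightarrow> (\<lambda>x. cnj (f x)) \<in> borel_measurable M"
  by (rule borel_measurable_continuous_on[OF _ , of cnj]) (auto intro: continuous_intros)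

lemma norm_mult_integrable:
  assumes "sq_int f" "sq_int g"
  shows "integrable lebesgue (\<lambda>x. cmod (f x) * cmod (g x))"
proof (rule Bochner_Integration.integrable_bound)
  show "integrable lebesgue (\<lambda>x. (cmod (f x))\<^sup>2 + (cmod (g x))\<^sup>2)"
    using assms by (auto simp: sq_int_def)
  have [measurable]: "f \<in> borel_measurable lebesgue" "g \<in> borel_measurable lebesgue"
    using assms by (auto simp: sq_int_def)
  show "(\<lambda>x. cmod (f x) * cmod (g x)) \<in> borel_measurable lebesgue" by measurable
  show "AE x in lebesgue. norm (cmod (f x) * cmod (g x)) \<le> norm ((cmod (f x))\<^sup>2 + (cmod (g x))\<^sup>2)"
  proof (rule AE_I2)
    fix x
    have "2 * (cmod (f x) * cmod (g x)) \<le> (cmod (f x))\<^sup>2 + (cmod (g x))\<^sup>2"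
      using sum_squares_bound[of "cmod (f x)" "cmod (g x)"] by (simp add: mult.assoc)
    moreover have "0 \<le> cmod (f x) * cmod (g x)" by simp
    ultimately have "cmod (f x) * cmod (g x) \<le> (cmod (f x))\<^sup>2 + (cmod (g x))\<^sup>2" by linarith
    then show "norm (cmod (f x) * cmod (g x)) \<le> norm ((cmod (f x))\<^sup>2 + (cmod (g x))\<^sup>2)" by simp
  qed
qed

lemma inner_integrable:
  assumes "sq_int f" "sq_int g"
  shows "integrable lebesgue (\<lambda>x. cnj (f x) * g x)"
proof (rule Bochner_Integration.integrable_bound[OF norm_mult_integrable[OF assms]])
  have [measurable]: "f \<in> borel_measurable lebesgue" "g \<in> borel_measurable lebesgue"
    using assms by (auto simp: sq_int_def)
  show "(\<lambda>x. cnj (f x) * g x) \<in> borel_measurable lebesgue" by measurable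
qed (simp add: norm_mult)

lemma sq_int_cmult: "sq_int f \<Longrightarrow> sq_int (\<lambda>x. c * f x)"
  unfolding sq_int_def by (auto simp: norm_mult power_mult_distrib intro: borel_measurable_times)

lemma sq_int_add:
  assumes "sq_int f" "sq_int g" shows "sq_int (\<lambda>x. f x + g x)"
proof (rule sq_int_bound)
  show "(\<lambda>x. f x + g x) \<in> borel_measurable lebesgue"
    using assms by (auto simp: sq_int_def)
  show "integrable lebesgue (\<lambda>x. 2 * (cmod (f x))\<^sup>2 + 2 * (cmod (g x))\<^sup>2)"
    using assms by (auto simp: sq_int_def)
  show "(cmod (f x + g x))\<^sup>2 \<le> 2 * (cmod (f x))\<^sup>2 + 2 * (cmod (g x))\<^sup>2" for x
  proof -
    have "(cmod (f x + g x))\<^sup>2 \<le> (cmod (f x) + cmod (g x))\<^sup>2"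
      by (intro power_mono norm_triangle_ineq) auto
    also have "\<dots> \<le> 2 * (cmod (f x))\<^sup>2 + 2 * (cmod (g x))\<^sup>2"
      using sum_squares_bound[of "cmod (f x)" "cmod (g x)"] by (simp add: power2_sum)
    finally show ?thesis .
  qed
qed

lemma sq_int_diff: "sq_int f \<Longrightarrow> sq_int g \<Longrightarrow> sq_int (\<lambda>x. f x - g x)"
  using sq_int_add[of f "\<lambda>x. (-1) * g x"] sq_int_cmult[of g "-1"] by simp

lemma sq_int_zero [simp]: "sq_int (\<lambda>_. 0)"
  by (simp add: sq_int_def)

lemma lebesgue_measurable_shift:
  fixes f :: "real \<Rightarrow> 'b::euclidean_space"
  assumes "f \<in> borel_measurable lebesgue" shows "(\<lambda>x. f (x + c)) \<in> borel_measurable lebesgue"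
  using measurable_compose[OF lebesgue_affine_measurable[of "\<lambda>_. 1" c] assms]
  by (simp add: o_def add.commute)

lemma integrable_shift:
  fixes f :: "real \<Rightarrow> 'b::euclidean_space"
  shows "integrable lebesgue f \<Longrightarrow> integrable lebesgue (\<lambda>x. f (x + c))"
  using lebesgue_integrable_real_affine[of f 1 c] by (simp add: add.commute)

lemma integral_shift:
  fixes f :: "real \<Rightarrow> 'b::euclidean_space"
  shows "(\<integral>x. f (x + c) \<partial>lebesgue) = (\<integral>x. f x \<partial>lebesgue)"
  using lebesgue_integral_real_affine[of 1 f c] by (simp add: add.commute)

lemma sq_int_shift: "sq_int f \<Longrightarrow> sq_int (\<lambda>x. f (x + c))"
  unfolding sq_int_def
  using integrable_shift[of "\<lambda>x. (cmod (f x))\<^sup>2" c] lebesgue_measurable_shift by auto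

lemma nrm2_shift: "nrm2 (\<lambda>x. f (x + c)) = nrm2 f"
  unfolding nrm2_def by (rule integral_shift)

lemma inner_L2_add_right: "sq_int f \<Longrightarrow> sq_int g \<Longrightarrow> sq_int h \<Longrightarrow>
    inner_L2 f (\<lambda>x. g x + h x) = inner_L2 f g + inner_L2 f h"
  unfolding inner_L2_def
  by (subst Bochner_Integration.integral_add[symmetric]) (auto simp: inner_integrable distrib_left
    distrib_right left_diff_distrib right_diff_distrib)

lemma inner_L2_add_left: "sq_int f \<Longrightarrow> sq_int g \<Longrightarrow> sq_int h \<Longrightarrow>
    inner_L2 (\<lambda>x. g x + h x) f = inner_L2 g f + inner_L2 h f"
  unfolding inner_L2_def
  by (subst Bochner_Integration.integral_add[symmetric]) (auto simp: inner_integrable distrib_left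
    distrib_right left_diff_distrib right_diff_distrib)

lemma inner_L2_cmult_right: "inner_L2 f (\<lambda>x. c * g x) = c * inner_L2 f g"
  unfolding inner_L2_def by (simp add: mult.left_commute)

lemma inner_L2_cmult_left: "inner_L2 (\<lambda>x. c * f x) g = cnj c * inner_L2 f g"
  unfolding inner_L2_def by (simp add: mult.assoc)

lemma inner_L2_diff_right: "sq_int f \<Longrightarrow> sq_int g \<Longrightarrow> sq_int h \<Longrightarrow>
    inner_L2 f (\<lambda>x. g x - h x) = inner_L2 f g - inner_L2 f h"
  unfolding inner_L2_def
  by (subst Bochner_Integration.integral_diff[symmetric]) (auto simp: inner_integrable distrib_left
    distrib_right left_diff_distrib right_diff_distrib)

lemma inner_L2_diff_left: "sq_int f \<Longrightarrow> sq_int g \<Longrightarrow> sq_int h \<Longrightarrow>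
    inner_L2 (\<lambda>x. g x - h x) f = inner_L2 g f - inner_L2 h f"
  unfolding inner_L2_def
  by (subst Bochner_Integration.integral_diff[symmetric]) (auto simp: inner_integrable distrib_left
    distrib_right left_diff_distrib right_diff_distrib)

lemma inner_L2_commute: "inner_L2 g f = cnj (inner_L2 f g)"
  unfolding inner_L2_def by (simp add: Bochner_Integration.integral_cnj[symmetric] mult.commute)

lemma inner_L2_self: "inner_L2 f f = complex_of_real (nrm2 f)"
proof -
  have "inner_L2 f f = (\<integral>x. complex_of_real ((cmod (f x))\<^sup>2) \<partial>lebesgue)"
    unfolding inner_L2_def by (intro Bochner_Integration.integral_cong)
      (auto simp: complex_norm_square[symmetric] mult.commute simp del: of_real_power)
  then show ?thesis by (simp only: nrm2_def integral_complex_of_real)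
qed

lemma inner_L2_shift: "inner_L2 (\<lambda>x. f (x + c)) (\<lambda>x. g (x + c)) = inner_L2 f g"
  unfolding inner_L2_def by (rule integral_shift[of "\<lambda>x. cnj (f x) * g x"])

text \<open>The quadratic form in \<open>s, t\<close> given by the integral of
  \<open>(s * cmod f - t * cmod g)^2\<close> is nonnegative; it is evaluated at
  \<open>s = c\<close>, \<open>t = nrm2 f\<close>.\<close>

lemma cauchy_schwarz_abs:
  assumes "sq_int f" "sq_int g"
  shows "(\<integral>x. cmod (f x) * cmod (g x) \<partial>lebesgue)\<^sup>2 \<le> nrm2 f * nrm2 g"
proof -
  define c where "c = (\<integral>x. cmod (f x) * cmod (g x) \<partial>lebesgue)"
  have c0: "0 \<le> c" unfolding c_def by simp
  have q: "0 \<le> s\<^sup>2 * nrm2 f - 2 * s * t * c + t\<^sup>2 * nrm2 g" for s t :: real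
  proof -
    have "0 \<le> (\<integral>x. (s * cmod (f x) - t * cmod (g x))\<^sup>2 \<partial>lebesgue)" by simp
    also have "\<dots> = (\<integral>x. s\<^sup>2 * (cmod (f x))\<^sup>2 - 2 * s * t * (cmod (f x) * cmod (g x)) + t\<^sup>2
      * (cmod (g x))\<^sup>2 \<partial>lebesgue)"
      by (intro Bochner_Integration.integral_cong) (auto simp: power2_diff power_mult_distrib algebra_simps)
    also have "\<dots> = s\<^sup>2 * nrm2 f - 2 * s * t * c + t\<^sup>2 * nrm2 g"
      using assms norm_mult_integrable[OF assms] by (simp add: c_def nrm2_def sq_int_def)
    finally show ?thesis .
  qed
  show ?thesis
  proof (cases "nrm2 f = 0")
    case True
    have "c = 0"
    proof (rule ccontr)
      assume "c \<noteq> 0"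
      then have "c > 0" using c0 by simp
      \<comment> \<open>With \<open>nrm2 f = 0\<close> and this \<open>s\<close>, the quadratic form
        takes the value -1.\<close>
      from q[of "(nrm2 g + 1) / (2 * c)" 1] True this show False by (simp add: field_simps)
    qed
    then show ?thesis using True by (simp add: c_def)
  next
    case False
    then have p: "0 < nrm2 f" using nrm2_nonneg[of f] by linarith
    have "0 \<le> nrm2 f * (nrm2 f * nrm2 g - c\<^sup>2)"
      using q[of c "nrm2 f"] by (simp add: algebra_simps power2_eq_square)
    then have "c\<^sup>2 \<le> nrm2 f * nrm2 g" using p by (simp add: zero_le_mult_iff)
    then show ?thesis by (simp add: c_def)
  qed
qed

definition nrm :: "(real \<Rightarrow> complex) \<Rightarrow> real" where "nrm f = sqrt (nrm2 f)"

lemma nrm_nonneg [simp]: "0 \<le> nrm f" by (simp add: nrm_def)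

lemma nrm_sq: "(nrm f)\<^sup>2 = nrm2 f" by (simp add: nrm_def)

lemma abs_inner_le:
  assumes "sq_int f" "sq_int g"
  shows "(\<integral>x. cmod (f x) * cmod (g x) \<partial>lebesgue) \<le> nrm f * nrm g"
  unfolding nrm_def real_sqrt_mult[symmetric]
  by (rule real_le_rsqrt[OF cauchy_schwarz_abs[OF assms]])

lemma cauchy_schwarz:
  assumes "sq_int f" "sq_int g"
  shows "cmod (inner_L2 f g) \<le> nrm f * nrm g"
proof -
  have "cmod (inner_L2 f g) \<le> (\<integral>x. cmod (f x) * cmod (g x) \<partial>lebesgue)"
    unfolding inner_L2_def using integral_norm_bound[of lebesgue "\<lambda>x. cnj (f x) * g x"]
      by (simp add: norm_mult)
  then show ?thesis using abs_inner_le[OF assms] by linarith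
qed

lemma nrm2_add:
  assumes "sq_int f" "sq_int g"
  shows "complex_of_real (nrm2 (\<lambda>x. f x + g x)) = nrm2 f + inner_L2 f g + inner_L2 g f + nrm2 g"
  unfolding inner_L2_self[symmetric]
  using assms by (simp add: inner_L2_add_left inner_L2_add_right sq_int_add)

lemma nrm_triangle:
  assumes "sq_int f" "sq_int g"
  shows "nrm (\<lambda>x. f x + g x) \<le> nrm f + nrm g"
proof (rule power2_le_imp_le)
  have "nrm2 (\<lambda>x. f x + g x) = Re (nrm2 f + inner_L2 f g + inner_L2 g f + nrm2 g)"
    using arg_cong[OF nrm2_add[OF assms], of Re] by (simp only: Re_complex_of_real)
  also have "\<dots> \<le> nrm2 f + cmod (inner_L2 f g) + cmod (inner_L2 g f) + nrm2 g"
    using complex_Re_le_cmod[of "inner_L2 f g"] complex_Re_le_cmod[of "inner_L2 g f"] by simp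
  also have "\<dots> \<le> nrm2 f + nrm f * nrm g + nrm g * nrm f + nrm2 g"
    using cauchy_schwarz assms by (intro add_mono) auto
  also have "\<dots> = (nrm f + nrm g)\<^sup>2" by (simp add: power2_sum nrm_sq)
  finally show "(nrm (\<lambda>x. f x + g x))\<^sup>2 \<le> (nrm f + nrm g)\<^sup>2" by (simp add: nrm_sq)
qed simp

lemma nrm2_cmult: "nrm2 (\<lambda>x. c * f x) = (cmod c)\<^sup>2 * nrm2 f"
  by (simp add: nrm2_def norm_mult power_mult_distrib)

lemma nrm_cmult: "nrm (\<lambda>x. c * f x) = cmod c * nrm f"
  by (simp add: nrm_def nrm2_cmult real_sqrt_mult)

lemma nrm_diff:
  assumes "sq_int f" "sq_int g"
  shows "nrm (\<lambda>x. f x - g x) \<le> nrm f + nrm g"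
  using nrm_triangle[OF assms(1) sq_int_cmult[OF assms(2), of "-1"]] nrm_cmult[of "-1" g] by simp

lemma nrm2_eq_0_AE: "sq_int f \<Longrightarrow> nrm2 f = 0 \<Longrightarrow> AE x in lebesgue. f x = 0"
  unfolding nrm2_def sq_int_def by (simp add: integral_nonneg_eq_0_iff_AE)

lemma nrm2_eq_0_continuous: "sq_int f \<Longrightarrow> nrm2 f = 0 \<Longrightarrow> continuous_on UNIV f \<Longrightarrow> f = (\<lambda>_. 0)"
  by (rule AE_eq_continuous_imp_eq) (auto intro: nrm2_eq_0_AE)

lemma integrable_imp_locint:
  fixes f :: "real \<Rightarrow> 'b::euclidean_space"
  assumes "integrable lebesgue f" shows "locint f"
  unfolding locint_def set_integrable_def using assms by (auto intro: integrable_mult_indicator)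

lemma sq_int_locint:
  assumes "sq_int f" shows "locint f"
proof (rule locint_bound)
  show "f \<in> borel_measurable lebesgue" using assms by (rule sq_int_measurable)
  show "locint (\<lambda>x. 1 + (cmod (f x))\<^sup>2)"
    by (intro locint_add locint_const integrable_imp_locint sq_int_integrable assms)
  show "norm (f x) \<le> 1 + (cmod (f x))\<^sup>2" for x
  proof -
    have "2 * cmod (f x) \<le> (cmod (f x))\<^sup>2 + 1" "0 \<le> cmod (f x)"
      using sum_squares_bound[of "cmod (f x)" 1] by simp_all
    then show ?thesis by linarith
  qed
qed

section \<open>Sobolev functions on the line\<close>

lemma H1_iff: "H1 u u' \<longleftrightarrow> acd u u' \<and> sq_int u \<and> sq_int u'"
  unfolding H1_def using acd_int0_iff[of u' u] acd_continuous[of u u'] sq_int_locint[of u'] by blast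

lemma H1_lin: "H1 u u' \<Longrightarrow> H1 v v' \<Longrightarrow> H1 (\<lambda>x. a * u x + b * v x) (\<lambda>x. a * u' x + b * v' x)"
  unfolding H1_iff
  using acd_add[OF acd_cmult[of u u' a] acd_cmult[of v v' b]]
    sq_int_add[OF sq_int_cmult[of u a] sq_int_cmult[of v b]]
    sq_int_add[OF sq_int_cmult[of u' a] sq_int_cmult[of v' b]] by blast

lemma H1_continuous: "H1 u u' \<Longrightarrow> continuous_on UNIV u"
  unfolding H1_def by blast

lemma sq_int_indicator:
  assumes "sq_int f" shows "sq_int (\<lambda>x. indicator {a..b} x * f x)"
proof (rule sq_int_bound[OF _ sq_int_integrable[OF assms]])
  show "(\<lambda>x. indicator {a..b} x * f x) \<in> borel_measurable lebesgue"
    by (rule borel_measurable_times[OF borel_measurable_indicator sq_int_measurable[OF assms]]) simp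
  show "(cmod (indicator {a..b} x * f x))\<^sup>2 \<le> (cmod (f x))\<^sup>2" for x
    by (simp add: indicator_def)
qed

lemma integral_sq_le_interval:
  assumes "sq_int f" "a \<le> b"
  shows "(integral {a..b} (\<lambda>x. cmod (f x)))\<^sup>2 \<le> (b - a) * integral {a..b} (\<lambda>x. (cmod (f x))\<^sup>2)"
proof -
  have s: "sq_int (\<lambda>x. indicator {a..b} x)"
    unfolding sq_int_def
  proof
    show "integrable lebesgue (\<lambda>x. (cmod (indicator {a..b} x))\<^sup>2)"
      using locint_integrable_indicator[OF locint_const[of "1::real"], of a b]
      by (rule Bochner_Integration.integrable_cong[THEN iffD1, rotated -1]) (auto simp: indicator_def)
  qed (rule borel_measurable_indicator, simp)
  have s2: "sq_int (\<lambda>x. indicator {a..b} x * f x)" by (rule sq_int_indicator[OF assms(1)])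
  have 1: "(\<integral>x. cmod (indicator {a..b} x) * cmod (indicator {a..b} x * f x) \<partial>lebesgue)
     = integral {a..b} (\<lambda>x. cmod (f x))"
    using locint_lebesgue_integral[OF locint_norm[OF sq_int_locint[OF assms(1)]], of a b, symmetric]
    by (simp, intro Bochner_Integration.integral_cong) (auto simp: indicator_def)
  have 2: "nrm2 (\<lambda>x. indicator {a..b} x) = b - a"
  proof -
    have "nrm2 (\<lambda>x. indicator {a..b} x) = (\<integral>x. indicator {a..b} x *\<^sub>R 1 \<partial>lebesgue)"
      unfolding nrm2_def by (intro Bochner_Integration.integral_cong) (auto simp: indicator_def)
    also have "\<dots> = integral {a..b} (\<lambda>x. 1)"
      by (rule locint_lebesgue_integral) simp
    also have "\<dots> = b - a" using assms(2) by simp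
    finally show ?thesis .
  qed
  have 3: "nrm2 (\<lambda>x. indicator {a..b} x * f x) = integral {a..b} (\<lambda>x. (cmod (f x))\<^sup>2)"
    unfolding nrm2_def
    using locint_lebesgue_integral[OF integrable_imp_locint[OF sq_int_integrable[OF assms(1)]], of a b,
      symmetric]
    by (simp, intro Bochner_Integration.integral_cong) (auto simp: indicator_def)
  show ?thesis using cauchy_schwarz_abs[OF s s2] unfolding 1 2 3 .
qed

text \<open>Compare \<open>u x\<close> with \<open>u y\<close> for every \<open>y\<close> in
  \<open>{x..x + d}\<close> and average over \<open>y\<close>. The free length \<open>d\<close>
  makes the weight of \<open>u'\<close> as small as desired at the price of a large weight on
  \<open>u\<close>, which yields small relative form bounds.\<close>

lemma H1_pointwise:
  assumes H: "H1 u u'" and d: "0 < d"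
  shows "(cmod (u x))\<^sup>2 \<le> integral {x..x+d} (\<lambda>y. (2 / d) * (cmod (u y))\<^sup>2 + (2 * d) * (cmod (u' y))\<^sup>2)"
proof -
  have a: "acd u u'" and su: "sq_int u" and su': "sq_int u'" using H by (auto simp: H1_iff)
  have l: "locint (\<lambda>y. (cmod (u y))\<^sup>2)" "locint (\<lambda>y. (cmod (u' y))\<^sup>2)" "locint u'"
    using su su' by (auto intro!: integrable_imp_locint sq_int_integrable sq_int_locint)
  define I where "I = integral {x..x+d} (\<lambda>y. cmod (u' y))"
  have I0: "0 \<le> I" unfolding I_def by (intro integral_nonneg locint_integrable locint_norm l) auto
  have y: "(cmod (u x))\<^sup>2 \<le> 2 * (cmod (u y))\<^sup>2 + 2 * I\<^sup>2" if y: "y \<in> {x..x+d}" for y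
  proof -
    have "cmod (u y - u x) \<le> integral {x..y} (\<lambda>y. cmod (u' y))"
      using acdD[OF a, of x y] y norm_integral_le[OF l(3) locint_norm[OF l(3)], of x y] by simp
    also have "\<dots> \<le> I" unfolding I_def by (rule integral_mono_set) (use y l locint_norm in auto)
    finally have "cmod (u x) \<le> cmod (u y) + I"
      using norm_triangle_ineq2[of "u x" "u y"] by (simp add: norm_minus_commute)
    then have "(cmod (u x))\<^sup>2 \<le> (cmod (u y) + I)\<^sup>2" by (intro power_mono) auto
    also have "\<dots> \<le> 2 * (cmod (u y))\<^sup>2 + 2 * I\<^sup>2"
      using sum_squares_bound[of "cmod (u y)" I] by (simp add: power2_sum)
    finally show ?thesis .
  qed
  have "integral {x..x+d} (\<lambda>_. (cmod (u x))\<^sup>2) \<le> integral {x..x+d} (\<lambda>y. 2 * (cmod (u y))\<^sup>2 + 2 * I\<^sup>2)"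
    by (intro integral_le_locint y) (auto intro!: locint_add locint_cont_mult l)
  also have "\<dots> = 2 * integral {x..x+d} (\<lambda>y. (cmod (u y))\<^sup>2) + d * (2 * I\<^sup>2)"
    using d by (subst Henstock_Kurzweil_Integration.integral_add)
      (auto intro!: locint_integrable locint_cont_mult l)
  finally have 1: "d * (cmod (u x))\<^sup>2 \<le> 2 * integral {x..x+d} (\<lambda>y. (cmod (u y))\<^sup>2) + d * (2 * I\<^sup>2)"
    using d by simp
  have "I\<^sup>2 \<le> d * integral {x..x+d} (\<lambda>y. (cmod (u' y))\<^sup>2)"
    using integral_sq_le_interval[OF su', of x "x+d"] d by (simp add: I_def)
  then have "d * (2 * I\<^sup>2) \<le> d * (2 * (d * integral {x..x+d} (\<lambda>y. (cmod (u' y))\<^sup>2)))"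
    using d by (intro mult_left_mono) auto
  with 1 have "d * (cmod (u x))\<^sup>2 \<le> 2 * integral {x..x+d} (\<lambda>y. (cmod (u y))\<^sup>2) + d * (2 * (d
    * integral {x..x+d} (\<lambda>y. (cmod (u' y))\<^sup>2)))"
    by linarith
  also have "\<dots> = d * ((2 / d) * integral {x..x+d} (\<lambda>y. (cmod (u y))\<^sup>2)
      + (2 * d) * integral {x..x+d} (\<lambda>y. (cmod (u' y))\<^sup>2))"
    using d by (simp add: distrib_left mult.assoc mult.left_commute)
  finally have "(cmod (u x))\<^sup>2 \<le> (2 / d) * integral {x..x+d} (\<lambda>y. (cmod (u y))\<^sup>2)
      + (2 * d) * integral {x..x+d} (\<lambda>y. (cmod (u' y))\<^sup>2)"
    using d by (simp add: mult_le_cancel_left_pos)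
  also have "\<dots> = integral {x..x+d} (\<lambda>y. (2 / d) * (cmod (u y))\<^sup>2 + (2 * d) * (cmod (u' y))\<^sup>2)"
    by (subst Henstock_Kurzweil_Integration.integral_add[OF locint_integrable[OF locint_cont_mult[OF
      continuous_on_const l(1)]]
          locint_integrable[OF locint_cont_mult[OF continuous_on_const l(2)]]]) simp
  finally show ?thesis .
qed

lemma integral_le_lebesgue:
  fixes h :: "real \<Rightarrow> real"
  assumes "integrable lebesgue h" "\<And>x. 0 \<le> h x"
  shows "integral {a..b} h \<le> (\<integral>x. h x \<partial>lebesgue)"
  unfolding locint_lebesgue_integral[OF integrable_imp_locint[OF assms(1)], symmetric]
  by (rule integral_mono[OF locint_integrable_indicator[OF integrable_imp_locint[OF assms(1)]] assms(1)])
     (use assms(2) in \<open>simp add: indicator_def\<close>)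

lemma H1_sup:
  assumes H: "H1 u u'"
  shows "(cmod (u x))\<^sup>2 \<le> 2 * nrm2 u + 2 * nrm2 u'"
proof -
  have su: "sq_int u" and su': "sq_int u'" using H by (auto simp: H1_iff)
  have "(cmod (u x))\<^sup>2 \<le> integral {x..x+1} (\<lambda>y. 2 * (cmod (u y))\<^sup>2 + 2 * (cmod (u' y))\<^sup>2)"
    using H1_pointwise[OF H, of 1 x] by simp
  also have "\<dots> \<le> (\<integral>y. 2 * (cmod (u y))\<^sup>2 + 2 * (cmod (u' y))\<^sup>2 \<partial>lebesgue)"
    using su su' by (intro integral_le_lebesgue) (auto simp: sq_int_def)
  also have "\<dots> = 2 * nrm2 u + 2 * nrm2 u'"
    using su su' by (simp add: nrm2_def sq_int_def)
  finally show ?thesis .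
qed

section \<open>The quadratic form and the resolvent\<close>

lemma loc_int_iff: "loc_int V \<longleftrightarrow> locint V"
  by (simp add: loc_int_def locint_def)

lemma L1_loc_unif_bound:
  assumes "L1_loc_unif V"
  obtains C where "0 \<le> C" "\<And>a b. b \<le> a + 2 \<Longrightarrow> integral {a..b} (\<lambda>x. \<bar>V x\<bar>) \<le> C"
proof -
  have l: "locint V" using assms by (simp add: L1_loc_unif_def loc_int_iff)
  then have la: "locint (\<lambda>x. \<bar>V x\<bar>)" using locint_norm by fastforce
  obtain C where C: "(LINT y:{x-1..x+1}|lebesgue. \<bar>V y\<bar>) \<le> C" for x
    using assms by (auto simp: L1_loc_unif_def)
  have C': "integral {x-1..x+1} (\<lambda>x. \<bar>V x\<bar>) \<le> C" for x
    using C[of x] set_lebesgue_integral_eq_integral(2)[OF locintD[OF la]] by metis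
  show ?thesis
  proof
    show "0 \<le> max C 0" by simp
    show "integral {a..b} (\<lambda>x. \<bar>V x\<bar>) \<le> max C 0" if "b \<le> a + 2" for a b
    proof -
      have "integral {a..b} (\<lambda>x. \<bar>V x\<bar>) \<le> integral {(a+1)-1..(a+1)+1} (\<lambda>x. \<bar>V x\<bar>)"
        by (rule integral_mono_set) (use la that in auto)
      then show ?thesis using C'[of "a+1"] by linarith
    qed
  qed
qed

lemma nn_integral_interval:
  fixes h :: "real \<Rightarrow> real"
  assumes "locint h" "\<And>x. 0 \<le> h x"
  shows "(\<integral>\<^sup>+x. indicator {a..b} x * ennreal (h x) \<partial>lebesgue) = ennreal (integral {a..b} h)"
proof -
  have "(\<integral>\<^sup>+x. indicator {a..b} x * ennreal (h x) \<partial>lebesgue)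
    = (\<integral>\<^sup>+x. ennreal (indicator {a..b} x *\<^sub>R h x) \<partial>lebesgue)"
    by (intro nn_integral_cong) (auto simp: indicator_def)
  also have "\<dots> = ennreal (\<integral>x. indicator {a..b} x *\<^sub>R h x \<partial>lebesgue)"
    by (rule nn_integral_eq_integral[OF locint_integrable_indicator[OF assms(1)]]) (use assms(2) in auto)
  finally show ?thesis by (simp only: locint_lebesgue_integral[OF assms(1)])
qed

text \<open>Insert \<open>H1_pointwise\<close> into the integral of
  \<open>\<bar>V\<bar> * (cmod u)^2\<close> and exchange the order by Tonelli: a point
  \<open>y\<close> is seen only from \<open>x\<close> in \<open>{y - d..y}\<close>, an interval over
  which \<open>\<bar>V\<bar>\<close> has integral at most \<open>C\<close>. Working with
  \<open>nn_integral\<close> gives integrability and bound together.\<close>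

lemma V_form_bound:
  assumes V: "locint V" and C: "0 \<le> C" "\<And>a b. b \<le> a + 2 \<Longrightarrow> integral {a..b} (\<lambda>x. \<bar>V x\<bar>) \<le> C"
    and d: "0 < d" "d \<le> 1" and H: "H1 u u'"
  shows "integrable lebesgue (\<lambda>x. \<bar>V x\<bar> * (cmod (u x))\<^sup>2)" (is ?int)
    and "(\<integral>x. \<bar>V x\<bar> * (cmod (u x))\<^sup>2 \<partial>lebesgue) \<le> C * ((2 / d) * nrm2 u + (2 * d) * nrm2 u')" (is ?le)
proof -
  have su: "sq_int u" and su': "sq_int u'" using H by (auto simp: H1_iff)
  define g where "g y = (2 / d) * (cmod (u y))\<^sup>2 + (2 * d) * (cmod (u' y))\<^sup>2" for y
  have g0: "0 \<le> g y" for y using d by (simp add: g_def)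
  have gi: "integrable lebesgue g" unfolding g_def using su su' by (auto simp: sq_int_def)
  have lg: "locint g" by (rule integrable_imp_locint[OF gi])
  have gI: "(\<integral>x. g x \<partial>lebesgue) = (2 / d) * nrm2 u + (2 * d) * nrm2 u'"
    unfolding g_def nrm2_def using su su' by (subst Bochner_Integration.integral_add)
      (auto simp: sq_int_def)
  have la: "locint (\<lambda>x. \<bar>V x\<bar>)" using locint_norm[OF V] by simp
  have [measurable]: "V \<in> borel_measurable lebesgue" "g \<in> borel_measurable lebesgue" "u
    \<in> borel_measurable lebesgue"
    using V lg su by (auto simp: locint_measurable sq_int_def)
  let ?A = "{p. fst p \<le> snd p} :: (real \<times> real) set"
  note id_lebesgue_measurable [measurable]
  have A: "?A \<in> sets (lebesgue \<Otimes>\<^sub>M lebesgue)" by (rule leb2_measurable_le)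
  have [measurable]: "(fst :: real \<times> real \<Rightarrow> real) \<in> borel_measurable (lebesgue \<Otimes>\<^sub>M lebesgue)"
    "(snd :: real \<times> real \<Rightarrow> real) \<in> borel_measurable (lebesgue \<Otimes>\<^sub>M lebesgue)"
    by (rule measurable_compose[OF measurable_fst id_lebesgue_measurable],
        rule measurable_compose[OF measurable_snd id_lebesgue_measurable])
  define k where "k p = ennreal \<bar>V (fst p)\<bar> * (ennreal (if fst p \<le> snd p \<and> snd p
    \<le> fst p + d then g (snd p) else 0))" for p
  have k[measurable]: "k \<in> borel_measurable (lebesgue \<Otimes>\<^sub>M lebesgue)"
    unfolding k_def by measurable
  have "(\<integral>\<^sup>+x. ennreal (\<bar>V x\<bar> * (cmod (u x))\<^sup>2) \<partial>lebesgue) \<le> (\<integral>\<^sup>+x. (\<integral>\<^sup>+y. k (x,y) \<partial>lebesgue) \<partial>lebesgue)"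
  proof (rule nn_integral_mono)
    fix x
    have "ennreal (\<bar>V x\<bar> * (cmod (u x))\<^sup>2) \<le> ennreal (\<bar>V x\<bar> * integral {x..x+d} g)"
      using H1_pointwise[OF H d(1), of x] by (intro ennreal_leI mult_left_mono) (auto simp: g_def[abs_def])
    also have "\<dots> = ennreal \<bar>V x\<bar> * (\<integral>\<^sup>+y. indicator {x..x+d} y * ennreal (g y) \<partial>lebesgue)"
      unfolding nn_integral_interval[OF lg g0]
      by (rule ennreal_mult) (auto intro!: integral_nonneg locint_integrable lg g0)
    also have "\<dots> = (\<integral>\<^sup>+y. ennreal \<bar>V x\<bar> * (indicator {x..x+d} y * ennreal (g y)) \<partial>lebesgue)"
      by (rule nn_integral_cmult[symmetric]) measurable
    also have "\<dots> = (\<integral>\<^sup>+y. k (x,y) \<partial>lebesgue)"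
      by (intro nn_integral_cong) (auto simp: k_def indicator_def)
    finally show "ennreal (\<bar>V x\<bar> * (cmod (u x))\<^sup>2) \<le> (\<integral>\<^sup>+y. k (x,y) \<partial>lebesgue)" .
  qed
  also have "\<dots> = (\<integral>\<^sup>+y. (\<integral>\<^sup>+x. k (x,y) \<partial>lebesgue) \<partial>lebesgue)"
    by (rule leb2.Fubini[OF k, symmetric])
  also have "\<dots> \<le> (\<integral>\<^sup>+y. ennreal (C * g y) \<partial>lebesgue)"
  proof (rule nn_integral_mono)
    fix y
    have "(\<integral>\<^sup>+x. k (x,y) \<partial>lebesgue) = (\<integral>\<^sup>+x. ennreal (g y) * (indicator {y-d..y} x
      * ennreal \<bar>V x\<bar>) \<partial>lebesgue)"
      by (intro nn_integral_cong) (auto simp: k_def indicator_def mult.commute)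
    also have "\<dots> = ennreal (g y) * (\<integral>\<^sup>+x. indicator {y-d..y} x * ennreal \<bar>V x\<bar> \<partial>lebesgue)"
      by (rule nn_integral_cmult) measurable
    also have "\<dots> = ennreal (g y) * ennreal (integral {y-d..y} (\<lambda>x. \<bar>V x\<bar>))"
      by (subst nn_integral_interval[OF la]) auto
    also have "\<dots> \<le> ennreal (g y) * ennreal C"
      using C(2)[of y "y-d"] d by (intro mult_left_mono ennreal_leI) auto
    also have "\<dots> = ennreal (C * g y)"
      using C(1) g0[of y] by (simp add: ennreal_mult mult.commute)
    finally show "(\<integral>\<^sup>+x. k (x,y) \<partial>lebesgue) \<le> ennreal (C * g y)" .
  qed
  also have "\<dots> = ennreal (\<integral>y. C * g y \<partial>lebesgue)"
    by (rule nn_integral_eq_integral) (use gi g0 C in auto)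
  also have "\<dots> = ennreal (C * ((2 / d) * nrm2 u + (2 * d) * nrm2 u'))"
    by (simp add: gI)
  finally have fin: "(\<integral>\<^sup>+x. ennreal (\<bar>V x\<bar> * (cmod (u x))\<^sup>2) \<partial>lebesgue) \<le> ennreal (C * ((2 / d) * nrm2 u + (2
    * d) * nrm2 u'))" .
  show i: ?int
  proof (rule integrableI_bounded)
    show "(\<integral>\<^sup>+ x. ennreal (norm (\<bar>V x\<bar> * (cmod (u x))\<^sup>2)) \<partial>lebesgue) < \<infinity>"
      using le_less_trans[OF fin ennreal_less_top] by (simp add: abs_mult)
  qed measurable
  have "ennreal (\<integral>x. \<bar>V x\<bar> * (cmod (u x))\<^sup>2 \<partial>lebesgue) = (\<integral>\<^sup>+x. ennreal (\<bar>V x\<bar> * (cmod (u x))\<^sup>2) \<partial>lebesgue)"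
    by (rule nn_integral_eq_integral[symmetric, OF i]) auto
  with fin have "ennreal (\<integral>x. \<bar>V x\<bar> * (cmod (u x))\<^sup>2 \<partial>lebesgue) \<le> ennreal (C * ((2 / d) * nrm2 u + (2 * d)
    * nrm2 u'))" by simp
  moreover have "0 \<le> C * ((2 / d) * nrm2 u + (2 * d) * nrm2 u')" using C d by simp
  ultimately show ?le by (simp add: ennreal_le_iff)
qed

lemma V_energy:
  assumes "L1_loc_unif V"
  obtains A where "0 \<le> A"
    "\<And>u u'. H1 u u' \<Longrightarrow> integrable lebesgue (\<lambda>x. V x * (cmod (u x))\<^sup>2)"
    "\<And>u u'. H1 u u' \<Longrightarrow> \<bar>\<integral>x. V x * (cmod (u x))\<^sup>2 \<partial>lebesgue\<bar> \<le> A * nrm2 u + nrm2 u' / 2"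
proof -
  have V: "locint V" using assms by (simp add: L1_loc_unif_def loc_int_iff)
  obtain C where C: "0 \<le> C" "\<And>a b. b \<le> a + 2 \<Longrightarrow> integral {a..b} (\<lambda>x. \<bar>V x\<bar>) \<le> C"
    using L1_loc_unif_bound[OF assms] by blast
  \<comment> \<open>Chosen so that \<open>C * (2 * d) \<le> 1 / 2\<close>: the potential has
    relative form bound 1/2 with respect to the kinetic energy.\<close>
  define d where "d = 1 / (4 * C + 1)"
  have d: "0 < d" "d \<le> 1" "C * (2 * d) \<le> 1 / 2" using C by (auto simp: d_def field_simps)
  show ?thesis
  proof
    show "0 \<le> C * (2 / d)" using C d by simp
    fix u u' assume H: "H1 u u'"
    have [measurable]: "V \<in> borel_measurable lebesgue" "u \<in> borel_measurable lebesgue"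
      using V H by (auto simp: locint_measurable sq_int_def H1_iff)
    note b = V_form_bound[OF V C d(1,2) H]
    show i: "integrable lebesgue (\<lambda>x. V x * (cmod (u x))\<^sup>2)"
      by (rule Bochner_Integration.integrable_bound[OF b(1)]) (auto simp: abs_mult)
    have "\<bar>\<integral>x. V x * (cmod (u x))\<^sup>2 \<partial>lebesgue\<bar> \<le> (\<integral>x. \<bar>V x\<bar> * (cmod (u x))\<^sup>2 \<partial>lebesgue)"
      using integral_norm_bound[of lebesgue "\<lambda>x. V x * (cmod (u x))\<^sup>2"] by (simp add: abs_mult)
    also have "\<dots> \<le> C * (2 / d) * nrm2 u + (C * (2 * d)) * nrm2 u'"
      using b(2) by (simp add: algebra_simps)
    also have "\<dots> \<le> C * (2 / d) * nrm2 u + (1/2) * nrm2 u'"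
      using d(3) by (intro add_left_mono mult_right_mono) auto
    finally show "\<bar>\<integral>x. V x * (cmod (u x))\<^sup>2 \<partial>lebesgue\<bar> \<le> C * (2 / d) * nrm2 u + nrm2 u' / 2" by simp
  qed
qed

lemma V_prod_integrable:
  assumes "L1_loc_unif V" "H1 \<phi> \<phi>'" "H1 u u'"
  shows "integrable lebesgue (\<lambda>x. complex_of_real (V x) * cnj (\<phi> x) * u x)"
proof -
  have V: "locint V" using assms by (simp add: L1_loc_unif_def loc_int_iff)
  obtain C where C: "0 \<le> C" "\<And>a b. b \<le> a + 2 \<Longrightarrow> integral {a..b} (\<lambda>x. \<bar>V x\<bar>) \<le> C"
    using L1_loc_unif_bound[OF assms(1)] by blast
  have b: "integrable lebesgue (\<lambda>x. \<bar>V x\<bar> * (cmod (v x))\<^sup>2)" if "H1 v v'" for v v'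
    by (rule V_form_bound(1)[OF V C _ _ that, of 1]) auto
  have i: "integrable lebesgue (\<lambda>x. \<bar>V x\<bar> * (cmod (\<phi> x))\<^sup>2 + \<bar>V x\<bar> * (cmod (u x))\<^sup>2)"
    using b[OF assms(2)] b[OF assms(3)] by (rule Bochner_Integration.integrable_add)
  have [measurable]: "V \<in> borel_measurable lebesgue" "u \<in> borel_measurable lebesgue" "\<phi>
    \<in> borel_measurable lebesgue"
    using V assms by (auto simp: locint_measurable sq_int_def H1_iff)
  show ?thesis
  proof (rule Bochner_Integration.integrable_bound[OF i])
    show "(\<lambda>x. complex_of_real (V x) * cnj (\<phi> x) * u x) \<in> borel_measurable lebesgue" by measurable
    show "AE x in lebesgue. norm (complex_of_real (V x) * cnj (\<phi> x) * u x) \<le> norm (\<bar>V x\<bar> * (cmod (\<phi> x))\<^sup>2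
      + \<bar>V x\<bar> * (cmod (u x))\<^sup>2)"
    proof (rule AE_I2)
      fix x
      have "2 * (cmod (\<phi> x) * cmod (u x)) \<le> (cmod (\<phi> x))\<^sup>2 + (cmod (u x))\<^sup>2"
        using sum_squares_bound[of "cmod (\<phi> x)" "cmod (u x)"] by (simp add: mult.assoc)
      moreover have "0 \<le> cmod (\<phi> x) * cmod (u x)" by simp
      ultimately have "cmod (\<phi> x) * cmod (u x) \<le> (cmod (\<phi> x))\<^sup>2 + (cmod (u x))\<^sup>2" by linarith
      then have "\<bar>V x\<bar> * (cmod (\<phi> x) * cmod (u x)) \<le> \<bar>V x\<bar> * ((cmod (\<phi> x))\<^sup>2 + (cmod (u x))\<^sup>2)"
        by (rule mult_left_mono) simp
      then show "norm (complex_of_real (V x) * cnj (\<phi> x) * u x) \<le> norm (\<bar>V x\<bar> * (cmod (\<phi> x))\<^sup>2 + \<bar>V x\<bar>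
        * (cmod (u x))\<^sup>2)"
        by (simp add: norm_mult distrib_left mult.assoc)
    qed
  qed
qed

section \<open>Integration by parts on the whole line and energy identities\<close>

lemma integrable_limit_zero:
  fixes h :: "real \<Rightarrow> complex"
  assumes h: "integrable lebesgue h" and lim: "(h \<longlongrightarrow> I) at_top"
  shows "I = 0"
proof (rule ccontr)
  assume I: "I \<noteq> 0"
  have "\<forall>\<^sub>F x in at_top. dist (h x) I < cmod I / 2"
    using lim I by (intro tendstoD) auto
  then obtain X where X: "\<And>x. X \<le> x \<Longrightarrow> dist (h x) I < cmod I / 2"
    by (auto simp: eventually_at_top_linorder)
  have Xl: "cmod I / 2 \<le> cmod (h x)" if "X \<le> x" for x
    using X[OF that] norm_triangle_ineq2[of I "I - h x"] by (simp add: dist_norm norm_minus_commute)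
  have "real n * (cmod I / 2) \<le> (\<integral>x. cmod (h x) \<partial>lebesgue)" for n
  proof -
    have "real n * (cmod I / 2) = integral {X..X + real n} (\<lambda>_. cmod I / 2)" by simp
    also have "\<dots> \<le> integral {X..X + real n} (\<lambda>x. cmod (h x))"
      by (rule integral_le_locint) (use Xl h in \<open>auto intro!: locint_norm integrable_imp_locint\<close>)
    also have "\<dots> \<le> (\<integral>x. cmod (h x) \<partial>lebesgue)"
      by (rule integral_le_lebesgue) (use h in auto)
    finally show ?thesis .
  qed
  moreover obtain n where "(\<integral>x. cmod (h x) \<partial>lebesgue) < real n * (cmod I / 2)"
    using I reals_Archimedean3[of "cmod I / 2"] by auto
  ultimately show False using not_le by blast
qed

text \<open>The integral of \<open>g\<close> over \<open>{-x..x}\<close> is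
  \<open>w x - w (- x)\<close>. It converges as \<open>x\<close> grows, and it is integrable in
  \<open>x\<close>, so its limit is 0; no decay of \<open>w\<close> has to be known
  beforehand.\<close>

lemma acd_integral_zero:
  fixes w g :: "real \<Rightarrow> complex"
  assumes a: "acd w g" and w: "integrable lebesgue w" and g: "integrable lebesgue g"
  shows "(\<integral>x. g x \<partial>lebesgue) = 0"
proof (rule integrable_limit_zero)
  show "integrable lebesgue (\<lambda>x. w x - w (- x))"
    using lebesgue_integrable_real_affine[OF w, of "-1" 0] w by simp
  have "((\<lambda>x. \<integral>t. indicator {-x..x} t *\<^sub>R g t \<partial>lebesgue) \<longlongrightarrow> (\<integral>t. g t \<partial>lebesgue)) at_top"
  proof (rule integral_dominated_convergence_at_top)
    show "integrable lebesgue (\<lambda>x. cmod (g x))" using g by simp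
    show "\<forall>\<^sub>F x in at_top. AE t in lebesgue. norm (indicat_real {- x..x} t *\<^sub>R g t) \<le> cmod (g t)"
      by (auto simp: indicator_def)
    show "AE t in lebesgue. ((\<lambda>x. indicat_real {- x..x} t *\<^sub>R g t) \<longlongrightarrow> g t) at_top"
    proof (rule AE_I2)
      fix t :: real
      have "\<forall>\<^sub>F x in at_top. indicat_real {- x..x} t *\<^sub>R g t = g t"
        using eventually_ge_at_top[of "\<bar>t\<bar>"] by eventually_elim (auto simp: indicator_def)
      then show "((\<lambda>x. indicat_real {- x..x} t *\<^sub>R g t) \<longlongrightarrow> g t) at_top" by (rule tendsto_eventually)
    qed
  qed (use g in \<open>auto intro!: indicator_lebesgue_measurable\<close>)
  moreover have "\<forall>\<^sub>F x in at_top. (\<integral>t. indicator {-x..x} t *\<^sub>R g t \<partial>lebesgue) = w x - w (- x)"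
    using eventually_ge_at_top[of 0]
    by eventually_elim (simp add: acdD[OF a] locint_lebesgue_integral acd_locint[OF a])
  ultimately show "((\<lambda>x. w x - w (- x)) \<longlongrightarrow> (\<integral>t. g t \<partial>lebesgue)) at_top"
    by (rule Lim_transform_eventually)
qed

text \<open>The derivative of \<open>cnj (\<phi> x) * u' x\<close> is exactly the integrand of the
  weak equation, so \<open>acd_integral_zero\<close> is the integration by parts that turns a square
  integrable solution of the differential equation into a weak one.\<close>

theorem ode_resolvent:
  assumes V: "L1_loc_unif V" and o: "ode (\<lambda>t. complex_of_real (V t) - z) f u u'"
    and s: "sq_int u" "sq_int u'" "sq_int f"
  shows "resolvent_sol V z f u u'"
  unfolding resolvent_sol_def
proof (intro conjI allI impI)
  have au: "acd u u'" and au': "acd u' (\<lambda>t. (complex_of_real (V t) - z) * u t - f t)"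
    using o by (auto simp: ode_def)
  show H: "H1 u u'" using au s by (simp add: H1_iff)
  fix \<phi> \<phi>' assume p: "H1 \<phi> \<phi>'"
  then have ap: "acd \<phi> \<phi>'" and sp: "sq_int \<phi>" "sq_int \<phi>'" by (auto simp: H1_iff)
  define G where "G x = cnj (\<phi>' x) * u' x + complex_of_real (V x) * cnj (\<phi> x) * u x - z * (cnj (\<phi> x) * u x)
    - cnj (\<phi> x) * f x" for x
  have aw: "acd (\<lambda>x. cnj (\<phi> x) * u' x) G"
    unfolding G_def using acd_mult[OF acd_cnj[OF ap] au'] by (simp add: algebra_simps)
  note i = inner_integrable[OF sp(2) s(2)] V_prod_integrable[OF V p H] integrable_mult_right[OF
    inner_integrable[OF sp(1) s(1)], of z] inner_integrable[OF sp(1) s(3)]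
  have Gi: "integrable lebesgue G"
    unfolding G_def by (intro Bochner_Integration.integrable_diff Bochner_Integration.integrable_add i)
  have "(\<integral>x. G x \<partial>lebesgue) = 0"
    by (rule acd_integral_zero[OF aw inner_integrable[OF sp(1) s(2)] Gi])
  moreover have "(\<integral>x. G x \<partial>lebesgue) = (\<integral>x. cnj (\<phi>' x) * u' x \<partial>lebesgue)
        + (\<integral>x. complex_of_real (V x) * cnj (\<phi> x) * u x \<partial>lebesgue)
        - (\<integral>x. z * (cnj (\<phi> x) * u x) \<partial>lebesgue) - (\<integral>x. cnj (\<phi> x) * f x \<partial>lebesgue)"
    unfolding G_def
    by (simp only: Bochner_Integration.integral_diff Bochner_Integration.integral_add
        Bochner_Integration.integrable_diff Bochner_Integration.integrable_add i)
  ultimately show "(\<integral>x. cnj (\<phi>' x) * u' x \<partial>lebesgue)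
        + (\<integral>x. complex_of_real (V x) * cnj (\<phi> x) * u x \<partial>lebesgue)
        - z * (\<integral>x. cnj (\<phi> x) * u x \<partial>lebesgue)
        = (\<integral>x. cnj (\<phi> x) * f x \<partial>lebesgue)"
    by simp
qed

text \<open>The weak equation tested with \<open>u\<close> itself. It is a notion of its own because
  Dirichlet solutions extended by zero satisfy it as well, so the bounds below apply to
  approximations and to the resolvent alike.\<close>

definition energy :: "(real \<Rightarrow> real) \<Rightarrow> complex \<Rightarrow> (real \<Rightarrow> complex) \<Rightarrow> (real \<Rightarrow> complex) \<Rightarrow> (real \<Rightarrow> complex) \<Rightarrow>
  bool" where
  "energy V z f u u' \<longleftrightarrow> H1 u u' \<and>
     complex_of_real (nrm2 u') + complex_of_real (\<integral>x. V x * (cmod (u x))\<^sup>2 \<partial>lebesgue) - z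
       * complex_of_real (nrm2 u) = inner_L2 u f"

lemma V_form_diag: "(\<integral>x. complex_of_real (V x) * cnj (u x) * u x \<partial>lebesgue) = complex_of_real (\<integral>x. V x
  * (cmod (u x))\<^sup>2 \<partial>lebesgue)"
proof -
  have "(\<integral>x. complex_of_real (V x) * cnj (u x) * u x \<partial>lebesgue) = (\<integral>x. complex_of_real (V x
    * (cmod (u x))\<^sup>2) \<partial>lebesgue)"
    by (intro Bochner_Integration.integral_cong) (simp_all only: of_real_mult complex_norm_square
      mult.commute mult.left_commute mult.assoc)
  then show ?thesis by (simp only: integral_complex_of_real)
qed

lemma resolvent_energy: "resolvent_sol V z f u u' \<Longrightarrow> energy V z f u u'"
  unfolding resolvent_sol_def energy_def inner_L2_self[symmetric] V_form_diag[symmetric]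
  by (auto simp: inner_L2_def)

text \<open>Potential and kinetic terms are real, so the imaginary part of the energy identity
  leaves \<open>Im z * nrm2 u = - Im (inner_L2 u f)\<close>; Cauchy-Schwarz does the rest.\<close>

lemma energy_Im:
  assumes e: "energy V z f u u'" and f: "sq_int f"
  shows "\<bar>Im z\<bar> * nrm u \<le> nrm f"
proof -
  have s: "sq_int u" using e by (simp add: energy_def H1_iff)
  have "Im z * nrm2 u = - Im (inner_L2 u f)"
  proof -
    have "Im (complex_of_real (nrm2 u') + complex_of_real (\<integral>x. V x * (cmod (u x))\<^sup>2 \<partial>lebesgue) - z
      * complex_of_real (nrm2 u)) = Im (inner_L2 u f)"
      using e unfolding energy_def by simp
    then show ?thesis by simp
  qed
  then have "\<bar>Im z\<bar> * nrm2 u \<le> cmod (inner_L2 u f)"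
    using abs_Im_le_cmod[of "inner_L2 u f"] by (metis abs_minus_cancel abs_mult abs_of_nonneg nrm2_nonneg)
  also have "\<dots> \<le> nrm u * nrm f" by (rule cauchy_schwarz[OF s f])
  finally have "nrm u * (\<bar>Im z\<bar> * nrm u) \<le> nrm u * nrm f"
    by (simp add: nrm_sq[symmetric] power2_eq_square mult.left_commute)
  then show ?thesis
    by (cases "nrm u = 0") (auto simp: mult_le_cancel_left less_le)
qed

text \<open>Real part of the energy identity: by the form bound 1/2, half of \<open>nrm2 u'\<close>
  is moved to the left. \<open>A\<close> depends on \<open>V\<close> alone, so the estimate is
  uniform in \<open>z\<close>, \<open>f\<close> and the interval of a Dirichlet problem.\<close>

lemma energy_Re:
  assumes V: "L1_loc_unif V"
  obtains A where "0 \<le> A" "\<And>z f u u'. energy V z f u u' \<Longrightarrow> sq_int f \<Longrightarrow>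
     nrm2 u' \<le> (A + 2 * cmod z) * nrm2 u + 2 * (nrm u * nrm f)"
proof -
  obtain A where A: "0 \<le> A" "\<And>u u'. H1 u u' \<Longrightarrow> \<bar>\<integral>x. V x * (cmod (u x))\<^sup>2 \<partial>lebesgue\<bar>
    \<le> A * nrm2 u + nrm2 u' / 2"
    using V_energy[OF V] by metis
  show ?thesis
  proof
    show "0 \<le> 2 * A" using A by simp
    fix z f u u' assume e: "energy V z f u u'" and f: "sq_int f"
    then have H: "H1 u u'" and s: "sq_int u" by (auto simp: energy_def H1_iff)
    have "Re (complex_of_real (nrm2 u') + complex_of_real (\<integral>x. V x * (cmod (u x))\<^sup>2 \<partial>lebesgue) - z
      * complex_of_real (nrm2 u)) = Re (inner_L2 u f)"
      using e unfolding energy_def by simp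
    then have "nrm2 u' + (\<integral>x. V x * (cmod (u x))\<^sup>2 \<partial>lebesgue) - Re z * nrm2 u = Re (inner_L2 u f)" by simp
    moreover have "Re (inner_L2 u f) \<le> nrm u * nrm f"
      using complex_Re_le_cmod[of "inner_L2 u f"] cauchy_schwarz[OF s f] by linarith
    moreover have "Re z * nrm2 u \<le> cmod z * nrm2 u"
      by (intro mult_right_mono complex_Re_le_cmod) simp
    ultimately have "nrm2 u' \<le> A * nrm2 u + nrm2 u' / 2 + cmod z * nrm2 u + nrm u * nrm f"
      using A(2)[OF H] by linarith
    then show "nrm2 u' \<le> (2 * A + 2 * cmod z) * nrm2 u + 2 * (nrm u * nrm f)"
      by (simp add: algebra_simps)
  qed
qed

section \<open>Dirichlet problems on bounded intervals\<close>

lemma integral_indicator_mult: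
  fixes g :: "real \<Rightarrow> 'b::{euclidean_space,real_normed_field}"
  assumes "locint g" "{c..d} \<subseteq> {a..b}"
  shows "integral {c..d} (\<lambda>t. indicator {a..b} t * g t) = integral {c..d} g"
  by (rule Henstock_Kurzweil_Integration.integral_cong) (use assms(2) in \<open>auto simp: indicator_def\<close>)

text \<open>Vanishing at both ends makes the extension by zero absolutely continuous; the jumps of
  the derivative at \<open>a\<close> and \<open>b\<close> concern a null set only.\<close>

lemma cut_H1:
  assumes a: "acd u u'" and c: "continuous_on UNIV u'" and ab: "a < b" and z: "u a = 0" "u b = 0"
  shows "H1 (\<lambda>t. indicator {a..b} t * u t) (\<lambda>t. indicator {a..b} t * u' t)"
proof -
  define v where "v t = indicator {a..b} t * u' t" for t
  have lu': "locint u'" by (rule acd_locint[OF a])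
  have lv: "locint v"
  proof (rule locint_bound[OF _ locint_norm[OF lu']])
    show "v \<in> borel_measurable lebesgue"
      unfolding v_def by (rule borel_measurable_times[OF borel_measurable_indicator locint_measurable[OF
        lu']]) simp
  qed (simp add: v_def indicator_def)
  have sq: "sq_int (\<lambda>t. indicator {a..b} t * h t)" if h: "continuous_on UNIV h" for h
  proof (rule sq_int_bound)
    show "(\<lambda>t. indicator {a..b} t * h t) \<in> borel_measurable lebesgue"
      by (rule borel_measurable_times[OF borel_measurable_indicator locint_measurable[OF
        locint_continuous[OF h]]]) simp
    show "integrable lebesgue (\<lambda>t. indicator {a..b} t *\<^sub>R (cmod (h t))\<^sup>2)"
      by (intro locint_integrable_indicator locint_continuous continuous_intros h)
  qed (simp add: indicator_def)
  have e: "(\<lambda>t. indicator {a..b} t * u t) = prim a v"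
  proof
    fix x
    have le: "integral {a..x} v = u x" if "a \<le> x" "x \<le> b" for x
      using integral_indicator_mult[OF lu', of a x a b] acdD[OF a that(1)] that z
        by (simp add: v_def[abs_def])
    consider "x < a" | "a \<le> x" "x \<le> b" | "b < x" by linarith
    then show "indicator {a..b} x * u x = prim a v x"
    proof cases
      case 1
      have "integral {x..a} v = integral {x..a} (\<lambda>_. 0)"
        by (rule integral_spike[of "{a}"]) (auto simp: v_def indicator_def)
      then show ?thesis using 1 by (simp add: prim_def)
    next
      case 2
      then show ?thesis using le by (simp add: prim_def)
    next
      case 3
      have "integral {b..x} v = integral {b..x} (\<lambda>_. 0)"
        by (rule integral_spike[of "{b}"]) (auto simp: v_def indicator_def)
      then have "integral {a..x} v = 0"
        using integral_locint_split[OF lv, of a b x] 3 ab le[of b] z by simp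
      then show ?thesis using 3 ab by (simp add: prim_def)
    qed
  qed
  show ?thesis
    unfolding H1_iff
    using acd_prim[OF lv, of a] sq[OF acd_continuous[OF a]] sq[OF c] unfolding e v_def[abs_def] by blast
qed

text \<open>Integrate the derivative of \<open>cnj u * u'\<close> over \<open>{a..b}\<close>; the
  boundary terms vanish because \<open>u\<close> does.\<close>

lemma cut_energy:
  assumes V: "L1_loc_unif V" and o: "ode (\<lambda>t. complex_of_real (V t) - z) f u u'" and f: "sq_int f"
    and ab: "a < b" and bc: "u a = 0" "u b = 0"
  shows "energy V z f (\<lambda>t. indicator {a..b} t * u t) (\<lambda>t. indicator {a..b} t * u' t)"
proof -
  define U where "U t = indicator {a..b} t * u t" for t
  define U' where "U' t = indicator {a..b} t * u' t" for t
  have au: "acd u u'" and au': "acd u' (\<lambda>t. (complex_of_real (V t) - z) * u t - f t)"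
    using o by (auto simp: ode_def)
  have H: "H1 U U'"
    unfolding U_def U'_def by (rule cut_H1[OF au acd_continuous[OF au'] ab bc])
  then have sU: "sq_int U" "sq_int U'" by (auto simp: H1_iff)
  define G where "G x = cnj (u' x) * u' x + cnj (u x) * ((complex_of_real (V x) - z) * u x - f x)" for x
  have aw: "acd (\<lambda>x. cnj (u x) * u' x) G"
    unfolding G_def by (rule acd_mult[OF acd_cnj[OF au] au'])
  have "0 = integral {a..b} G" using acdD[OF aw, of a b] ab bc by simp
  also have "\<dots> = (\<integral>x. indicator {a..b} x *\<^sub>R G x \<partial>lebesgue)"
    by (rule locint_lebesgue_integral[OF acd_locint[OF aw], symmetric])
  also have "\<dots> = (\<integral>x. cnj (U' x) * U' x + complex_of_real (V x) * cnj (U x) * U x - z * (cnj (U x) * U x)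
    - cnj (U x) * f x \<partial>lebesgue)"
    by (rule Bochner_Integration.integral_cong) (auto simp: G_def U_def U'_def indicator_def algebra_simps)
  also have "\<dots> = (\<integral>x. cnj (U' x) * U' x \<partial>lebesgue)
        + (\<integral>x. complex_of_real (V x) * cnj (U x) * U x \<partial>lebesgue)
        - (\<integral>x. z * (cnj (U x) * U x) \<partial>lebesgue) - (\<integral>x. cnj (U x) * f x \<partial>lebesgue)"
  proof -
    note i = inner_integrable[OF sU(2) sU(2)] V_prod_integrable[OF V H H] integrable_mult_right[OF
      inner_integrable[OF sU(1) sU(1)], of z] inner_integrable[OF sU(1) f]
    show ?thesis by (simp only: Bochner_Integration.integral_diff Bochner_Integration.integral_add
        Bochner_Integration.integrable_diff Bochner_Integration.integrable_add i)
  qed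
  also have "\<dots> = complex_of_real (nrm2 U') + complex_of_real (\<integral>x. V x * (cmod (U x))\<^sup>2 \<partial>lebesgue) - z
    * complex_of_real (nrm2 U) - inner_L2 U f"
    unfolding V_form_diag by (simp add: inner_L2_self[symmetric] inner_L2_def)
  finally have "energy V z f U U'" unfolding energy_def using H by simp
  then show ?thesis unfolding U_def[abs_def] U'_def[abs_def] .
qed

lemma locint_potential: "L1_loc_unif V \<Longrightarrow> locint (\<lambda>t. complex_of_real (V t) - z)"
  unfolding L1_loc_unif_def loc_int_iff
  by (intro locint_diff locint_const locint_linear[OF bounded_linear_of_real]) auto

text \<open>A particular solution with zero data at \<open>a\<close> is corrected by a multiple of
  the homogeneous solution \<open>s\<close> with \<open>s a = 0\<close>, \<open>s' a = 1\<close>,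
  which is possible once \<open>s b \<noteq> 0\<close>.\<close>

lemma dirichlet_solution:
  assumes V: "L1_loc_unif V" and z: "Im z \<noteq> 0" and f: "sq_int f" and ab: "a < b"
  obtains u u' where "ode (\<lambda>t. complex_of_real (V t) - z) f u u'" "u a = 0" "u b = 0"
proof -
  let ?q = "\<lambda>t. complex_of_real (V t) - z"
  have lq: "locint ?q" by (rule locint_potential[OF V])
  obtain p p' where p: "ode ?q f p p'" "p a = 0" "p' a = 0"
    using ode_exists[OF lq sq_int_locint[OF f]] by metis
  obtain s s' where s: "ode ?q (\<lambda>_. 0) s s'" "s a = 0" "s' a = 1"
    using ode_exists[OF lq locint_const] by metis
  \<comment> \<open>If \<open>s b = 0\<close>, then \<open>z\<close> would be a non-real Dirichlet
    eigenvalue. \<open>energy_Im\<close> forces \<open>s = 0\<close> on \<open>{a..b}\<close>, so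
    \<open>s'\<close> is constantly 1 there, which contradicts \<open>s b = s a\<close>.\<close>
  have sb: "s b \<noteq> 0"
  proof
    assume sb: "s b = 0"
    have as: "acd s s'" and as': "acd s' (\<lambda>t. ?q t * s t - 0)" using s by (auto simp: ode_def)
    have e: "energy V z (\<lambda>_. 0) (\<lambda>t. indicator {a..b} t * s t) (\<lambda>t. indicator {a..b} t * s' t)"
      by (rule cut_energy[OF V s(1) sq_int_zero ab s(2) sb])
    have "nrm (\<lambda>_. 0) = 0" by (simp add: nrm_def nrm2_def)
    with energy_Im[OF e sq_int_zero] have "\<bar>Im z\<bar> * nrm (\<lambda>t. indicator {a..b} t * s t) \<le> 0" by simp
    moreover have "0 < \<bar>Im z\<bar>" using z by simp
    ultimately have "nrm (\<lambda>t. indicator {a..b} t * s t) = 0"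
      by (metis linorder_not_less mult_pos_pos nrm_nonneg order_antisym_conv)
    then have n0: "nrm2 (\<lambda>t. indicator {a..b} t * s t) = 0" by (simp add: nrm_def)
    have "(\<lambda>t. indicator {a..b} t * s t) = (\<lambda>_. 0)"
      using e n0 by (intro nrm2_eq_0_continuous) (auto simp: energy_def H1_iff intro: acd_continuous)
    from fun_cong[OF this] have s0: "s t = 0" if "t \<in> {a..b}" for t using that
      by (metis indicator_simps(1) mult_1)
    have s1: "s' t = 1" if t: "t \<in> {a..b}" for t
    proof -
      have "s' t - s' a = integral {a..t} (\<lambda>t. ?q t * s t - 0)" using acdD[OF as'] t by simp
      also have "\<dots> = integral {a..t} (\<lambda>_. 0)"
        by (rule Henstock_Kurzweil_Integration.integral_cong) (use s0 t in auto)
      finally show ?thesis using s by simp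
    qed
    have "s b - s a = integral {a..b} s'" using acdD[OF as] ab by simp
    also have "\<dots> = integral {a..b} (\<lambda>_. 1)"
      by (rule Henstock_Kurzweil_Integration.integral_cong) (use s1 in auto)
    finally show False using sb s ab by simp
  qed
  have "ode ?q f (\<lambda>t. 1 * p t + (- p b / s b) * s t) (\<lambda>t. 1 * p' t + (- p b / s b) * s' t)"
    using ode_lin[OF p(1) s(1), of 1 "- p b / s b"] by simp
  then show ?thesis by (rule that) (use p s sb in auto)
qed

lemma sq_int_limit:
  assumes g: "\<And>n. sq_int (g n)" and M: "\<And>n. nrm2 (g n) \<le> M" and lim: "\<And>x. (\<lambda>n. g n x) \<longlonglongrightarrow> f x"
  shows "sq_int f" "nrm2 f \<le> M"
proof -
  have gm[measurable]: "g n \<in> borel_measurable lebesgue" for n using g by (rule sq_int_measurable)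
  have fm[measurable]: "f \<in> borel_measurable lebesgue"
    by (rule borel_measurable_LIMSEQ_metric[OF gm lim])
  have M0: "0 \<le> M" using M[of 0] nrm2_nonneg[of "g 0"] by linarith
  have gn: "(\<integral>\<^sup>+x. ennreal ((cmod (g n x))\<^sup>2) \<partial>lebesgue) \<le> ennreal M" for n
  proof -
    have "(\<integral>\<^sup>+x. ennreal ((cmod (g n x))\<^sup>2) \<partial>lebesgue) = ennreal (nrm2 (g n))"
      unfolding nrm2_def by (rule nn_integral_eq_integral) (use g in \<open>auto simp: sq_int_def\<close>)
    then show ?thesis using M by (simp add: ennreal_leI)
  qed
  have "(\<integral>\<^sup>+x. ennreal ((cmod (f x))\<^sup>2) \<partial>lebesgue) = (\<integral>\<^sup>+x. liminf (\<lambda>n. ennreal ((cmod (g n x))\<^sup>2)) \<partial>lebesgue)"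
  proof (rule nn_integral_cong)
    fix x
    have "(\<lambda>n. ennreal ((cmod (g n x))\<^sup>2)) \<longlonglongrightarrow> ennreal ((cmod (f x))\<^sup>2)"
      by (intro tendsto_ennrealI tendsto_intros lim)
    then show "ennreal ((cmod (f x))\<^sup>2) = liminf (\<lambda>n. ennreal ((cmod (g n x))\<^sup>2))"
      by (rule lim_imp_Liminf[symmetric, rotated]) simp
  qed
  also have "\<dots> \<le> liminf (\<lambda>n. \<integral>\<^sup>+x. ennreal ((cmod (g n x))\<^sup>2) \<partial>lebesgue)"
    by (rule nn_integral_liminf) measurable
  also have "\<dots> \<le> ennreal M"
    by (rule Liminf_le) (use gn in \<open>auto intro: always_eventually\<close>)
  finally have fin: "(\<integral>\<^sup>+x. ennreal ((cmod (f x))\<^sup>2) \<partial>lebesgue) \<le> ennreal M" .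
  have i: "integrable lebesgue (\<lambda>x. (cmod (f x))\<^sup>2)"
  proof (rule integrableI_bounded)
    show "(\<integral>\<^sup>+ x. ennreal (norm ((cmod (f x))\<^sup>2)) \<partial>lebesgue) < \<infinity>"
      using le_less_trans[OF fin ennreal_less_top] by simp
  qed measurable
  then show "sq_int f" by (simp add: sq_int_def)
  have "ennreal (nrm2 f) = (\<integral>\<^sup>+x. ennreal ((cmod (f x))\<^sup>2) \<partial>lebesgue)"
    unfolding nrm2_def by (rule nn_integral_eq_integral[symmetric, OF i]) auto
  then have "ennreal (nrm2 f) \<le> ennreal M" using fin by simp
  then show "nrm2 f \<le> M" using M0 by (simp add: ennreal_le_iff)
qed

lemma le_one_plus_sq: "x \<le> 1 + x\<^sup>2" for x :: real
proof -
  have "0 \<le> (x - 1/2)\<^sup>2" by simp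
  also have "(x - 1/2)\<^sup>2 = x\<^sup>2 - x + 1/4" by (simp add: power2_eq_square algebra_simps)
  finally show ?thesis by linarith
qed

text \<open>The solutions of the Dirichlet problems on \<open>[-n, n]\<close> obey \<open>n\<close>-independent energy bounds, so
  their Cauchy data at the origin have a convergent subsequence.\<close>

theorem resolvent_exists:
  assumes V: "L1_loc_unif V" and z: "Im z \<noteq> 0" and f: "sq_int f"
  obtains u u' where "resolvent_sol V z f u u'" "ode (\<lambda>t. complex_of_real (V t) - z) f u u'"
proof -
  let ?q = "\<lambda>t. complex_of_real (V t) - z"
  have lq: "locint ?q" by (rule locint_potential[OF V])
  have lf: "locint f" by (rule sq_int_locint[OF f])
  define N where "N n = real (Suc n)" for n
  have N1: "1 \<le> N n" for n by (simp add: N_def)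
  have "\<exists>p. ode ?q f (fst p) (snd p) \<and> fst p (- N n) = 0 \<and> fst p (N n) = 0" for n
    using dirichlet_solution[OF V z f, of "- N n" "N n"] N1[of n]
      by (metis fst_conv snd_conv less_eq_real_def neg_less_pos zero_less_one order_less_le_trans)
  then obtain P where P: "\<And>n. ode ?q f (fst (P n)) (snd (P n))" "\<And>n. fst (P n) (- N n) = 0"
    "\<And>n. fst (P n) (N n) = 0"
    by metis
  define U where "U n = fst (P n)" for n
  define U' where "U' n = snd (P n)" for n
  have o: "ode ?q f (U n) (U' n)" and bc: "U n (- N n) = 0" "U n (N n) = 0" for n
    using P by (auto simp: U_def U'_def)
  have aU: "acd (U n) (U' n)" and aU': "acd (U' n) (\<lambda>t. ?q t * U n t - f t)" for n
    using o by (auto simp: ode_def)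
  define W where "W n t = indicator {- N n..N n} t * U n t" for n t
  define W' where "W' n t = indicator {- N n..N n} t * U' n t" for n t
  have e: "energy V z f (W n) (W' n)" for n
    unfolding W_def W'_def
    by (rule cut_energy[OF V o f _ bc]) (use N1[of n] in linarith)
  have HW: "H1 (W n) (W' n)" and sW: "sq_int (W n)" "sq_int (W' n)" for n
    using e[of n] by (auto simp: energy_def H1_iff)
  obtain A where A: "0 \<le> A" "\<And>z f u u'. energy V z f u u' \<Longrightarrow> sq_int f \<Longrightarrow>
     nrm2 u' \<le> (A + 2 * cmod z) * nrm2 u + 2 * (nrm u * nrm f)"
    using energy_Re[OF V] by blast
  define M1 where "M1 = nrm f / \<bar>Im z\<bar>"
  have M1: "nrm (W n) \<le> M1" for n
    using energy_Im[OF e f, of n] z by (simp add: M1_def field_simps)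
  have M10: "0 \<le> M1" by (simp add: M1_def)
  have M1': "nrm2 (W n) \<le> M1\<^sup>2" for n
    using M1[of n] unfolding nrm_sq[symmetric] by (intro power_mono) auto
  define M2 where "M2 = (A + 2 * cmod z) * M1\<^sup>2 + 2 * (M1 * nrm f)"
  have M2: "nrm2 (W' n) \<le> M2" for n
  proof -
    have "nrm2 (W' n) \<le> (A + 2 * cmod z) * nrm2 (W n) + 2 * (nrm (W n) * nrm f)" by (rule A(2)[OF e f])
    also have "\<dots> \<le> M2" unfolding M2_def
      by (intro add_mono mult_left_mono mult_right_mono M1 M1') (use A in auto)
    finally show ?thesis .
  qed
  \<comment> \<open>The sup bound given by \<open>H1_sup\<close>; on \<open>{- N n..N n}\<close> the
    cut-off function agrees with \<open>U n\<close>.\<close>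
  define S where "S = sqrt (2 * M1\<^sup>2 + 2 * M2)"
  have S: "cmod (U n x) \<le> S" if "x \<in> {- N n..N n}" for n x
  proof -
    have "(cmod (W n x))\<^sup>2 \<le> 2 * M1\<^sup>2 + 2 * M2"
      using H1_sup[OF HW, of n x] M1'[of n] M2[of n] by linarith
    then have "cmod (W n x) \<le> S" unfolding S_def by (rule real_le_rsqrt)
    then show ?thesis using that by (simp add: W_def)
  qed
  have "0 \<in> {- N 0..N 0}" using N1[of 0] by auto
  then have S0: "0 \<le> S" using S[of 0 0] norm_ge_zero[of "U 0 0"] by linarith
  define k where "k t = S * cmod (?q t) + cmod (f t)" for t
  have lk: "locint k" and k0: "\<And>t. 0 \<le> k t"
    unfolding k_def using S0 by (auto intro!: locint_add locint_cont_mult locint_norm lq lf)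
  define D where "D = integral {0..1} k"
  \<comment> \<open>The energy bounds \<open>U' n\<close> in the mean only. The equation bounds its
    oscillation on \<open>{0..1}\<close> by \<open>D\<close>, so averaging over that interval bounds
    the value at 0.\<close>
  have D: "cmod (U' n 0) \<le> 1 + M2 + D" for n
  proof -
    have lU': "locint (\<lambda>x. cmod (U' n x))" by (rule locint_norm[OF acd_locint[OF aU]])
    have y: "cmod (U' n 0) \<le> cmod (U' n x) + D" if x: "x \<in> {0..1}" for x
    proof -
      have "cmod (U' n x - U' n 0) \<le> integral {0..x} k"
        unfolding acdD[OF aU', of 0 x n, unfolded atLeastAtMost_iff, OF x[unfolded atLeastAtMost_iff, THEN
          conjunct1]]
      proof (rule norm_integral_le[OF acd_locint[OF aU'] lk])
        fix t assume t: "t \<in> {0..x}"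
        have "norm (?q t * U n t - f t) \<le> cmod (?q t) * cmod (U n t) + cmod (f t)"
          by (rule order_trans[OF norm_triangle_ineq4]) (simp add: norm_mult)
        also have "\<dots> \<le> cmod (?q t) * S + cmod (f t)"
          using S[of t n] t x N1[of n] by (intro add_right_mono mult_left_mono) auto
        finally show "norm (?q t * U n t - f t) \<le> k t" by (simp add: k_def mult.commute)
      qed
      also have "\<dots> \<le> D" unfolding D_def by (rule integral_mono_set[OF lk k0]) (use x in auto)
      finally show ?thesis using norm_triangle_ineq2[of "U' n 0" "U' n x"] by (simp add: norm_minus_commute)
    qed
    have lW: "locint (\<lambda>x. (cmod (W' n x))\<^sup>2)" by (rule integrable_imp_locint[OF sq_int_integrable[OF sW(2)]])
    have "cmod (U' n 0) = integral {0..1::real} (\<lambda>_. cmod (U' n 0))" by simp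
    also have "\<dots> \<le> integral {0..1} (\<lambda>x. (1 + D) + (cmod (W' n x))\<^sup>2)"
    proof (rule integral_le_locint)
      fix x :: real assume x: "x \<in> {0..1}"
      have "W' n x = U' n x" using x N1[of n] by (simp add: W'_def)
      moreover have "cmod (U' n x) \<le> 1 + (cmod (U' n x))\<^sup>2"
        by (rule le_one_plus_sq)
      ultimately show "cmod (U' n 0) \<le> (1 + D) + (cmod (W' n x))\<^sup>2" using y[OF x] by simp
    qed (auto intro!: locint_add lW)
    also have "\<dots> = (1 + D) + integral {0..1} (\<lambda>x. (cmod (W' n x))\<^sup>2)"
      by (subst Henstock_Kurzweil_Integration.integral_add) (auto intro!: locint_integrable lW)
    also have "integral {0..1} (\<lambda>x. (cmod (W' n x))\<^sup>2) \<le> nrm2 (W' n)"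
      unfolding nrm2_def by (rule integral_le_lebesgue[OF sq_int_integrable[OF sW(2)]]) simp
    finally show ?thesis using M2[of n] by simp
  qed
  have "bounded (range (\<lambda>n. (U n 0, U' n 0)))"
    unfolding bounded_iff
  proof (intro exI ballI)
    fix p assume "p \<in> range (\<lambda>n. (U n 0, U' n 0))"
    then obtain n where p: "p = (U n 0, U' n 0)" by auto
    have "norm p \<le> cmod (U n 0) + cmod (U' n 0)" unfolding p by (rule norm_Pair_le)
    also have "\<dots> \<le> S + (1 + M2 + D)"
      using N1[of n] by (intro add_mono S D) auto
    finally show "norm p \<le> S + (1 + M2 + D)" .
  qed
  then obtain l r where r: "strict_mono r" and l: "((\<lambda>n. (U n 0, U' n 0)) \<circ> r) \<longlonglongrightarrow> l"
    using bounded_imp_convergent_subsequence by blast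
  have l1: "(\<lambda>n. U (r n) 0) \<longlonglongrightarrow> fst l" and l2: "(\<lambda>n. U' (r n) 0) \<longlonglongrightarrow> snd l"
    using tendsto_fst[OF l] tendsto_snd[OF l] by (simp_all add: o_def)
  obtain u u' where u: "ode ?q f u u'" "u 0 = fst l" "u' 0 = snd l"
    using ode_exists[OF lq lf] by metis
  \<comment> \<open>Convergence of the Cauchy data at 0 spreads to every \<open>x\<close> by
    \<open>ode_bound\<close>; for each fixed \<open>x\<close> the cut-off is eventually
    invisible.\<close>
  have conv: "(\<lambda>n. W (r n) x) \<longlonglongrightarrow> u x \<and> (\<lambda>n. W' (r n) x) \<longlonglongrightarrow> u' x" for x
  proof -
    define E where "E = exp (integral {-\<bar>x\<bar>..\<bar>x\<bar>} (\<lambda>t. 1 + cmod (?q t)))"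
    have xin: "x \<in> {-\<bar>x\<bar>..\<bar>x\<bar>}"
      using abs_ge_self[of x] abs_ge_minus_self[of x] unfolding atLeastAtMost_iff by linarith
    have b: "cmod (U (r n) x - u x) + cmod (U' (r n) x - u' x) \<le> (cmod (U (r n) 0 - u 0) + cmod (U' (r n) 0
      - u' 0)) * E" for n
    proof -
      have "ode ?q (\<lambda>_. 0) (\<lambda>t. U (r n) t - u t) (\<lambda>t. U' (r n) t - u' t)"
        using ode_diff[OF o u(1), of "r n"] by simp
      from ode_bound[OF this lq locint_const, of 0 "-\<bar>x\<bar>" "\<bar>x\<bar>" x] xin show ?thesis by (simp add: E_def)
    qed
    have t: "(\<lambda>n. (cmod (U (r n) 0 - u 0) + cmod (U' (r n) 0 - u' 0)) * E) \<longlonglongrightarrow> (cmod (fst l - u 0)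
      + cmod (snd l - u' 0)) * E"
      by (intro tendsto_intros l1 l2)
    then have t0: "(\<lambda>n. (cmod (U (r n) 0 - u 0) + cmod (U' (r n) 0 - u' 0)) * E) \<longlonglongrightarrow> 0" using u by simp
    have "(\<lambda>n. U (r n) x - u x) \<longlonglongrightarrow> 0"
      by (rule Lim_null_comparison[OF _ t0]) (use b in \<open>auto intro!: always_eventually intro: order_trans[OF
        _ b]\<close>)
    moreover have "(\<lambda>n. U' (r n) x - u' x) \<longlonglongrightarrow> 0"
      by (rule Lim_null_comparison[OF _ t0]) (use b in \<open>auto intro!: always_eventually intro: order_trans[OF
        _ b]\<close>)
    moreover have ev: "\<forall>\<^sub>F n in sequentially. U (r n) x = W (r n) x \<and> U' (r n) x = W' (r n) x"
    proof -
      obtain m where m: "\<bar>x\<bar> \<le> real m" using real_arch_simple by blast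
      show ?thesis using eventually_ge_at_top[of m]
      proof eventually_elim
        case (elim n)
        have "n \<le> r n" using r by (rule seq_suble)
        then have "\<bar>x\<bar> \<le> N (r n)" using elim m by (simp add: N_def)
        then show ?case by (auto simp: W_def W'_def indicator_def)
      qed
    qed
    ultimately show ?thesis
      unfolding LIM_zero_iff
      by (auto intro: Lim_transform_eventually elim: eventually_mono)
  qed
  have s: "sq_int u" "sq_int u'"
    using sq_int_limit(1)[of "\<lambda>n. W (r n)" "M1\<^sup>2" u] sq_int_limit(1)[of "\<lambda>n. W' (r n)" M2 u'] sW M1' M2 conv
      by auto
  show ?thesis by (rule that[OF ode_resolvent[OF V u(1) s f] u(1)])
qed

section \<open>The resolvent as a family of operators\<close>

lemma resolvent_sol_lin:
  assumes V: "L1_loc_unif V" and u: "resolvent_sol V z f u u'" and v: "resolvent_sol V z g v v'"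
    and f: "sq_int f" and g: "sq_int g"
  shows "resolvent_sol V z (\<lambda>x. a * f x + b * g x) (\<lambda>x. a * u x + b * v x) (\<lambda>x. a * u' x + b * v' x)"
  unfolding resolvent_sol_def
proof (intro conjI allI impI)
  have Hu: "H1 u u'" and Hv: "H1 v v'" using u v by (auto simp: resolvent_sol_def)
  show "H1 (\<lambda>x. a * u x + b * v x) (\<lambda>x. a * u' x + b * v' x)" by (rule H1_lin[OF Hu Hv])
  fix \<phi> \<phi>' assume p: "H1 \<phi> \<phi>'"
  have s: "sq_int \<phi>" "sq_int \<phi>'" "sq_int u" "sq_int u'" "sq_int v" "sq_int v'"
    using p Hu Hv by (auto simp: H1_iff)
  have l: "(\<integral>x. h x * (a * F x + b * G x) \<partial>lebesgue) = a * (\<integral>x. h x * F x \<partial>lebesgue) + b * (\<integral>x. h x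
    * G x \<partial>lebesgue)"
    if "integrable lebesgue (\<lambda>x. h x * F x)" "integrable lebesgue (\<lambda>x. h x * G x)"
      for h F G :: "real \<Rightarrow> complex"
  proof -
    have "(\<integral>x. h x * (a * F x + b * G x) \<partial>lebesgue) = (\<integral>x. a * (h x * F x) + b * (h x * G x) \<partial>lebesgue)"
      by (rule Bochner_Integration.integral_cong) (auto simp: algebra_simps)
    also have "\<dots> = a * (\<integral>x. h x * F x \<partial>lebesgue) + b * (\<integral>x. h x * G x \<partial>lebesgue)"
      using that by (subst Bochner_Integration.integral_add) auto
    finally show ?thesis .
  qed
  have 1: "(\<integral>x. cnj (\<phi>' x) * u' x \<partial>lebesgue)
        + (\<integral>x. complex_of_real (V x) * cnj (\<phi> x) * u x \<partial>lebesgue)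
        - z * (\<integral>x. cnj (\<phi> x) * u x \<partial>lebesgue) = (\<integral>x. cnj (\<phi> x) * f x \<partial>lebesgue)"
    "(\<integral>x. cnj (\<phi>' x) * v' x \<partial>lebesgue)
        + (\<integral>x. complex_of_real (V x) * cnj (\<phi> x) * v x \<partial>lebesgue)
        - z * (\<integral>x. cnj (\<phi> x) * v x \<partial>lebesgue) = (\<integral>x. cnj (\<phi> x) * g x \<partial>lebesgue)"
    using u v p unfolding resolvent_sol_def by blast+
  show "(\<integral>x. cnj (\<phi>' x) * (a * u' x + b * v' x) \<partial>lebesgue)
        + (\<integral>x. complex_of_real (V x) * cnj (\<phi> x) * (a * u x + b * v x) \<partial>lebesgue)
        - z * (\<integral>x. cnj (\<phi> x) * (a * u x + b * v x) \<partial>lebesgue)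
        = (\<integral>x. cnj (\<phi> x) * (a * f x + b * g x) \<partial>lebesgue)"
    unfolding l[OF inner_integrable[OF s(2) s(4)] inner_integrable[OF s(2) s(6)]]
      l[OF inner_integrable[OF s(1) s(3)] inner_integrable[OF s(1) s(5)]]
      l[OF inner_integrable[OF s(1) f] inner_integrable[OF s(1) g]]
      l[OF V_prod_integrable[OF V p Hu] V_prod_integrable[OF V p Hv]]
      1[symmetric]
    by (simp add: algebra_simps)
qed

locale schroedinger =
  fixes V :: "real \<Rightarrow> real"
  assumes V: "L1_loc_unif V"
begin

text \<open>For non-real \<open>z\<close> and square integrable \<open>f\<close> the choice is
  harmless: by \<open>sol_unique\<close> the solution is unique as a function, not merely almost
  everywhere.\<close>

definition R :: "complex \<Rightarrow> (real \<Rightarrow> complex) \<Rightarrow> real \<Rightarrow> complex" where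
  "R z f = (SOME u. \<exists>u'. resolvent_sol V z f u u')"

lemma R_sol:
  assumes "Im z \<noteq> 0" "sq_int f" shows "\<exists>u'. resolvent_sol V z f (R z f) u'"
proof -
  obtain u u' where "resolvent_sol V z f u u'" by (rule resolvent_exists[OF V assms])
  then have "\<exists>u u'. resolvent_sol V z f u u'" by blast
  then show ?thesis unfolding R_def by (rule someI_ex)
qed

text \<open>The difference solves the equation with zero right-hand side, so
  \<open>energy_Im\<close> makes its norm zero, and continuity makes it vanish everywhere.\<close>

lemma sol_unique:
  assumes u: "resolvent_sol V z f u u'" and v: "resolvent_sol V z f v v'" and z: "Im z \<noteq> 0"
    and f: "sq_int f"
  shows "u = v"
proof -
  have s: "resolvent_sol V z (\<lambda>_. 0) (\<lambda>x. u x - v x) (\<lambda>x. u' x - v' x)"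
    using resolvent_sol_lin[OF V u v f f, of 1 "-1"] by simp
  then have H: "H1 (\<lambda>x. u x - v x) (\<lambda>x. u' x - v' x)" by (simp add: resolvent_sol_def)
  have "\<bar>Im z\<bar> * nrm (\<lambda>x. u x - v x) \<le> 0"
    using energy_Im[OF resolvent_energy[OF s] sq_int_zero] by (simp add: nrm_def[of "\<lambda>_. 0"] nrm2_def[of
      "\<lambda>_. 0"])
  then have "nrm (\<lambda>x. u x - v x) \<le> 0" using z by (simp add: mult_le_0_iff)
  then have "nrm2 (\<lambda>x. u x - v x) = 0" using nrm2_nonneg[of "\<lambda>x. u x - v x"]
    by (simp add: nrm_def del: nrm2_nonneg)
  then have "(\<lambda>x. u x - v x) = (\<lambda>_. 0)"
    using H by (intro nrm2_eq_0_continuous) (auto simp: H1_iff intro: acd_continuous)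
  then show ?thesis by (metis eq_iff_diff_eq_0 ext)
qed

lemma R_eq: "resolvent_sol V z f u u' \<Longrightarrow> Im z \<noteq> 0 \<Longrightarrow> sq_int f \<Longrightarrow> R z f = u"
  using R_sol sol_unique by blast

lemma R_ode:
  assumes "Im z \<noteq> 0" "sq_int f"
  shows "\<exists>u'. ode (\<lambda>t. complex_of_real (V t) - z) f (R z f) u' \<and> resolvent_sol V z f (R z f) u'"
proof -
  obtain u u' where u: "resolvent_sol V z f u u'" "ode (\<lambda>t. complex_of_real (V t) - z) f u u'"
    by (rule resolvent_exists[OF V assms])
  then show ?thesis using R_eq[OF u(1) assms] by blast
qed

lemma R_H1: "Im z \<noteq> 0 \<Longrightarrow> sq_int f \<Longrightarrow> \<exists>u'. H1 (R z f) u'"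
  using R_sol by (metis resolvent_sol_def)

lemma R_sq [simp]: "Im z \<noteq> 0 \<Longrightarrow> sq_int f \<Longrightarrow> sq_int (R z f)"
  using R_H1 H1_iff by blast

lemma R_continuous: "Im z \<noteq> 0 \<Longrightarrow> sq_int f \<Longrightarrow> continuous_on UNIV (R z f)"
  using R_H1 H1_continuous by blast

lemma R_lin:
  assumes z: "Im z \<noteq> 0" and f: "sq_int f" and g: "sq_int g"
  shows "R z (\<lambda>x. a * f x + b * g x) = (\<lambda>x. a * R z f x + b * R z g x)"
proof -
  obtain u' v' where "resolvent_sol V z f (R z f) u'" "resolvent_sol V z g (R z g) v'"
    using R_sol z f g by metis
  from resolvent_sol_lin[OF V this f g, of a b]
  show ?thesis by (rule R_eq[OF _ z sq_int_add[OF sq_int_cmult[OF f] sq_int_cmult[OF g]]])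
qed

lemma R_norm: "Im z \<noteq> 0 \<Longrightarrow> sq_int f \<Longrightarrow> \<bar>Im z\<bar> * nrm (R z f) \<le> nrm f"
  using R_sol resolvent_energy energy_Im by metis

lemma R_norm': "Im z \<noteq> 0 \<Longrightarrow> sq_int f \<Longrightarrow> nrm (R z f) \<le> nrm f / \<bar>Im z\<bar>"
  using R_norm by (simp add: field_simps)

text \<open>Test the equation of each of \<open>R z g\<close> and \<open>R (cnj z) f\<close> with
  the other one; the quadratic form is Hermitian because \<open>V\<close> is real.\<close>

lemma R_adj:
  assumes z: "Im z \<noteq> 0" and f: "sq_int f" and g: "sq_int g"
  shows "inner_L2 (R (cnj z) f) g = inner_L2 f (R z g)"
proof -
  have z': "Im (cnj z) \<noteq> 0" using z by simp
  define v where "v = R (cnj z) f"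
  define u where "u = R z g"
  obtain v' where v: "resolvent_sol V (cnj z) f v v'" using R_sol[OF z' f] by (auto simp: v_def)
  obtain u' where u: "resolvent_sol V z g u u'" using R_sol[OF z g] by (auto simp: u_def)
  have Hv: "H1 v v'" and Hu: "H1 u u'" using u v by (auto simp: resolvent_sol_def)
  have 1: "(\<integral>x. cnj (v' x) * u' x \<partial>lebesgue)
        + (\<integral>x. complex_of_real (V x) * cnj (v x) * u x \<partial>lebesgue)
        - z * (\<integral>x. cnj (v x) * u x \<partial>lebesgue) = inner_L2 v g"
    using u Hv unfolding resolvent_sol_def inner_L2_def by blast
  have 2: "(\<integral>x. cnj (u' x) * v' x \<partial>lebesgue)
        + (\<integral>x. complex_of_real (V x) * cnj (u x) * v x \<partial>lebesgue)
        - cnj z * (\<integral>x. cnj (u x) * v x \<partial>lebesgue) = inner_L2 u f"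
    using v Hu unfolding resolvent_sol_def inner_L2_def by blast
  have c: "cnj (\<integral>x. h x \<partial>lebesgue) = (\<integral>x. cnj (h x) \<partial>lebesgue)" for h :: "real \<Rightarrow> complex"
    by (simp add: Bochner_Integration.integral_cnj)
  have "inner_L2 f u = cnj (inner_L2 u f)" by (rule inner_L2_commute)
  also have "\<dots> = (\<integral>x. cnj (v' x) * u' x \<partial>lebesgue)
        + (\<integral>x. complex_of_real (V x) * cnj (v x) * u x \<partial>lebesgue)
        - z * (\<integral>x. cnj (v x) * u x \<partial>lebesgue)"
    unfolding 2[symmetric] by (simp add: c mult_ac)
  also have "\<dots> = inner_L2 v g" by (rule 1)
  finally show ?thesis by (simp add: u_def v_def)
qed

lemma R_cnj_inner:
  assumes "Im z \<noteq> 0" "sq_int f"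
  shows "inner_L2 f (R (cnj z) f) = cnj (inner_L2 f (R z f))"
  using R_adj[OF assms(1,2,2)] inner_L2_commute[of "R (cnj z) f" f]
  by (metis complex_cnj_cnj)

text \<open>Imaginary part of the energy identity. Read through a spectral measure, it converts a
  bound on \<open>R z f\<close> near the real axis into one on the imaginary part of the Borel
  transform.\<close>

lemma R_Im:
  assumes z: "Im z \<noteq> 0" and f: "sq_int f"
  shows "Im (inner_L2 f (R z f)) = Im z * nrm2 (R z f)"
proof -
  obtain u' where "energy V z f (R z f) u'" using R_sol[OF assms] resolvent_energy by blast
  then have "Im (inner_L2 (R z f) f) = Im (complex_of_real (nrm2 u') + complex_of_real (\<integral>x. V x
    * (cmod (R z f x))\<^sup>2 \<partial>lebesgue) - z * complex_of_real (nrm2 (R z f)))"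
    by (simp add: energy_def)
  then have "Im (inner_L2 (R z f) f) = - Im z * nrm2 (R z f)" by simp
  then show ?thesis using inner_L2_commute[of f "R z f"] by simp
qed

text \<open>\<open>R w f\<close> also solves the equation with parameter \<open>z\<close> and
  right-hand side \<open>f + (w - z) * R w f\<close>; uniqueness and linearity turn this into the
  first resolvent identity.\<close>

lemma R_ident:
  assumes z: "Im z \<noteq> 0" and w: "Im w \<noteq> 0" and f: "sq_int f"
  shows "R z f x - R w f x = (z - w) * R z (R w f) x"
proof -
  obtain u' where u: "resolvent_sol V w f (R w f) u'" using R_sol[OF w f] by blast
  have su: "sq_int (R w f)" using w f by simp
  have "resolvent_sol V z (\<lambda>x. 1 * f x + (w - z) * R w f x) (R w f) u'"
    unfolding resolvent_sol_def
  proof (intro conjI allI impI)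
    show "H1 (R w f) u'" using u by (simp add: resolvent_sol_def)
    fix \<phi> \<phi>' assume p: "H1 \<phi> \<phi>'"
    then have s: "sq_int \<phi>" by (simp add: H1_iff)
    have e: "(\<integral>x. cnj (\<phi>' x) * u' x \<partial>lebesgue)
        + (\<integral>x. complex_of_real (V x) * cnj (\<phi> x) * R w f x \<partial>lebesgue)
        - w * (\<integral>x. cnj (\<phi> x) * R w f x \<partial>lebesgue) = (\<integral>x. cnj (\<phi> x) * f x \<partial>lebesgue)"
      using u p unfolding resolvent_sol_def by blast
    have "(\<integral>x. cnj (\<phi> x) * (1 * f x + (w - z) * R w f x) \<partial>lebesgue) = inner_L2 \<phi> (\<lambda>x. f x + (w - z)
      * R w f x)"
      by (simp add: inner_L2_def)
    also have "\<dots> = inner_L2 \<phi> f + (w - z) * inner_L2 \<phi> (R w f)"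
      using inner_L2_add_right[OF s f sq_int_cmult[OF su, of "w - z"]] by (simp add: inner_L2_cmult_right)
    finally show "(\<integral>x. cnj (\<phi>' x) * u' x \<partial>lebesgue)
        + (\<integral>x. complex_of_real (V x) * cnj (\<phi> x) * R w f x \<partial>lebesgue)
        - z * (\<integral>x. cnj (\<phi> x) * R w f x \<partial>lebesgue) = (\<integral>x. cnj (\<phi> x) * (1 * f x + (w - z)
          * R w f x) \<partial>lebesgue)"
      using e by (simp add: inner_L2_def algebra_simps)
  qed
  then have "R z (\<lambda>x. 1 * f x + (w - z) * R w f x) = R w f"
    by (rule R_eq[OF _ z sq_int_add[OF sq_int_cmult[OF f] sq_int_cmult[OF su]]])
  then have "R w f x = 1 * R z f x + (w - z) * R z (R w f) x"
    unfolding R_lin[OF z f su] by metis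
  then show ?thesis by (simp add: algebra_simps)
qed

end

section \<open>Density of the form domain and the weak limit of the resolvent\<close>

lemma nrm2_tendsto_0:
  assumes m: "\<And>n. g n \<in> borel_measurable lebesgue" "f \<in> borel_measurable lebesgue"
    and W: "integrable lebesgue W" "\<And>n x. (cmod (f x - g n x))\<^sup>2 \<le> W x"
    and lim: "AE x in lebesgue. (\<lambda>n. g n x) \<longlonglongrightarrow> f x"
  shows "(\<lambda>n. nrm2 (\<lambda>x. f x - g n x)) \<longlonglongrightarrow> 0"
proof -
  note m[measurable]
  have "(\<lambda>n. \<integral>x. (cmod (f x - g n x))\<^sup>2 \<partial>lebesgue) \<longlonglongrightarrow> (\<integral>x. 0 \<partial>(lebesgue :: real measure))"
  proof (rule integral_dominated_convergence[OF _ _ W(1)])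
    show "AE x in lebesgue. (\<lambda>n. (cmod (f x - g n x))\<^sup>2) \<longlonglongrightarrow> 0"
      using lim
    proof eventually_elim
      case (elim x)
      have "(\<lambda>n. (cmod (f x - g n x))\<^sup>2) \<longlonglongrightarrow> (cmod (f x - f x))\<^sup>2"
        by (intro tendsto_intros elim)
      then show ?case by simp
    qed
  qed (use W(2) in \<open>auto\<close>)
  then show ?thesis by (simp add: nrm2_def)
qed

text \<open>Averages over \<open>{x..x + 1 / (n + 1)}\<close> are difference quotients of a
  primitive of \<open>h\<close>, hence lie in \<open>H1\<close>. They converge almost everywhere by
  Lebesgue differentiation and are dominated by a constant on a bounded interval.\<close>

lemma mollify:
  fixes h :: "real \<Rightarrow> complex"
  assumes h: "h \<in> borel_measurable lebesgue" and M: "\<And>x. cmod (h x) \<le> M"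
    and m: "\<And>x. m < \<bar>x\<bar> \<Longrightarrow> h x = 0"
  shows "\<exists>g g'. (\<forall>n. H1 (g n) (g' n)) \<and> (\<lambda>n. nrm2 (\<lambda>x. h x - g n x)) \<longlonglongrightarrow> 0"
proof -
  have M0: "0 \<le> M" using M[of 0] norm_ge_zero[of "h 0"] by linarith
  have l: "locint h" by (rule locint_bound[OF h locint_const M])
  define d where "d n = 1 / real (Suc n)" for n
  have d: "0 < d n" "d n \<le> 1" for n by (auto simp: d_def)
  define P where "P = prim 0 h"
  have P: "acd P h" unfolding P_def by (rule acd_prim[OF l])
  define g where "g n x = complex_of_real (1 / d n) * (P (x + d n) - P x)" for n x
  define g' where "g' n x = complex_of_real (1 / d n) * (h (x + d n) - h x)" for n x
  have gi: "g n x = complex_of_real (1 / d n) * integral {x..x + d n} h" for n x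
    using acdD[OF P, of x "x + d n"] d[of n] by (simp add: g_def)
  have gM: "cmod (g n x) \<le> M" for n x
  proof -
    have "cmod (integral {x..x + d n} h) \<le> integral {x..x + d n} (\<lambda>_. M)"
      by (rule norm_integral_le[OF l locint_const M])
    then have "cmod (integral {x..x + d n} h) \<le> d n * M" using d[of n] by simp
    then have "(1 / d n) * cmod (integral {x..x + d n} h) \<le> (1 / d n) * (d n * M)"
      using d[of n] by (intro mult_left_mono) auto
    then show ?thesis unfolding gi using d[of n] by (simp add: norm_mult norm_divide)
  qed
  have g0: "g n x = 0" if "m + 1 < \<bar>x\<bar>" for n x
  proof -
    have "integral {x..x + d n} h = integral {x..x + d n} (\<lambda>_. 0)"
      by (rule Henstock_Kurzweil_Integration.integral_cong) (use m that d[of n] in auto)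
    then show ?thesis by (simp add: gi)
  qed
  have acdg: "acd (g n) (g' n)" for n
    unfolding g_def g'_def by (intro acd_cmult acd_diff acd_shift P)
  have ii: "integrable lebesgue (\<lambda>x. indicator {-(m+2)..m+2} x *\<^sub>R c)" for c :: real
    by (rule locint_integrable_indicator) simp
  have sq: "sq_int k" if k: "k \<in> borel_measurable lebesgue" "\<And>x. cmod (k x) \<le> c" "\<And>x. m + 2 < \<bar>x\<bar> \<Longrightarrow> k x = 0"
    for k c
  proof (rule sq_int_bound[OF k(1) ii[of "c\<^sup>2"]])
    show "(cmod (k x))\<^sup>2 \<le> indicator {-(m+2)..m+2} x *\<^sub>R c\<^sup>2" for x
      using k(2)[of x] k(3)[of x] by (cases "m + 2 < \<bar>x\<bar>") (auto simp: indicator_def abs_le_iff intro!: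
        power_mono)
  qed
  have gm: "g n \<in> borel_measurable lebesgue" for n
    by (rule locint_measurable[OF locint_continuous[OF acd_continuous[OF acdg]]])
  have H: "H1 (g n) (g' n)" for n
    unfolding H1_iff
  proof (intro conjI acdg)
    show "sq_int (g n)" by (rule sq[OF gm gM g0]) auto
    have "sq_int h" by (rule sq[OF h M m]) auto
    then show "sq_int (g' n)" unfolding g'_def by (intro sq_int_cmult sq_int_diff sq_int_shift)
  qed
  obtain N where N: "negligible N" "\<And>x e. \<lbrakk>x \<notin> N; 0 < e\<rbrakk> \<Longrightarrow>
               \<exists>d>0. \<forall>k. 0 < k \<and> k < d \<longrightarrow>
                         norm(integral (cbox x (x + k *\<^sub>R One)) h /\<^sub>R k ^ DIM(real) - h x) < e"
    using integrable_ccontinuous_explicit[of h] locint_integrable[OF l] by (auto simp: cbox_interval)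
  have d0: "d \<longlonglongrightarrow> 0" unfolding d_def by (rule LIMSEQ_Suc[OF lim_1_over_n])
  have lim: "AE x in lebesgue. (\<lambda>n. g n x) \<longlonglongrightarrow> h x"
  proof -
    have "(\<lambda>n. g n x) \<longlonglongrightarrow> h x" if xN: "x \<notin> N" for x
    proof (rule tendstoI)
      fix e :: real assume e: "0 < e"
      obtain k where k: "0 < k" "\<And>t. 0 < t \<Longrightarrow> t < k \<Longrightarrow> norm(integral (cbox x (x
        + t *\<^sub>R One)) h /\<^sub>R t ^ DIM(real) - h x) < e"
        using N(2)[OF xN e] by blast
      have "\<forall>\<^sub>F n in sequentially. d n < k" using order_tendstoD(2)[OF d0 k(1)] .
      then show "\<forall>\<^sub>F n in sequentially. dist (g n x) (h x) < e"
      proof eventually_elim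
        case (elim n)
        from k(2)[OF d(1) elim] show ?case
          unfolding gi dist_norm by (simp add: cbox_interval scaleR_conv_of_real divide_inverse)
      qed
    qed
    then show ?thesis using N(1) by (auto simp: eventually_ae_filter_negligible)
  qed
  have "(\<lambda>n. nrm2 (\<lambda>x. h x - g n x)) \<longlonglongrightarrow> 0"
  proof (rule nrm2_tendsto_0[OF gm h ii[of "(2 * M)\<^sup>2"] _ lim])
    fix n x
    show "(cmod (h x - g n x))\<^sup>2 \<le> indicator {-(m+2)..m+2} x *\<^sub>R (2 * M)\<^sup>2"
    proof (cases "m + 2 < \<bar>x\<bar>")
      case True
      then show ?thesis using m g0[of x n] by (auto simp: indicator_def)
    next
      case False
      have "cmod (h x - g n x) \<le> 2 * M" using norm_triangle_ineq4[of "h x" "g n x"] M[of x] gM[of n x]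
        by linarith
      then have "(cmod (h x - g n x))\<^sup>2 \<le> (2 * M)\<^sup>2" by (intro power_mono) auto
      then show ?thesis using False by (auto simp: indicator_def)
    qed
  qed
  then show ?thesis using H by blast
qed

text \<open>Truncate \<open>f\<close> in size and support, then mollify; each of the two errors is
  made smaller than \<open>e / 2\<close>.\<close>

lemma H1_dense:
  assumes f: "sq_int f" and e: "0 < e"
  shows "\<exists>\<phi> \<phi>'. H1 \<phi> \<phi>' \<and> nrm (\<lambda>x. f x - \<phi> x) < e"
proof -
  define h where "h n x = (if \<bar>x\<bar> \<le> real n \<and> cmod (f x) \<le> real n then f x else 0)" for n x
  note id_lebesgue_measurable [measurable]
  have [measurable]: "f \<in> borel_measurable lebesgue" using f by (rule sq_int_measurable)
  have hm: "h n \<in> borel_measurable lebesgue" for n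
    unfolding h_def by measurable
  have "(\<lambda>n. nrm2 (\<lambda>x. f x - h n x)) \<longlonglongrightarrow> 0"
  proof (rule nrm2_tendsto_0[OF hm sq_int_measurable[OF f] sq_int_integrable[OF f]])
    show "(cmod (f x - h n x))\<^sup>2 \<le> (cmod (f x))\<^sup>2" for n x by (simp add: h_def)
    have "(\<lambda>n. h n x) \<longlonglongrightarrow> f x" for x
    proof (rule tendsto_eventually)
      obtain m where m: "max \<bar>x\<bar> (cmod (f x)) \<le> real m" using real_arch_simple by blast
      show "\<forall>\<^sub>F n in sequentially. h n x = f x"
        using eventually_ge_at_top[of m] by eventually_elim (use m in \<open>auto simp: h_def\<close>)
    qed
    then show "AE x in lebesgue. (\<lambda>n. h n x) \<longlonglongrightarrow> f x" by simp
  qed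
  then have "\<forall>\<^sub>F n in sequentially. nrm2 (\<lambda>x. f x - h n x) < (e/2)\<^sup>2"
    by (rule order_tendstoD) (use e in simp)
  then obtain n where n: "nrm2 (\<lambda>x. f x - h n x) < (e/2)\<^sup>2" by (auto simp: eventually_sequentially)
  obtain g g' where g: "\<And>k. H1 (g k) (g' k)" "(\<lambda>k. nrm2 (\<lambda>x. h n x - g k x)) \<longlonglongrightarrow> 0"
  proof -
    have "cmod (h n x) \<le> real n" for x by (simp add: h_def)
    moreover have "h n x = 0" if "real n < \<bar>x\<bar>" for x using that by (simp add: h_def)
    ultimately show ?thesis using mollify[OF hm, of n "real n" "real n"] that by blast
  qed
  have "\<forall>\<^sub>F k in sequentially. nrm2 (\<lambda>x. h n x - g k x) < (e/2)\<^sup>2"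
    using g(2) by (rule order_tendstoD) (use e in simp)
  then obtain k where k: "nrm2 (\<lambda>x. h n x - g k x) < (e/2)\<^sup>2" by (auto simp: eventually_sequentially)
  have s: "sq_int (h n)"
    by (rule sq_int_bound[OF hm sq_int_integrable[OF f]]) (simp add: h_def)
  have sg: "sq_int (g k)" using g(1)[of k] by (simp add: H1_iff)
  have "nrm (\<lambda>x. f x - g k x) \<le> nrm (\<lambda>x. f x - h n x) + nrm (\<lambda>x. h n x - g k x)"
    using nrm_triangle[OF sq_int_diff[OF f s] sq_int_diff[OF s sg]] by simp
  also have "\<dots> < e/2 + e/2"
  proof (rule add_strict_mono)
    show "nrm (\<lambda>x. f x - h n x) < e/2" unfolding nrm_def
      by (rule real_less_lsqrt[OF _ n]) (use e in simp)
    show "nrm (\<lambda>x. h n x - g k x) < e/2" unfolding nrm_def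
      by (rule real_less_lsqrt[OF _ k]) (use e in simp)
  qed
  finally show ?thesis using g(1)[of k] by auto
qed

text \<open>\<open>V\<close> may change sign, so \<open>sqrt \<bar>V\<bar>\<close> is distributed
  over both factors before the ordinary Cauchy-Schwarz inequality is applied.\<close>

lemma V_form_cauchy_schwarz:
  assumes V: "locint V" and i: "integrable lebesgue (\<lambda>x. \<bar>V x\<bar> * (cmod (\<phi> x))\<^sup>2)"
    "integrable lebesgue (\<lambda>x. \<bar>V x\<bar> * (cmod (u x))\<^sup>2)"
    and m: "\<phi> \<in> borel_measurable lebesgue" "u \<in> borel_measurable lebesgue"
  shows "(cmod (\<integral>x. complex_of_real (V x) * cnj (\<phi> x) * u x \<partial>lebesgue))\<^sup>2
     \<le> (\<integral>x. \<bar>V x\<bar> * (cmod (\<phi> x))\<^sup>2 \<partial>lebesgue) * (\<integral>x. \<bar>V x\<bar> * (cmod (u x))\<^sup>2 \<partial>lebesgue)"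
proof -
  note m[measurable]
  have [measurable]: "V \<in> borel_measurable lebesgue" by (rule locint_measurable[OF V])
  define w where "w f x = complex_of_real (sqrt \<bar>V x\<bar>) * f x" for f x
  have n: "(cmod (w f x))\<^sup>2 = \<bar>V x\<bar> * (cmod (f x))\<^sup>2" for f x
    by (simp add: w_def norm_mult power_mult_distrib)
  have s: "sq_int (w \<phi>)" "sq_int (w u)"
    using i unfolding sq_int_def n by (auto simp: w_def[abs_def])
  have "cmod (\<integral>x. complex_of_real (V x) * cnj (\<phi> x) * u x \<partial>lebesgue) \<le> (\<integral>x. cmod (complex_of_real (V x)
    * cnj (\<phi> x) * u x) \<partial>lebesgue)"
    by (rule integral_norm_bound)
  also have "\<dots> = (\<integral>x. cmod (w \<phi> x) * cmod (w u x) \<partial>lebesgue)"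
  proof (rule Bochner_Integration.integral_cong[OF refl])
    fix x
    have "sqrt \<bar>V x\<bar> * sqrt \<bar>V x\<bar> = \<bar>V x\<bar>" by simp
    then show "cmod (complex_of_real (V x) * cnj (\<phi> x) * u x) = cmod (w \<phi> x) * cmod (w u x)"
      by (simp add: w_def norm_mult mult_ac)
  qed
  finally have "(cmod (\<integral>x. complex_of_real (V x) * cnj (\<phi> x) * u x \<partial>lebesgue))\<^sup>2 \<le> (\<integral>x. cmod (w \<phi> x)
    * cmod (w u x) \<partial>lebesgue)\<^sup>2"
    by (intro power_mono) auto
  also have "\<dots> \<le> nrm2 (w \<phi>) * nrm2 (w u)" by (rule cauchy_schwarz_abs[OF s])
  finally show ?thesis by (simp add: nrm2_def n)
qed

context schroedinger
begin

text \<open>For \<open>z = \<i> y\<close> the weak equation expresses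
  \<open>- z * inner_L2 \<phi> u\<close> as \<open>inner_L2 \<phi> f\<close> minus two form terms.
  Since \<open>nrm2 u\<close> is O(1/y^2) and \<open>nrm2 u'\<close> is O(1/y), both form terms are
  O(1/sqrt y).\<close>

lemma R_weak_H1:
  assumes p: "H1 \<phi> \<phi>'" and f: "sq_int f"
  shows "(\<lambda>n. - (\<i> * real (Suc n)) * inner_L2 \<phi> (R (\<i> * real (Suc n)) f)) \<longlonglongrightarrow> inner_L2 \<phi> f"
proof -
  define y where "y n = real (Suc n)" for n
  define z where "z n = \<i> * complex_of_real (y n)" for n
  have y1: "1 \<le> y n" for n by (simp add: y_def)
  have z: "Im (z n) = y n" "Im (z n) \<noteq> 0" "cmod (z n) = y n" for n using y1[of n]
    by (auto simp: z_def norm_mult)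
  obtain u' where u': "\<And>n. resolvent_sol V (z n) f (R (z n) f) (u' n)"
    using R_sol[OF z(2) f] by metis
  define u where "u n = R (z n) f" for n
  have H: "H1 (u n) (u' n)" for n using u' by (auto simp: resolvent_sol_def u_def)
  then have s: "sq_int (u n)" "sq_int (u' n)" for n by (auto simp: H1_iff)
  have sp: "sq_int \<phi>" "sq_int \<phi>'" using p by (auto simp: H1_iff)
  have lV: "locint V" using V by (simp add: L1_loc_unif_def loc_int_iff)
  obtain C where C: "0 \<le> C" "\<And>a b. b \<le> a + 2 \<Longrightarrow> integral {a..b} (\<lambda>x. \<bar>V x\<bar>) \<le> C"
    using L1_loc_unif_bound[OF V] by blast
  obtain A where A: "0 \<le> A" "\<And>z f u u'. energy V z f u u' \<Longrightarrow> sq_int f \<Longrightarrow>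
     nrm2 u' \<le> (A + 2 * cmod z) * nrm2 u + 2 * (nrm u * nrm f)"
    using energy_Re[OF V] by blast
  define F where "F = nrm2 f"
  have F0: "0 \<le> F" by (simp add: F_def)
  have nu: "nrm (u n) \<le> nrm f / y n" for n
    using R_norm'[OF z(2) f, of n] y1[of n] by (simp add: u_def z)
  have nu2: "nrm2 (u n) \<le> F / (y n * y n)" for n
  proof -
    have "(nrm (u n))\<^sup>2 \<le> (nrm f / y n)\<^sup>2" using nu[of n] by (intro power_mono) auto
    then show ?thesis by (simp add: nrm_sq F_def power_divide) (simp add: power2_eq_square)
  qed
  have nu2': "nrm2 (u n) \<le> F / y n" for n
  proof -
    have "F / (y n * y n) \<le> F / (y n * 1)" using y1[of n] F0 by (intro divide_left_mono mult_left_mono) auto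
    then show ?thesis using nu2[of n] by simp
  qed
  \<comment> \<open>\<open>energy_Re\<close> with \<open>cmod z = y n\<close>: of the 4, a 2 comes
    from \<open>2 * cmod z\<close> and a 2 from the mixed term.\<close>
  have nu': "nrm2 (u' n) \<le> (A + 4) * F / y n" for n
  proof -
    have "nrm2 (u' n) \<le> (A + 2 * y n) * nrm2 (u n) + 2 * (nrm (u n) * nrm f)"
      using A(2)[OF resolvent_energy[OF u'] f, of n] by (simp add: z u_def)
    also have "\<dots> \<le> A * (F / y n) + 2 * y n * (F / (y n * y n)) + 2 * (nrm f / y n * nrm f)"
      unfolding distrib_right
      by (intro add_mono mult_left_mono mult_right_mono nu nu2 nu2') (use A y1[of n] in auto)
    also have "\<dots> = (A + 4) * F / y n"
      using y1[of n] by (simp add: F_def nrm_sq[symmetric] power2_eq_square field_simps)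
    finally show ?thesis .
  qed
  define a where "a = (\<integral>x. \<bar>V x\<bar> * (cmod (\<phi> x))\<^sup>2 \<partial>lebesgue)"
  have a0: "0 \<le> a" by (simp add: a_def)
  have Vi: "integrable lebesgue (\<lambda>x. \<bar>V x\<bar> * (cmod (v x))\<^sup>2)" "(\<integral>x. \<bar>V x\<bar> * (cmod (v x))\<^sup>2 \<partial>lebesgue)
    \<le> C * (2 * nrm2 v + 2 * nrm2 v')" if "H1 v v'" for v v'
    using V_form_bound[OF lV C _ _ that, of 1] by auto
  define b where "b n = (\<integral>x. complex_of_real (V x) * cnj (\<phi> x) * u n x \<partial>lebesgue)" for n
  have inv0: "(\<lambda>n. c / y n) \<longlonglongrightarrow> 0" for c :: real
    unfolding y_def using LIMSEQ_Suc[OF lim_const_over_n] by blast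
  have "b \<longlonglongrightarrow> 0"
  proof (rule Lim_null_comparison)
    show "\<forall>\<^sub>F n in sequentially. cmod (b n) \<le> sqrt ((a * (C * (2 * F + 2 * ((A + 4) * F)))) / y n)"
    proof (rule always_eventually, rule allI, rule real_le_rsqrt)
      fix n
      have "(cmod (b n))\<^sup>2 \<le> a * (\<integral>x. \<bar>V x\<bar> * (cmod (u n x))\<^sup>2 \<partial>lebesgue)"
        unfolding b_def a_def
        by (rule V_form_cauchy_schwarz[OF lV Vi(1)[OF p] Vi(1)[OF H]]) (use sp s in \<open>auto simp: sq_int_def\<close>)
      also have "\<dots> \<le> a * (C * (2 * nrm2 (u n) + 2 * nrm2 (u' n)))"
        by (intro mult_left_mono a0 Vi(2)[OF H])
      also have "\<dots> \<le> a * (C * (2 * (F / y n) + 2 * ((A + 4) * F / y n)))"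
        by (intro mult_left_mono add_mono a0 C(1) nu2' nu') auto
      also have "\<dots> = (a * (C * (2 * F + 2 * ((A + 4) * F)))) / y n"
        by (simp add: algebra_simps add_divide_distrib)
      finally show "(cmod (b n))\<^sup>2 \<le> (a * (C * (2 * F + 2 * ((A + 4) * F)))) / y n" .
    qed
    show "(\<lambda>n. sqrt ((a * (C * (2 * F + 2 * ((A + 4) * F)))) / y n)) \<longlonglongrightarrow> 0"
      using tendsto_real_sqrt[OF inv0] by simp
  qed
  moreover have "(\<lambda>n. inner_L2 \<phi>' (u' n)) \<longlonglongrightarrow> 0"
  proof (rule Lim_null_comparison)
    show "\<forall>\<^sub>F n in sequentially. cmod (inner_L2 \<phi>' (u' n)) \<le> nrm \<phi>' * sqrt ((A + 4) * F / y n)"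
    proof (rule always_eventually, rule allI)
      fix n
      have "cmod (inner_L2 \<phi>' (u' n)) \<le> nrm \<phi>' * nrm (u' n)" by (rule cauchy_schwarz[OF sp(2) s(2)])
      also have "\<dots> \<le> nrm \<phi>' * sqrt ((A + 4) * F / y n)"
        using nu'[of n] unfolding nrm_def[of "u' n"] by (intro mult_left_mono) (auto simp: nrm_def)
      finally show "cmod (inner_L2 \<phi>' (u' n)) \<le> nrm \<phi>' * sqrt ((A + 4) * F / y n)" .
    qed
    show "(\<lambda>n. nrm \<phi>' * sqrt ((A + 4) * F / y n)) \<longlonglongrightarrow> 0"
      using tendsto_mult[OF tendsto_const tendsto_real_sqrt[OF inv0], of "nrm \<phi>'"] by simp
  qed
  ultimately have "(\<lambda>n. inner_L2 \<phi> f - (inner_L2 \<phi>' (u' n) + b n)) \<longlonglongrightarrow> inner_L2 \<phi> f - (0 + 0)"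
    by (intro tendsto_intros)
  moreover have "inner_L2 \<phi> f - (inner_L2 \<phi>' (u' n) + b n) = - (\<i> * real (Suc n)) * inner_L2 \<phi> (R (\<i>
    * real (Suc n)) f)" for n
  proof -
    have "inner_L2 \<phi>' (u' n) + b n - z n * inner_L2 \<phi> (u n) = inner_L2 \<phi> f"
      using u'[of n] p unfolding resolvent_sol_def inner_L2_def b_def u_def by blast
    then show ?thesis by (simp add: z_def y_def u_def algebra_simps)
  qed
  ultimately show ?thesis by simp
qed

text \<open>The operators \<open>- z R z\<close> at \<open>z = \<i> y\<close> are contractions by
  \<open>R_norm\<close>, so convergence against the dense set of \<open>H1\<close> functions extends
  to all of L2. It recovers \<open>f\<close> from its resolvent wherever Borel transforms have to be
  turned back into forms.\<close>

lemma R_weak: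
  assumes g: "sq_int g" and f: "sq_int f"
  shows "(\<lambda>n. - (\<i> * real (Suc n)) * inner_L2 g (R (\<i> * real (Suc n)) f)) \<longlonglongrightarrow> inner_L2 g f"
proof (rule tendstoI)
  fix e :: real assume e: "0 < e"
  define h where "h n = (\<lambda>x. - (\<i> * real (Suc n)) * R (\<i> * real (Suc n)) f x)" for n
  have z: "Im (\<i> * real (Suc n)) \<noteq> 0" for n by simp
  have sh: "sq_int (h n)" for n unfolding h_def by (intro sq_int_cmult R_sq z f)
  have nh: "nrm (h n) \<le> nrm f" for n
    using R_norm[OF z f, of n] unfolding h_def nrm_cmult by (simp add: norm_mult del: of_nat_Suc)
  have F: "0 < nrm f + 1" by (simp add: add_nonneg_pos)
  obtain \<phi> \<phi>' where p: "H1 \<phi> \<phi>'" "nrm (\<lambda>x. g x - \<phi> x) < e / (4 * (nrm f + 1))"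
    using H1_dense[OF g, of "e / (4 * (nrm f + 1))"] e F by auto
  have sp: "sq_int \<phi>" using p by (simp add: H1_iff)
  have sd: "sq_int (\<lambda>x. g x - \<phi> x)" by (rule sq_int_diff[OF g sp])
  have small: "cmod (inner_L2 (\<lambda>x. g x - \<phi> x) k) \<le> e / 4" if "sq_int k" "nrm k \<le> nrm f" for k
  proof -
    have "cmod (inner_L2 (\<lambda>x. g x - \<phi> x) k) \<le> nrm (\<lambda>x. g x - \<phi> x) * nrm k"
      by (rule cauchy_schwarz[OF sd that(1)])
    also have "\<dots> \<le> e / (4 * (nrm f + 1)) * (nrm f + 1)"
      using p(2) that(2) e F by (intro mult_mono) auto
    also have "\<dots> = e / 4" using F by (simp add: field_simps)
    finally show ?thesis .
  qed
  have lim: "(\<lambda>n. inner_L2 \<phi> (h n)) \<longlonglongrightarrow> inner_L2 \<phi> f"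
    using R_weak_H1[OF p(1) f] by (simp only: h_def inner_L2_cmult_right)
  have "\<forall>\<^sub>F n in sequentially. dist (inner_L2 \<phi> (h n)) (inner_L2 \<phi> f) < e / 2"
    using lim e by (intro tendstoD) auto
  then show "\<forall>\<^sub>F n in sequentially. dist (- (\<i> * real (Suc n)) * inner_L2 g (R (\<i>
    * real (Suc n)) f)) (inner_L2 g f) < e"
  proof eventually_elim
    case (elim n)
    have 1: "inner_L2 g k = inner_L2 (\<lambda>x. g x - \<phi> x) k + inner_L2 \<phi> k" if "sq_int k" for k
      using inner_L2_diff_left[OF that g sp] by simp
    have "inner_L2 g (h n) - inner_L2 g f = inner_L2 (\<lambda>x. g x - \<phi> x) (h n) + (inner_L2 \<phi> (h n)
      - inner_L2 \<phi> f) - inner_L2 (\<lambda>x. g x - \<phi> x) f"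
      unfolding 1[OF sh] 1[OF f] by simp
    then have "cmod (inner_L2 g (h n) - inner_L2 g f) \<le> cmod (inner_L2 (\<lambda>x. g x - \<phi> x) (h n))
      + cmod (inner_L2 \<phi> (h n) - inner_L2 \<phi> f) + cmod (inner_L2 (\<lambda>x. g x - \<phi> x) f)"
      by (smt (verit) norm_triangle_ineq norm_triangle_ineq4)
    also have "\<dots> < e / 4 + e / 2 + e / 4"
      using small[OF sh nh, of n] small[OF f order_refl] elim unfolding dist_norm by linarith
    finally have "cmod (inner_L2 g (h n) - inner_L2 g f) < e" by simp
    then show ?case by (simp only: dist_norm h_def inner_L2_cmult_right)
  qed
qed

end

section \<open>Existence of spectral measures\<close>

text \<open>Densities carried by \<open>{0..2*pi}\<close> form a tight family, so Helly selection
  gives a weak limit of a subsequence; \<open>cis (k * \<theta>)\<close> is bounded and continuous,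
  so the Fourier coefficients pass to the limit.\<close>

lemma circle_limit:
  fixes s :: "nat \<Rightarrow> real \<Rightarrow> real"
  assumes cont: "\<And>N. continuous_on UNIV (s N)" and nn: "\<And>N \<theta>. 0 \<le> s N \<theta>"
    and mass: "\<And>N. (\<integral>\<theta>. indicator {0..2*pi} \<theta> * s N \<theta> \<partial>lborel) = 1"
    and lim: "\<And>k. (\<lambda>N. \<integral>\<theta>. (indicator {0..2*pi} \<theta> * s N \<theta>) *\<^sub>R cis (real k * \<theta>) \<partial>lborel) \<longlonglongrightarrow> c k"
  obtains M where "real_distribution M" "\<And>k. (\<integral>\<theta>. cis (real k * \<theta>) \<partial>M) = c k"
proof -
  define g where "g N \<theta> = indicator {0..2*pi} \<theta> * s N \<theta>" for N \<theta>
  have gm[measurable]: "g N \<in> borel_measurable borel" for N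
    unfolding g_def by (intro borel_measurable_times borel_measurable_indicator
      borel_measurable_continuous_onI cont) auto
  have g0: "0 \<le> g N \<theta>" for N \<theta> using nn by (simp add: g_def)
  have gi: "integrable lborel (g N)" for N
    using mass[of N] unfolding g_def using not_integrable_integral_eq by force
  define \<mu> where "\<mu> N = density lborel (\<lambda>\<theta>. ennreal (g N \<theta>))" for N
  have rd: "real_distribution (\<mu> N)" for N
  proof -
    have "prob_space (\<mu> N)"
    proof
      have "emeasure (\<mu> N) (space (\<mu> N)) = (\<integral>\<^sup>+\<theta>. ennreal (g N \<theta>) \<partial>lborel)"
        unfolding \<mu>_def by (subst emeasure_density) auto
      also have "\<dots> = ennreal (\<integral>\<theta>. g N \<theta> \<partial>lborel)"
        by (rule nn_integral_eq_integral[OF gi]) (use g0 in auto)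
      finally show "emeasure (\<mu> N) (space (\<mu> N)) = 1" using mass[of N] by (simp add: g_def)
    qed
    then show ?thesis
      by (intro real_distribution.intro real_distribution_axioms.intro) (auto simp: \<mu>_def)
  qed
  have "tight \<mu>"
    unfolding tight_def
  proof (intro conjI allI impI rd)
    fix e :: real assume e: "0 < e"
    \<comment> \<open>Tightness is stated with intervals open on the left, so the left end is moved
      from 0 to -1 to capture all the mass.\<close>
    have "1 - e < measure (\<mu> N) {-1<..2*pi}" for N
    proof -
      have "emeasure (\<mu> N) {-1<..2*pi} = (\<integral>\<^sup>+\<theta>. ennreal (g N \<theta>) * indicator {-1<..2*pi} \<theta> \<partial>lborel)"
        unfolding \<mu>_def by (rule emeasure_density) auto
      also have "\<dots> = (\<integral>\<^sup>+\<theta>. ennreal (g N \<theta>) \<partial>lborel)"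
        by (intro nn_integral_cong) (auto simp: g_def indicator_def)
      also have "\<dots> = ennreal (\<integral>\<theta>. g N \<theta> \<partial>lborel)"
        by (rule nn_integral_eq_integral[OF gi]) (use g0 in auto)
      finally show ?thesis using mass[of N] e by (simp add: g_def measure_def)
    qed
    then have *: "\<forall>N. 1 - e < measure (\<mu> N) {-1<..2*pi}" by blast
    show "\<exists>a b. a < b \<and> (\<forall>n. 1 - e < measure (\<mu> n) {a<..b})"
    proof (rule exI, rule exI, rule conjI[OF _ *])
      show "(-1::real) < 2 * pi" using pi_gt_zero by linarith
    qed
  qed
  then obtain r M where r: "strict_mono r" and M: "real_distribution M" and w: "weak_conv_m (\<mu> \<circ> id \<circ> r) M"
    using tight_imp_convergent_subsubsequence[of \<mu> id] strict_mono_id by blast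
  show ?thesis
  proof (rule that[OF M])
    fix k
    have "(\<lambda>n. \<integral>\<theta>. cis (real k * \<theta>) \<partial>((\<mu> \<circ> id \<circ> r) n)) \<longlonglongrightarrow> (\<integral>\<theta>. cis (real k * \<theta>) \<partial>M)"
    proof (rule weak_conv_imp_integral_bdd_continuous_conv[where B = 1])
      show "real_distribution ((\<mu> \<circ> id \<circ> r) n)" for n using rd by simp
      have "continuous_on UNIV (\<lambda>\<theta>. cis (real k * \<theta>))" by (intro continuous_intros)
      then show "isCont (\<lambda>\<theta>. cis (real k * \<theta>)) x" for x
        by (simp add: continuous_on_eq_continuous_at)
    qed (use M w in \<open>auto simp: o_def\<close>)
    moreover have "(\<integral>\<theta>. cis (real k * \<theta>) \<partial>((\<mu> \<circ> id \<circ> r) n)) = (\<integral>\<theta>. (indicator {0..2*pi} \<theta>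
      * s (r n) \<theta>) *\<^sub>R cis (real k * \<theta>) \<partial>lborel)" for n
    proof -
      have "(\<integral>\<theta>. cis (real k * \<theta>) \<partial>density lborel (\<lambda>\<theta>. ennreal (g (r n) \<theta>))) = (\<integral>\<theta>. g (r n) \<theta> *\<^sub>R cis (real k
        * \<theta>) \<partial>lborel)"
        by (rule integral_density) (use g0 gm in \<open>auto intro!: borel_measurable_continuous_onI
          continuous_intros\<close>)
      then show ?thesis by (simp add: \<mu>_def g_def)
    qed
    moreover have "(\<lambda>n. \<integral>\<theta>. (indicator {0..2*pi} \<theta> * s (r n) \<theta>) *\<^sub>R cis (real k * \<theta>) \<partial>lborel) \<longlonglongrightarrow> c k"
      using LIMSEQ_subseq_LIMSEQ[OF lim r] by (simp add: o_def)
    ultimately show "(\<integral>\<theta>. cis (real k * \<theta>) \<partial>M) = c k"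
      using LIMSEQ_unique by auto
  qed
qed

lemma integral_cis:
  fixes m :: int
  shows "(\<integral>\<theta>. indicator {0..2*pi} \<theta> *\<^sub>R cis (real_of_int m * \<theta>) \<partial>lborel) = (if m = 0 then of_real (2
    * pi) else 0)"
proof (cases "m = 0")
  case True
  then show ?thesis by (simp add: scaleR_conv_of_real integral_complex_of_real del: of_real_mult)
next
  case False
  define F where "F \<theta> = exp (\<i> * of_int m * complex_of_real \<theta>) / (\<i> * of_int m)" for \<theta>
  have "(\<integral>\<theta>. indicator {0..2*pi} \<theta> *\<^sub>R cis (real_of_int m * \<theta>) \<partial>lborel) = F (2*pi) - F 0"
  proof (rule integral_FTC_atLeastAtMost)
    show "(F has_vector_derivative cis (real_of_int m * x)) (at x within {0..2 * pi})" for x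
    proof -
      have "((\<lambda>z. exp (\<i> * of_int m * z) / (\<i> * of_int m)) has_field_derivative exp (\<i> * of_int m
        * complex_of_real x)) (at (complex_of_real x))"
        using False by (auto intro!: derivative_eq_intros)
      then have "(F has_vector_derivative exp (\<i> * of_int m * complex_of_real x)) (at x within {0..2 * pi})"
        unfolding F_def by (rule has_vector_derivative_real_field)
      then show ?thesis by (simp add: cis_conv_exp mult.assoc)
    qed
    show "continuous_on {0..2 * pi} (\<lambda>x. cis (real_of_int m * x))" by (intro continuous_intros)
  qed auto
  also have "\<dots> = 0"
  proof -
    have "exp (\<i> * of_int m * complex_of_real (2 * pi)) = cis (2 * pi * real_of_int m)"
      by (simp add: cis_conv_exp mult_ac)
    also have "\<dots> = 1" by (rule cis_multiple_2pi) simp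
    finally show ?thesis by (simp add: F_def)
  qed
  finally show ?thesis using False by simp
qed

lemma sq_int_sum:
  "finite A \<Longrightarrow> (\<And>i. i \<in> A \<Longrightarrow> sq_int (g i)) \<Longrightarrow> sq_int (\<lambda>x. \<Sum>i\<in>A. a i * g i x)"
  by (induction A rule: finite_induct) (auto intro!: sq_int_add sq_int_cmult)

lemma inner_L2_sum_right:
  assumes "finite A" "\<And>i. i \<in> A \<Longrightarrow> sq_int (g i)" "sq_int h"
  shows "inner_L2 h (\<lambda>x. \<Sum>i\<in>A. a i * g i x) = (\<Sum>i\<in>A. a i * inner_L2 h (g i))"
  using assms
proof (induction A rule: finite_induct)
  case empty
  then show ?case by (simp add: inner_L2_def)
next
  case (insert i A)
  then have "inner_L2 h (\<lambda>x. a i * g i x + (\<Sum>i\<in>A. a i * g i x)) = inner_L2 h (\<lambda>x. a i * g i x)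
    + inner_L2 h (\<lambda>x. \<Sum>i\<in>A. a i * g i x)"
    by (intro inner_L2_add_right sq_int_cmult sq_int_sum) auto
  then show ?case using insert by (simp add: inner_L2_cmult_right)
qed

lemma inner_L2_sum_left:
  assumes "finite A" "\<And>i. i \<in> A \<Longrightarrow> sq_int (g i)" "sq_int h"
  shows "inner_L2 (\<lambda>x. \<Sum>i\<in>A. a i * g i x) h = (\<Sum>i\<in>A. cnj (a i) * inner_L2 (g i) h)"
proof -
  have "inner_L2 (\<lambda>x. \<Sum>i\<in>A. a i * g i x) h = cnj (\<Sum>i\<in>A. a i * inner_L2 h (g i))"
    using inner_L2_commute[of "\<lambda>x. \<Sum>i\<in>A. a i * g i x" h] by (simp only: inner_L2_sum_right[OF assms])
  then show ?thesis by (simp add: inner_L2_commute[of "g _" h])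
qed

text \<open>The inverse Cayley map carries the unit circle to the real line. At
  \<open>w = 1\<close>, the image of infinity, division by zero makes both sides 0.\<close>

lemma cayley_real:
  assumes w: "cmod w = 1"
  shows "cnj (\<i> * (w + 1) / (w - 1)) = \<i> * (w + 1) / (w - 1)"
proof (cases "w = 1")
  case False
  have "w * cnj w = 1" using w by (simp add: complex_norm_square[symmetric])
  moreover have "cnj w \<noteq> 1" using False by (metis complex_cnj_cnj complex_cnj_one)
  ultimately show ?thesis using False
    by (simp add: divide_simps) (simp add: algebra_simps)
qed simp

section \<open>The Cayley transform and its moments\<close>

context schroedinger
begin

text \<open>\<open>I + 2 \<i> R(\<i>)\<close> is \<open>(H + \<i>) (H - \<i>)^(-1)\<close>, written
  without reference to the domain of \<open>H\<close>. A spectral point \<open>l\<close> corresponds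
  to \<open>w = (l + \<i>) / (l - \<i>)\<close>.\<close>

definition cayley :: "(real \<Rightarrow> complex) \<Rightarrow> real \<Rightarrow> complex" where
  "cayley f = (\<lambda>x. f x + 2 * \<i> * R \<i> f x)"

lemma cayley_sq: "sq_int f \<Longrightarrow> sq_int (cayley f)"
  unfolding cayley_def by (intro sq_int_add sq_int_cmult R_sq) auto

text \<open>The resolvent identity between \<open>\<i>\<close> and \<open>-\<i>\<close>, with
  \<open>R(-\<i>)\<close> adjoint to \<open>R(\<i>)\<close>, gives
  \<open>inner_L2 f v - inner_L2 u g = 2 * \<i> * inner_L2 u v\<close>, which cancels the mixed
  terms exactly.\<close>

lemma cayley_isometry:
  assumes f: "sq_int f" and g: "sq_int g"
  shows "inner_L2 (cayley f) (cayley g) = inner_L2 f g"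
proof -
  define u where "u = R \<i> f"
  define v where "v = R \<i> g"
  have su: "sq_int u" and sv: "sq_int v" using f g by (auto simp: u_def v_def)
  have "(\<lambda>x. R (-\<i>) g x - v x) = (\<lambda>x. (- 2 * \<i>) * R (-\<i>) v x)"
    using R_ident[of "-\<i>" \<i> g] g by (auto simp: v_def)
  then have "inner_L2 f (\<lambda>x. R (-\<i>) g x - v x) = (- 2 * \<i>) * inner_L2 f (R (-\<i>) v)"
    by (simp only: inner_L2_cmult_right)
  moreover have "inner_L2 f (\<lambda>x. R (-\<i>) g x - v x) = inner_L2 f (R (-\<i>) g) - inner_L2 f v"
    by (rule inner_L2_diff_right) (use f g sv in auto)
  moreover have "inner_L2 f (R (-\<i>) h) = inner_L2 u h" if "sq_int h" for h
    using R_adj[of "-\<i>" f h] f that by (simp add: u_def)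
  ultimately have k: "inner_L2 f v - inner_L2 u g = 2 * \<i> * inner_L2 u v"
    using g sv by (simp add: algebra_simps)
  have Ug: "inner_L2 h (cayley g) = inner_L2 h g + 2 * \<i> * inner_L2 h v" if "sq_int h" for h
    using inner_L2_add_right[OF that g sq_int_cmult[OF sv, of "2 * \<i>"]]
    unfolding cayley_def v_def[symmetric] by (simp add: inner_L2_cmult_right)
  have "inner_L2 (cayley f) (cayley g) = inner_L2 f (cayley g) + inner_L2 (\<lambda>x. (2 * \<i>) * u x) (cayley g)"
    unfolding cayley_def[of f] u_def[symmetric]
    by (rule inner_L2_add_left) (use f g su cayley_sq in \<open>auto intro: sq_int_cmult\<close>)
  also have "\<dots> = inner_L2 f (cayley g) - 2 * \<i> * inner_L2 u (cayley g)"
    by (simp add: inner_L2_cmult_left)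
  finally have "inner_L2 (cayley f) (cayley g) = inner_L2 f g + 2 * \<i> * (inner_L2 f v - inner_L2 u g - 2 * \<i>
    * inner_L2 u v)"
    unfolding Ug[OF f] Ug[OF su] by (simp add: algebra_simps)
  then show ?thesis using k by simp
qed

definition cayley_pow :: "nat \<Rightarrow> (real \<Rightarrow> complex) \<Rightarrow> real \<Rightarrow> complex" where
  "cayley_pow n = cayley ^^ n"

lemma cayley_pow_sq: "sq_int f \<Longrightarrow> sq_int (cayley_pow n f)"
  unfolding cayley_pow_def by (induction n) (auto intro: cayley_sq)

text \<open>Isometry makes the Gram matrix of the powers a Toeplitz matrix; this is what turns it
  into a sequence of Fourier coefficients.\<close>

lemma cayley_pow_inner:
  assumes "sq_int f" shows "inner_L2 (cayley_pow m f) (cayley_pow (m + k) f) = inner_L2 f (cayley_pow k f)"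
proof (induction m)
  case (Suc m)
  then show ?case using cayley_isometry[OF cayley_pow_sq[OF assms] cayley_pow_sq[OF assms], of m "m + k"]
    by (simp add: cayley_pow_def)
qed (simp add: cayley_pow_def)

lemma cayley_pow_nrm: "sq_int f \<Longrightarrow> nrm (cayley_pow m f) = nrm f"
  using cayley_pow_inner[of f m 0] by (simp add: inner_L2_self nrm_def cayley_pow_def)

text \<open>The densities \<open>\<parallel>\<Sum>n\<le>N. exp (- i n \<theta>) U\<^sup>n f\<parallel>\<^sup>2\<close>, with \<open>U\<close> the Cayley transform, are positive
  and have Fejer-weighted Fourier coefficients \<open>\<langle>f, U\<^sup>k f\<rangle>\<close>.\<close>

lemma trig_measure_exists:
  assumes f: "sq_int f" and c0: "nrm2 f \<noteq> 0"
  obtains M where "real_distribution M" "\<And>k. nrm2 f * (\<integral>\<theta>. cis (real k * \<theta>) \<partial>M)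
    = inner_L2 f (cayley_pow k f)"
proof -
  define C where "C = nrm2 f"
  have C: "0 < C" using c0 nrm2_nonneg[of f] unfolding C_def by linarith
  define S where "S N \<theta> = (\<lambda>x. \<Sum>n<Suc N. cis (- real n * \<theta>) * cayley_pow n f x)" for N \<theta>
  \<comment> \<open>Normalizes the total mass to 1: the diagonal of the double sum contributes
    \<open>2 * pi * C\<close> for each of its \<open>Suc N\<close> entries, and the off-diagonal
    terms integrate to 0.\<close>
  define K where "K N = 1 / (2 * pi * real (Suc N) * C)" for N
  have K0: "0 \<le> K N" for N using C by (simp add: K_def)
  define s where "s N \<theta> = K N * nrm2 (S N \<theta>)" for N \<theta>
  have S_sq: "sq_int (S N \<theta>)" for N \<theta>
    unfolding S_def by (intro sq_int_sum cayley_pow_sq f) auto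
  have s_eq: "complex_of_real (s N \<theta>) = of_real (K N) * (\<Sum>m<Suc N. \<Sum>n<Suc N. cis ((real m - real n) * \<theta>)
    * inner_L2 (cayley_pow m f) (cayley_pow n f))" for N \<theta>
  proof -
    have "complex_of_real (nrm2 (S N \<theta>)) = inner_L2 (S N \<theta>) (S N \<theta>)" by (simp add: inner_L2_self)
    also have "\<dots> = (\<Sum>m<Suc N. cnj (cis (- real m * \<theta>)) * inner_L2 (cayley_pow m f) (S N \<theta>))"
      by (subst (1) S_def, rule inner_L2_sum_left) (auto intro: cayley_pow_sq f S_sq)
    also have "\<dots> = (\<Sum>m<Suc N. cnj (cis (- real m * \<theta>)) * (\<Sum>n<Suc N. cis (- real n * \<theta>)
      * inner_L2 (cayley_pow m f) (cayley_pow n f)))"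
      unfolding S_def by (subst inner_L2_sum_right) (auto intro: cayley_pow_sq f)
    also have "\<dots> = (\<Sum>m<Suc N. \<Sum>n<Suc N. cis ((real m - real n) * \<theta>) * inner_L2 (cayley_pow m f) (cayley_pow
      n f))"
    proof -
      have "cnj (cis (- real m * \<theta>)) * (cis (- real n * \<theta>) * a) = cis ((real m - real n) * \<theta>) * a" for m n a
      proof -
        have "cnj (cis (- real m * \<theta>)) * cis (- real n * \<theta>) = cis ((real m - real n) * \<theta>)"
          by (simp add: cis_cnj cis_mult algebra_simps)
        then show ?thesis by (simp add: mult.assoc[symmetric])
      qed
      then show ?thesis by (simp only: sum_distrib_left)
    qed
    finally show ?thesis by (simp add: s_def)
  qed
  have cont: "continuous_on UNIV (s N)" for N
  proof -
    have "s N = (\<lambda>\<theta>. Re (of_real (K N) * (\<Sum>m<Suc N. \<Sum>n<Suc N. cis ((real m - real n) * \<theta>)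
      * inner_L2 (cayley_pow m f) (cayley_pow n f))))"
      unfolding s_eq[symmetric] by simp
    then show ?thesis by (simp only:) (intro continuous_intros)
  qed
  \<comment> \<open>The Fejer weight counts the pairs \<open>(m, m + k)\<close> with both indices
    below \<open>Suc N\<close>; truncated subtraction makes it 0 when \<open>k > N\<close>.\<close>
  have coeff: "(\<integral>\<theta>. (indicator {0..2*pi} \<theta> * s N \<theta>) *\<^sub>R cis (real k * \<theta>) \<partial>lborel) = of_nat (Suc N
    - k) / of_nat (Suc N) * (inner_L2 f (cayley_pow k f) / C)" for N k
  proof -
    have i: "integrable lborel (\<lambda>\<theta>. indicator {0..2*pi} \<theta> *\<^sub>R cis (real_of_int j * \<theta>))" for j
      by (rule borel_integrable_compact[of "{0..2*pi}" "\<lambda>\<theta>. cis (real_of_int j * \<theta>)"])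
        (auto intro!: continuous_intros)
    let ?a = "\<lambda>m n. of_real (K N) * inner_L2 (cayley_pow m f) (cayley_pow n f)"
    have "(\<integral>\<theta>. (indicator {0..2*pi} \<theta> * s N \<theta>) *\<^sub>R cis (real k * \<theta>) \<partial>lborel)
       = (\<integral>\<theta>. (\<Sum>m<Suc N. \<Sum>n<Suc N. ?a m n * (indicator {0..2*pi} \<theta> *\<^sub>R cis (real_of_int (int k + int m
         - int n) * \<theta>))) \<partial>lborel)"
    proof (rule Bochner_Integration.integral_cong[OF refl])
      fix \<theta> :: real
      have c: "cis ((real m - real n) * \<theta>) * a * cis (real k * \<theta>) = a * cis (real_of_int (int k + int m
        - int n) * \<theta>)" for m n a
      proof -
        have "cis ((real m - real n) * \<theta>) * cis (real k * \<theta>) = cis (real_of_int (int k + int m - int n)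
          * \<theta>)"
          by (simp add: cis_mult algebra_simps)
        then show ?thesis by (metis mult.assoc mult.commute)
      qed
      have "(indicator {0..2*pi} \<theta> * s N \<theta>) *\<^sub>R cis (real k * \<theta>) = indicator {0..2*pi} \<theta> *\<^sub>R (complex_of_real
        (s N \<theta>) * cis (real k * \<theta>))"
        by (simp add: scaleR_conv_of_real)
      also have "\<dots> = indicator {0..2*pi} \<theta> *\<^sub>R (of_real (K N) * (\<Sum>m<Suc N. \<Sum>n<Suc N. cis ((real m - real n)
        * \<theta>) * inner_L2 (cayley_pow m f) (cayley_pow n f) * cis (real k * \<theta>)))"
        unfolding s_eq by (simp only: sum_distrib_right mult.assoc)
      also have "\<dots> = (\<Sum>m<Suc N. \<Sum>n<Suc N. ?a m n * (indicator {0..2*pi} \<theta> *\<^sub>R cis (real_of_int (int k + int m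
        - int n) * \<theta>)))"
        unfolding c by (simp only: sum_distrib_left scaleR_sum_right mult_scaleR_right mult.assoc)
      finally show "(indicator {0..2*pi} \<theta> * s N \<theta>) *\<^sub>R cis (real k * \<theta>) = (\<Sum>m<Suc N. \<Sum>n<Suc N. ?a m n
        * (indicator {0..2*pi} \<theta> *\<^sub>R cis (real_of_int (int k + int m - int n) * \<theta>)))" .
    qed
    also have "\<dots> = (\<Sum>m<Suc N. \<Sum>n<Suc N. ?a m n * (if int k + int m - int n = 0 then of_real (2
      * pi) else 0))"
    proof -
      have ii: "integrable lborel (\<lambda>\<theta>. a * (indicator {0..2*pi} \<theta> *\<^sub>R cis (real_of_int j * \<theta>)))" for a j
        by (rule integrable_mult_right[OF i])
      show ?thesis
        by (subst Bochner_Integration.integral_sum, intro Bochner_Integration.integrable_sum ii, rule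
          sum.cong[OF refl],
            subst Bochner_Integration.integral_sum, rule ii, rule sum.cong[OF refl], subst
              integral_mult_right_zero, subst integral_cis, rule refl)
    qed
    also have "\<dots> = (\<Sum>m<Suc N. if m < Suc N - k then of_real (2 * pi * K N)
      * inner_L2 f (cayley_pow k f) else 0)"
    proof (rule sum.cong[OF refl])
      fix m assume m: "m \<in> {..<Suc N}"
      have "(\<Sum>n<Suc N. ?a m n * (if int k + int m - int n = 0 then of_real (2 * pi) else 0))
        = (\<Sum>n<Suc N. if n = m + k then ?a m n * of_real (2 * pi) else 0)"
        by (rule sum.cong) auto
      also have "\<dots> = (if m + k < Suc N then ?a m (m + k) * of_real (2 * pi) else 0)"
        by (subst sum.delta) auto
      also have "\<dots> = (if m < Suc N - k then of_real (2 * pi * K N) * inner_L2 f (cayley_pow k f) else 0)"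
        unfolding cayley_pow_inner[OF f] by (auto simp: mult_ac)
      finally show "(\<Sum>n<Suc N. ?a m n * (if int k + int m - int n = 0 then of_real (2 * pi) else 0)) = (if m
        < Suc N - k then of_real (2 * pi * K N) * inner_L2 f (cayley_pow k f) else 0)" .
    qed
    also have "\<dots> = of_nat (Suc N - k) * (of_real (2 * pi * K N) * inner_L2 f (cayley_pow k f))"
    proof -
      have "{..<Suc N} \<inter> {m. m < Suc N - k} = {..<Suc N - k}" by auto
      then show ?thesis by (simp add: sum.If_cases del: sum.lessThan_Suc)
    qed
    also have "of_real (2 * pi * K N) = 1 / (complex_of_nat (Suc N) * of_real C)"
      using C by (simp add: K_def field_simps del: of_nat_Suc)
    finally show ?thesis using C by (simp add: field_simps del: of_nat_Suc)
  qed
  have mass: "(\<integral>\<theta>. indicator {0..2*pi} \<theta> * s N \<theta> \<partial>lborel) = 1" for N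
  proof -
    have "inner_L2 f (cayley_pow 0 f) = of_real C" by (simp add: cayley_pow_def inner_L2_self C_def)
    then have "complex_of_real (\<integral>\<theta>. indicator {0..2*pi} \<theta> * s N \<theta> \<partial>lborel) = 1"
      using coeff[of N 0] C by (simp add: scaleR_conv_of_real integral_complex_of_real[symmetric] del:
        of_nat_Suc)
    then show ?thesis by (metis of_real_eq_1_iff)
  qed
  have lim: "(\<lambda>N. \<integral>\<theta>. (indicator {0..2*pi} \<theta> * s N \<theta>) *\<^sub>R cis (real k * \<theta>) \<partial>lborel)
    \<longlonglongrightarrow> inner_L2 f (cayley_pow k f) / C" for k
  proof -
    have "(\<lambda>N. 1 - of_nat k / complex_of_nat (Suc N)) \<longlonglongrightarrow> 1 - 0"
      by (intro tendsto_intros LIMSEQ_Suc[OF lim_const_over_n])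
    moreover have "\<forall>\<^sub>F N in sequentially. 1 - of_nat k / complex_of_nat (Suc N) = of_nat (Suc N
      - k) / complex_of_nat (Suc N)"
      using eventually_ge_at_top[of k]
      by eventually_elim (simp add: of_nat_diff diff_divide_distrib del: of_nat_Suc)
    ultimately have "(\<lambda>N. of_nat (Suc N - k) / complex_of_nat (Suc N)) \<longlonglongrightarrow> 1"
      using Lim_transform_eventually by fastforce
    from tendsto_mult[OF this tendsto_const, of "inner_L2 f (cayley_pow k f) / C"] show ?thesis
      unfolding coeff by simp
  qed
  obtain M where M: "real_distribution M" "\<And>k. (\<integral>\<theta>. cis (real k * \<theta>) \<partial>M) = inner_L2 f (cayley_pow k f) / C"
    using circle_limit[of s "\<lambda>k. inner_L2 f (cayley_pow k f) / C"] cont mass lim K0 by (auto simp: s_def)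
  show ?thesis by (rule that[OF M(1)]) (use M(2) C in \<open>simp add: C_def\<close>)
qed

text \<open>Insert the definition of \<open>cayley\<close> into the resolvent identity for
  \<open>z\<close> and \<open>\<i>\<close>. The ratio \<open>(z - \<i>) / (z + \<i>)\<close> has
  modulus below 1 in the upper half-plane, so iterating expands \<open>R z\<close> in powers of the
  Cayley transform.\<close>

lemma R_cayley_step:
  assumes z: "Im z > 0" and g: "sq_int g"
  shows "R z g x = (cayley g x - g x) / (\<i> + z) + (z - \<i>) / (z + \<i>) * R z (cayley g) x"
proof -
  have z0: "Im z \<noteq> 0" and zi: "z + \<i> \<noteq> 0" using z by (auto simp: complex_eq_iff)
  have 1: "R z (cayley g) x = R z g x + 2 * \<i> * R z (R \<i> g) x"
  proof -
    have "R z (\<lambda>x. 1 * g x + (2 * \<i>) * R \<i> g x) = (\<lambda>x. 1 * R z g x + (2 * \<i>) * R z (R \<i> g) x)"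
      by (rule R_lin[OF z0 g R_sq]) (use g in auto)
    then show ?thesis unfolding cayley_def by (simp add: fun_eq_iff)
  qed
  have 2: "R z g x - R \<i> g x = (z - \<i>) * R z (R \<i> g) x" by (rule R_ident[OF z0 _ g]) simp
  have "(z - \<i>) * R z (cayley g) x = (z - \<i>) * R z g x + 2 * \<i> * (R z g x - R \<i> g x)"
    unfolding 1 2 by (simp add: algebra_simps)
  moreover have "cayley g x - g x = 2 * \<i> * R \<i> g x" by (simp add: cayley_def)
  ultimately have "(cayley g x - g x) + (z - \<i>) * R z (cayley g) x = (z + \<i>) * R z g x"
    by (simp add: algebra_simps)
  then show ?thesis using zi by (simp add: add_divide_distrib[symmetric] eq_divide_eq add.commute
    mult.commute)
qed

lemma R_cayley_series:
  assumes z: "Im z > 0" and f: "sq_int f"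
  shows "inner_L2 f (R z f) = (\<Sum>k<n. ((z - \<i>) / (z + \<i>)) ^ k * (inner_L2 f (cayley_pow (Suc k) f)
    - inner_L2 f (cayley_pow k f)) / (\<i> + z))
     + ((z - \<i>) / (z + \<i>)) ^ n * inner_L2 f (R z (cayley_pow n f))"
proof (induction n)
  case 0
  then show ?case by (simp add: cayley_pow_def)
next
  case (Suc n)
  define q where "q = (z - \<i>) / (z + \<i>)"
  define g where "g = cayley_pow n f"
  have sg: "sq_int g" and sU: "sq_int (cayley g)" using f by (auto simp: g_def cayley_pow_sq cayley_sq)
  have z0: "Im z \<noteq> 0" using z by simp
  have "R z g = (\<lambda>x. (1 / (\<i> + z)) * (cayley g x - g x) + q * R z (cayley g) x)"
    using R_cayley_step[OF z sg] by (simp add: q_def fun_eq_iff)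
  then have "inner_L2 f (R z g) = (1 / (\<i> + z)) * (inner_L2 f (cayley g) - inner_L2 f g) + q
    * inner_L2 f (R z (cayley g))"
    using inner_L2_add_right[OF f sq_int_cmult[OF sq_int_diff[OF sU sg], of "1 / (\<i> + z)"] sq_int_cmult[OF
      R_sq[OF z0 sU], of q]]
      inner_L2_diff_right[OF f sU sg] by (simp only: inner_L2_cmult_right)
  moreover have "cayley g = cayley_pow (Suc n) f" by (simp add: g_def cayley_pow_def)
  ultimately have "q ^ n * inner_L2 f (R z (cayley_pow n f)) = q ^ n * (inner_L2 f (cayley_pow (Suc n) f)
    - inner_L2 f (cayley_pow n f)) / (\<i> + z) + q ^ Suc n * inner_L2 f (R z (cayley_pow (Suc n) f))"
    by (simp add: g_def distrib_left)
  then show ?case using Suc unfolding q_def[symmetric] by simp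
qed

text \<open>The matrix element and the circle integral satisfy the same recursion in
  \<open>n\<close>, with equal moments. Their difference is therefore \<open>q ^ n\<close> times an
  error bounded in \<open>n\<close>, and \<open>cmod q < 1\<close>.\<close>

lemma spec_meas_upper:
  assumes f: "sq_int f" and M: "real_distribution M" "\<And>k. nrm2 f * (\<integral>\<theta>. cis (real k * \<theta>) \<partial>M)
    = inner_L2 f (cayley_pow k f)"
    and z: "Im z > 0"
  shows "inner_L2 f (R z f) = nrm2 f * (\<integral>\<theta>. (cis \<theta> - 1) / (\<i> * (cis \<theta> + 1) - z * (cis \<theta> - 1)) \<partial>M)"
proof -
  interpret M: real_distribution M by (rule M(1))
  define q where "q = (z - \<i>) / (z + \<i>)"
  have zi: "z + \<i> \<noteq> 0" using z by (auto simp: complex_eq_iff)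
  have q1: "cmod q < 1"
  proof -
    have "(cmod (z - \<i>))\<^sup>2 < (cmod (z + \<i>))\<^sup>2"
    proof -
      have "(cmod (z - \<i>))\<^sup>2 = (Re z)\<^sup>2 + (Im z - 1)\<^sup>2" "(cmod (z + \<i>))\<^sup>2 = (Re z)\<^sup>2 + (Im z + 1)\<^sup>2"
        by (simp_all add: cmod_power2)
      then show ?thesis using z by (simp only:) (simp add: power2_eq_square algebra_simps)
    qed
    then have "cmod (z - \<i>) < cmod (z + \<i>)" by (rule power2_less_imp_less) simp
    then show ?thesis using zi by (simp add: q_def norm_divide)
  qed
  \<comment> \<open>This is \<open>1 / (l - z)\<close> with
    \<open>l = \<i> (w + 1) / (w - 1)\<close>, \<open>w = cis \<theta>\<close>, after clearing the
    denominator; in this form it is continuous and vanishes at \<open>w = 1\<close>.\<close>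
  define h where "h \<theta> = (cis \<theta> - 1) / (\<i> * (cis \<theta> + 1) - z * (cis \<theta> - 1))" for \<theta>
  have den: "\<i> * (cis \<theta> + 1) - z * (cis \<theta> - 1) = (\<i> + z) * (1 - q * cis \<theta>)" for \<theta>
  proof -
    have "(\<i> + z) * (q * cis \<theta>) = (z - \<i>) * cis \<theta>" using zi by (simp add: q_def add.commute)
    then show ?thesis by (simp add: algebra_simps)
  qed
  have ql: "1 - cmod q \<le> cmod (1 - q * cis \<theta>)" for \<theta>
    using norm_triangle_ineq2[of 1 "q * cis \<theta>"] by (simp add: norm_mult)
  have den0: "1 - q * cis \<theta> \<noteq> 0" for \<theta> using ql[of \<theta>] q1 by auto
  have hc: "continuous_on UNIV h"
    unfolding h_def den by (intro continuous_intros) (use den0 zi in \<open>auto simp: add.commute\<close>)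
  have hm[measurable]: "h \<in> borel_measurable borel" by (rule borel_measurable_continuous_onI[OF hc])
  define B where "B = 2 / (cmod (\<i> + z) * (1 - cmod q))"
  have hB: "cmod (h \<theta>) \<le> B" for \<theta>
  proof -
    have "cmod (cis \<theta> - 1) \<le> 2" using norm_triangle_ineq4[of "cis \<theta>" 1] by simp
    then show ?thesis unfolding h_def den B_def norm_divide norm_mult
      using ql[of \<theta>] q1 zi by (intro frac_le mult_left_mono mult_pos_pos) (auto simp: add.commute)
  qed
 have cism[measurable]: "(\<lambda>\<theta>. cis (real k * \<theta>)) \<in> borel_measurable borel" for k
    by (intro borel_measurable_continuous_onI continuous_intros)
  have hi: "integrable M h" by (rule M.integrable_const_bound[of _ B]) (use hB in auto)
  have ci: "integrable M (\<lambda>\<theta>. cis (real k * \<theta>))" for k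
    by (rule M.integrable_const_bound[of _ 1]) auto
  have chi: "integrable M (\<lambda>\<theta>. cis (real k * \<theta>) * h \<theta>)" for k
    by (rule M.integrable_const_bound[of _ B]) (use hB in \<open>auto simp: norm_mult\<close>)
  have step: "(\<integral>\<theta>. h \<theta> \<partial>M) = (\<Sum>k<n. q ^ k * ((\<integral>\<theta>. cis (real (Suc k) * \<theta>) \<partial>M) - (\<integral>\<theta>. cis (real k
    * \<theta>) \<partial>M)) / (\<i> + z))
     + q ^ n * (\<integral>\<theta>. cis (real n * \<theta>) * h \<theta> \<partial>M)" for n
  proof (induction n)
    case (Suc n)
    have "cis (real n * \<theta>) * h \<theta> = (1 / (\<i> + z)) * (cis (real (Suc n) * \<theta>) - cis (real n * \<theta>)) + q
      * (cis (real (Suc n) * \<theta>) * h \<theta>)" for \<theta>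
    proof -
      have "h \<theta> = (1 / (\<i> + z)) * (cis \<theta> - 1) + q * (cis \<theta> * h \<theta>)"
        unfolding h_def den using zi den0[of \<theta>]
        by (simp add: divide_simps add.commute) (simp add: algebra_simps)
      then have "cis (real n * \<theta>) * h \<theta> = cis (real n * \<theta>) * ((1 / (\<i> + z)) * (cis \<theta> - 1) + q * (cis \<theta>
        * h \<theta>))" by simp
      moreover have "cis (real (Suc n) * \<theta>) = cis (real n * \<theta>) * cis \<theta>"
        by (simp add: cis_mult algebra_simps)
      ultimately show ?thesis by (simp only:) (simp add: algebra_simps diff_divide_distrib)
    qed
    then have "(\<integral>\<theta>. cis (real n * \<theta>) * h \<theta> \<partial>M) = (\<integral>\<theta>. (1 / (\<i> + z)) * (cis (real (Suc n) * \<theta>) - cis (real n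
      * \<theta>)) + q * (cis (real (Suc n) * \<theta>) * h \<theta>) \<partial>M)"
      by simp
    also have "\<dots> = (1 / (\<i> + z)) * ((\<integral>\<theta>. cis (real (Suc n) * \<theta>) \<partial>M) - (\<integral>\<theta>. cis (real n * \<theta>) \<partial>M)) + q
      * (\<integral>\<theta>. cis (real (Suc n) * \<theta>) * h \<theta> \<partial>M)"
      by (subst Bochner_Integration.integral_add)
         (auto intro!: ci chi integrable_mult_right Bochner_Integration.integrable_diff simp:
           Bochner_Integration.integral_diff[OF ci ci] simp del: of_nat_Suc)
    finally have X: "(\<integral>\<theta>. cis (real n * \<theta>) * h \<theta> \<partial>M) = (1 / (\<i> + z)) * ((\<integral>\<theta>. cis (real (Suc n) * \<theta>) \<partial>M)
      - (\<integral>\<theta>. cis (real n * \<theta>) \<partial>M)) + q * (\<integral>\<theta>. cis (real (Suc n) * \<theta>) * h \<theta> \<partial>M)" .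
    have "q ^ n * (\<integral>\<theta>. cis (real n * \<theta>) * h \<theta> \<partial>M) = q ^ n * ((\<integral>\<theta>. cis (real (Suc n) * \<theta>) \<partial>M)
      - (\<integral>\<theta>. cis (real n * \<theta>) \<partial>M)) / (\<i> + z) + q ^ Suc n * (\<integral>\<theta>. cis (real (Suc n) * \<theta>) * h \<theta> \<partial>M)"
      unfolding X by (simp add: distrib_left del: of_nat_Suc)
    then show ?case using Suc by (simp del: of_nat_Suc)
  qed simp
  define E where "E n = inner_L2 f (R z (cayley_pow n f)) - nrm2 f * (\<integral>\<theta>. cis (real n * \<theta>) * h \<theta> \<partial>M)" for n
  have e: "inner_L2 f (R z f) - nrm2 f * (\<integral>\<theta>. h \<theta> \<partial>M) = q ^ n * E n" for n
  proof -
    have "nrm2 f * (\<integral>\<theta>. h \<theta> \<partial>M) = (\<Sum>k<n. q ^ k * (inner_L2 f (cayley_pow (Suc k) f)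
      - inner_L2 f (cayley_pow k f)) / (\<i> + z)) + q ^ n * (nrm2 f * (\<integral>\<theta>. cis (real n * \<theta>) * h \<theta> \<partial>M))"
      unfolding step[of n] M(2)[symmetric] by (simp add: sum_distrib_left algebra_simps diff_divide_distrib
        del: of_nat_Suc)
    then show ?thesis using R_cayley_series[OF z f, of n] unfolding q_def[symmetric] E_def
      by (simp add: algebra_simps)
  qed
  have EB: "cmod (E n) \<le> nrm f * (nrm f / Im z) + nrm2 f * B" for n
  proof -
    have z0: "Im z \<noteq> 0" using z by simp
    have "cmod (inner_L2 f (R z (cayley_pow n f))) \<le> nrm f * nrm (R z (cayley_pow n f))"
      by (rule cauchy_schwarz) (use f z0 cayley_pow_sq in auto)
    also have "\<dots> \<le> nrm f * (nrm f / Im z)"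
      using R_norm'[OF z0 cayley_pow_sq[OF f], of n] z
        by (intro mult_left_mono) (auto simp: cayley_pow_nrm[OF f])
    finally have 1: "cmod (inner_L2 f (R z (cayley_pow n f))) \<le> nrm f * (nrm f / Im z)" .
    have "cmod (\<integral>\<theta>. cis (real n * \<theta>) * h \<theta> \<partial>M) \<le> (\<integral>\<theta>. cmod (cis (real n * \<theta>) * h \<theta>) \<partial>M)"
      by (rule integral_norm_bound)
    also have "\<dots> \<le> B"
      by (rule M.integral_le_const[OF integrable_norm[OF chi]]) (use hB in \<open>auto simp: norm_mult\<close>)
    finally have "cmod (\<integral>\<theta>. cis (real n * \<theta>) * h \<theta> \<partial>M) \<le> B" .
    then have "cmod (nrm2 f * (\<integral>\<theta>. cis (real n * \<theta>) * h \<theta> \<partial>M)) \<le> nrm2 f * B"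
      by (simp add: norm_mult mult_left_mono)
    then show ?thesis unfolding E_def
      using 1 norm_triangle_ineq4[of "inner_L2 f (R z (cayley_pow n f))" "nrm2 f * (\<integral>\<theta>. cis (real n * \<theta>)
        * h \<theta> \<partial>M)"] by linarith
  qed
  have "(\<lambda>n. q ^ n * E n) \<longlonglongrightarrow> 0"
  proof (rule Lim_null_comparison)
    show "\<forall>\<^sub>F n in sequentially. cmod (q ^ n * E n) \<le> cmod q ^ n * (nrm f * (nrm f / Im z) + nrm2 f * B)"
      unfolding norm_mult norm_power by (intro always_eventually allI mult_left_mono EB) simp
    show "(\<lambda>n. cmod q ^ n * (nrm f * (nrm f / Im z) + nrm2 f * B)) \<longlonglongrightarrow> 0"
      by (rule tendsto_mult_left_zero, rule LIMSEQ_realpow_zero) (use q1 in auto)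
  qed
  then have "(\<lambda>n::nat. inner_L2 f (R z f) - nrm2 f * (\<integral>\<theta>. h \<theta> \<partial>M)) \<longlonglongrightarrow> 0"
    by (simp only: e[symmetric])
  then have "inner_L2 f (R z f) - nrm2 f * (\<integral>\<theta>. h \<theta> \<partial>M) = 0"
    by (simp only: LIMSEQ_const_iff)
  then show ?thesis by (simp add: h_def)
qed

text \<open>Existence and uniqueness of the resolvent collapse the quantifier over weak solutions to
  the single function \<open>R z f\<close>.\<close>

lemma spec_meas_iff:
  assumes f: "sq_int f"
  shows "spec_meas V f \<mu> \<longleftrightarrow> sets \<mu> = sets borel \<and> finite_measure \<mu> \<and>
     (\<forall>z. Im z \<noteq> 0 \<longrightarrow> (\<integral>l. 1 / (complex_of_real l - z) \<partial>\<mu>) = inner_L2 f (R z f))"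
  unfolding spec_meas_def using R_sol[OF _ f] R_eq[OF _ _ f] by metis

lemma cnj_cauchy_transform: "(\<integral>l. 1 / (complex_of_real l - cnj z) \<partial>\<mu>) = cnj (\<integral>l. 1 / (complex_of_real l
  - z) \<partial>\<mu>)"
  by (subst Bochner_Integration.integral_cnj[symmetric]) simp

text \<open>The measure on the circle is transported to the line by the inverse Cayley map. The
  upper half-plane identity is then reflected to the lower one by conjugation. Null vectors get the
  zero measure, as the normalization divides by \<open>nrm2 f\<close>.\<close>

theorem spec_meas_exists:
  assumes f: "sq_int f"
  shows "\<exists>\<mu>. spec_meas V f \<mu>"
proof (cases "nrm2 f = 0")
  case True
  then have "nrm f = 0" by (simp add: nrm_def)
  have "inner_L2 f (R z f) = 0" if "Im z \<noteq> 0" for z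
    using cauchy_schwarz[OF f R_sq[OF that f]] \<open>nrm f = 0\<close> by simp
  moreover have "finite_measure (null_measure borel)" by (rule finite_measureI) simp
  ultimately have "spec_meas V f (null_measure borel)"
    unfolding spec_meas_iff[OF f] by simp
  then show ?thesis by blast
next
  case False
  then obtain M where M: "real_distribution M" "\<And>k. nrm2 f * (\<integral>\<theta>. cis (real k * \<theta>) \<partial>M)
    = inner_L2 f (cayley_pow k f)"
    using trig_measure_exists[OF f] by blast
  interpret M: real_distribution M by (rule M(1))
  define C where "C = nrm2 f"
  have C: "0 \<le> C" by (simp add: C_def)
  \<comment> \<open>The weight removes the point \<open>w = 1\<close>, which corresponds to infinity
    on the line; the kernel is 0 there, so the transform does not change.\<close>
  define g where "g \<theta> = C * (if cis \<theta> = 1 then 0 else 1)" for \<theta>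
  define L where "L \<theta> = Re (\<i> * (cis \<theta> + 1) / (cis \<theta> - 1))" for \<theta>
  have cm[measurable]: "cis \<in> borel_measurable borel"
    by (intro borel_measurable_continuous_onI continuous_intros)
  have gm[measurable]: "g \<in> borel_measurable borel" unfolding g_def by measurable
  have Lm[measurable]: "L \<in> borel_measurable borel" unfolding L_def by measurable
  have g0: "0 \<le> g \<theta>" "g \<theta> \<le> C" for \<theta> using C by (auto simp: g_def)
  define D where "D = density M (\<lambda>\<theta>. ennreal (g \<theta>))"
  define \<mu> where "\<mu> = distr D borel L"
  have "finite_measure D"
  proof (rule finite_measureI)
    have "emeasure D (space D) = (\<integral>\<^sup>+\<theta>. ennreal (g \<theta>) \<partial>M)"
      unfolding D_def by (subst emeasure_density) (auto intro!: nn_integral_cong)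
    also have "\<dots> \<le> (\<integral>\<^sup>+\<theta>. ennreal C \<partial>M)" by (intro nn_integral_mono ennreal_leI g0)
    also have "\<dots> = ennreal C" using M.emeasure_space_1 by simp
    finally show "emeasure D (space D) \<noteq> \<infinity>" using ennreal_less_top[of C]
      by (metis infinity_ennreal_def linorder_not_less top.not_eq_extremum)
  qed
  then have fin: "finite_measure \<mu>"
    unfolding \<mu>_def by (rule finite_measure.finite_measure_distr) (simp add: D_def)
  have up: "(\<integral>l. 1 / (complex_of_real l - z) \<partial>\<mu>) = inner_L2 f (R z f)" if z: "Im z > 0" for z
  proof -
    have "(\<integral>l. 1 / (complex_of_real l - z) \<partial>\<mu>) = (\<integral>\<theta>. 1 / (complex_of_real (L \<theta>) - z) \<partial>D)"
      unfolding \<mu>_def by (rule integral_distr) (auto simp: D_def)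
    also have "\<dots> = (\<integral>\<theta>. g \<theta> *\<^sub>R (1 / (complex_of_real (L \<theta>) - z)) \<partial>M)"
      unfolding D_def by (rule integral_density) (auto simp: g0)
    also have "\<dots> = (\<integral>\<theta>. C * ((cis \<theta> - 1) / (\<i> * (cis \<theta> + 1) - z * (cis \<theta> - 1))) \<partial>M)"
    proof (rule Bochner_Integration.integral_cong[OF refl])
      fix \<theta>
      show "g \<theta> *\<^sub>R (1 / (complex_of_real (L \<theta>) - z)) = C * ((cis \<theta> - 1) / (\<i> * (cis \<theta> + 1) - z * (cis \<theta>
        - 1)))"
      proof (cases "cis \<theta> = 1")
        case False
        have "complex_of_real (L \<theta>) = \<i> * (cis \<theta> + 1) / (cis \<theta> - 1)"
        proof -
          have "cnj (\<i> * (cis \<theta> + 1) / (cis \<theta> - 1)) = \<i> * (cis \<theta> + 1) / (cis \<theta> - 1)"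
            by (rule cayley_real) simp
          then show ?thesis unfolding L_def by (metis Reals_cnj_iff of_real_Re)
        qed
        then have "complex_of_real (L \<theta>) - z = (\<i> * (cis \<theta> + 1) - z * (cis \<theta> - 1)) / (cis \<theta> - 1)"
          using False by (simp add: field_simps)
        then show ?thesis using False by (simp add: g_def scaleR_conv_of_real)
      qed (simp add: g_def)
    qed
    also have "\<dots> = C * (\<integral>\<theta>. (cis \<theta> - 1) / (\<i> * (cis \<theta> + 1) - z * (cis \<theta> - 1)) \<partial>M)"
      by (rule integral_mult_right_zero)
    also have "\<dots> = inner_L2 f (R z f)"
      using spec_meas_upper[OF f M z] by (simp add: C_def)
    finally show ?thesis .
  qed
  have "(\<integral>l. 1 / (complex_of_real l - z) \<partial>\<mu>) = inner_L2 f (R z f)" if z: "Im z \<noteq> 0" for z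
  proof (cases "Im z > 0")
    case False
    then have z': "Im (cnj z) > 0" "Im (cnj z) \<noteq> 0" using z by auto
    have "(\<integral>l. 1 / (complex_of_real l - z) \<partial>\<mu>) = cnj (\<integral>l. 1 / (complex_of_real l - cnj z) \<partial>\<mu>)"
      using cnj_cauchy_transform[where z = "cnj z"] by simp
    also have "\<dots> = inner_L2 f (R z f)"
      unfolding up[OF z'(1)] using R_cnj_inner[OF z'(2) f] by simp
    finally show ?thesis .
  qed (rule up)
  then have "spec_meas V f \<mu>" unfolding spec_meas_iff[OF f] using fin by (simp add: \<mu>_def)
  then show ?thesis by blast
qed

end

section \<open>The resolvent commutes with the sum of shifts\<close>

definition T :: "real \<Rightarrow> (real \<Rightarrow> complex) \<Rightarrow> real \<Rightarrow> complex" where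
  "T L f x = f (x - L) + f (x + L)"

lemma T_shift: "(\<lambda>x. shift L f x + shift (- L) f x) = T L f"
  by (simp add: T_def shift_def fun_eq_iff)

lemma T_sq: "sq_int f \<Longrightarrow> sq_int (T L f)"
  using sq_int_add[OF sq_int_shift[of f "-L"] sq_int_shift[of f L]] by (simp add: T_def[abs_def])

lemma T_continuous:
  assumes "continuous_on UNIV f" shows "continuous_on UNIV (T L f)"
proof -
  have "continuous_on UNIV (\<lambda>x. f (x - L))" "continuous_on UNIV (\<lambda>x. f (x + L))"
    by (rule continuous_on_compose2[OF assms]; (intro continuous_intros)?; simp)+
  then show ?thesis unfolding T_def[abs_def] by (rule continuous_on_add)
qed

lemma T_lin: "T L (\<lambda>x. a * f x + b * g x) = (\<lambda>x. a * T L f x + b * T L g x)"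
  by (simp add: T_def fun_eq_iff algebra_simps)

lemma T_nrm: assumes "sq_int f" shows "nrm (T L f) \<le> 2 * nrm f"
proof -
  have "nrm (\<lambda>x. f (x + (- L)) + f (x + L)) \<le> nrm (\<lambda>x. f (x + (- L))) + nrm (\<lambda>x. f (x + L))"
    by (intro nrm_triangle sq_int_shift assms)
  also have "\<dots> = 2 * nrm f" by (simp only: nrm_def nrm2_shift)
  finally show ?thesis by (simp add: T_def[abs_def] add.commute)
qed

lemma T_selfadj:
  assumes "sq_int f" "sq_int g" shows "inner_L2 f (T L g) = inner_L2 (T L f) g"
proof -
  have m: "sq_int (\<lambda>x. h (x - L))" if "sq_int h" for h using sq_int_shift[OF that, of "-L"] by simp
  have 1: "inner_L2 f (\<lambda>x. g (x - L)) = inner_L2 (\<lambda>x. f (x + L)) g"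
    using inner_L2_shift[of f L "\<lambda>x. g (x - L)"] by simp
  have 2: "inner_L2 f (\<lambda>x. g (x + L)) = inner_L2 (\<lambda>x. f (x - L)) g"
    using inner_L2_shift[of f "-L" "\<lambda>x. g (x + L)"] by simp
  have "inner_L2 f (\<lambda>x. g (x - L) + g (x + L)) = inner_L2 f (\<lambda>x. g (x - L)) + inner_L2 f (\<lambda>x. g (x + L))"
    by (rule inner_L2_add_right[OF assms(1) m[OF assms(2)] sq_int_shift[OF assms(2), of L]])
  also have "\<dots> = inner_L2 (\<lambda>x. f (x - L)) g + inner_L2 (\<lambda>x. f (x + L)) g"
    unfolding 1 2 by (rule add.commute)
  also have "\<dots> = inner_L2 (\<lambda>x. f (x - L) + f (x + L)) g"
    by (rule inner_L2_add_left[OF assms(2) m[OF assms(1)] sq_int_shift[OF assms(1), of L], symmetric])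
  finally show ?thesis by (simp only: T_def[abs_def])
qed

section \<open>Borel transforms of measures and matrix elements of the resolvent\<close>

lemma inverse_Im_bound: "Im z \<noteq> 0 \<Longrightarrow> cmod (1 / (complex_of_real l - z)) \<le> 1 / \<bar>Im z\<bar>"
  using abs_Im_le_cmod[of "complex_of_real l - z"] by (simp add: norm_divide frac_le)

lemma real_minus_nonreal: "Im z \<noteq> 0 \<Longrightarrow> complex_of_real l - z \<noteq> 0"
  by (auto simp: complex_eq_iff)

text \<open>The Borel transform of the complex measure \<open>g d\<mu>\<close>; with
  \<open>g = 1\<close> it is the function prescribed by \<open>spec_meas\<close>.\<close>

definition CT :: "real measure \<Rightarrow> (real \<Rightarrow> complex) \<Rightarrow> complex \<Rightarrow> complex" where
  "CT \<mu> g z = (\<integral>l. g l / (complex_of_real l - z) \<partial>\<mu>)"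

lemma CT_integrable:
  assumes s: "sets \<mu> = sets borel" and g: "integrable \<mu> g" and z: "Im z \<noteq> 0"
  shows "integrable \<mu> (\<lambda>l. g l / (complex_of_real l - z))"
proof (rule Bochner_Integration.integrable_bound)
  show "integrable \<mu> (\<lambda>l. (1 / \<bar>Im z\<bar>) * cmod (g l))" using g by simp
  have [measurable_cong]: "sets \<mu> = sets borel" by (rule s)
  have [measurable]: "g \<in> borel_measurable \<mu>" using g by simp
  show "(\<lambda>l. g l / (complex_of_real l - z)) \<in> borel_measurable \<mu>" by measurable
  have "cmod (g l) * cmod (1 / (complex_of_real l - z)) \<le> cmod (g l) * (1 / \<bar>Im z\<bar>)" for l
    by (intro mult_left_mono inverse_Im_bound z) simp
  then show "AE l in \<mu>. cmod (g l / (complex_of_real l - z)) \<le> norm ((1 / \<bar>Im z\<bar>) * cmod (g l))"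
    by (simp add: norm_divide)
qed

text \<open>Partial fractions; the counterpart for measures of the resolvent identity, in the same
  form so that one argument treats both sides.\<close>

lemma CT_diff:
  assumes s: "sets \<mu> = sets borel" and g: "integrable \<mu> g" and z: "Im z \<noteq> 0" "Im w \<noteq> 0"
  shows "CT \<mu> g z - CT \<mu> g w = (z - w) * CT \<mu> (\<lambda>l. g l / (complex_of_real l - w)) z"
proof -
  have "CT \<mu> g z - CT \<mu> g w = (\<integral>l. g l / (complex_of_real l - z) - g l / (complex_of_real l - w) \<partial>\<mu>)"
    unfolding CT_def by (rule Bochner_Integration.integral_diff[symmetric]) (intro CT_integrable s g z)+
  also have "\<dots> = (\<integral>l. (z - w) * (g l / (complex_of_real l - w) / (complex_of_real l - z)) \<partial>\<mu>)"
  proof (rule Bochner_Integration.integral_cong[OF refl])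
    fix l
    show "g l / (complex_of_real l - z) - g l / (complex_of_real l - w)
      = (z - w) * (g l / (complex_of_real l - w) / (complex_of_real l - z))"
      using real_minus_nonreal[OF z(1), of l] real_minus_nonreal[OF z(2), of l]
      by (simp add: divide_simps) (simp add: algebra_simps)
  qed
  finally show ?thesis unfolding CT_def by (simp only: integral_mult_right_zero)
qed

lemma CT_bound:
  assumes s: "sets \<mu> = sets borel" and g: "integrable \<mu> g" and z: "Im z \<noteq> 0"
  shows "cmod (CT \<mu> g z) \<le> (\<integral>l. cmod (g l) \<partial>\<mu>) / \<bar>Im z\<bar>"
proof -
  have "cmod (CT \<mu> g z) \<le> (\<integral>l. cmod (g l / (complex_of_real l - z)) \<partial>\<mu>)"
    unfolding CT_def by (rule integral_norm_bound)
  also have "\<dots> \<le> (\<integral>l. (1 / \<bar>Im z\<bar>) * cmod (g l) \<partial>\<mu>)"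
  proof (rule integral_mono[OF integrable_norm[OF CT_integrable[OF s g z]]])
    fix l
    have "cmod (g l) * cmod (1 / (complex_of_real l - z)) \<le> cmod (g l) * (1 / \<bar>Im z\<bar>)"
      by (intro mult_left_mono inverse_Im_bound z) simp
    then show "cmod (g l / (complex_of_real l - z)) \<le> 1 / \<bar>Im z\<bar> * cmod (g l)" by (simp add: norm_divide)
  qed (use g in simp)
  finally show ?thesis by simp
qed

text \<open>Borel transforms and resolvent matrix elements share this scheme: a difference identity
  \<open>f z - f w = (z - w) * k z\<close> reduces differentiability of \<open>f\<close> at
  \<open>w\<close> to continuity of \<open>k\<close>, and \<open>k\<close> is again of the same
  kind.\<close>

lemma quotient_limit:
  fixes f k :: "complex \<Rightarrow> complex"
  assumes d: "\<And>z. Im z \<noteq> 0 \<Longrightarrow> f z - f w = (z - w) * k z"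
    and k: "(k \<longlongrightarrow> k w) (at w)" and w: "Im w \<noteq> 0"
  shows "(f has_field_derivative k w) (at w)"
proof -
  have "\<forall>\<^sub>F z in at w. Im z \<noteq> 0"
  proof -
    have "open {z. Im z \<noteq> 0}" by (intro open_Collect_neq continuous_intros)
    then show ?thesis using w eventually_at_in_open'[of "{z. Im z \<noteq> 0}" w] by simp
  qed
  moreover have "\<forall>\<^sub>F z in at w. z \<noteq> w" by (simp add: eventually_at_filter)
  ultimately have "\<forall>\<^sub>F z in at w. k z = (f z - f w) / (z - w)"
    by eventually_elim (simp add: d)
  with k have "((\<lambda>z. (f z - f w) / (z - w)) \<longlongrightarrow> k w) (at w)"
    by (rule Lim_transform_eventually)
  then show ?thesis by (simp add: has_field_derivative_iff)
qed

text \<open>\<open>k\<close> stays bounded near \<open>w\<close>, because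
  \<open>\<bar>Im z\<bar>\<close> stays away from 0 there.\<close>

lemma tendsto_from_quotient:
  fixes f k :: "complex \<Rightarrow> complex"
  assumes d: "\<And>z. Im z \<noteq> 0 \<Longrightarrow> f z - f w = (z - w) * k z"
    and B: "\<And>z. Im z \<noteq> 0 \<Longrightarrow> cmod (k z) \<le> B / \<bar>Im z\<bar>" and w: "Im w \<noteq> 0"
  shows "(f \<longlongrightarrow> f w) (at w)"
proof -
  have 1: "\<forall>\<^sub>F z in at w. Im z \<noteq> 0"
  proof -
    have "open {z. Im z \<noteq> 0}" by (intro open_Collect_neq continuous_intros)
    then show ?thesis using w eventually_at_in_open'[of "{z. Im z \<noteq> 0}" w] by simp
  qed
  have "((\<lambda>z. cmod (z - w) * (B / \<bar>Im z\<bar>)) \<longlongrightarrow> cmod (w - w) * (B / \<bar>Im w\<bar>)) (at w)"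
    by (intro tendsto_intros) (use w in auto)
  then have 2: "((\<lambda>z. cmod (z - w) * (B / \<bar>Im z\<bar>)) \<longlongrightarrow> 0) (at w)" by simp
  have "((\<lambda>z. f z - f w) \<longlongrightarrow> 0) (at w)"
  proof (rule Lim_null_comparison[OF _ 2])
    show "\<forall>\<^sub>F z in at w. cmod (f z - f w) \<le> cmod (z - w) * (B / \<bar>Im z\<bar>)"
      using 1
    proof eventually_elim
      case (elim z)
      show ?case unfolding d[OF elim] norm_mult by (intro mult_left_mono B elim) simp
    qed
  qed
  then show ?thesis by (simp add: LIM_zero_iff)
qed

lemma CT_tendsto:
  assumes s: "sets \<mu> = sets borel" and g: "integrable \<mu> g" and w: "Im w \<noteq> 0"
  shows "(CT \<mu> g \<longlongrightarrow> CT \<mu> g w) (at w)"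
  by (rule tendsto_from_quotient[OF CT_diff[OF s g _ w] CT_bound[OF s CT_integrable[OF s g w]] w])

lemma CT_deriv:
  assumes s: "sets \<mu> = sets borel" and g: "integrable \<mu> g" and w: "Im w \<noteq> 0"
  shows "(CT \<mu> g has_field_derivative CT \<mu> (\<lambda>l. g l / (complex_of_real l - w)) w) (at w)"
  by (rule quotient_limit[OF CT_diff[OF s g _ w] CT_tendsto[OF s CT_integrable[OF s g w] w] w])

text \<open>Needed at coinciding parameters, where the difference identities cannot be divided by
  \<open>z - w\<close>.\<close>

lemma eq_by_continuity:
  fixes f g :: "complex \<Rightarrow> complex"
  assumes "(f \<longlongrightarrow> f w0) (at w0)" "(g \<longlongrightarrow> g w0) (at w0)" "\<And>w. Im w \<noteq> 0 \<Longrightarrow> w \<noteq> w0 \<Longrightarrow> f w = g w" "Im w0 \<noteq> 0"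
  shows "f w0 = g w0"
proof (rule tendsto_unique[OF _ _ assms(2)])
  have "open {z. Im z \<noteq> 0}" by (intro open_Collect_neq continuous_intros)
  then have "\<forall>\<^sub>F z in at w0. Im z \<noteq> 0" using assms(4) eventually_at_in_open'[of "{z. Im z \<noteq> 0}" w0] by simp
  moreover have "\<forall>\<^sub>F z in at w0. z \<noteq> w0" by (simp add: eventually_at_filter)
  ultimately have "\<forall>\<^sub>F w in at w0. f w = g w" by eventually_elim (rule assms(3))
  then show "(g \<longlongrightarrow> f w0) (at w0)" by (rule Lim_transform_eventually[OF assms(1)])
qed simp

context schroedinger
begin

lemma R_inner_diff:
  assumes g: "sq_int g" and h: "sq_int h" and z: "Im z \<noteq> 0" "Im w \<noteq> 0"
  shows "inner_L2 g (R z h) - inner_L2 g (R w h) = (z - w) * inner_L2 g (R z (R w h))"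
proof -
  have "(\<lambda>x. R z h x - R w h x) = (\<lambda>x. (z - w) * R z (R w h) x)"
    using R_ident[OF z h] by auto
  then have "inner_L2 g (\<lambda>x. R z h x - R w h x) = (z - w) * inner_L2 g (R z (R w h))"
    by (simp only: inner_L2_cmult_right)
  then show ?thesis using inner_L2_diff_right[OF g R_sq[OF z(1) h] R_sq[OF z(2) h]] by simp
qed

lemma R_inner_bound:
  assumes g: "sq_int g" and h: "sq_int h" and z: "Im z \<noteq> 0"
  shows "cmod (inner_L2 g (R z h)) \<le> nrm g * nrm h / \<bar>Im z\<bar>"
proof -
  have "cmod (inner_L2 g (R z h)) \<le> nrm g * nrm (R z h)" by (rule cauchy_schwarz) (use assms in auto)
  also have "\<dots> \<le> nrm g * (nrm h / \<bar>Im z\<bar>)" by (intro mult_left_mono R_norm' z h) simp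
  finally show ?thesis by simp
qed

lemma R_inner_tendsto:
  assumes g: "sq_int g" and h: "sq_int h" and w: "Im w \<noteq> 0"
  shows "((\<lambda>z. inner_L2 g (R z h)) \<longlongrightarrow> inner_L2 g (R w h)) (at w)"
  by (rule tendsto_from_quotient[OF R_inner_diff[OF g h _ w] R_inner_bound[OF g R_sq[OF w h]] w])

lemma R_inner_deriv:
  assumes g: "sq_int g" and h: "sq_int h" and w: "Im w \<noteq> 0"
  shows "((\<lambda>z. inner_L2 g (R z h)) has_field_derivative inner_L2 g (R w (R w h))) (at w)"
  by (rule quotient_limit[OF R_inner_diff[OF g h _ w] R_inner_tendsto[OF g R_sq[OF w h] w] w])

lemma spec_measD:
  assumes "sq_int f" "spec_meas V f \<mu>"
  shows "sets \<mu> = sets borel" "finite_measure \<mu>" "Im z \<noteq> 0 \<Longrightarrow> CT \<mu> (\<lambda>_. 1) z = inner_L2 f (R z f)"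
  using assms spec_meas_iff by (auto simp: CT_def)

text \<open>For distinct parameters, divide the resolvent identity and its counterpart
  \<open>CT_diff\<close> by the same factor; the case \<open>w = z\<close> follows by
  continuity.\<close>

lemma spec_meas_RR:
  assumes f: "sq_int f" and m: "spec_meas V f \<mu>" and z: "Im z \<noteq> 0" and w: "Im w \<noteq> 0"
  shows "inner_L2 f (R w (R z f)) = CT \<mu> (\<lambda>l. 1 / (complex_of_real l - z)) w"
proof -
  note s = spec_measD[OF f m]
  interpret finite_measure \<mu> by (rule s(2))
  have i: "integrable \<mu> (\<lambda>l. 1 :: complex)" by simp
  have ne: "inner_L2 f (R v (R z f)) = CT \<mu> (\<lambda>l. 1 / (complex_of_real l - z)) v" if v: "Im v \<noteq> 0" "v \<noteq> z"
    for v
  proof -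
    have "(v - z) * inner_L2 f (R v (R z f)) = (v - z) * CT \<mu> (\<lambda>l. 1 / (complex_of_real l - z)) v"
      unfolding R_inner_diff[OF f f v(1) z, symmetric] CT_diff[OF s(1) i v(1) z, symmetric] s(3)[OF v(1)]
        s(3)[OF z] ..
    then show ?thesis using v by simp
  qed
  show ?thesis
  proof (cases "w = z")
    case True
    show ?thesis unfolding True
      by (rule eq_by_continuity[OF R_inner_tendsto[OF f R_sq[OF z f] z] CT_tendsto[OF s(1) CT_integrable[OF
        s(1) i z] z] ne z])
  qed (rule ne[OF w])
qed

text \<open>Moving the left resolvent to the other side produces \<open>R (cnj z)\<close>, so the
  same division works again, now with \<open>w = cnj z\<close> as the exceptional parameter.\<close>

lemma spec_meas_RRR:
  assumes f: "sq_int f" and m: "spec_meas V f \<mu>" and z: "Im z \<noteq> 0" and w: "Im w \<noteq> 0"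
  shows "inner_L2 (R z f) (R w (R z f)) = CT \<mu> (\<lambda>l. 1 / (complex_of_real l - z) / (complex_of_real l
    - cnj z)) w"
proof -
  note s = spec_measD[OF f m]
  interpret finite_measure \<mu> by (rule s(2))
  have i: "integrable \<mu> (\<lambda>l. 1 :: complex)" by simp
  have z': "Im (cnj z) \<noteq> 0" using z by simp
  have su: "sq_int (R z f)" using z f by simp
  note iz = CT_integrable[OF s(1) i z]
  have ne: "inner_L2 (R z f) (R v (R z f)) = CT \<mu> (\<lambda>l. 1 / (complex_of_real l - z) / (complex_of_real l
    - cnj z)) v" if v: "Im v \<noteq> 0" "v \<noteq> cnj z" for v
  proof -
    have a: "inner_L2 (R z f) h = inner_L2 f (R (cnj z) h)" if "sq_int h" for h
      using R_adj[OF z' f that] by simp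
    define Y where "Y = inner_L2 f (R (cnj z) (R v (R z f)))"
    define C where "C = CT \<mu> (\<lambda>l. 1 / (complex_of_real l - z) / (complex_of_real l - cnj z)) v"
    have "inner_L2 f (R (cnj z) (R z f)) - inner_L2 f (R v (R z f)) = (cnj z - v) * Y"
      unfolding Y_def by (rule R_inner_diff[OF f su z' v(1)])
    moreover have "inner_L2 f (R v (R z f)) - inner_L2 f (R (cnj z) (R z f)) = (v - cnj z) * C"
      unfolding C_def spec_meas_RR[OF f m z v(1)] spec_meas_RR[OF f m z z']
        by (rule CT_diff[OF s(1) iz v(1) z'])
    moreover have "(v - cnj z) * Y = - ((cnj z - v) * Y)" by (simp add: algebra_simps)
    ultimately have "(v - cnj z) * Y = (v - cnj z) * C" by (metis minus_diff_eq)
    then show ?thesis using v a[OF R_sq[OF v(1) su]] by (simp add: Y_def C_def)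
  qed
  show ?thesis
  proof (cases "w = cnj z")
    case True
    show ?thesis unfolding True
      by (rule eq_by_continuity[OF R_inner_tendsto[OF su su z'] CT_tendsto[OF s(1) CT_integrable[OF s(1) iz
        z'] z'] ne z'])
  qed (rule ne[OF w])
qed

lemma spec_meas_RRf:
  assumes f: "sq_int f" and m: "spec_meas V f \<mu>" and z: "Im z \<noteq> 0" and w: "Im w \<noteq> 0"
  shows "inner_L2 (R z f) (R w f) = CT \<mu> (\<lambda>l. 1 / (complex_of_real l - cnj z)) w"
proof -
  note s = spec_measD[OF f m]
  interpret finite_measure \<mu> by (rule s(2))
  have z': "Im (cnj z) \<noteq> 0" using z by simp
  have "inner_L2 (R z f) (R w f) = inner_L2 f (R (cnj z) (R w f))"
    using R_adj[OF z' f R_sq[OF w f]] by simp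
  also have "\<dots> = CT \<mu> (\<lambda>l. 1 / (complex_of_real l - w)) (cnj z)" by (rule spec_meas_RR[OF f m w z'])
  also have "\<dots> = CT \<mu> (\<lambda>l. 1 / (complex_of_real l - cnj z)) w" unfolding CT_def by (simp add: mult.commute)
  finally show ?thesis .
qed

text \<open>The squared modulus of the symbol of \<open>a + b R(z)\<close>, which is the density of
  the spectral measure of \<open>a f + b R(z) f\<close> with respect to that of
  \<open>f\<close>.\<close>

definition dens :: "complex \<Rightarrow> complex \<Rightarrow> complex \<Rightarrow> real \<Rightarrow> real" where
  "dens a b z l = (cmod (a + b / (complex_of_real l - z)))\<^sup>2"

lemma dens_expand: "complex_of_real (dens a b z l) = cnj a * a + cnj a * b * (1 / (complex_of_real l - z))
   + cnj b * a * (1 / (complex_of_real l - cnj z)) + cnj b * b * (1 / (complex_of_real l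
     - z) / (complex_of_real l - cnj z))"
proof -
  have "(a + b / X) * cnj (a + b / X) = cnj a * a + cnj a * b * (1 / X) + cnj b * a * (1 / cnj X) + cnj b
    * b * (1 / X / cnj X)" for X
    by (simp add: divide_inverse algebra_simps)
  from this[of "complex_of_real l - z"] show ?thesis
    unfolding dens_def complex_norm_square by simp
qed

lemma dens_bound: "Im z \<noteq> 0 \<Longrightarrow> dens a b z l \<le> (cmod a + cmod b / \<bar>Im z\<bar>)\<^sup>2"
proof -
  assume z: "Im z \<noteq> 0"
  have "cmod (a + b / (complex_of_real l - z)) \<le> cmod a + cmod b * cmod (1 / (complex_of_real l - z))"
    by (rule order_trans[OF norm_triangle_ineq]) (simp add: norm_divide)
  also have "\<dots> \<le> cmod a + cmod b * (1 / \<bar>Im z\<bar>)"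
    by (intro add_left_mono mult_left_mono inverse_Im_bound z) simp
  finally show ?thesis unfolding dens_def by (intro power_mono) auto
qed

lemma dens_measurable [measurable]: "dens a b z \<in> borel_measurable borel"
  unfolding dens_def by measurable

text \<open>\<open>fcalc_eq\<close> speaks of one vector at a time, so polarization needs spectral
  measures of combinations. Both sides expand into the same four terms, matched by the preceding
  identities.\<close>

lemma spec_meas_lin:
  assumes f: "sq_int f" and m: "spec_meas V f \<mu>" and z: "Im z \<noteq> 0"
  shows "spec_meas V (\<lambda>x. a * f x + b * R z f x) (density \<mu> (\<lambda>l. ennreal (dens a b z l)))"
proof -
  note s = spec_measD[OF f m]
  interpret finite_measure \<mu> by (rule s(2))
  have [measurable_cong]: "sets \<mu> = sets borel" by (rule s(1))
  have z': "Im (cnj z) \<noteq> 0" using z by simp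
  have su: "sq_int (R z f)" using z f by simp
  define h where "h = (\<lambda>x. a * f x + b * R z f x)"
  have sh: "sq_int h" unfolding h_def by (intro sq_int_add sq_int_cmult f su)
  have sa: "sq_int (\<lambda>x. a * f x)" and sb: "sq_int (\<lambda>x. b * R z f x)" by (intro sq_int_cmult f su)+
  define D where "D = density \<mu> (\<lambda>l. ennreal (dens a b z l))"
  have dn: "0 \<le> dens a b z l" for l by (simp add: dens_def)
  have "spec_meas V h D" unfolding spec_meas_iff[OF sh]
  proof (intro conjI allI impI)
    show "sets D = sets borel" by (simp add: D_def s(1))
    show "finite_measure D"
    proof (rule finite_measureI)
      have "emeasure D (space D) = (\<integral>\<^sup>+l. ennreal (dens a b z l) \<partial>\<mu>)"
        unfolding D_def by (subst emeasure_density) (auto intro!: nn_integral_cong)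
      also have "\<dots> \<le> (\<integral>\<^sup>+l. ennreal ((cmod a + cmod b / \<bar>Im z\<bar>)\<^sup>2) \<partial>\<mu>)"
        by (intro nn_integral_mono ennreal_leI dens_bound z)
      also have "\<dots> = ennreal ((cmod a + cmod b / \<bar>Im z\<bar>)\<^sup>2 * measure \<mu> (space \<mu>))"
        by (simp add: emeasure_eq_measure ennreal_mult)
      also have "\<dots> < \<infinity>" by simp
      finally show "emeasure D (space D) \<noteq> \<infinity>" by simp
    qed
    fix w assume w: "Im w \<noteq> 0"
    have i: "integrable \<mu> (\<lambda>l. 1 :: complex)" by simp
    note iz = CT_integrable[OF s(1) i z] CT_integrable[OF s(1) i z'] CT_integrable[OF s(1) CT_integrable[OF
      s(1) i z] z']
    note iw = CT_integrable[OF s(1) _ w]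
    have "(\<integral>l. 1 / (complex_of_real l - w) \<partial>D) = (\<integral>l. dens a b z l *\<^sub>R (1 / (complex_of_real l - w)) \<partial>\<mu>)"
      unfolding D_def by (rule integral_density) (auto simp: dn)
    also have "\<dots> = (\<integral>l. cnj a * a * (1 / (complex_of_real l - w)) + cnj a * b * (1 / (complex_of_real l
      - z) / (complex_of_real l - w))
       + cnj b * a * (1 / (complex_of_real l - cnj z) / (complex_of_real l - w)) + cnj b * b
         * (1 / (complex_of_real l - z) / (complex_of_real l - cnj z) / (complex_of_real l - w)) \<partial>\<mu>)"
      unfolding scaleR_conv_of_real dens_expand
      by (rule Bochner_Integration.integral_cong[OF refl]) (simp only: distrib_right times_divide_eq_right
        mult_1_right add_divide_distrib)
    also have "\<dots> = cnj a * a * CT \<mu> (\<lambda>_. 1) w + cnj a * b * CT \<mu> (\<lambda>l. 1 / (complex_of_real l - z)) w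
       + cnj b * a * CT \<mu> (\<lambda>l. 1 / (complex_of_real l - cnj z)) w + cnj b * b
         * CT \<mu> (\<lambda>l. 1 / (complex_of_real l - z) / (complex_of_real l - cnj z)) w"
      unfolding CT_def
      by (simp only: Bochner_Integration.integral_add Bochner_Integration.integrable_add
        integrable_mult_right integral_mult_right_zero iw[OF i] iw[OF iz(1)] iw[OF iz(2)] iw[OF iz(3)])
    also have "\<dots> = cnj a * a * inner_L2 f (R w f) + cnj a * b * inner_L2 f (R w (R z f))
       + cnj b * a * inner_L2 (R z f) (R w f) + cnj b * b * inner_L2 (R z f) (R w (R z f))"
      unfolding s(3)[OF w] spec_meas_RR[OF f m z w] spec_meas_RRf[OF f m z w] spec_meas_RRR[OF f m z w] ..
    also have "\<dots> = inner_L2 h (R w h)"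
    proof -
      have "R w h = (\<lambda>x. a * R w f x + b * R w (R z f) x)" unfolding h_def by (rule R_lin[OF w f su])
      then have e: "inner_L2 k (R w h) = a * inner_L2 k (R w f) + b * inner_L2 k (R w (R z f))"
        if "sq_int k" for k
        using inner_L2_add_right[OF that sq_int_cmult[OF R_sq[OF w f], of a] sq_int_cmult[OF R_sq[OF w su],
          of b]]
        by (simp only: inner_L2_cmult_right)
      have hl: "inner_L2 h k = cnj a * inner_L2 f k + cnj b * inner_L2 (R z f) k" if "sq_int k" for k
        unfolding h_def using inner_L2_add_left[OF that sa sb] by (simp only: inner_L2_cmult_left)
      have "inner_L2 h (R w h) = cnj a * inner_L2 f (R w h) + cnj b * inner_L2 (R z f) (R w h)"
        by (rule hl[OF R_sq[OF w sh]])
      then show ?thesis unfolding e[OF f] e[OF su] by (simp add: algebra_simps)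
    qed
    finally show "(\<integral>l. 1 / (complex_of_real l - w) \<partial>D) = inner_L2 h (R w h)" .
  qed
  then show ?thesis unfolding h_def D_def .
qed

end

section \<open>Polarization of the functional calculus and commutation\<close>

lemma integrable_of_square:
  fixes F :: "real \<Rightarrow> complex"
  assumes "finite_measure \<mu>" "F \<in> borel_measurable \<mu>" "integrable \<mu> (\<lambda>l. (cmod (F l))\<^sup>2)"
  shows "integrable \<mu> F"
proof -
  interpret finite_measure \<mu> by fact
  show ?thesis
  proof (rule Bochner_Integration.integrable_bound)
    show "integrable \<mu> (\<lambda>l. 1 + (cmod (F l))\<^sup>2)" using assms by simp
    show "AE l in \<mu>. norm (F l) \<le> norm (1 + (cmod (F l))\<^sup>2)"
    proof (rule AE_I2)
      fix l show "norm (F l) \<le> norm (1 + (cmod (F l))\<^sup>2)"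
        using le_one_plus_sq[of "cmod (F l)"] by (rule order_trans) simp
    qed
  qed (rule assms)
qed

context schroedinger
begin

text \<open>The form of \<open>T L\<close> at \<open>f + c R(z) f\<close> is an integral of
  \<open>F\<close> against an explicit density. The combination over
  \<open>c = 1, \<i>, -1, -\<i>\<close> isolates the coefficient of \<open>c\<close>, which is the
  matrix element between \<open>f\<close> and \<open>R z f\<close>.\<close>

lemma fcalc_CT:
  assumes F: "fcalc_eq V F (T L)" and Fm: "(\<lambda>l. F (complex_of_real l)) \<in> borel_measurable borel"
    and f: "sq_int f" and m: "spec_meas V f \<mu>" and z: "Im z \<noteq> 0"
  shows "inner_L2 f (T L (R z f)) = CT \<mu> (\<lambda>l. F (complex_of_real l)) z"
proof -
  note s = spec_measD[OF f m]
  interpret finite_measure \<mu> by (rule s(2))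
  have [measurable_cong]: "sets \<mu> = sets borel" by (rule s(1))
  note Fm[measurable]
  have Fi: "integrable \<mu> (\<lambda>l. F (complex_of_real l))"
  proof (rule integrable_of_square[OF s(2)])
    show "(\<lambda>l. F (complex_of_real l)) \<in> borel_measurable \<mu>" by measurable
    show "integrable \<mu> (\<lambda>l. (cmod (F (complex_of_real l)))\<^sup>2)"
      using F f m unfolding fcalc_eq_def by blast
  qed
  define g where "g = R z f"
  have sg: "sq_int g" using z f by (simp add: g_def)
  define Q where "Q c = inner_L2 (\<lambda>x. 1 * f x + c * g x) (T L (\<lambda>x. 1 * f x + c * g x))" for c
  have Q1: "Q c = (\<integral>l. dens 1 c z l *\<^sub>R F (complex_of_real l) \<partial>\<mu>)" for c
  proof -
    have "sq_int (\<lambda>x. 1 * f x + c * g x)" by (intro sq_int_add sq_int_cmult f sg)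
    moreover have "spec_meas V (\<lambda>x. 1 * f x + c * g x) (density \<mu> (\<lambda>l. ennreal (dens 1 c z l)))"
      unfolding g_def by (rule spec_meas_lin[OF f m z])
    ultimately have "Q c = (\<integral>l. F (complex_of_real l) \<partial>(density \<mu> (\<lambda>l. ennreal (dens 1 c z l))))"
      using F unfolding fcalc_eq_def Q_def by metis
    also have "\<dots> = (\<integral>l. dens 1 c z l *\<^sub>R F (complex_of_real l) \<partial>\<mu>)"
      by (rule integral_density) (auto simp: dens_def)
    finally show ?thesis .
  qed
  have Q2: "Q c = inner_L2 f (T L f) + c * inner_L2 f (T L g) + cnj c * inner_L2 g (T L f) + cnj c * c
    * inner_L2 g (T L g)" for c
  proof -
    have s1: "sq_int (\<lambda>x. 1 * k x)" if "sq_int k" for k using that by simp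
    have e: "inner_L2 k (T L (\<lambda>x. 1 * f x + c * g x)) = inner_L2 k (T L f) + c * inner_L2 k (T L g)"
      if "sq_int k" for k
      unfolding T_lin using inner_L2_add_right[OF that s1[OF T_sq[OF f]] sq_int_cmult[OF T_sq[OF sg], of c]]
      by (simp only: inner_L2_cmult_right mult_1)
    have "Q c = inner_L2 f (T L (\<lambda>x. 1 * f x + c * g x)) + cnj c * inner_L2 g (T L (\<lambda>x. 1 * f x + c * g x))"
      unfolding Q_def using inner_L2_add_left[OF T_sq[OF sq_int_add[OF s1[OF f] sq_int_cmult[OF sg, of c]]]
        s1[OF f] sq_int_cmult[OF sg, of c]]
      by (simp only: inner_L2_cmult_left mult_1 complex_cnj_one)
    then show ?thesis unfolding e[OF f] e[OF sg] by (simp add: algebra_simps)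
  qed
  have di: "integrable \<mu> (\<lambda>l. dens 1 c z l *\<^sub>R F (complex_of_real l))" for c
  proof (rule Bochner_Integration.integrable_bound)
    show "integrable \<mu> (\<lambda>l. (cmod 1 + cmod c / \<bar>Im z\<bar>)\<^sup>2 * cmod (F (complex_of_real l)))" using Fi by simp
    show "AE l in \<mu>. norm (dens 1 c z l *\<^sub>R F (complex_of_real l)) \<le> norm ((cmod 1 + cmod c / \<bar>Im z\<bar>)\<^sup>2
      * cmod (F (complex_of_real l)))"
    proof (rule AE_I2)
      fix l
      have "dens 1 c z l * cmod (F (complex_of_real l)) \<le> (cmod 1 + cmod c / \<bar>Im z\<bar>)\<^sup>2
        * cmod (F (complex_of_real l))"
        by (intro mult_right_mono dens_bound z) simp
      moreover have "norm (dens 1 c z l *\<^sub>R F (complex_of_real l)) = dens 1 c z l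
        * cmod (F (complex_of_real l))"
        by (simp add: dens_def)
      ultimately show "norm (dens 1 c z l *\<^sub>R F (complex_of_real l)) \<le> norm ((cmod 1 + cmod c / \<bar>Im z\<bar>)\<^sup>2
        * cmod (F (complex_of_real l)))"
        by (simp only: norm_mult real_norm_def abs_norm_cancel abs_power2 abs_of_nonneg[OF zero_le_power2])
    qed
  qed measurable
  have "4 * inner_L2 f (T L g) = Q 1 - \<i> * Q \<i> - Q (-1) + \<i> * Q (-\<i>)"
    unfolding Q2 by (simp add: algebra_simps)
  also have "\<dots> = (\<integral>l. dens 1 1 z l *\<^sub>R F (complex_of_real l) - \<i> * (dens 1 \<i> z l *\<^sub>R F (complex_of_real l))
    - dens 1 (-1) z l *\<^sub>R F (complex_of_real l) + \<i> * (dens 1 (-\<i>) z l *\<^sub>R F (complex_of_real l)) \<partial>\<mu>)"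
    unfolding Q1 by (simp only: Bochner_Integration.integral_add Bochner_Integration.integral_diff
      Bochner_Integration.integrable_add Bochner_Integration.integrable_diff integrable_mult_right
      integral_mult_right_zero di)
  also have "\<dots> = (\<integral>l. 4 * (F (complex_of_real l) / (complex_of_real l - z)) \<partial>\<mu>)"
    by (rule Bochner_Integration.integral_cong[OF refl])
       (simp only: scaleR_conv_of_real dens_expand, simp add: algebra_simps)
  also have "\<dots> = 4 * CT \<mu> (\<lambda>l. F (complex_of_real l)) z"
    unfolding CT_def by (rule integral_mult_right_zero)
  finally show ?thesis by (simp add: g_def)
qed

text \<open>The form of \<open>R z\<close> after \<open>T L\<close> at \<open>g\<close> is the
  conjugate of the form of \<open>T L\<close> after \<open>R (cnj z)\<close>. By
  \<open>fcalc_CT\<close> both orders give the Borel transform of \<open>F\<close>, as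
  \<open>F\<close> is real on the real line. So the commutator has zero diagonal form, hence is
  zero.\<close>

theorem T_commutes_R:
  assumes F: "fcalc_eq V F (T L)" and Fm: "(\<lambda>l. F (complex_of_real l)) \<in> borel_measurable borel"
    and Fr: "\<And>l. cnj (F (complex_of_real l)) = F (complex_of_real l)"
    and f: "sq_int f" and z: "Im z \<noteq> 0"
  shows "R z (T L f) = T L (R z f)"
proof -
  have z': "Im (cnj z) \<noteq> 0" using z by simp
  define C where "C g = (\<lambda>x. T L (R z g) x - R z (T L g) x)" for g
  have sC: "sq_int (C g)" if "sq_int g" for g
    unfolding C_def using that z by (intro sq_int_diff T_sq R_sq) auto
  have C0: "inner_L2 g (C g) = 0" if g: "sq_int g" for g
  proof -
    obtain \<mu> where m: "spec_meas V g \<mu>" using spec_meas_exists[OF g] by blast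
    have "inner_L2 g (R z (T L g)) = inner_L2 (R (cnj z) g) (T L g)"
      using R_adj[OF z g T_sq[OF g]] by simp
    also have "\<dots> = inner_L2 (T L (R (cnj z) g)) g"
      by (rule T_selfadj) (use z' g in auto)
    also have "\<dots> = cnj (inner_L2 g (T L (R (cnj z) g)))" by (rule inner_L2_commute)
    also have "\<dots> = cnj (CT \<mu> (\<lambda>l. F (complex_of_real l)) (cnj z))"
      by (simp only: fcalc_CT[OF F Fm g m z'])
    also have "\<dots> = CT \<mu> (\<lambda>l. F (complex_of_real l)) z"
      unfolding CT_def by (subst Bochner_Integration.integral_cnj[symmetric]) (simp add: Fr)
    also have "\<dots> = inner_L2 g (T L (R z g))" by (rule fcalc_CT[OF F Fm g m z, symmetric])
    finally show ?thesis unfolding C_def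
      using inner_L2_diff_right[OF g T_sq[OF R_sq[OF z g]] R_sq[OF z T_sq[OF g]]] by simp
  qed
  have Clin: "C (\<lambda>x. a * g x + b * h x) = (\<lambda>x. a * C g x + b * C h x)" if "sq_int g" "sq_int h" for a b g h
    unfolding C_def R_lin[OF z that] T_lin R_lin[OF z T_sq[OF that(1)] T_sq[OF that(2)]]
      by (simp add: algebra_simps)
  \<comment> \<open>The cross terms of the vanishing form at \<open>f + b h\<close>; taking
    \<open>b = 1\<close> and \<open>b = \<i>\<close> separates them.\<close>
  have exp: "cnj b * inner_L2 h (C f) + b * inner_L2 f (C h) = 0" if h: "sq_int h" for h b
  proof -
    define k where "k = (\<lambda>x. 1 * f x + b * h x)"
    have sk: "sq_int k" unfolding k_def by (intro sq_int_add sq_int_cmult f h)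
    have Ck: "inner_L2 g (C k) = inner_L2 g (C f) + b * inner_L2 g (C h)" if "sq_int g" for g
      unfolding k_def Clin[OF f h] using inner_L2_add_right[OF that sC[OF f] sq_int_cmult[OF sC[OF h], of
        b]]
      by (simp add: inner_L2_cmult_right)
    have "0 = inner_L2 k (C k)" using C0[OF sk] by simp
    also have "\<dots> = inner_L2 f (C k) + cnj b * inner_L2 h (C k)"
      using inner_L2_add_left[OF sC[OF sk] f sq_int_cmult[OF h, of b]] unfolding k_def
        by (simp add: inner_L2_cmult_left)
    also have "\<dots> = cnj b * inner_L2 h (C f) + b * inner_L2 f (C h)"
      unfolding Ck[OF f] Ck[OF h] C0[OF f] C0[OF h] by simp
    finally show ?thesis by simp
  qed
  have "inner_L2 h (C f) = 0" if h: "sq_int h" for h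
  proof -
    have "inner_L2 h (C f) + inner_L2 f (C h) = 0" using exp[OF h, of 1] by simp
    moreover have "- \<i> * inner_L2 h (C f) + \<i> * inner_L2 f (C h) = 0" using exp[OF h, of \<i>] by simp
    then have "\<i> * (inner_L2 f (C h) - inner_L2 h (C f)) = 0" by (simp add: algebra_simps)
    then have "inner_L2 f (C h) = inner_L2 h (C f)" by simp
    ultimately show ?thesis by simp
  qed
  from this[OF sC[OF f]] have "nrm2 (C f) = 0" by (simp add: inner_L2_self)
  moreover have "continuous_on UNIV (C f)"
    unfolding C_def using f z by (intro continuous_intros T_continuous R_continuous T_sq) auto
  ultimately have "C f = (\<lambda>_. 0)" using sC[OF f] by (intro nrm2_eq_0_continuous)
  then show ?thesis unfolding C_def by (simp add: fun_eq_iff)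
qed

end

section \<open>Periodicity of the potential\<close>

lemma max_power_deriv: "((\<lambda>t::real. max 0 t ^ (n + 2)) has_real_derivative (real (n + 2) * max 0 t ^ (n
  + 1))) (at t)"
proof -
  consider "t > 0" | "t < 0" | "t = 0" by linarith
  then show ?thesis
  proof cases
    case 1
    have "((\<lambda>t. t ^ (n + 2)) has_real_derivative (real (n + 2) * t ^ (n + 1))) (at t)"
      by (rule derivative_eq_intros refl)+ simp
    then have "((\<lambda>t. max 0 t ^ (n + 2)) has_real_derivative (real (n + 2) * t ^ (n + 1))) (at t)"
      by (rule has_field_derivative_transform_within_open[of _ _ _ "{0<..}"]) (use 1 in auto)
    then show ?thesis using 1 by simp
  next
    case 2
    have "((\<lambda>t. 0) has_real_derivative 0) (at t)" by simp
    then have "((\<lambda>t. max 0 t ^ (n + 2)) has_real_derivative 0) (at t)"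
      by (rule has_field_derivative_transform_within_open[of _ _ _ "{..<0}"]) (use 2 in auto)
    then show ?thesis using 2 by simp
  next
    case 3
    have l: "((\<lambda>h::real. \<bar>h\<bar> ^ (n + 1)) \<longlongrightarrow> 0) (at 0)"
      by (rule tendsto_eq_intros refl | simp)+
    have "((\<lambda>h::real. (max 0 (0 + h) ^ (n + 2) - max 0 0 ^ (n + 2)) / h) \<longlongrightarrow> 0) (at 0)"
    proof (rule Lim_null_comparison[OF always_eventually l], rule allI)
      fix h :: real
      show "norm ((max 0 (0 + h) ^ (n + 2) - max 0 0 ^ (n + 2)) / h) \<le> \<bar>h\<bar> ^ (n + 1)"
      proof (cases "h > 0")
        case False
        then have "max 0 (0 + h) = 0" by simp
        moreover have "0 \<le> \<bar>h\<bar> ^ (n + 1)" by (intro zero_le_power) simp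
        ultimately show ?thesis by (simp only:) simp
      qed simp
    qed
    then show ?thesis using 3 by (simp add: DERIV_def)
  qed
qed

lemma acd_real_derivative:
  assumes "\<And>x. (c has_real_derivative c' x) (at x)" "continuous_on UNIV c'"
  shows "acd (\<lambda>x. complex_of_real (c x)) (\<lambda>x. complex_of_real (c' x))"
proof (rule acd_has_vector_derivative)
  show "((\<lambda>x. complex_of_real (c x)) has_vector_derivative complex_of_real (c' x)) (at x)" for x
    using assms(1)[of x] by (intro has_vector_derivative_of_real)
      (simp add: has_real_derivative_iff_has_vector_derivative)
qed (intro continuous_intros assms)

text \<open>The positive part of \<open>L^2 - (x - p)^2\<close> is raised to the third power, the
  least integer power with a continuous second derivative; only two derivatives enter the
  application.\<close>

lemma cutoff_exists:
  fixes L p :: real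
  assumes "L > 0"
  obtains c c' c'' where "acd c c'" "acd c' c''" "continuous_on UNIV c''"
    "\<And>x. \<bar>x - p\<bar> < L \<Longrightarrow> c x \<noteq> (0::complex)" "\<And>x. L \<le> \<bar>x - p\<bar> \<Longrightarrow> c x = 0 \<and> c' x = 0 \<and> c'' x = 0"
proof -
  define q where "q x = L\<^sup>2 - (x - p)\<^sup>2" for x
  define k where "k n x = max 0 (q x) ^ n" for n x
  have q: "(q has_real_derivative - 2 * (x - p)) (at x)" for x
    unfolding q_def by (auto intro!: derivative_eq_intros)
  have qc: "continuous_on UNIV q" unfolding q_def by (intro continuous_intros)
  have kc: "continuous_on UNIV (k n)" for n unfolding k_def by (intro continuous_intros qc)
  have k: "(k (n + 2) has_real_derivative (real (n + 2) * k (n + 1) x) * (- 2 * (x - p))) (at x)" for n x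
    unfolding k_def by (rule DERIV_chain2[OF max_power_deriv q])
  define c where "c x = k 3 x" for x
  define c' where "c' x = - 6 * (x - p) * k 2 x" for x
  define c'' where "c'' x = - 6 * k 2 x + 24 * (x - p)\<^sup>2 * k 1 x" for x
  have c: "(c has_real_derivative c' x) (at x)" for x
  proof -
    have "(k 3 has_real_derivative (3 * k 2 x) * (- 2 * (x - p))) (at x)" using k[of 1 x]
      by (simp add: numeral_eq_Suc)
    moreover have "(3 * k 2 x) * (- 2 * (x - p)) = c' x" by (simp add: c'_def algebra_simps)
    ultimately show ?thesis unfolding c_def[abs_def] by simp
  qed
  have c': "(c' has_real_derivative c'' x) (at x)" for x
  proof -
    have "((\<lambda>x. (- 6 * (x - p)) * k 2 x) has_real_derivative (- 6) * k 2 x + (2 * k 1 x) * (- 2 * (x - p))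
      * (- 6 * (x - p))) (at x)"
    proof (rule DERIV_mult)
      show "((\<lambda>x. - 6 * (x - p)) has_real_derivative - 6) (at x)" by (auto intro!: derivative_eq_intros)
      show "(k 2 has_real_derivative (2 * k 1 x) * (- 2 * (x - p))) (at x)" using k[of 0 x]
        by (simp add: numeral_eq_Suc)
    qed
    moreover have "(- 6) * k 2 x + (2 * k 1 x) * (- 2 * (x - p)) * (- 6 * (x - p)) = c'' x"
      by (simp add: c''_def power2_eq_square algebra_simps)
    ultimately show ?thesis unfolding c'_def[abs_def] by simp
  qed
  have cc': "continuous_on UNIV c'" and cc'': "continuous_on UNIV c''"
    unfolding c'_def c''_def by (intro continuous_intros kc)+
  show ?thesis
  proof (rule that[of "\<lambda>x. complex_of_real (c x)" "\<lambda>x. complex_of_real (c' x)"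
    "\<lambda>x. complex_of_real (c'' x)"])
    show "acd (\<lambda>x. complex_of_real (c x)) (\<lambda>x. complex_of_real (c' x))"
      by (rule acd_real_derivative[OF c cc'])
    show "acd (\<lambda>x. complex_of_real (c' x)) (\<lambda>x. complex_of_real (c'' x))"
      by (rule acd_real_derivative[OF c' cc''])
    show "continuous_on UNIV (\<lambda>x. complex_of_real (c'' x))" by (intro continuous_intros cc'')
    fix x
    have e: "q x = L\<^sup>2 - \<bar>x - p\<bar>\<^sup>2" by (simp add: q_def)
    show "complex_of_real (c x) \<noteq> 0" if "\<bar>x - p\<bar> < L"
    proof -
      have "\<bar>x - p\<bar>\<^sup>2 < L\<^sup>2" using that by (intro power_strict_mono) auto
      then have "c x \<noteq> 0" by (simp add: c_def k_def e)
      then show ?thesis by simp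
    qed
    show "complex_of_real (c x) = 0 \<and> complex_of_real (c' x) = 0 \<and> complex_of_real (c'' x) = 0"
      if "L \<le> \<bar>x - p\<bar>"
    proof -
      have "L\<^sup>2 \<le> \<bar>x - p\<bar>\<^sup>2" using that assms by (intro power_mono) auto
      then show ?thesis by (simp add: c_def c'_def c''_def k_def e)
    qed
  qed
qed

lemma sq_int_compact_support:
  assumes c: "continuous_on UNIV f" and z: "\<And>x. x \<notin> {a..b} \<Longrightarrow> f x = 0"
  shows "sq_int f"
proof (rule sq_int_bound[OF locint_measurable[OF locint_continuous[OF c]]])
  show "integrable lebesgue (\<lambda>x. indicator {a..b} x *\<^sub>R (cmod (f x))\<^sup>2)"
    by (intro locint_integrable_indicator locint_continuous continuous_intros c)
  show "(cmod (f x))\<^sup>2 \<le> indicator {a..b} x *\<^sub>R (cmod (f x))\<^sup>2" for x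
    using z[of x] by (cases "x \<in> {a..b}") auto
qed

text \<open>In the derivative of the Wronskian the terms containing \<open>q\<close> cancel.\<close>

lemma wronskian:
  assumes w: "ode q (\<lambda>_. 0) w w'" and v: "ode q (\<lambda>_. 0) v v'"
  shows "w x * v' x - w' x * v x = w y * v' y - w' y * v y"
proof -
  have "acd (\<lambda>x. w x * v' x - w' x * v x) (\<lambda>x. (w' x * v' x + w x * (q x * v x - 0)) - ((q x * w x - 0)
    * v x + w' x * v' x))"
    using w v unfolding ode_def by (intro acd_diff acd_mult) auto
  then have a: "acd (\<lambda>x. w x * v' x - w' x * v x) (\<lambda>x. 0)" by (simp add: algebra_simps)
  show ?thesis using acdD[OF a, of x y] acdD[OF a, of y x] by (cases "x \<le> y") auto
qed

context schroedinger
begin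

text \<open>Apply the commutation relation to \<open>f = (H - i) (c w)\<close> for a cutoff function \<open>c\<close>.\<close>

lemma commuting_imp_local:
  assumes com: "\<And>f. sq_int f \<Longrightarrow> R \<i> (T L f) = T L (R \<i> f)" and L: "L > 0"
    and w: "ode (\<lambda>t. complex_of_real (V t) - \<i>) (\<lambda>_. 0) w w'"
  shows "AE x in lebesgue. \<bar>x - L - p\<bar> \<le> L / 2 \<longrightarrow> (complex_of_real (V x) - complex_of_real (V (x - L)))
    * w (x - L) = 0"
proof -
  obtain c c' c'' where c: "acd c c'" "acd c' c''" "continuous_on UNIV c''"
    and c0: "\<And>x. \<bar>x - p\<bar> < L \<Longrightarrow> c x \<noteq> (0::complex)" and c1: "\<And>x. L \<le> \<bar>x - p\<bar> \<Longrightarrow> c x = 0 \<and> c' x = 0 \<and> c'' x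
      = 0"
    using cutoff_exists[OF L, of p] by blast
  let ?q = "\<lambda>t. complex_of_real (V t) - \<i>"
  have aw: "acd w w'" "acd w' (\<lambda>t. ?q t * w t - 0)" using w by (auto simp: ode_def)
  define u where "u x = c x * w x" for x
  define u' where "u' x = c' x * w x + c x * w' x" for x
  \<comment> \<open>\<open>(H - \<i>) (c w)\<close> computed formally: the terms with
    \<open>V\<close> cancel because \<open>w\<close> is a homogeneous solution. So \<open>f\<close>
    is continuous with compact support although \<open>V\<close> is only locally integrable.\<close>
  define f where "f x = - (c'' x * w x + 2 * (c' x * w' x))" for x
  have cont: "continuous_on UNIV c" "continuous_on UNIV c'" "continuous_on UNIV w" "continuous_on UNIV w'"
    using c aw acd_continuous by blast+
  have au: "acd u u'" unfolding u_def u'_def by (rule acd_mult[OF c(1) aw(1)])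
  have "acd u' (\<lambda>x. (c'' x * w x + c' x * w' x) + (c' x * w' x + c x * (?q x * w x - 0)))"
    unfolding u'_def by (intro acd_add acd_mult c aw)
  then have au': "acd u' (\<lambda>x. ?q x * u x - f x)"
    by (simp add: u_def f_def algebra_simps)
  have o: "ode ?q f u u'" using au au' by (simp add: ode_def)
  have out: "c x = 0 \<and> c' x = 0 \<and> c'' x = 0" if "x \<notin> {p-L..p+L}" for x
    using that by (intro c1) auto
  have su: "sq_int u" "sq_int u'" "sq_int f"
    unfolding u_def u'_def f_def
    by (rule sq_int_compact_support[of _ "p-L" "p+L"]; (intro continuous_intros cont c(3))?; use out in
      simp)+
  have Ru: "R \<i> f = u"
    by (rule R_eq[OF ode_resolvent[OF V o su]]) (use su in auto)
  have RT: "R \<i> (T L f) = T L u" using com[OF su(3)] Ru by simp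
  obtain v' where v': "ode ?q (T L f) (T L u) v'"
    using R_ode[of \<i> "T L f"] T_sq[OF su(3)] RT by auto
  have aT: "acd (T L g) (T L g')" if "acd g g'" for g g'
    using acd_add[OF acd_shift[OF that, of "-L"] acd_shift[OF that, of L]] by (simp add: T_def[abs_def])
  have av: "acd (T L u) v'" "acd v' (\<lambda>t. ?q t * T L u t - T L f t)" using v' by (auto simp: ode_def)
  \<comment> \<open>Both are continuous derivatives of \<open>T L u\<close>. Comparing their own
    derivatives then gives, almost everywhere, an identity from which \<open>f\<close> drops out:
    multiplication by \<open>V\<close> commutes with \<open>T L\<close> on \<open>u\<close>.\<close>
  have "v' = T L u'"
    by (rule acd_continuous_unique[OF av(1) aT[OF au] acd_continuous[OF av(2)] acd_continuous[OF aT[OF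
      au']]])
  then have "AE x in lebesgue. ?q x * T L u x - T L f x = T L (\<lambda>x. ?q x * u x - f x) x"
    using acd_AE_unique[OF av(2)] aT[OF au'] by simp
  then show ?thesis
  proof eventually_elim
    case (elim x)
    show ?case
    proof
      assume x: "\<bar>x - L - p\<bar> \<le> L / 2"
      \<comment> \<open>In this window the point \<open>x + L\<close> is at distance at least
        \<open>3 * L / 2\<close> from \<open>p\<close>, so the forward translate lies outside the
        support of \<open>c\<close> and only the backward one remains.\<close>
      have "L \<le> \<bar>x + L - p\<bar>" using x L by linarith
      then have "u (x + L) = 0" using c1 by (simp add: u_def)
      with elim have "(complex_of_real (V x) - complex_of_real (V (x - L))) * u (x - L) = 0"
        by (simp add: T_def algebra_simps)
      moreover have "c (x - L) \<noteq> 0" using x L by (intro c0) auto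
      ultimately show "(complex_of_real (V x) - complex_of_real (V (x - L))) * w (x - L) = 0"
        by (auto simp: u_def)
    qed
  qed
qed

text \<open>Two solutions with Wronskian 1 have no common zero, so for each \<open>x\<close> one of
  them can be divided out. The centres run over the integer multiples of \<open>L\<close>, a
  countable set, so one null set serves all windows.\<close>

theorem commuting_imp_periodic:
  assumes com: "\<And>f. sq_int f \<Longrightarrow> R \<i> (T L f) = T L (R \<i> f)" and L: "L > 0"
  shows "AE x in lebesgue. V (x + L) = V x"
proof -
  let ?q = "\<lambda>t. complex_of_real (V t) - \<i>"
  have lq: "locint ?q" by (rule locint_potential[OF V])
  obtain w w' where w: "ode ?q (\<lambda>_. 0) w w'" "w 0 = 1" "w' 0 = 0" using ode_exists[OF lq locint_const]
    by metis
  obtain v v' where v: "ode ?q (\<lambda>_. 0) v v'" "v 0 = 0" "v' 0 = 1" using ode_exists[OF lq locint_const]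
    by metis
  have nz: "w x \<noteq> 0 \<or> v x \<noteq> 0" for x
    using wronskian[OF w(1) v(1), of x 0] w v by auto
  have "AE x in lebesgue. \<forall>k::int. (\<bar>x - L - real_of_int k * L\<bar> \<le> L / 2 \<longrightarrow> (complex_of_real (V x)
    - complex_of_real (V (x - L))) * w (x - L) = 0)
    \<and> (\<bar>x - L - real_of_int k * L\<bar> \<le> L / 2 \<longrightarrow> (complex_of_real (V x) - complex_of_real (V (x - L))) * v (x
      - L) = 0)"
    unfolding AE_all_countable AE_conj_iff
    by (intro allI conjI commuting_imp_local[OF com L w(1)] commuting_imp_local[OF com L v(1)])
  then have "AE x in lebesgue. V x = V (x - L)"
  proof eventually_elim
    case (elim x)
    \<comment> \<open>The nearest integer puts \<open>x - L\<close> within \<open>L / 2\<close> of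
      the centre \<open>k * L\<close>.\<close>
    define k where "k = round ((x - L) / L)"
    have "\<bar>(x - L) / L - real_of_int k\<bar> \<le> 1 / 2"
      unfolding k_def using of_int_round_abs_le[of "(x - L) / L"] by (simp add: abs_minus_commute)
    then have "\<bar>(x - L) / L - real_of_int k\<bar> * L \<le> 1 / 2 * L" using L by (intro mult_right_mono) auto
    moreover have "\<bar>(x - L) / L - real_of_int k\<bar> * L = \<bar>x - L - real_of_int k * L\<bar>"
    proof -
      have "\<bar>(x - L) / L - real_of_int k\<bar> * L = \<bar>((x - L) / L - real_of_int k) * L\<bar>" using L
        by (simp add: abs_mult)
      also have "((x - L) / L - real_of_int k) * L = x - L - real_of_int k * L" using L
        by (simp add: field_simps)
      finally show ?thesis .
    qed
    ultimately have "\<bar>x - L - real_of_int k * L\<bar> \<le> L / 2" by simp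
    with elim nz[of "x - L"] have "complex_of_real (V x) - complex_of_real (V (x - L)) = 0" by auto
    then show ?case by simp
  qed
  then obtain N where N: "negligible N" "\<And>x. x \<notin> N \<Longrightarrow> V x = V (x - L)"
    by (auto simp: eventually_ae_filter_negligible)
  have "negligible ((\<lambda>x. - L + x) ` N)" by (rule negligible_translation[OF N(1)])
  moreover have "V (x + L) = V x" if "x \<notin> (\<lambda>x. - L + x) ` N" for x
  proof -
    have "x + L \<notin> N"
    proof
      assume "x + L \<in> N"
      then have "- L + (x + L) \<in> (\<lambda>x. - L + x) ` N" by (rule imageI)
      then show False using that by simp
    qed
    then show ?thesis using N(2)[of "x + L"] by simp
  qed
  ultimately show ?thesis by (auto simp: eventually_ae_filter_negligible)
qed

end

section \<open>The discriminant\<close>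

abbreviation pot :: "(real \<Rightarrow> real) \<Rightarrow> complex \<Rightarrow> real \<Rightarrow> complex" where
  "pot W z \<equiv> \<lambda>t. complex_of_real (W t) - z"

lemma pot_locint: "locint W \<Longrightarrow> locint (pot W z)"
  by (intro locint_diff locint_const locint_linear[OF bounded_linear_of_real])

lemma solves_iff_ode:
  assumes W: "locint W"
  shows "solves W E u u' \<longleftrightarrow> ode (pot W E) (\<lambda>_. 0) u u'"
proof
  assume s: "solves W E u u'"
  then have c: "continuous_on UNIV u" "continuous_on UNIV u'" unfolding solves_def by blast+
  have l: "locint (\<lambda>t. (complex_of_real (W t) - E) * u t)"
    by (rule locint_mult_cont[OF c(1) pot_locint[OF W]])
  show "ode (pot W E) (\<lambda>_. 0) u u'"
    using s acd_int0_iff[OF locint_continuous[OF c(2)], of u] acd_int0_iff[OF l, of u']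
    unfolding solves_def ode_def diff_0_right by blast
next
  assume o: "ode (pot W E) (\<lambda>_. 0) u u'"
  then have a: "acd u u'" "acd u' (\<lambda>t. (complex_of_real (W t) - E) * u t)" unfolding ode_def diff_0_right
    by auto
  show "solves W E u u'"
    unfolding solves_def
    using acd_continuous[OF a(1)] acd_continuous[OF a(2)] acd_int0_iff[OF acd_locint[OF a(1)], of u]
      acd_int0_iff[OF acd_locint[OF a(2)], of u'] a
    by blast
qed

text \<open>Uniqueness for the initial value problem justifies the definite description in
  \<open>fundsol\<close>.\<close>

lemma fundsol_unique:
  assumes W: "locint W" and o: "ode (pot W E) (\<lambda>_. 0) u u'"
  shows "fundsol W E (u 0) (u' 0) = (u, u')"
  unfolding fundsol_def
proof (rule the_equality)
  show "solves W E (fst (u, u')) (snd (u, u')) \<and> fst (u, u') 0 = u 0 \<and> snd (u, u') 0 = u' 0"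
    using o solves_iff_ode[OF W] by simp
  fix p assume p: "solves W E (fst p) (snd p) \<and> fst p 0 = u 0 \<and> snd p 0 = u' 0"
  then have "ode (pot W E) (\<lambda>_. 0) (fst p) (snd p)" using solves_iff_ode[OF W] by simp
  from ode_unique[OF this o pot_locint[OF W]] p show "p = (u, u')" by (metis prod.collapse)
qed

lemma fundsol_ode:
  assumes W: "locint W"
  shows "ode (pot W E) (\<lambda>_. 0) (fst (fundsol W E a b)) (snd (fundsol W E a b))"
    "fst (fundsol W E a b) 0 = a" "snd (fundsol W E a b) 0 = b"
proof -
  obtain u u' where u: "ode (pot W E) (\<lambda>_. 0) u u'" "u 0 = a" "u' 0 = b"
    using ode_exists[OF pot_locint[OF W] locint_const] by metis
  have "fundsol W E a b = (u, u')" using fundsol_unique[OF W u(1)] u by simp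
  then show "ode (pot W E) (\<lambda>_. 0) (fst (fundsol W E a b)) (snd (fundsol W E a b))"
    "fst (fundsol W E a b) 0 = a" "snd (fundsol W E a b) 0 = b" using u by simp_all
qed

text \<open>Conjugating a solution for \<open>E\<close> gives one for \<open>cnj E\<close>, since
  \<open>W\<close> is real; hence the discriminant is real on the real line.\<close>

lemma discr_cnj:
  assumes W: "locint W"
  shows "discr W L (cnj E) = cnj (discr W L E)"
proof -
  have *: "fundsol W (cnj E) (cnj a) (cnj b) = (\<lambda>x. cnj (fst (fundsol W E a b) x), \<lambda>x. cnj (snd (fundsol W E
    a b) x))" for a b
  proof -
    define u where "u = fst (fundsol W E a b)"
    define u' where "u' = snd (fundsol W E a b)"
    have u: "acd u u'" "acd u' (\<lambda>t. (complex_of_real (W t) - E) * u t)" "u 0 = a" "u' 0 = b"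
      using fundsol_ode[OF W, of E a b] by (simp_all add: ode_def u_def u'_def)
    have "ode (pot W (cnj E)) (\<lambda>_. 0) (\<lambda>x. cnj (u x)) (\<lambda>x. cnj (u' x))"
      unfolding ode_def using acd_cnj[OF u(1)] acd_cnj[OF u(2)] by simp
    from fundsol_unique[OF W this] u show ?thesis by (simp add: u_def u'_def)
  qed
  show ?thesis using *[of 1 0] *[of 0 1] by (simp add: discr_def u_N_def u_D'_def)
qed

lemma discr_real: "locint W \<Longrightarrow> cnj (discr W L (complex_of_real l)) = discr W L (complex_of_real l)"
  using discr_cnj[of W L "complex_of_real l"] by simp

section \<open>Dependence of solutions on the spectral parameter\<close>

definition Kint :: "(real \<Rightarrow> real) \<Rightarrow> complex \<Rightarrow> real \<Rightarrow> real \<Rightarrow> real" where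
  "Kint W z a b = integral {a..b} (\<lambda>t. 1 + cmod (pot W z t))"

lemma Kint_bound:
  assumes W: "locint W" and ab: "a \<le> b"
  shows "Kint W z a b \<le> integral {a..b} (\<lambda>t. \<bar>W t\<bar>) + (1 + cmod z) * (b - a)"
proof -
  have l: "locint (\<lambda>t. \<bar>W t\<bar>)" using locint_norm[OF W] by simp
  have "Kint W z a b \<le> integral {a..b} (\<lambda>t. \<bar>W t\<bar> + (1 + cmod z))"
    unfolding Kint_def
  proof (rule integral_le_locint)
    show "1 + cmod (pot W z t) \<le> \<bar>W t\<bar> + (1 + cmod z)" for t
      using norm_triangle_ineq4[of "complex_of_real (W t)" z] by simp
  qed (intro locint_add locint_const locint_norm pot_locint W l)+
  also have "\<dots> = integral {a..b} (\<lambda>t. \<bar>W t\<bar>) + (1 + cmod z) * (b - a)"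
    using ab by (subst Henstock_Kurzweil_Integration.integral_add) (auto intro!: locint_integrable l)
  finally show ?thesis .
qed

text \<open>The difference solves either equation, with \<open>z - w\<close> times the other
  solution as source. The first form serves the Lipschitz bound, the second one the
  derivative.\<close>

lemma ode_param_diff:
  assumes u: "ode (pot W z) f u u'" and v: "ode (pot W w) f v v'"
  shows "ode (pot W z) (\<lambda>t. (z - w) * v t) (\<lambda>t. u t - v t) (\<lambda>t. u' t - v' t)"
    "ode (pot W w) (\<lambda>t. (z - w) * u t) (\<lambda>t. u t - v t) (\<lambda>t. u' t - v' t)"
proof -
  have a: "acd (\<lambda>t. u t - v t) (\<lambda>t. u' t - v' t)" using u v by (auto simp: ode_def intro: acd_diff)
  have b: "acd (\<lambda>t. u' t - v' t) (\<lambda>t. (pot W z t * u t - f t) - (pot W w t * v t - f t))"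
    by (rule acd_diff) (use u v in \<open>auto simp: ode_def\<close>)
  show "ode (pot W z) (\<lambda>t. (z - w) * v t) (\<lambda>t. u t - v t) (\<lambda>t. u' t - v' t)"
    "ode (pot W w) (\<lambda>t. (z - w) * u t) (\<lambda>t. u t - v t) (\<lambda>t. u' t - v' t)"
    unfolding ode_def using a b by (auto simp: algebra_simps)
qed

text \<open>The difference has zero Cauchy data at \<open>c\<close> and a source of size
  \<open>cmod (z - w)\<close> times the sup bound for \<open>v\<close>, so \<open>ode_bound\<close>
  applies twice.\<close>

lemma ode_lipschitz:
  assumes W: "locint W" and f: "locint f" and u: "ode (pot W z) f u u'" and v: "ode (pot W w) f v v'"
    and c: "u c = v c" "u' c = v' c" and x: "c \<in> {a..b}" "x \<in> {a..b}"
  shows "cmod (u x - v x) + cmod (u' x - v' x) \<le> cmod (z - w) * ((b - a) * ((cmod (v c) + cmod (v' c)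
    + integral {a..b} (\<lambda>t. cmod (f t))) * exp (Kint W w a b)) * exp (Kint W z a b))"
proof -
  define M where "M = (cmod (v c) + cmod (v' c) + integral {a..b} (\<lambda>t. cmod (f t))) * exp (Kint W w a b)"
  have M: "cmod (v t) \<le> M" if "t \<in> {a..b}" for t
  proof -
    have "cmod (v t) + cmod (v' t) \<le> M"
      using ode_bound[OF v pot_locint[OF W] f x(1) that] by (simp add: M_def Kint_def)
    then show ?thesis using norm_ge_zero[of "v' t"] by linarith
  qed
  have cv: "continuous_on UNIV v" using v by (auto simp: ode_def intro: acd_continuous)
  have lv: "locint (\<lambda>t. (z - w) * v t)" by (intro locint_continuous continuous_intros cv)
  have "cmod (u x - v x) + cmod (u' x - v' x) \<le> integral {a..b} (\<lambda>t. cmod ((z - w) * v t))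
    * exp (Kint W z a b)"
    using ode_bound[OF ode_param_diff(1)[OF u v] pot_locint[OF W] lv x] c by (simp add: Kint_def)
  also have "integral {a..b} (\<lambda>t. cmod ((z - w) * v t)) \<le> integral {a..b} (\<lambda>t. cmod (z - w) * M)"
    using M by (intro integral_le_locint locint_norm lv locint_const) (simp add: norm_mult mult_left_mono)
  also have "\<dots> = cmod (z - w) * ((b - a) * M)" using x by simp
  finally show ?thesis by (simp add: M_def mult_ac mult_right_mono)
qed

text \<open>The candidate derivative \<open>y\<close> solves the variational equation, with
  \<open>u w\<close> as source. The error of the difference quotient solves the same equation with
  source \<open>u z - u w\<close>, which is O(|z - w|) by the Lipschitz bound.\<close>

lemma fundsol_deriv:
  assumes W: "locint W"
  shows "(\<lambda>E. fst (fundsol W E \<alpha> \<beta>) x) field_differentiable (at w)"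
    "(\<lambda>E. snd (fundsol W E \<alpha> \<beta>) x) field_differentiable (at w)"
proof -
  define u where "u E = fst (fundsol W E \<alpha> \<beta>)" for E
  define u' where "u' E = snd (fundsol W E \<alpha> \<beta>)" for E
  have o: "ode (pot W E) (\<lambda>_. 0) (u E) (u' E)" "u E 0 = \<alpha>" "u' E 0 = \<beta>" for E
    using fundsol_ode[OF W] by (auto simp: u_def u'_def)
  have cu: "continuous_on UNIV (u E)" for E using o by (auto simp: ode_def intro: acd_continuous)
  obtain y y' where y: "ode (pot W w) (u w) y y'" "y 0 = 0" "y' 0 = 0"
    using ode_exists[OF pot_locint[OF W] locint_continuous[OF cu]] by metis
  define a where "a = - \<bar>x\<bar>"
  define b where "b = \<bar>x\<bar>"
  have ab: "a \<le> b" "0 \<in> {a..b}" "x \<in> {a..b}"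
    using abs_ge_self[of x] abs_ge_minus_self[of x] unfolding a_def b_def by auto
  \<comment> \<open>A Lipschitz constant uniform over \<open>cmod (z - w) < 1\<close>; the
    \<open>cmod w + 1\<close> in the exponent bounds \<open>cmod z\<close> there.\<close>
  define C where "C = (b - a) * ((cmod \<alpha> + cmod \<beta>) * exp (Kint W w a b)) * exp (integral {a..b} (\<lambda>t. \<bar>W t\<bar>)
    + (1 + (cmod w + 1)) * (b - a))"
  define B where "B = (b - a) * C * exp (Kint W w a b)"
  have est: "cmod ((u z x - u w x) / (z - w) - y x) + cmod ((u' z x - u' w x) / (z - w) - y' x)
    \<le> cmod (z - w) * B"
    if z: "z \<noteq> w" "cmod (z - w) < 1" for z
  proof -
    have Kz: "Kint W z a b \<le> integral {a..b} (\<lambda>t. \<bar>W t\<bar>) + (1 + (cmod w + 1)) * (b - a)"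
    proof -
      have "cmod z \<le> cmod w + 1" using z norm_triangle_ineq2[of z w] by linarith
      then have "(1 + cmod z) * (b - a) \<le> (1 + (cmod w + 1)) * (b - a)"
        using ab by (intro mult_right_mono) auto
      then show ?thesis using Kint_bound[OF W ab(1), of z] by linarith
    qed
    have lip: "cmod (u z t - u w t) \<le> cmod (z - w) * C" if t: "t \<in> {a..b}" for t
    proof -
      have "cmod (u z t - u w t) + cmod (u' z t - u' w t) \<le> cmod (z - w) * ((b - a) * ((cmod \<alpha> + cmod \<beta>)
        * exp (Kint W w a b)) * exp (Kint W z a b))"
        using ode_lipschitz[OF W locint_const o(1) o(1), of z 0 w a b t] o(2,3) ab t by simp
      also have "\<dots> \<le> cmod (z - w) * C"
        unfolding C_def using Kz ab by (intro mult_left_mono) auto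
      finally show ?thesis using norm_ge_zero[of "u' z t - u' w t"] by linarith
    qed
    have dlin: "ode (pot W w) (\<lambda>t. (1 / (z - w)) * ((z - w) * u z t) + (-1) * u w t)
       (\<lambda>t. (1 / (z - w)) * (u z t - u w t) + (-1) * y t) (\<lambda>t. (1 / (z - w)) * (u' z t - u' w t) + (-1)
         * y' t)"
      by (rule ode_lin[OF ode_param_diff(2)[OF o(1) o(1)] y(1)])
    have d: "ode (pot W w) (\<lambda>t. u z t - u w t)
       (\<lambda>t. (u z t - u w t) / (z - w) - y t) (\<lambda>t. (u' z t - u' w t) / (z - w) - y' t)"
      using dlin z(1) by simp
    have ld: "locint (\<lambda>t. u z t - u w t)" by (intro locint_continuous continuous_intros cu)
    have "cmod ((u z x - u w x) / (z - w) - y x) + cmod ((u' z x - u' w x) / (z - w) - y' x)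
       \<le> integral {a..b} (\<lambda>t. cmod (u z t - u w t)) * exp (Kint W w a b)"
      using ode_bound[OF d pot_locint[OF W] ld ab(2,3)] o y by (simp add: Kint_def)
    also have "\<dots> \<le> integral {a..b} (\<lambda>t. cmod (z - w) * C) * exp (Kint W w a b)"
      by (intro mult_right_mono integral_le_locint lip locint_norm ld locint_const) auto
    also have "\<dots> = cmod (z - w) * B" using ab by (simp add: B_def)
    finally show ?thesis .
  qed
  have ev: "\<forall>\<^sub>F z in at w. z \<noteq> w \<and> cmod (z - w) < 1"
    unfolding eventually_at dist_norm by (intro exI[of _ 1]) auto
  have "((\<lambda>z. cmod (z - w) * B) \<longlongrightarrow> cmod (w - w) * B) (at w)" by (intro tendsto_intros)
  then have lim0: "((\<lambda>z. cmod (z - w) * B) \<longlongrightarrow> 0) (at w)" by simp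
  have "((\<lambda>z. (u z x - u w x) / (z - w) - y x) \<longlongrightarrow> 0) (at w)"
  proof (rule Lim_null_comparison[OF _ lim0])
    show "\<forall>\<^sub>F z in at w. cmod ((u z x - u w x) / (z - w) - y x) \<le> cmod (z - w) * B"
      using ev
    proof eventually_elim
      case (elim z)
      then show ?case using est[of z] norm_ge_zero[of "(u' z x - u' w x) / (z - w) - y' x"] by linarith
    qed
  qed
  then have "((\<lambda>E. u E x) has_field_derivative y x) (at w)"
    by (simp add: has_field_derivative_iff LIM_zero_iff)
  then show "(\<lambda>E. fst (fundsol W E \<alpha> \<beta>) x) field_differentiable (at w)"
    unfolding u_def field_differentiable_def by blast
  have "((\<lambda>z. (u' z x - u' w x) / (z - w) - y' x) \<longlongrightarrow> 0) (at w)"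
  proof (rule Lim_null_comparison[OF _ lim0])
    show "\<forall>\<^sub>F z in at w. cmod ((u' z x - u' w x) / (z - w) - y' x) \<le> cmod (z - w) * B"
      using ev
    proof eventually_elim
      case (elim z)
      then show ?case using est[of z] norm_ge_zero[of "(u z x - u w x) / (z - w) - y x"] by linarith
    qed
  qed
  then have "((\<lambda>E. u' E x) has_field_derivative y' x) (at w)"
    by (simp add: has_field_derivative_iff LIM_zero_iff)
  then show "(\<lambda>E. snd (fundsol W E \<alpha> \<beta>) x) field_differentiable (at w)"
    unfolding u'_def field_differentiable_def by blast
qed

theorem discr_holomorphic:
  assumes "locint W" shows "discr W L holomorphic_on UNIV"
  unfolding discr_def[abs_def] u_N_def u_D'_def
  by (intro holomorphic_on_add)
     (simp_all add: holomorphic_on_def fundsol_deriv[OF assms] field_differentiable_at_within)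

lemma discr_continuous: "locint W \<Longrightarrow> continuous_on UNIV (discr W L)"
  by (intro holomorphic_on_imp_continuous_on discr_holomorphic)

lemma discr_measurable: "locint W \<Longrightarrow> (\<lambda>l. discr W L (complex_of_real l)) \<in> borel_measurable borel"
  by (intro borel_measurable_continuous_onI continuous_on_compose2[OF discr_continuous] continuous_intros)
    auto

section \<open>Monodromy of a periodic potential\<close>

locale periodic_potential = 
  fixes V :: "real \<Rightarrow> real" and L :: real
  assumes lV: "locint V" and per: "AE x in lebesgue. V (x + L) = V x"
begin

text \<open>Second derivatives are fixed only up to null sets, so periodicity almost everywhere is
  enough.\<close>

lemma ode_shift:
  assumes "ode (pot V z) f u u'"
  shows "ode (pot V z) (\<lambda>t. f (t + L)) (\<lambda>t. u (t + L)) (\<lambda>t. u' (t + L))"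
proof -
  have a: "acd u u'" "acd u' (\<lambda>t. pot V z t * u t - f t)" using assms by (auto simp: ode_def)
  have "acd (\<lambda>t. u' (t + L)) (\<lambda>t. pot V z t * u (t + L) - f (t + L))"
    by (rule acd_cong_AE[OF acd_shift[OF a(2)]]) (use per in eventually_elim, simp)
  then show ?thesis using acd_shift[OF a(1)] by (simp add: ode_def)
qed

text \<open>Cayley-Hamilton for the monodromy matrix, whose determinant is a Wronskian and equals 1:
  \<open>u (t + 2 L) - \<Delta> u (t + L) + u t\<close> has zero Cauchy data at 0 and solves the
  homogeneous equation, so it vanishes for all \<open>t\<close>.\<close>

lemma monodromy:
  assumes o: "ode (pot V z) (\<lambda>_. 0) u u'"
  shows "u (x + L) + u (x - L) = discr V L z * u x" "u' (x + L) + u' (x - L) = discr V L z * u' x"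
proof -
  define th where "th = fst (fundsol V z 1 0)"
  define th' where "th' = snd (fundsol V z 1 0)"
  define ph where "ph = fst (fundsol V z 0 1)"
  define ph' where "ph' = snd (fundsol V z 0 1)"
  have t: "ode (pot V z) (\<lambda>_. 0) th th'" "th 0 = 1" "th' 0 = 0"
    and p: "ode (pot V z) (\<lambda>_. 0) ph ph'" "ph 0 = 0" "ph' 0 = 1"
    using fundsol_ode[OF lV] by (auto simp: th_def th'_def ph_def ph'_def)
  have D: "discr V L z = th L + ph' L" by (simp add: discr_def u_N_def u_D'_def th_def ph'_def)
  have det: "th L * ph' L - th' L * ph L = 1" using wronskian[OF t(1) p(1), of L 0] t p by simp
  have rep: "v x = v 0 * th x + v' 0 * ph x" "v' x = v 0 * th' x + v' 0 * ph' x"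
    if v: "ode (pot V z) (\<lambda>_. 0) v v'" for v v' x
  proof -
    have "ode (pot V z) (\<lambda>_. 0) (\<lambda>t. v 0 * th t + v' 0 * ph t) (\<lambda>t. v 0 * th' t + v' 0 * ph' t)"
      using ode_lin[OF t(1) p(1), of "v 0" "v' 0"] by simp
    from ode_unique[OF v this pot_locint[OF lV], of 0] t p
    show "v x = v 0 * th x + v' 0 * ph x" "v' x = v 0 * th' x + v' 0 * ph' x" by (auto dest: fun_cong)
  qed
  have o1: "ode (pot V z) (\<lambda>_. 0) (\<lambda>t. u (t + L)) (\<lambda>t. u' (t + L))" using ode_shift[OF o] by simp
  have o2: "ode (pot V z) (\<lambda>_. 0) (\<lambda>t. u (t + L + L)) (\<lambda>t. u' (t + L + L))" using ode_shift[OF o1] by simp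
  have "ode (pot V z) (\<lambda>_. 0) (\<lambda>t. 1 * u (t + L + L) + 1 * u t) (\<lambda>t. 1 * u' (t + L + L) + 1 * u' t)"
    using ode_lin[OF o2 o, of 1 1] by simp
  from ode_lin[OF this o1, of 1 "- discr V L z"]
  have oz: "ode (pot V z) (\<lambda>_. 0) (\<lambda>t. u (t + L + L) + u t - discr V L z * u (t + L)) (\<lambda>t. u' (t + L + L)
    + u' t - discr V L z * u' (t + L))"
    by simp
  have a: "u L = u 0 * th L + u' 0 * ph L" "u' L = u 0 * th' L + u' 0 * ph' L" using rep[OF o, of L] by auto
  have b: "u (L + L) = u L * th L + u' L * ph L" "u' (L + L) = u L * th' L + u' L * ph' L"
    using rep[OF o1, of L] by auto
  have c1: "u (L + L) + u 0 - discr V L z * u L = u 0 * (1 - (th L * ph' L - th' L * ph L))"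
    unfolding b D a by (simp add: algebra_simps)
  have c2: "u' (L + L) + u' 0 - discr V L z * u' L = u' 0 * (1 - (th L * ph' L - th' L * ph L))"
    unfolding b D a by (simp add: algebra_simps)
  have z0: "(\<lambda>t. u (t + L + L) + u t - discr V L z * u (t + L)) = (\<lambda>_. 0) \<and> (\<lambda>t. u' (t + L + L) + u' t
    - discr V L z * u' (t + L)) = (\<lambda>_. 0)"
    by (rule ode_zero[OF oz pot_locint[OF lV], of 0]) (use c1 c2 det in auto)
  from fun_cong[OF conjunct1[OF z0], of "x - L"] fun_cong[OF conjunct2[OF z0], of "x - L"]
  show "u (x + L) + u (x - L) = discr V L z * u x" "u' (x + L) + u' (x - L) = discr V L z * u' x"
    by (simp_all add: algebra_simps)
qed

lemma discr_0: "discr V 0 z = 2"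
  using fundsol_ode[OF lV] by (simp add: discr_def u_N_def u_D'_def)

text \<open>\<open>monodromy\<close> for the two fundamental solutions, the second one
  differentiated, added up: the Chebyshev recursion for traces of powers of the monodromy
  matrix.\<close>

lemma discr_recurrence:
  "discr V (real (n + 2) * L) z = discr V L z * discr V (real (n + 1) * L) z - discr V (real n * L) z"
proof -
  have e: "real (n + 1) * L + L = real (n + 2) * L" "real (n + 1) * L - L = real n * L"
    by (simp_all add: algebra_simps)
  show ?thesis
    using monodromy(1)[OF fundsol_ode(1)[OF lV], of z 1 0 "real (n + 1) * L"]
      monodromy(2)[OF fundsol_ode(1)[OF lV], of z 0 1 "real (n + 1) * L"]
    unfolding e by (simp add: discr_def u_N_def u_D'_def algebra_simps)
qed

text \<open>Periodicity almost everywhere composes because translates of null sets are null.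
  \<open>periodic_potential\<close> leaves positivity of the period to
  \<open>periodic_schroedinger\<close>, so the induction can start at period 0.\<close>

lemma periodic_multiple: "periodic_potential V (real n * L)"
proof (induction n)
  case 0
  show ?case by unfold_locales (use lV in auto)
next
  case (Suc n)
  interpret m: periodic_potential V "real n * L" by fact
  obtain N where N: "negligible N" "\<And>x. x \<notin> N \<Longrightarrow> V (x + real n * L) = V x"
    using m.per by (auto simp: eventually_ae_filter_negligible)
  obtain N' where N': "negligible N'" "\<And>x. x \<notin> N' \<Longrightarrow> V (x + L) = V x"
    using per by (auto simp: eventually_ae_filter_negligible)
  define S where "S = N \<union> (\<lambda>x. - (real n * L) + x) ` N'"
  have "negligible S" unfolding S_def
    by (intro negligible_Un N(1) negligible_translation N'(1))
  moreover have "V (x + real (Suc n) * L) = V x" if xS: "x \<notin> S" for x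
  proof -
    have "x + real n * L \<notin> N'"
    proof
      assume "x + real n * L \<in> N'"
      then have "- (real n * L) + (x + real n * L) \<in> (\<lambda>x. - (real n * L) + x) ` N'" by (rule imageI)
      then show False using xS by (simp add: S_def)
    qed
    then have "V (x + real n * L + L) = V x" using N(2)[of x] N'(2)[of "x + real n * L"] xS
      by (simp add: S_def)
    then show ?thesis by (simp add: algebra_simps)
  qed
  ultimately have "AE x in lebesgue. V (x + real (Suc n) * L) = V x"
    by (auto simp: eventually_ae_filter_negligible)
  then show ?case using lV by unfold_locales
qed

end

section \<open>Cauchy transforms\<close>

text \<open>The value on the diagonal removes the singularity, so for entire \<open>g\<close> this
  is entire in \<open>z\<close>.\<close>

definition diff_quot :: "(complex \<Rightarrow> complex) \<Rightarrow> complex \<Rightarrow> complex \<Rightarrow> complex" where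
  "diff_quot g w z = (if z = w then deriv g w else (g z - g w) / (z - w))"

lemma diff_quot_commute: "diff_quot g w z = diff_quot g z w"
proof (cases "z = w")
  case False
  have "(g z - g w) / (z - w) = (- (g z - g w)) / (- (z - w))" by (rule minus_divide_divide[symmetric])
  also have "\<dots> = (g w - g z) / (w - z)" by (simp only: minus_diff_eq)
  finally show ?thesis using False False[symmetric] unfolding diff_quot_def by (simp only: if_False)
qed (simp only:)

lemma diff_quot_holomorphic: "g holomorphic_on UNIV \<Longrightarrow> diff_quot g w holomorphic_on UNIV"
  unfolding diff_quot_def[abs_def] by (rule pole_lemma_open) auto

lemma diff_quot_bound_near:
  assumes g: "g holomorphic_on UNIV" and B: "\<And>z. z \<in> cball 0 r \<Longrightarrow> cmod (deriv g z) \<le> B"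
    and z: "z \<in> cball 0 r" "w \<in> cball 0 r"
  shows "cmod (diff_quot g w z) \<le> B"
proof (cases "z = w")
  case True
  then have "diff_quot g w z = deriv g w" unfolding diff_quot_def by simp
  then show ?thesis using B[OF z(2)] by simp
next
  case False
  have "cmod (g z - g w) \<le> B * cmod (z - w)"
  proof (rule field_differentiable_bound[where f = g and f' = "deriv g" and S = "cball 0 r"])
    show "(g has_field_derivative deriv g x) (at x within cball 0 r)" for x
      by (rule has_field_derivative_at_within[OF holomorphic_derivI[OF g]]) auto
  qed (use B z in auto)
  moreover have "0 < cmod (z - w)" using False by simp
  moreover have "cmod (diff_quot g w z) = cmod (g z - g w) / cmod (z - w)"
    using False by (simp only: diff_quot_def if_False norm_divide)
  ultimately show ?thesis by (simp only: pos_divide_le_eq)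
qed

text \<open>Dominated convergence along a bounded sequence \<open>z n\<close>: for \<open>l\<close>
  within distance 1 of \<open>z n\<close> a bound on the derivative of \<open>g\<close> is used,
  farther away \<open>cmod (g l)\<close> plus a bound on \<open>g (z n)\<close>. Real points
  \<open>z\<close>, where \<open>CT\<close> itself may be singular, are included.\<close>

lemma diff_quot_integral_continuous:
  assumes s: "sets \<mu> = sets borel" and fin: "finite_measure \<mu>" and g: "g holomorphic_on UNIV"
    and gi: "integrable \<mu> (\<lambda>l. g (complex_of_real l))"
  shows "continuous_on UNIV (\<lambda>z. \<integral>l. diff_quot g z (complex_of_real l) \<partial>\<mu>)"
proof -
  interpret finite_measure \<mu> by (rule fin)
  have [measurable_cong]: "sets \<mu> = sets borel" by (rule s)
  have dm: "(\<lambda>l. diff_quot g z (complex_of_real l)) \<in> borel_measurable \<mu>" for z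
  proof -
    have "(\<lambda>l. diff_quot g z (complex_of_real l)) \<in> borel_measurable borel"
      by (intro borel_measurable_continuous_onI continuous_on_compose2[OF
        holomorphic_on_imp_continuous_on[OF diff_quot_holomorphic[OF g]]] continuous_intros) auto
    then show ?thesis by measurable
  qed
  have gc: "continuous_on UNIV g" by (rule holomorphic_on_imp_continuous_on[OF g])
  have g'c: "continuous_on UNIV (deriv g)"
    by (rule holomorphic_on_imp_continuous_on[OF holomorphic_deriv[OF g]]) simp
  show ?thesis unfolding continuous_on_sequentially
  proof (intro ballI allI impI)
    fix z :: "nat \<Rightarrow> complex" and a
    assume "a \<in> UNIV" "(\<forall>n. z n \<in> UNIV) \<and> z \<longlonglongrightarrow> a"
    then have za: "z \<longlonglongrightarrow> a" by simp
    have "Bseq z" by (rule convergent_imp_Bseq[OF convergentI[OF za]])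
    then obtain r where r: "\<And>n. cmod (z n) \<le> r" by (meson BseqE)
    define R where "R = r + 1"
    have zR: "z n \<in> cball 0 R" for n using r[of n] by (simp add: R_def)
    have "bounded (deriv g ` cball 0 R)" "bounded (g ` cball 0 R)"
      by (intro compact_imp_bounded compact_continuous_image continuous_on_subset[OF g'c]
        continuous_on_subset[OF gc]; simp)+
    then obtain B1 B2 where "\<forall>w\<in>deriv g ` cball 0 R. cmod w \<le> B1" "\<forall>w\<in>g ` cball 0 R. cmod w \<le> B2"
      unfolding bounded_iff by blast
    then have B1: "\<And>w. w \<in> cball 0 R \<Longrightarrow> cmod (deriv g w) \<le> B1"
      and B2: "\<And>w. w \<in> cball 0 R \<Longrightarrow> cmod (g w) \<le> B2" by blast+
    have B0: "0 \<le> B1" "0 \<le> B2" using B1[OF zR] B2[OF zR] norm_ge_zero order_trans by blast+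
    show "((\<lambda>z. \<integral>l. diff_quot g z (complex_of_real l) \<partial>\<mu>) \<circ> z) \<longlonglongrightarrow> (\<integral>l. diff_quot g a (complex_of_real l) \<partial>\<mu>)"
      unfolding o_def
    proof (rule integral_dominated_convergence[where w = "\<lambda>l. cmod (g (complex_of_real l)) + B2 + B1"])
      show "integrable \<mu> (\<lambda>l. cmod (g (complex_of_real l)) + B2 + B1)" using gi by simp
      show "AE l in \<mu>. (\<lambda>n. diff_quot g (z n) (complex_of_real l)) \<longlonglongrightarrow> diff_quot g a (complex_of_real l)"
      proof (rule AE_I2)
        fix l
        have "continuous_on UNIV (diff_quot g (complex_of_real l))"
          by (rule holomorphic_on_imp_continuous_on[OF diff_quot_holomorphic[OF g]])
        then have "isCont (diff_quot g (complex_of_real l)) a" by (simp add: continuous_on_eq_continuous_at)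
        from isCont_tendsto_compose[OF this za]
        show "(\<lambda>n. diff_quot g (z n) (complex_of_real l)) \<longlonglongrightarrow> diff_quot g a (complex_of_real l)"
          by (simp add: diff_quot_commute[of g "complex_of_real l"])
      qed
      fix n
      show "AE l in \<mu>. norm (diff_quot g (z n) (complex_of_real l)) \<le> cmod (g (complex_of_real l)) + B2
        + B1"
      proof (rule AE_I2)
        fix l
        show "norm (diff_quot g (z n) (complex_of_real l)) \<le> cmod (g (complex_of_real l)) + B2 + B1"
        proof (cases "cmod (complex_of_real l - z n) \<le> 1")
          case True
          have "cmod (complex_of_real l) \<le> R"
            using norm_triangle_ineq2[of "complex_of_real l" "z n"] True r[of n] unfolding R_def by linarith
          then have "complex_of_real l \<in> cball 0 R" by simp
          have "cmod (diff_quot g (z n) (complex_of_real l)) \<le> B1"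
            by (rule diff_quot_bound_near[OF g _ \<open>complex_of_real l \<in> cball 0 R\<close> zR]) (rule B1)
          then show ?thesis using B0 norm_ge_zero[of "g (complex_of_real l)"] by linarith
        next
          case False
          then have ne: "complex_of_real l \<noteq> z n" by auto
          have "cmod (diff_quot g (z n) (complex_of_real l)) = cmod (g (complex_of_real l)
            - g (z n)) / cmod (complex_of_real l - z n)"
            using ne by (simp add: diff_quot_def norm_divide)
          also have "\<dots> \<le> cmod (g (complex_of_real l) - g (z n)) / 1"
            using False by (intro divide_left_mono) auto
          also have "\<dots> \<le> cmod (g (complex_of_real l)) + B2 + B1"
            using norm_triangle_ineq4[of "g (complex_of_real l)" "g (z n)"] B2[OF zR, of n] B0 by simp
          finally show ?thesis .
        qed
      qed
    qed (rule dm)+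
  qed
qed

lemma diff_quot_integral_eq:
  assumes s: "sets \<mu> = sets borel" and fin: "finite_measure \<mu>"
    and gi: "integrable \<mu> (\<lambda>l. g (complex_of_real l))" and z: "Im z \<noteq> 0"
  shows "(\<integral>l. diff_quot g z (complex_of_real l) \<partial>\<mu>) = CT \<mu> (\<lambda>l. g (complex_of_real l)) z - g z
    * CT \<mu> (\<lambda>_. 1) z"
proof -
  interpret finite_measure \<mu> by (rule fin)
  have i: "integrable \<mu> (\<lambda>l. 1 :: complex)" by simp
  have "(\<integral>l. diff_quot g z (complex_of_real l) \<partial>\<mu>) = (\<integral>l. g (complex_of_real l) / (complex_of_real l - z)
    - g z * (1 / (complex_of_real l - z)) \<partial>\<mu>)"
  proof (rule Bochner_Integration.integral_cong[OF refl])
    fix l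
    have "complex_of_real l \<noteq> z" using real_minus_nonreal[OF z, of l] by auto
    then show "diff_quot g z (complex_of_real l) = g (complex_of_real l) / (complex_of_real l - z) - g z
      * (1 / (complex_of_real l - z))"
      by (simp add: diff_quot_def diff_divide_distrib)
  qed
  also have "\<dots> = CT \<mu> (\<lambda>l. g (complex_of_real l)) z - g z * CT \<mu> (\<lambda>_. 1) z"
    unfolding CT_def
    by (subst Bochner_Integration.integral_diff[OF CT_integrable[OF s gi z] integrable_mult_right[OF
      CT_integrable[OF s i z]]])
       (simp only: integral_mult_right_zero)
  finally show ?thesis .
qed

text \<open>The imaginary part is a Poisson integral, and the Poisson kernel
  \<open>e / ((l - E)^2 + e^2)\<close> is at least \<open>1 / (2 * e)\<close> on the ball.\<close>

lemma Im_CT_ball: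
  assumes s: "sets \<mu> = sets borel" and fin: "finite_measure \<mu>" and e: "0 < e"
  shows "measure \<mu> (cball E e) \<le> 2 * e * Im (CT \<mu> (\<lambda>_. 1) (Complex E e))"
proof -
  interpret finite_measure \<mu> by (rule fin)
  have z: "Im (Complex E e) \<noteq> 0" using e by simp
  have i: "integrable \<mu> (\<lambda>l. 1 :: complex)" by simp
  note ci = CT_integrable[OF s i z]
  have sp: "space \<mu> = UNIV" using sets_eq_imp_space_eq[OF s] by simp
  have B: "cball E e \<in> sets \<mu>" by (simp add: s)
  have im: "Im (1 / (complex_of_real l - Complex E e)) = e / ((l - E)\<^sup>2 + e\<^sup>2)" for l
    by (simp add: complex_eq_iff Im_divide)
  have "measure \<mu> (cball E e) = (\<integral>l. indicator (cball E e) l \<partial>\<mu>)" using B by simp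
  also have "\<dots> \<le> (\<integral>l. 2 * e * Im (1 / (complex_of_real l - Complex E e)) \<partial>\<mu>)"
  proof (rule integral_mono)
    show "integrable \<mu> (indicator (cball E e) :: real \<Rightarrow> real)"
      by (rule integrable_real_indicator[OF B]) (simp add: emeasure_eq_measure)
    show "integrable \<mu> (\<lambda>l. 2 * e * Im (1 / (complex_of_real l - Complex E e)))"
      by (intro integrable_mult_right integrable_Im ci)
    fix l
    show "indicator (cball E e) l \<le> 2 * e * Im (1 / (complex_of_real l - Complex E e))"
    proof (cases "l \<in> cball E e")
      case True
      then have "\<bar>l - E\<bar> \<le> e" by (simp add: dist_real_def abs_minus_commute)
      then have "\<bar>l - E\<bar>\<^sup>2 \<le> e\<^sup>2" by (intro power_mono) auto
      then have "(l - E)\<^sup>2 + e\<^sup>2 \<le> 2 * e\<^sup>2" by simp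
      moreover have "0 < (l - E)\<^sup>2 + e\<^sup>2" using e by (simp add: add_nonneg_pos)
      ultimately have "1 \<le> 2 * e * (e / ((l - E)\<^sup>2 + e\<^sup>2))"
        by (simp add: le_divide_eq power2_eq_square)
      then show ?thesis using True by (simp only: im indicator_simps)
    next
      case False
      have "0 \<le> 2 * e * (e / ((l - E)\<^sup>2 + e\<^sup>2))" using e by simp
      moreover have "indicator (cball E e) l = (0::real)" using False by simp
      ultimately show ?thesis unfolding im by linarith
    qed
  qed
  also have "\<dots> = 2 * e * (\<integral>l. Im (1 / (complex_of_real l - Complex E e)) \<partial>\<mu>)"
    by (rule integral_mult_right_zero)
  also have "(\<integral>l. Im (1 / (complex_of_real l - Complex E e)) \<partial>\<mu>) = Im (CT \<mu> (\<lambda>_. 1) (Complex E e))"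
    unfolding CT_def by (rule integral_Im[OF ci])
  finally show ?thesis .
qed

text \<open>If small balls have measure o(e), uniformly in the centre near \<open>x\<close>, then
  covering \<open>ball x r\<close> by about \<open>2 * r / e\<close> of them shows that it is null.
  The Lindelof property collects countably many such balls.\<close>

lemma null_by_small_balls:
  fixes \<mu> :: "real measure"
  assumes s: "sets \<mu> = sets borel" and fin: "finite_measure \<mu>" and O: "open U"
    and small: "\<And>x. x \<in> U \<Longrightarrow> \<exists>r>0. \<forall>\<eta>>0. \<exists>d>0. \<forall>e E. 0 < e \<longrightarrow> e < d \<longrightarrow> \<bar>E - x\<bar> \<le> r \<longrightarrow> measure \<mu> (cball E e)
      \<le> \<eta> * e"
  shows "AE l in \<mu>. l \<notin> U"
proof -
  interpret finite_measure \<mu> by (rule fin)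
  have sp: "space \<mu> = UNIV" using sets_eq_imp_space_eq[OF s] by simp
  have sb: "cball E e \<in> sets \<mu>" "ball E e \<in> sets \<mu>" for E e :: real by (simp_all add: s)
  have "\<exists>r>0. ball x r \<in> null_sets \<mu>" if x: "x \<in> U" for x
  proof -
    obtain r where r: "r > 0" and sm: "\<And>\<eta>. \<eta> > 0 \<Longrightarrow> \<exists>d>0. \<forall>e E. 0 < e \<longrightarrow> e < d \<longrightarrow> \<bar>E - x\<bar> \<le> r
      \<longrightarrow> measure \<mu> (cball E e) \<le> \<eta> * e"
      using small[OF x] by blast
    have "measure \<mu> (ball x r) \<le> \<epsilon>" if eps: "\<epsilon> > 0" for \<epsilon>
    proof -
      \<comment> \<open>The cover has \<open>2 * N + 1 \<le> 3 * N\<close> balls of radius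
        \<open>e = r / N\<close>, with total measure at most \<open>3 * \<eta> * r\<close>.\<close>
      define \<eta> where "\<eta> = \<epsilon> / (3 * r)"
      have eta: "\<eta> > 0" using eps r by (simp add: \<eta>_def)
      obtain d where d: "d > 0" "\<And>e E. 0 < e \<Longrightarrow> e < d \<Longrightarrow> \<bar>E - x\<bar> \<le> r \<Longrightarrow> measure \<mu> (cball E e) \<le> \<eta> * e"
        using sm[OF eta] by blast
      obtain N where N: "r / d < real N" using reals_Archimedean2 by blast
      have "0 < r / d" using r d by simp
      then have N0: "0 < N" using N by (intro gr0I) auto
      define e where "e = r / real N"
      have e: "0 < e" "e < d" "real N * e = r" using N N0 r d(1) by (auto simp: e_def field_simps)
      define c where "c j = x - r + real j * e" for j
      have cj: "\<bar>c j - x\<bar> \<le> r" if "j \<le> 2 * N" for j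
      proof -
        have "real j * e \<le> real (2 * N) * e" using that e by (intro mult_right_mono) auto
        moreover have "real (2 * N) * e = 2 * r" using e(3) by simp
        ultimately have "real j * e \<le> 2 * r" by simp
        moreover have "0 \<le> real j * e" using e by simp
        ultimately show ?thesis unfolding c_def by linarith
      qed
      have sub: "ball x r \<subseteq> (\<Union>j\<in>{..2*N}. cball (c j) e)"
      proof
        fix y assume "y \<in> ball x r"
        then have y: "x - r < y" "y < x + r" by (auto simp: dist_real_def abs_less_iff)
        define j where "j = nat \<lfloor>(y - (x - r)) / e\<rfloor>"
        have fl: "0 \<le> \<lfloor>(y - (x - r)) / e\<rfloor>" using y e by (simp add: zero_le_floor)
        have j: "real j \<le> (y - (x - r)) / e" "(y - (x - r)) / e < real j + 1"
          using fl by (auto simp: j_def)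
        have j1: "real j * e \<le> y - (x - r)" using j(1) e by (simp add: pos_le_divide_eq)
        have j2: "y - (x - r) < (real j + 1) * e" using j(2) e by (simp add: pos_divide_less_eq)
        have "real j * e < 2 * (real N * e)" using j1 y e by simp
        then have "real j < 2 * real N" using e(1) by (simp add: mult.assoc[symmetric])
        then have "j \<le> 2 * N" by linarith
        moreover have "\<bar>c j - y\<bar> \<le> e" using j1 j2 unfolding c_def by (simp add: abs_le_iff algebra_simps)
        ultimately show "y \<in> (\<Union>j\<in>{..2*N}. cball (c j) e)" by (auto simp: dist_real_def)
      qed
      have "measure \<mu> (ball x r) \<le> measure \<mu> (\<Union>j\<in>{..2*N}. cball (c j) e)"
        by (rule finite_measure_mono[OF sub]) (auto intro: sb)
      also have "\<dots> \<le> (\<Sum>j\<in>{..2*N}. measure \<mu> (cball (c j) e))"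
        by (rule finite_measure_subadditive_finite) (auto intro: sb)
      also have "\<dots> \<le> (\<Sum>j\<in>{..2*N}. \<eta> * e)"
        by (intro sum_mono d(2) e cj) auto
      also have "\<dots> = (2 * real N + 1) * (\<eta> * e)" by simp
      also have "\<dots> \<le> (3 * real N) * (\<eta> * e)"
        using N0 eta e by (intro mult_right_mono) auto
      also have "\<dots> = 3 * \<eta> * r" using e(3) by (simp add: mult_ac)
      also have "\<dots> = \<epsilon>" using r by (simp add: \<eta>_def)
      finally show ?thesis .
    qed
    then have "measure \<mu> (ball x r) \<le> 0" by (rule field_le_epsilon[of _ 0, simplified])
    then have "measure \<mu> (ball x r) = 0" using measure_nonneg[of \<mu> "ball x r"] by linarith
    then have "ball x r \<in> null_sets \<mu>" using sb by (simp add: null_sets_def emeasure_eq_measure)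
    then show ?thesis using r by blast
  qed
  then obtain r where r: "\<And>x. x \<in> U \<Longrightarrow> r x > 0" "\<And>x. x \<in> U \<Longrightarrow> ball x (r x) \<in> null_sets \<mu>" by metis
  obtain F where F: "F \<subseteq> (\<lambda>x. ball x (r x)) ` U" "countable F" "\<Union>F = (\<Union>x\<in>U. ball x (r x))"
    using Lindelof[of "(\<lambda>x. ball x (r x)) ` U"] by auto
  have "(\<Union>S\<in>F. S) \<in> null_sets \<mu>"
    by (rule null_sets_UN'[OF F(2)]) (use F(1) r(2) in auto)
  then have "\<Union>F \<in> null_sets \<mu>" by simp
  moreover have "U \<subseteq> \<Union>F" unfolding F(3) using r(1) by force
  ultimately show ?thesis by (intro AE_I'[of "\<Union>F"]) auto
qed

text \<open>On the circle of radius \<open>R\<close> the factor \<open>z^2 - R^2\<close> has modulus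
  \<open>2 * R * \<bar>Im z\<bar>\<close>, which cancels the singular bound at the real axis. The
  maximum principle then bounds \<open>f z\<close> by
  \<open>2 * R * C / (R^2 - \<bar>z\<bar>^2)\<close>, which tends to 0 as \<open>R\<close>
  grows.\<close>

lemma entire_inverse_Im_bound_zero:
  assumes f: "f holomorphic_on UNIV" and C: "\<And>z. Im z \<noteq> 0 \<Longrightarrow> cmod (f z) \<le> C / \<bar>Im z\<bar>"
  shows "f z = 0"
proof -
  have "cmod (f \<i>) \<le> C" using C[of \<i>] by simp
  then have C0: "0 \<le> C" by (rule order_trans[OF norm_ge_zero])
  have b: "cmod ((z\<^sup>2 - (of_real R)\<^sup>2) * f z) \<le> 2 * R * C" if R: "cmod z < R" for R
  proof (rule maximum_modulus_frontier[of "\<lambda>z. (z\<^sup>2 - (of_real R)\<^sup>2) * f z" "ball 0 R"])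
    have R0: "0 < R" using R norm_ge_zero[of z] by linarith
    show "(\<lambda>z. (z\<^sup>2 - (of_real R)\<^sup>2) * f z) holomorphic_on interior (ball 0 R)"
      by (intro holomorphic_intros holomorphic_on_subset[OF f]) auto
    show "continuous_on (closure (ball 0 R)) (\<lambda>z. (z\<^sup>2 - (of_real R)\<^sup>2) * f z)"
      by (intro continuous_intros continuous_on_subset[OF holomorphic_on_imp_continuous_on[OF f]]) auto
    fix w :: complex assume "w \<in> frontier (ball 0 R)"
    then have w: "cmod w = R" using R0 by (simp add: frontier_ball dist_norm)
    have "w\<^sup>2 - (of_real R)\<^sup>2 = w * (w - cnj w)"
      using complex_norm_square[of w] w by (simp add: power2_eq_square algebra_simps)
    also have "w - cnj w = of_real (2 * Im w) * \<i>" by (simp add: complex_eq_iff)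
    finally have "cmod (w\<^sup>2 - (of_real R)\<^sup>2) = R * (2 * \<bar>Im w\<bar>)"
      using w by (simp add: norm_mult)
    then have e: "cmod ((w\<^sup>2 - (of_real R)\<^sup>2) * f w) = R * (2 * \<bar>Im w\<bar>) * cmod (f w)" by (simp add: norm_mult)
    show "cmod ((w\<^sup>2 - (of_real R)\<^sup>2) * f w) \<le> 2 * R * C"
    proof (cases "Im w = 0")
      case True
      then show ?thesis unfolding e using R0 C0 by simp
    next
      case False
      have "R * (2 * \<bar>Im w\<bar>) * cmod (f w) \<le> R * (2 * \<bar>Im w\<bar>) * (C / \<bar>Im w\<bar>)"
        using C[OF False] R0 by (intro mult_left_mono) auto
      then show ?thesis unfolding e using False by simp
    qed
  qed (use R in auto)
  show ?thesis
  proof (rule ccontr)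
    assume fz: "f z \<noteq> 0"
    define k where "k = cmod (f z)"
    have k: "0 < k" using fz by (simp add: k_def)
    \<comment> \<open>Large enough that \<open>(R\<^sup>2 - (cmod z)\<^sup>2) * k\<close> exceeds
      \<open>2 * R * C\<close>.\<close>
    define R where "R = cmod z + 1 + 2 * C / k + (cmod z)\<^sup>2"
    have R: "cmod z < R" "1 \<le> R" "2 * C / k + (cmod z)\<^sup>2 + 1 \<le> R"
      using C0 k norm_ge_zero[of z] zero_le_power2[of "cmod z"] divide_nonneg_pos[of "2 * C" k]
        unfolding R_def by linarith+
    have "R\<^sup>2 - (cmod z)\<^sup>2 \<le> cmod (z\<^sup>2 - (of_real R)\<^sup>2)"
      using norm_triangle_ineq2[of "(of_real R :: complex)\<^sup>2" "z\<^sup>2"]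
        by (simp add: norm_power norm_minus_commute)
    then have "(R\<^sup>2 - (cmod z)\<^sup>2) * k \<le> cmod (z\<^sup>2 - (of_real R)\<^sup>2) * k" using k by (intro mult_right_mono) auto
    also have "\<dots> \<le> 2 * R * C" using b[OF R(1)] by (simp add: norm_mult k_def)
    finally have 1: "(R\<^sup>2 - (cmod z)\<^sup>2) * k \<le> 2 * R * C" .
    have "(2 * C / k + (cmod z)\<^sup>2 + 1) * R \<le> R * R" using R by (intro mult_right_mono) auto
    then have "(2 * C / k) * R + (cmod z)\<^sup>2 * R + R \<le> R\<^sup>2" by (simp add: algebra_simps power2_eq_square)
    moreover have "(cmod z)\<^sup>2 * 1 \<le> (cmod z)\<^sup>2 * R" using R by (intro mult_left_mono) auto
    ultimately have "(2 * C / k) * R + 1 \<le> R\<^sup>2 - (cmod z)\<^sup>2" using R(2) by linarith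
    then have "((2 * C / k) * R + 1) * k \<le> (R\<^sup>2 - (cmod z)\<^sup>2) * k" using k by (intro mult_right_mono) auto
    moreover have "((2 * C / k) * R + 1) * k = 2 * R * C + k" using k by (simp add: field_simps)
    ultimately show False using 1 k by linarith
  qed
qed

text \<open>A Morera-type pasting argument across a line; the inner product with \<open>\<i>\<close>
  is the imaginary part.\<close>

lemma holomorphic_across_real_axis:
  assumes c: "continuous_on UNIV f" and h: "\<And>z. Im z \<noteq> 0 \<Longrightarrow> f field_differentiable (at z)"
  shows "f holomorphic_on UNIV"
proof (rule holomorphic_on_paste_across_line[of UNIV \<i> _ 0])
  have "f holomorphic_on {z. Im z \<noteq> 0}"
    unfolding holomorphic_on_def using h by (auto intro: field_differentiable_at_within)
  then show "f holomorphic_on UNIV \<inter> {z. \<i> \<bullet> z < 0}" "f holomorphic_on UNIV \<inter> {z. 0 < \<i> \<bullet> z}"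
    by (auto elim!: holomorphic_on_subset)
qed (use c in auto)

text \<open>At \<open>z = \<i> y\<close> the factor \<open>- z / (l - z)\<close> has modulus at most
  1 and tends to 1. This is the counterpart for measures of \<open>R_weak\<close>.\<close>

lemma CT_limit:
  assumes s: "sets \<mu> = sets borel" and g: "integrable \<mu> g"
  shows "(\<lambda>n. - (\<i> * real (Suc n)) * CT \<mu> g (\<i> * real (Suc n))) \<longlonglongrightarrow> (\<integral>l. g l \<partial>\<mu>)"
proof -
  have [measurable_cong]: "sets \<mu> = sets borel" by (rule s)
  have [measurable]: "g \<in> borel_measurable \<mu>" using g by simp
  define k where "k n l = - (\<i> * real (Suc n)) * (g l / (complex_of_real l - \<i> * real (Suc n)))" for n l
  have "(\<lambda>n. \<integral>l. k n l \<partial>\<mu>) \<longlonglongrightarrow> (\<integral>l. g l \<partial>\<mu>)"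
  proof (rule integral_dominated_convergence[where w = "\<lambda>l. cmod (g l)"])
    show "k n \<in> borel_measurable \<mu>" for n unfolding k_def by measurable
    show "AE l in \<mu>. (\<lambda>n. k n l) \<longlonglongrightarrow> g l"
    proof (rule AE_I2)
      fix l
      have 1: "(\<lambda>n. complex_of_real (- l) / (complex_of_real (real (Suc n)))) \<longlonglongrightarrow> 0"
        using LIMSEQ_Suc[OF lim_const_over_n[of "complex_of_real (- l)"]] by simp
      then have "(\<lambda>n. g l / (1 - \<i> * (complex_of_real (- l) / (complex_of_real (real (Suc n))))))
        \<longlonglongrightarrow> g l / (1 - \<i> * 0)"
        by (intro tendsto_intros) auto
      moreover have "k n l = g l / (1 - \<i> * (complex_of_real (- l) / (complex_of_real (real (Suc n)))))"
        for n
      proof -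
        define y where "y = complex_of_real (real (Suc n))"
        have y: "y \<noteq> 0" by (simp add: y_def del: of_nat_Suc)
        have "complex_of_real l - \<i> * y = - (\<i> * y) * (1 - \<i> * (complex_of_real (- l) / y))"
          using y by (simp add: field_simps)
        then show ?thesis using y unfolding k_def y_def[symmetric] by simp
      qed
      ultimately show "(\<lambda>n. k n l) \<longlonglongrightarrow> g l" by simp
    qed
    show "AE l in \<mu>. norm (k n l) \<le> cmod (g l)" for n
    proof (rule AE_I2)
      fix l
      have "cmod (1 / (complex_of_real l - \<i> * real (Suc n))) \<le> 1 / real (Suc n)"
        using inverse_Im_bound[of "\<i> * real (Suc n)" l] by (simp del: of_nat_Suc)
      then have "(real (Suc n) * cmod (g l)) * cmod (1 / (complex_of_real l - \<i> * real (Suc n)))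
        \<le> (real (Suc n) * cmod (g l)) * (1 / real (Suc n))"
        by (intro mult_left_mono) auto
      then show "norm (k n l) \<le> cmod (g l)" by (simp add: k_def norm_mult norm_divide del: of_nat_Suc)
    qed
  qed (use g in auto)
  then show ?thesis unfolding k_def CT_def by (simp only: integral_mult_right_zero)
qed

section \<open>Functional calculus of a periodic potential\<close>

lemma nrm_le_mult:
  assumes g: "g \<in> borel_measurable lebesgue" and h: "sq_int h" and c: "0 \<le> c" and le: "\<And>x. cmod (g x)
    \<le> c * cmod (h x)"
  shows "sq_int g" "nrm g \<le> c * nrm h"
proof -
  have le2: "(cmod (g x))\<^sup>2 \<le> c\<^sup>2 * (cmod (h x))\<^sup>2" for x
    using power_mono[OF le[of x] norm_ge_zero, of 2] by (simp only: power_mult_distrib)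
  have i: "integrable lebesgue (\<lambda>x. c\<^sup>2 * (cmod (h x))\<^sup>2)"
    by (rule integrable_mult_right[OF sq_int_integrable[OF h]])
  show sg: "sq_int g" by (rule sq_int_bound[OF g i le2])
  have "nrm2 g \<le> (\<integral>x. c\<^sup>2 * (cmod (h x))\<^sup>2 \<partial>lebesgue)"
    unfolding nrm2_def by (rule integral_mono[OF sq_int_integrable[OF sg] i le2])
  also have "\<dots> = c\<^sup>2 * nrm2 h" unfolding nrm2_def by (rule integral_mult_right_zero)
  finally have "sqrt (nrm2 g) \<le> sqrt (c\<^sup>2 * nrm2 h)" by (rule real_sqrt_le_mono)
  also have "\<dots> = c * sqrt (nrm2 h)" using c by (simp add: real_sqrt_mult)
  finally show "nrm g \<le> c * nrm h" unfolding nrm_def .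
qed

text \<open>A local L1 norm: what the solution with zero Cauchy data at \<open>x\<close> can see of
  its source up to distance \<open>L\<close>.\<close>

definition window :: "real \<Rightarrow> (real \<Rightarrow> complex) \<Rightarrow> real \<Rightarrow> real" where
  "window L f x = integral {x - L..x + L} (\<lambda>t. cmod (f t))"

lemma window_nonneg: "locint f \<Longrightarrow> 0 \<le> window L f x"
  unfolding window_def by (intro integral_nonneg locint_integrable locint_norm) auto

lemma window_continuous:
  assumes f: "locint f" and L: "0 < L" shows "continuous_on UNIV (window L f)"
proof -
  define P where "P = prim 0 (\<lambda>t. cmod (f t))"
  have P: "acd P (\<lambda>t. cmod (f t))" unfolding P_def by (rule acd_prim[OF locint_norm[OF f]])
  have e: "window L f x = P (x + L) - P (x + (- L))" for x
    using acdD[OF P, of "x - L" "x + L"] L by (simp add: window_def)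
  have "continuous_on UNIV (\<lambda>x. P (x + L) - P (x + (- L)))"
    by (intro continuous_on_diff acd_continuous[OF acd_shift[OF P]])
  then show ?thesis by (simp only: e[symmetric])
qed

text \<open>Cauchy-Schwarz on the window costs one factor \<open>2 * L\<close>; in Tonelli's theorem
  each \<open>y\<close> lies in the windows of a set of \<open>x\<close> of length
  \<open>2 * L\<close>, which costs the other.\<close>

lemma window_sq:
  assumes f: "sq_int f" and L: "0 < L"
  shows "sq_int (\<lambda>x. complex_of_real (window L f x))" "nrm (\<lambda>x. complex_of_real (window L f x))
    \<le> 2 * L * nrm f"
proof -
  define h where "h y = (cmod (f y))\<^sup>2" for y
  have hi: "integrable lebesgue h" unfolding h_def by (rule sq_int_integrable[OF f])
  have lh: "locint h" by (rule integrable_imp_locint[OF hi])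
  have h0: "0 \<le> h y" for y by (simp add: h_def)
  have wc: "continuous_on UNIV (window L f)" by (rule window_continuous[OF sq_int_locint[OF f] L])
  have wm: "window L f \<in> borel_measurable lebesgue" by (rule locint_measurable[OF locint_continuous[OF wc]])
  note wm[measurable]
  have [measurable]: "h \<in> borel_measurable lebesgue" using hi by simp
  have [measurable]: "(fst :: real \<times> real \<Rightarrow> real) \<in> borel_measurable (lebesgue \<Otimes>\<^sub>M lebesgue)"
    "(snd :: real \<times> real \<Rightarrow> real) \<in> borel_measurable (lebesgue \<Otimes>\<^sub>M lebesgue)"
    by (rule measurable_compose[OF measurable_fst id_lebesgue_measurable],
        rule measurable_compose[OF measurable_snd id_lebesgue_measurable])
  define k where "k p = (ennreal (if fst p - L \<le> snd p \<and> snd p \<le> fst p + L then 2 * L * h (snd p) else 0))"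
    for p
  have k[measurable]: "k \<in> borel_measurable (lebesgue \<Otimes>\<^sub>M lebesgue)"
    unfolding k_def by measurable
  have "(\<integral>\<^sup>+x. ennreal ((window L f x)\<^sup>2) \<partial>lebesgue) \<le> (\<integral>\<^sup>+x. (\<integral>\<^sup>+y. k (x,y) \<partial>lebesgue) \<partial>lebesgue)"
  proof (rule nn_integral_mono)
    fix x
    have "ennreal ((window L f x)\<^sup>2) \<le> ennreal (2 * L * integral {x-L..x+L} h)"
      using integral_sq_le_interval[OF f, of "x - L" "x + L"] L
        by (intro ennreal_leI) (simp add: window_def h_def[abs_def])
    also have "\<dots> = ennreal (integral {x-L..x+L} (\<lambda>y. 2 * L * h y))" by simp
    also have "\<dots> = (\<integral>\<^sup>+y. indicator {x-L..x+L} y * ennreal (2 * L * h y) \<partial>lebesgue)"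
      using L h0 by (intro nn_integral_interval[symmetric] locint_cont_mult lh continuous_intros) auto
    also have "\<dots> = (\<integral>\<^sup>+y. k (x,y) \<partial>lebesgue)"
      by (intro nn_integral_cong) (auto simp: k_def indicator_def)
    finally show "ennreal ((window L f x)\<^sup>2) \<le> (\<integral>\<^sup>+y. k (x,y) \<partial>lebesgue)" .
  qed
  also have "\<dots> = (\<integral>\<^sup>+y. (\<integral>\<^sup>+x. k (x,y) \<partial>lebesgue) \<partial>lebesgue)"
    by (rule leb2.Fubini[OF k, symmetric])
  also have "\<dots> = (\<integral>\<^sup>+y. ennreal ((2 * L)\<^sup>2 * h y) \<partial>lebesgue)"
  proof (rule nn_integral_cong)
    fix y
    have "(\<integral>\<^sup>+x. k (x,y) \<partial>lebesgue) = (\<integral>\<^sup>+x. indicator {y-L..y+L} x * ennreal (2 * L * h y) \<partial>lebesgue)"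
      by (intro nn_integral_cong) (auto simp: k_def indicator_def)
    also have "\<dots> = ennreal (integral {y-L..y+L} (\<lambda>x. 2 * L * h y))"
      using L h0 by (intro nn_integral_interval) auto
    also have "\<dots> = ennreal ((2 * L)\<^sup>2 * h y)" using L by (simp add: power2_eq_square mult_ac)
    finally show "(\<integral>\<^sup>+x. k (x,y) \<partial>lebesgue) = ennreal ((2 * L)\<^sup>2 * h y)" .
  qed
  also have "\<dots> = ennreal (\<integral>y. (2 * L)\<^sup>2 * h y \<partial>lebesgue)"
    by (rule nn_integral_eq_integral) (use hi h0 in auto)
  also have "\<dots> = ennreal ((2 * L)\<^sup>2 * nrm2 f)" by (simp add: nrm2_def h_def)
  finally have fin: "(\<integral>\<^sup>+x. ennreal ((window L f x)\<^sup>2) \<partial>lebesgue) \<le> ennreal ((2 * L)\<^sup>2 * nrm2 f)" .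
  have i: "integrable lebesgue (\<lambda>x. (window L f x)\<^sup>2)"
  proof (rule integrableI_bounded)
    show "(\<integral>\<^sup>+ x. ennreal (norm ((window L f x)\<^sup>2)) \<partial>lebesgue) < \<infinity>"
      using le_less_trans[OF fin ennreal_less_top] by simp
  qed measurable
  then show "sq_int (\<lambda>x. complex_of_real (window L f x))" by (simp add: sq_int_def)
  have "ennreal (nrm2 (\<lambda>x. complex_of_real (window L f x))) = (\<integral>\<^sup>+x. ennreal ((window L f x)\<^sup>2) \<partial>lebesgue)"
    unfolding nrm2_def using nn_integral_eq_integral[OF i] by simp
  then have "ennreal (nrm2 (\<lambda>x. complex_of_real (window L f x))) \<le> ennreal ((2 * L)\<^sup>2 * nrm2 f)" using fin
    by simp
  then have "nrm2 (\<lambda>x. complex_of_real (window L f x)) \<le> (2 * L)\<^sup>2 * nrm2 f" by (simp add: ennreal_le_iff)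
  then have "sqrt (nrm2 (\<lambda>x. complex_of_real (window L f x))) \<le> sqrt ((2 * L)\<^sup>2 * nrm2 f)"
    by (rule real_sqrt_le_mono)
  then show "nrm (\<lambda>x. complex_of_real (window L f x)) \<le> 2 * L * nrm f"
    using L by (simp add: nrm_def real_sqrt_mult)
qed

lemma L1_loc_unif_window:
  assumes V: "L1_loc_unif V"
  shows "\<exists>C\<ge>0. \<forall>x. integral {x - real n..x + real n} (\<lambda>t. \<bar>V t\<bar>) \<le> C"
proof (induction n)
  case 0
  show ?case by (rule exI[of _ 0]) simp
next
  case (Suc n)
  have "locint V" using V by (simp add: L1_loc_unif_def loc_int_iff)
  then have l: "locint (\<lambda>t. \<bar>V t\<bar>)" using locint_norm by fastforce
  obtain C where C: "0 \<le> C" "\<And>x. integral {x - real n..x + real n} (\<lambda>t. \<bar>V t\<bar>) \<le> C" using Suc by blast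
  obtain D where D: "0 \<le> D" "\<And>a b. b \<le> a + 2 \<Longrightarrow> integral {a..b} (\<lambda>x. \<bar>V x\<bar>) \<le> D"
    using L1_loc_unif_bound[OF V] by blast
  have "integral {x - real (Suc n)..x + real (Suc n)} (\<lambda>t. \<bar>V t\<bar>) \<le> C + 2 * D" for x
  proof -
    have "integral {x - real (Suc n)..x + real (Suc n)} (\<lambda>t. \<bar>V t\<bar>)
      = integral {x - real (Suc n)..x - real n} (\<lambda>t. \<bar>V t\<bar>) + (integral {x - real n..x + real n} (\<lambda>t. \<bar>V t\<bar>)
        + integral {x + real n..x + real (Suc n)} (\<lambda>t. \<bar>V t\<bar>))"
      using integral_locint_split[OF l, of "x - real (Suc n)" "x - real n" "x + real (Suc n)"]
        integral_locint_split[OF l, of "x - real n" "x + real n" "x + real (Suc n)"] by simp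
    moreover have "integral {x - real (Suc n)..x - real n} (\<lambda>t. \<bar>V t\<bar>) \<le> D" by (rule D(2)) simp
    moreover have "integral {x + real n..x + real (Suc n)} (\<lambda>t. \<bar>V t\<bar>) \<le> D" by (rule D(2)) simp
    ultimately show ?thesis using C(2)[of x] by linarith
  qed
  then show ?case using C D by (intro exI[of _ "C + 2 * D"]) auto
qed

section \<open>The defect operator, a local form of the resolvent\<close>

locale periodic_schroedinger = schroedinger V + periodic_potential V L for V L +
  assumes L: "0 < L"
begin

lemma V_window: "\<exists>C\<ge>0. \<forall>x. integral {x - L..x + L} (\<lambda>t. \<bar>V t\<bar>) \<le> C"
proof -
  obtain n where n: "L \<le> real n" using real_arch_simple by blast
  obtain C where C: "0 \<le> C" "\<And>x. integral {x - real n..x + real n} (\<lambda>t. \<bar>V t\<bar>) \<le> C"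
    using L1_loc_unif_window[OF V] by blast
  have "locint (\<lambda>t. \<bar>V t\<bar>)" using locint_norm[OF lV] by simp
  then have "integral {x - L..x + L} (\<lambda>t. \<bar>V t\<bar>) \<le> C" for x
    using integral_mono_set[of "\<lambda>t. \<bar>V t\<bar>" "x - L" "x + L" "x - real n" "x + real n"] C(2)[of x] n
      by fastforce
  then show ?thesis using C(1) by blast
qed

definition window_bound :: real where "window_bound = (SOME C. 0 \<le> C \<and> (\<forall>x. integral {x - L..x
  + L} (\<lambda>t. \<bar>V t\<bar>) \<le> C))"

lemma window_bound: "integral {x - L..x + L} (\<lambda>t. \<bar>V t\<bar>) \<le> window_bound"
  unfolding window_bound_def using someI_ex[of "\<lambda>C. 0 \<le> C \<and> (\<forall>x. integral {x - L..x + L} (\<lambda>t. \<bar>V t\<bar>)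
    \<le> C)"] V_window by blast

text \<open>Bounds the Gronwall factor on \<open>{x - L..x + L}\<close> by a quantity depending on
  \<open>cmod z\<close> alone; uniformity in \<open>x\<close> is where uniform local integrability
  of \<open>V\<close> enters.\<close>

definition exp_window :: "real \<Rightarrow> real" where "exp_window r = exp (window_bound + (1 + r) * (2 * L))"

lemma exp_window_pos [simp]: "0 < exp_window r" by (simp add: exp_window_def)

lemma exp_Kint: "exp (Kint V z (x - L) (x + L)) \<le> exp_window (cmod z)"
  unfolding exp_window_def using Kint_bound[OF lV, of "x - L" "x + L" z] window_bound[of x] L by simp

definition sol :: "(real \<Rightarrow> complex) \<Rightarrow> complex \<Rightarrow> real \<Rightarrow> (real \<Rightarrow> complex) \<times> (real \<Rightarrow> complex)" where
  "sol f z x = (SOME p. ode (pot V z) f (fst p) (snd p) \<and> fst p x = 0 \<and> snd p x = 0)"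

lemma sol:
  assumes "locint f"
  shows "ode (pot V z) f (fst (sol f z x)) (snd (sol f z x))" "fst (sol f z x) x = 0" "snd (sol f z x) x
    = 0"
proof -
  obtain u u' where "ode (pot V z) f u u'" "u x = 0" "u' x = 0"
    using ode_exists[OF pot_locint[OF lV] assms] by metis
  then have "\<exists>p. ode (pot V z) f (fst p) (snd p) \<and> fst p x = 0 \<and> snd p x = 0"
    by (intro exI[of _ "(u, u')"]) simp
  from someI_ex[OF this] show "ode (pot V z) f (fst (sol f z x)) (snd (sol f z x))" "fst (sol f z x) x = 0"
    "snd (sol f z x) x = 0"
    unfolding sol_def by auto
qed

text \<open>For non-real \<open>z\<close> this is \<open>(T - \<Delta>(z)) R(z) f\<close>, but it only involves the solution with zero
  Cauchy data at \<open>x\<close>, hence makes sense for all \<open>z\<close>.\<close>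

definition defect :: "(real \<Rightarrow> complex) \<Rightarrow> complex \<Rightarrow> real \<Rightarrow> complex" where
  "defect f z x = fst (sol f z x) (x + L) + fst (sol f z x) (x - L)"

lemma defect_bound:
  assumes f: "locint f" shows "cmod (defect f z x) \<le> (2 * exp_window (cmod z)) * window L f x"
proof -
  have "cmod (fst (sol f z x) y) \<le> window L f x * exp_window (cmod z)" if y: "y \<in> {x - L..x + L}" for y
  proof -
    have "cmod (fst (sol f z x) y) + cmod (snd (sol f z x) y) \<le> window L f x * exp (Kint V z (x - L) (x
      + L))"
      using ode_bound[OF sol(1)[OF f, of z x] pot_locint[OF lV] f, of x "x - L" "x + L" y] y L sol[OF f, of
        z x]
      by (simp add: window_def Kint_def)
    also have "\<dots> \<le> window L f x * exp_window (cmod z)" by (intro mult_left_mono exp_Kint window_nonneg f)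
    finally show ?thesis using norm_ge_zero[of "snd (sol f z x) y"] by linarith
  qed
  from this[of "x + L"] this[of "x - L"] have "cmod (fst (sol f z x) (x + L)) + cmod (fst (sol f z x) (x
    - L)) \<le> 2 * (window L f x * exp_window (cmod z))"
    using L by simp
  then have "cmod (defect f z x) \<le> 2 * (window L f x * exp_window (cmod z))"
    unfolding defect_def using norm_triangle_ineq[of "fst (sol f z x) (x + L)" "fst (sol f z x) (x - L)"]
      by linarith
  then show ?thesis by (simp add: mult_ac)
qed

text \<open>Both solutions have zero Cauchy data at \<open>x\<close>, so
  \<open>ode_lipschitz\<close> on the window applies, once for each of its ends.\<close>

lemma defect_lipschitz:
  assumes f: "locint f"
  shows "cmod (defect f z x - defect f w x) \<le> (cmod (z - w) * (4 * L * exp_window (cmod w)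
    * exp_window (cmod z))) * window L f x"
proof -
  have "cmod (fst (sol f z x) y - fst (sol f w x) y) \<le> cmod (z - w) * ((2 * L) * (window L f x
    * exp_window (cmod w)) * exp_window (cmod z))"
    if y: "y \<in> {x - L..x + L}" for y
  proof -
    have "cmod (fst (sol f z x) y - fst (sol f w x) y) + cmod (snd (sol f z x) y - snd (sol f w x) y)
      \<le> cmod (z - w) * ((2 * L) * (window L f x * exp (Kint V w (x - L) (x + L))) * exp (Kint V z (x - L) (x
        + L)))"
      using ode_lipschitz[OF lV f sol(1)[OF f, of z x] sol(1)[OF f, of w x], where c = x and a = "x - L"
        and b = "x + L" and x = y] y L sol[OF f, of z x] sol[OF f, of w x]
      by (simp add: window_def)
    also have "\<dots> \<le> cmod (z - w) * ((2 * L) * (window L f x * exp_window (cmod w)) * exp_window (cmod z))"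
      using L window_nonneg[OF f, of L x] by (intro mult_left_mono mult_mono exp_Kint)
        (auto simp: less_imp_le)
    finally show ?thesis using norm_ge_zero[of "snd (sol f z x) y - snd (sol f w x) y"] by linarith
  qed
  from this[of "x + L"] this[of "x - L"] have "cmod (fst (sol f z x) (x + L) - fst (sol f w x) (x + L))
    + cmod (fst (sol f z x) (x - L) - fst (sol f w x) (x - L))
      \<le> 2 * (cmod (z - w) * ((2 * L) * (window L f x * exp_window (cmod w)) * exp_window (cmod z)))"
    using L by simp
  moreover have "defect f z x - defect f w x = (fst (sol f z x) (x + L) - fst (sol f w x) (x + L))
    + (fst (sol f z x) (x - L) - fst (sol f w x) (x - L))"
    by (simp add: defect_def)
  ultimately have "cmod (defect f z x - defect f w x) \<le> 2 * (cmod (z - w) * ((2 * L) * (window L f x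
    * exp_window (cmod w)) * exp_window (cmod z)))"
    using norm_triangle_ineq[of "fst (sol f z x) (x + L) - fst (sol f w x) (x + L)" "fst (sol f z x) (x - L)
      - fst (sol f w x) (x - L)"]
    by (simp only:)
  then show ?thesis by (simp add: mult_ac)
qed

text \<open>Subtracting \<open>sol f z x\<close> from \<open>R z f\<close> leaves a homogeneous
  solution, to which \<open>monodromy\<close> applies at \<open>x\<close>; the subtracted part
  vanishes at \<open>x\<close> itself, so it contributes only at \<open>x + L\<close> and
  \<open>x - L\<close>.\<close>

lemma defect_eq:
  assumes z: "Im z \<noteq> 0" and f: "sq_int f"
  shows "defect f z x = T L (R z f) x - discr V L z * R z f x"
proof -
  obtain u' where u: "ode (pot V z) f (R z f) u'" using R_ode[OF z f] by blast
  note s = sol[OF sq_int_locint[OF f], of z x]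
  have "ode (pot V z) (\<lambda>_. 0) (\<lambda>t. R z f t - fst (sol f z x) t) (\<lambda>t. u' t - snd (sol f z x) t)"
    using ode_diff[OF u s(1)] by simp
  from monodromy(1)[OF this, of x]
  have "(R z f (x + L) - fst (sol f z x) (x + L)) + (R z f (x - L) - fst (sol f z x) (x - L)) = discr V L z
    * R z f x"
    by (simp only: s(2) diff_0_right)
  moreover have "(a - c) + (b - d) = e \<Longrightarrow> c + d = (b + a) - e" for a b c d e :: complex
    by (simp add: algebra_simps)
  ultimately show ?thesis unfolding T_def defect_def by blast
qed

text \<open>The solution used in \<open>defect\<close> changes with \<open>x\<close>. For non-real
  \<open>z\<close> continuity follows from \<open>defect_eq\<close>; a real \<open>z\<close> is
  approached along \<open>z + \<i> / (n + 1)\<close>, with pointwise convergence from the Lipschitz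
  bound.\<close>

lemma defect_measurable:
  assumes f: "sq_int f" shows "defect f z \<in> borel_measurable lebesgue"
proof -
  have nr: "defect f w \<in> borel_measurable lebesgue" if "Im w \<noteq> 0" for w
  proof -
    have "continuous_on UNIV (defect f w)"
      unfolding defect_eq[OF that f, abs_def] by (intro continuous_intros T_continuous R_continuous that f)
    then show ?thesis by (rule locint_measurable[OF locint_continuous])
  qed
  show ?thesis
  proof (cases "Im z = 0")
    case True
    define y where "y n = 1 / real (Suc n)" for n
    define w where "w n = z + \<i> * complex_of_real (y n)" for n
    have y: "0 < y n" "y n \<le> 1" for n by (auto simp: y_def)
    have y0: "y \<longlonglongrightarrow> 0" unfolding y_def by (rule LIMSEQ_Suc[OF lim_1_over_n])
    have wz: "cmod (w n - z) = y n" for n using y(1)[of n] by (simp add: w_def norm_mult)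
    have wm: "defect f (w n) \<in> borel_measurable lebesgue" for n
      by (rule nr) (use True y(1)[of n] in \<open>simp add: w_def\<close>)
    have "(\<lambda>n. defect f (w n) x) \<longlonglongrightarrow> defect f z x" for x
    proof -
      define c where "c = (4 * L * exp_window (cmod z) * exp_window (cmod z + 1)) * window L f x"
      have b: "cmod (defect f (w n) x - defect f z x) \<le> y n * c" for n
      proof -
        have "cmod (w n) \<le> cmod z + 1" using norm_triangle_ineq2[of "w n" z] wz[of n] y(2)[of n] by linarith
        then have "exp_window (cmod (w n)) \<le> exp_window (cmod z + 1)" unfolding exp_window_def using L
          by simp
        then have b3: "(y n * (4 * L * exp_window (cmod z) * exp_window (cmod (w n)))) * window L f x
          \<le> (y n * (4 * L * exp_window (cmod z) * exp_window (cmod z + 1))) * window L f x"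
          using y(1)[of n] L window_nonneg[OF sq_int_locint[OF f], of L x]
          by (intro mult_right_mono mult_left_mono) (auto simp: less_imp_le)
        have b2: "cmod (defect f (w n) x - defect f z x) \<le> (y n * (4 * L * exp_window (cmod z)
          * exp_window (cmod (w n)))) * window L f x"
          using defect_lipschitz[OF sq_int_locint[OF f], of "w n" x z] by (simp only: wz)
        from order_trans[OF b2 b3] show ?thesis by (simp add: c_def mult.assoc)
      qed
      have "(\<lambda>n. y n * c) \<longlonglongrightarrow> 0 * c" by (intro tendsto_intros y0)
      then have "(\<lambda>n. y n * c) \<longlonglongrightarrow> 0" by simp
      then have "(\<lambda>n. defect f (w n) x - defect f z x) \<longlonglongrightarrow> 0"
        by (rule Lim_null_comparison[rotated]) (use b in \<open>auto intro: always_eventually\<close>)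
      then show ?thesis by (simp add: LIM_zero_iff)
    qed
    then show ?thesis by (rule borel_measurable_LIMSEQ_metric[OF wm])
  qed (rule nr)
qed

lemma defect_sq:
  assumes f: "sq_int f"
  shows "sq_int (defect f z)" "nrm (defect f z) \<le> (2 * exp_window (cmod z)) * (2 * L * nrm f)"
proof -
  note w = window_sq[OF f L]
  have b: "cmod (defect f z x) \<le> (2 * exp_window (cmod z)) * cmod (complex_of_real (window L f x))" for x
    using defect_bound[OF sq_int_locint[OF f], of z x] window_nonneg[OF sq_int_locint[OF f], of L x] by simp
  note n = nrm_le_mult[OF defect_measurable[OF f] w(1) _ b]
  show "sq_int (defect f z)" by (rule n(1)) (simp add: less_imp_le)
  have "nrm (defect f z) \<le> (2 * exp_window (cmod z)) * nrm (\<lambda>x. complex_of_real (window L f x))"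
    by (rule n(2)) (simp add: less_imp_le)
  also have "\<dots> \<le> (2 * exp_window (cmod z)) * (2 * L * nrm f)"
    by (intro mult_left_mono w) (simp add: less_imp_le)
  finally show "nrm (defect f z) \<le> (2 * exp_window (cmod z)) * (2 * L * nrm f)" .
qed

lemma defect_nrm_lipschitz:
  assumes f: "sq_int f"
  shows "nrm (\<lambda>x. defect f z x - defect f w x) \<le> (cmod (z - w) * (4 * L * exp_window (cmod w)
    * exp_window (cmod z))) * (2 * L * nrm f)"
proof -
  note wi = window_sq[OF f L]
  define c where "c = cmod (z - w) * (4 * L * exp_window (cmod w) * exp_window (cmod z))"
  have c0: "0 \<le> c" unfolding c_def using L by (simp add: less_imp_le)
  have b: "cmod (defect f z x - defect f w x) \<le> c * cmod (complex_of_real (window L f x))" for x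
    using defect_lipschitz[OF sq_int_locint[OF f], of z x w] window_nonneg[OF sq_int_locint[OF f], of L x]
      by (simp add: c_def)
  have "nrm (\<lambda>x. defect f z x - defect f w x) \<le> c * nrm (\<lambda>x. complex_of_real (window L f x))"
    by (rule nrm_le_mult(2)[OF sq_int_measurable[OF sq_int_diff[OF defect_sq(1)[OF f] defect_sq(1)[OF f]]]
      wi(1) c0 b])
  also have "\<dots> \<le> c * (2 * L * nrm f)" by (intro mult_left_mono wi c0)
  finally show ?thesis by (simp add: c_def)
qed

definition defect_form :: "(real \<Rightarrow> complex) \<Rightarrow> complex \<Rightarrow> complex" where
  "defect_form f z = inner_L2 f (defect f z)"

lemma defect_form_continuous:
  assumes f: "sq_int f" shows "continuous_on UNIV (defect_form f)"
proof -
  have "isCont (defect_form f) w" for w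
  proof -
    have b: "cmod (defect_form f z - defect_form f w) \<le> nrm f * ((cmod (z - w) * (4 * L
      * exp_window (cmod w) * exp_window (cmod z))) * (2 * L * nrm f))" for z
    proof -
      have "defect_form f z - defect_form f w = inner_L2 f (\<lambda>x. defect f z x - defect f w x)"
        unfolding defect_form_def using inner_L2_diff_right[OF f defect_sq(1)[OF f] defect_sq(1)[OF f]]
          by simp
      then have "cmod (defect_form f z - defect_form f w) \<le> nrm f * nrm (\<lambda>x. defect f z x - defect f w x)"
        using cauchy_schwarz[OF f sq_int_diff[OF defect_sq(1)[OF f] defect_sq(1)[OF f]]] by simp
      also have "\<dots> \<le> nrm f * ((cmod (z - w) * (4 * L * exp_window (cmod w) * exp_window (cmod z))) * (2 * L
        * nrm f))"
        by (intro mult_left_mono defect_nrm_lipschitz f) simp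
      finally show ?thesis .
    qed
    have "((\<lambda>z. nrm f * ((cmod (z - w) * (4 * L * exp_window (cmod w) * exp_window (cmod z))) * (2 * L
      * nrm f))) \<longlongrightarrow>
       nrm f * ((cmod (w - w) * (4 * L * exp_window (cmod w) * exp_window (cmod w))) * (2 * L
         * nrm f))) (at w)"
      unfolding exp_window_def by (intro tendsto_intros)
    then have "((\<lambda>z. nrm f * ((cmod (z - w) * (4 * L * exp_window (cmod w) * exp_window (cmod z))) * (2 * L
      * nrm f))) \<longlongrightarrow> 0) (at w)" by simp
    then have "((\<lambda>z. defect_form f z - defect_form f w) \<longlongrightarrow> 0) (at w)"
      by (rule Lim_null_comparison[rotated]) (use b in \<open>auto intro: always_eventually\<close>)
    then show ?thesis by (simp add: isCont_def LIM_zero_iff)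
  qed
  then show ?thesis by (simp add: continuous_on_eq_continuous_at)
qed

lemma defect_form_eq:
  assumes z: "Im z \<noteq> 0" and f: "sq_int f"
  shows "defect_form f z = inner_L2 f (T L (R z f)) - discr V L z * inner_L2 f (R z f)"
proof -
  have s: "sq_int (R z f)" using z f by simp
  have "defect f z = (\<lambda>x. T L (R z f) x - discr V L z * R z f x)" using defect_eq[OF z f] by auto
  then have "defect_form f z = inner_L2 f (\<lambda>x. T L (R z f) x - discr V L z * R z f x)"
    by (simp only: defect_form_def)
  also have "\<dots> = inner_L2 f (T L (R z f)) - discr V L z * inner_L2 f (R z f)"
    using inner_L2_diff_right[OF f T_sq[OF s] sq_int_cmult[OF s, of "discr V L z"]]
      by (simp only: inner_L2_cmult_right)
  finally show ?thesis .
qed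

text \<open>Where \<open>\<bar>\<Delta>\<bar> > 2\<close>, the identity \<open>(T - \<Delta>(z)) R(z) f = defect f z\<close> and \<open>\<parallel>T\<parallel> \<le> 2\<close> bound \<open>R(z) f\<close>
  up to the real axis, so the spectral measure vanishes there.\<close>

lemma discr_AE_le_2:
  assumes f: "sq_int f" and m: "spec_meas V f \<mu>"
  shows "AE l in \<mu>. cmod (discr V L (complex_of_real l)) \<le> 2"
proof -
  note s = spec_measD[OF f m]
  define D where "D = discr V L"
  have Dc: "continuous_on UNIV D" unfolding D_def by (rule discr_continuous[OF lV])
  define O' where "O' = {l. 2 < cmod (D (complex_of_real l))}"
  have "AE l in \<mu>. l \<notin> O'"
  proof (rule null_by_small_balls[OF s(1,2)])
    show "open O'" unfolding O'_def
      by (intro open_Collect_less continuous_intros continuous_on_compose2[OF Dc]) auto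
    fix x assume "x \<in> O'"
    then have x: "2 < cmod (D (complex_of_real x))" by (simp add: O'_def)
    \<comment> \<open>Half of the gap above 2, so that a gap survives in a full complex
      neighbourhood of \<open>x\<close>.\<close>
    define \<delta> where "\<delta> = (cmod (D (complex_of_real x)) - 2) / 2"
    have d: "0 < \<delta>" "2 + \<delta> < cmod (D (complex_of_real x))" using x by (auto simp: \<delta>_def field_simps)
    have "open {z. 2 + \<delta> < cmod (D z)}"
      by (intro open_Collect_less continuous_intros Dc)
    then obtain \<rho> where \<rho>: "0 < \<rho>" "ball (complex_of_real x) \<rho> \<subseteq> {z. 2 + \<delta> < cmod (D z)}"
      using d(2) openE by blast
    define r where "r = \<rho> / 3"
    have r: "0 < r" using \<rho> by (simp add: r_def)
    define B where "B = (2 * exp_window (cmod (complex_of_real x) + \<rho>)) * (2 * L * nrm f) / \<delta>"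
    \<comment> \<open>The estimate is quadratic in \<open>e\<close>: \<open>R_Im\<close> gives one
      factor, the imaginary part of \<open>z\<close>, and \<open>Im_CT_ball\<close> the other. This
      is stronger than the o(e) required.\<close>
    have small: "measure \<mu> (cball E e) \<le> 2 * e * (e * B\<^sup>2)" if e: "0 < e" "e < r" "\<bar>E - x\<bar> \<le> r" for e E
    proof -
      define z where "z = Complex E e"
      have z: "Im z \<noteq> 0" using e by (simp add: z_def)
      have "cmod (z - complex_of_real x) \<le> \<bar>E - x\<bar> + \<bar>e\<bar>"
        using cmod_le[of "z - complex_of_real x"] by (simp add: z_def)
      also have "\<dots> < \<rho>" using e \<rho>(1) unfolding r_def by linarith
      finally have zx: "cmod (z - complex_of_real x) < \<rho>" .
      then have Dz: "2 + \<delta> < cmod (D z)" using \<rho>(2) by (auto simp: dist_norm norm_minus_commute)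
      have cz: "cmod z \<le> cmod (complex_of_real x) + \<rho>"
        using norm_triangle_ineq2[of z "complex_of_real x"] zx by linarith
      define u where "u = R z f"
      have su: "sq_int u" using z f by (simp add: u_def)
      have "(\<lambda>t. D z * u t) = (\<lambda>t. T L u t - defect f z t)" using defect_eq[OF z f]
        by (auto simp: u_def D_def)
      then have "cmod (D z) * nrm u \<le> nrm (T L u) + nrm (defect f z)"
        using nrm_diff[OF T_sq[OF su] defect_sq(1)[OF f]] nrm_cmult[of "D z" u] by metis
      also have "\<dots> \<le> 2 * nrm u + (2 * exp_window (cmod z)) * (2 * L * nrm f)"
        by (intro add_mono T_nrm su defect_sq f)
      finally have 1: "cmod (D z) * nrm u \<le> 2 * nrm u + (2 * exp_window (cmod z)) * (2 * L * nrm f)" .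
      have "(2 + \<delta>) * nrm u \<le> cmod (D z) * nrm u" using Dz by (intro mult_right_mono) auto
      then have "\<delta> * nrm u \<le> (2 * exp_window (cmod z)) * (2 * L * nrm f)" using 1
        by (simp add: algebra_simps)
      also have "\<dots> \<le> (2 * exp_window (cmod (complex_of_real x) + \<rho>)) * (2 * L * nrm f)"
        using cz L by (intro mult_right_mono mult_left_mono) (auto simp: exp_window_def)
      finally have nu: "nrm u \<le> B" using d(1) by (simp add: B_def pos_le_divide_eq mult.commute)
      have "Im (CT \<mu> (\<lambda>_. 1) z) = e * nrm2 u"
        using s(3)[OF z] R_Im[OF z f] by (simp add: u_def z_def)
      also have "\<dots> \<le> e * B\<^sup>2"
        using nu e power_mono[OF nu, of 2] by (intro mult_left_mono) (auto simp: nrm_sq)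
      finally have "2 * e * Im (CT \<mu> (\<lambda>_. 1) z) \<le> 2 * e * (e * B\<^sup>2)" using e by (intro mult_left_mono) auto
      then show ?thesis using Im_CT_ball[OF s(1,2) e(1), of E] unfolding z_def by linarith
    qed
    show "\<exists>r>0. \<forall>\<eta>>0. \<exists>d>0. \<forall>e E. 0 < e \<longrightarrow> e < d \<longrightarrow> \<bar>E - x\<bar> \<le> r \<longrightarrow> measure \<mu> (cball E e) \<le> \<eta> * e"
    proof (rule exI[of _ r], rule conjI[OF r], intro allI impI)
      fix \<eta> :: real assume eta: "0 < \<eta>"
      have Bp: "0 < 2 * B\<^sup>2 + 1" by (simp add: add_nonneg_pos)
      show "\<exists>d>0. \<forall>e E. 0 < e \<longrightarrow> e < d \<longrightarrow> \<bar>E - x\<bar> \<le> r \<longrightarrow> measure \<mu> (cball E e) \<le> \<eta> * e"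
      proof (intro exI[of _ "min r (\<eta> / (2 * B\<^sup>2 + 1))"] conjI allI impI)
        show "0 < min r (\<eta> / (2 * B\<^sup>2 + 1))" using r eta Bp by simp
        fix e E :: real assume e: "0 < e" "e < min r (\<eta> / (2 * B\<^sup>2 + 1))" "\<bar>E - x\<bar> \<le> r"
        then have "e * (2 * B\<^sup>2 + 1) < \<eta>" using Bp by (simp add: pos_less_divide_eq)
        then have "e * (2 * B\<^sup>2) \<le> \<eta>" using e(1) by (simp add: algebra_simps)
        then have "(e * (2 * B\<^sup>2)) * e \<le> \<eta> * e" using e(1) by (intro mult_right_mono) auto
        moreover have "measure \<mu> (cball E e) \<le> 2 * e * (e * B\<^sup>2)" using small[of e E] e by simp
        ultimately show "measure \<mu> (cball E e) \<le> \<eta> * e" by (simp add: mult_ac)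
      qed
    qed
  qed
  then show ?thesis by eventually_elim (simp add: O'_def D_def)
qed

theorem fcalc_periodic: "fcalc_eq V (discr V L) (T L)"
  unfolding fcalc_eq_def
proof (intro allI impI)
  fix f \<mu> assume f: "sq_int f" and m: "spec_meas V f \<mu>"
  note s = spec_measD[OF f m]
  interpret finite_measure \<mu> by (rule s(2))
  have [measurable_cong]: "sets \<mu> = sets borel" by (rule s(1))
  define D where "D = discr V L"
  have Dh: "D holomorphic_on UNIV" unfolding D_def by (rule discr_holomorphic[OF lV])
  have "(\<lambda>l. D (complex_of_real l)) \<in> borel_measurable borel"
    unfolding D_def by (rule discr_measurable[OF lV])
  then have Dm[measurable]: "(\<lambda>l. D (complex_of_real l)) \<in> borel_measurable \<mu>" by measurable
  have D2: "AE l in \<mu>. cmod (D (complex_of_real l)) \<le> 2" unfolding D_def by (rule discr_AE_le_2[OF f m])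
  have Di: "integrable \<mu> (\<lambda>l. D (complex_of_real l))"
    by (rule integrable_const_bound[OF D2 Dm])
  have Di2: "integrable \<mu> (\<lambda>l. (cmod (D (complex_of_real l)))\<^sup>2)"
  proof (rule integrable_const_bound[where B = 4])
    show "AE l in \<mu>. norm ((cmod (D (complex_of_real l)))\<^sup>2) \<le> 4"
      using D2
    proof eventually_elim
      case (elim l)
      then have "(cmod (D (complex_of_real l)))\<^sup>2 \<le> 2\<^sup>2" by (intro power_mono) auto
      then show ?case by simp
    qed
  qed measurable
  \<comment> \<open>Off the real axis both terms contain \<open>- D z * inner_L2 f (R z f)\<close>,
    which cancels. Each is continuous on the whole plane, so \<open>E\<close> extends across the
    axis.\<close>
  define E where "E z = defect_form f z - (\<integral>l. diff_quot D z (complex_of_real l) \<partial>\<mu>)" for z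
  have Ec: "continuous_on UNIV E"
    unfolding E_def by (intro continuous_on_diff defect_form_continuous[OF f]
      diff_quot_integral_continuous[OF s(1,2) Dh Di])
  have TR: "inner_L2 f (T L (R z f)) = inner_L2 (T L f) (R z f)" if "Im z \<noteq> 0" for z
    by (rule T_selfadj) (use that f in auto)
  have Ee: "E z = inner_L2 (T L f) (R z f) - CT \<mu> (\<lambda>l. D (complex_of_real l)) z" if z: "Im z \<noteq> 0" for z
    unfolding E_def defect_form_eq[OF z f] diff_quot_integral_eq[OF s(1,2) Di z] s(3)[OF z] TR[OF z]
      by (simp add: D_def)
  have Eh: "E holomorphic_on UNIV"
  proof (rule holomorphic_across_real_axis[OF Ec])
    fix z :: complex assume z: "Im z \<noteq> 0"
    have "((\<lambda>z. inner_L2 (T L f) (R z f) - CT \<mu> (\<lambda>l. D (complex_of_real l)) z) has_field_derivative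
       inner_L2 (T L f) (R z (R z f)) - CT \<mu> (\<lambda>l. D (complex_of_real l) / (complex_of_real l
         - z)) z) (at z)"
      by (intro DERIV_diff R_inner_deriv[OF T_sq[OF f] f z] CT_deriv[OF s(1) Di z])
    moreover have "open {z. Im z \<noteq> 0}" by (intro open_Collect_neq continuous_intros)
    ultimately have "(E has_field_derivative
       inner_L2 (T L f) (R z (R z f)) - CT \<mu> (\<lambda>l. D (complex_of_real l) / (complex_of_real l
         - z)) z) (at z)"
      by (rule has_field_derivative_transform_within_open[where S = "{z. Im z \<noteq> 0}"])
        (use z in \<open>auto simp: Ee\<close>)
    then show "E field_differentiable (at z)" by (auto simp: field_differentiable_def)
  qed
  define C where "C = nrm (T L f) * nrm f + (\<integral>l. cmod (D (complex_of_real l)) \<partial>\<mu>)"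
  have E0: "E z = 0" for z
  proof (rule entire_inverse_Im_bound_zero[OF Eh])
    fix z :: complex assume z: "Im z \<noteq> 0"
    have "cmod (E z) \<le> cmod (inner_L2 (T L f) (R z f)) + cmod (CT \<mu> (\<lambda>l. D (complex_of_real l)) z)"
      unfolding Ee[OF z] by (rule norm_triangle_ineq4)
    also have "\<dots> \<le> nrm (T L f) * nrm f / \<bar>Im z\<bar> + (\<integral>l. cmod (D (complex_of_real l)) \<partial>\<mu>) / \<bar>Im z\<bar>"
      by (intro add_mono R_inner_bound[OF T_sq[OF f] f z] CT_bound[OF s(1) Di z])
    also have "\<dots> = C / \<bar>Im z\<bar>" by (simp add: C_def add_divide_distrib)
    finally show "cmod (E z) \<le> C / \<bar>Im z\<bar>" .
  qed
  have z: "Im (\<i> * complex_of_real (real (Suc n))) \<noteq> 0" for n by simp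
  have CTe: "CT \<mu> (\<lambda>l. D (complex_of_real l)) w = inner_L2 (T L f) (R w f)" if "Im w \<noteq> 0" for w
    using Ee[OF that] E0[of w] by simp
  \<comment> \<open>\<open>E = 0\<close> identifies the two Borel transforms; their asymptotics
    along \<open>\<i> (n + 1)\<close> then give the quadratic form of \<open>T L\<close> at
    \<open>f\<close>.\<close>
  have "(\<lambda>n. - (\<i> * real (Suc n)) * inner_L2 (T L f) (R (\<i> * real (Suc n)) f))
    \<longlonglongrightarrow> (\<integral>l. D (complex_of_real l) \<partial>\<mu>)"
    using CT_limit[OF s(1) Di] by (simp only: CTe[OF z])
  moreover have "(\<lambda>n. - (\<i> * real (Suc n)) * inner_L2 (T L f) (R (\<i> * real (Suc n)) f))
    \<longlonglongrightarrow> inner_L2 (T L f) f"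
    by (rule R_weak[OF T_sq[OF f] f])
  ultimately have "(\<integral>l. D (complex_of_real l) \<partial>\<mu>) = inner_L2 (T L f) f" by (rule LIMSEQ_unique)
  then show "integrable \<mu> (\<lambda>l. (cmod (discr V L (complex_of_real l)))\<^sup>2)
    \<and> (\<integral>l. discr V L (complex_of_real l) \<partial>\<mu>) = inner_L2 f (T L f)"
    using Di2 T_selfadj[OF f f] by (simp add: D_def)
qed

end

section \<open>The functional calculus determines the discriminant\<close>

text \<open>The identity \<open>2 cos a * 2 cos b = 2 cos (a + b) + 2 cos (a - b)\<close> in terms
  of the recursion alone, so it also holds where \<open>t 1\<close> exceeds 2 in modulus.\<close>

lemma chebyshev_product:
  fixes t :: "nat \<Rightarrow> real"
  assumes t0: "t 0 = 2" and rec: "\<And>n. t (n + 2) = t 1 * t (n + 1) - t n"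
  shows "t n * t (n + k) = t (2 * n + k) + t k"
proof -
  have "\<forall>k. t n * t (n + k) = t (2 * n + k) + t k" for n
  proof (induction n rule: less_induct)
    case (less n)
    consider "n = 0" | "n = 1" | m where "n = m + 2"
      by (metis One_nat_def Suc_1 add_2_eq_Suc' not0_implies_Suc)
    then show ?case
    proof cases
      case 1
      then show ?thesis using t0 by simp
    next
      case 2
      then show ?thesis using rec by (simp add: algebra_simps)
    next
      case 3
      show ?thesis
      proof
        fix k
        have 1: "t (m + 1) * t (m + 2 + k) = t (2 * m + k + 3) + t (k + 1)"
          using less[of "m + 1"] 3 by (auto dest!: spec[of _ "k + 1"] simp: algebra_simps numeral_eq_Suc)
        have 2: "t m * t (m + 2 + k) = t (2 * m + k + 2) + t (k + 2)"
          using less[of m] 3 by (auto dest!: spec[of _ "k + 2"] simp: algebra_simps)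
        have "t n * t (n + k) = t 1 * (t (m + 1) * t (m + 2 + k)) - t m * t (m + 2 + k)"
          unfolding 3 rec[of m] by (simp only: left_diff_distrib mult.assoc)
        also have "\<dots> = t 1 * t (2 * m + k + 2 + 1) + t 1 * t (k + 1) - t (2 * m + k + 2) - t (k + 2)"
          unfolding 1 2 by (simp add: algebra_simps numeral_eq_Suc)
        also have "\<dots> = t (2 * m + k + 2 + 2) + t k"
          using rec[of "2 * m + k + 2"] rec[of k] by simp
        finally show "t n * t (n + k) = t (2 * n + k) + t k" using 3 by (simp add: algebra_simps)
      qed
    qed
  qed
  then show ?thesis by blast
qed

context periodic_schroedinger
begin

definition trace :: "nat \<Rightarrow> real \<Rightarrow> real" where
  "trace n l = Re (discr V (real n * L) (complex_of_real l))"

lemma trace_eq: "discr V (real n * L) (complex_of_real l) = complex_of_real (trace n l)"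
  unfolding trace_def using discr_real[OF lV, of "real n * L" l]
  by (metis Reals_cnj_iff of_real_Re)

lemma trace_0: "trace 0 l = 2"
  by (simp add: trace_def discr_0)

lemma trace_rec: "trace (n + 2) l = trace 1 l * trace (n + 1) l - trace n l"
proof -
  have 1: "discr V L (complex_of_real l) = complex_of_real (trace 1 l)" using trace_eq[of 1 l] by simp
  have "complex_of_real (trace (n + 2) l) = complex_of_real (trace 1 l * trace (n + 1) l - trace n l)"
    using discr_recurrence[of n "complex_of_real l"] unfolding trace_eq 1
      by (simp only: of_real_mult of_real_diff)
  then show ?thesis by (simp only: of_real_eq_iff)
qed

lemma trace_product: "trace n l * trace (n + k) l = trace (2 * n + k) l + trace k l"
  using chebyshev_product[of "\<lambda>n. trace n l"] trace_0 trace_rec by blast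

text \<open>\<open>V\<close> also has period \<open>n L\<close>, so \<open>fcalc_periodic\<close>
  for that period evaluates the integral as the form of the shifts by \<open>n L\<close> at
  \<open>f\<close>. It vanishes because translates of a function living in one period have disjoint
  supports.\<close>

lemma trace_moments:
  assumes f: "sq_int f" and m: "spec_meas V f \<mu>" and supp: "\<And>x. x \<notin> {0<..<L} \<Longrightarrow> f x = 0"
  shows "integrable \<mu> (trace n)" "(\<integral>l. trace n l \<partial>\<mu>) = (if n = 0 then 2 * measure \<mu> (space \<mu>) else 0)"
proof -
  note s = spec_measD[OF f m]
  interpret finite_measure \<mu> by (rule s(2))
  have "integrable \<mu> (trace n) \<and> (\<integral>l. trace n l \<partial>\<mu>) = (if n = 0 then 2 * measure \<mu> (space \<mu>) else 0)"
  proof (cases "n = 0")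
    case True
    then have "trace n = (\<lambda>_. 2)" using trace_0 by auto
    then show ?thesis using True by simp
  next
    case False
    then have nL: "L \<le> real n * L" using L by simp
    interpret p: periodic_potential V "real n * L" by (rule periodic_multiple)
    interpret p: periodic_schroedinger V "real n * L"
      by unfold_locales (use False L in simp)
    have c: "integrable \<mu> (\<lambda>l. (cmod (complex_of_real (trace n l)))\<^sup>2)" "(\<integral>l. complex_of_real (trace n l) \<partial>\<mu>)
      = inner_L2 f (T (real n * L) f)"
      using p.fcalc_periodic f m unfolding fcalc_eq_def trace_eq by blast+
    have "(\<lambda>l. complex_of_real (trace n l)) \<in> borel_measurable borel"
      unfolding trace_eq[symmetric] by (rule discr_measurable[OF lV])
    then have "(\<lambda>l. complex_of_real (trace n l)) \<in> borel_measurable \<mu>" using s(1)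
      by (simp cong: measurable_cong_sets)
    then have i: "integrable \<mu> (\<lambda>l. complex_of_real (trace n l))"
      by (rule integrable_of_square[OF s(2) _ c(1)])
    have "cnj (f x) * T (real n * L) f x = 0" for x
    proof (cases "x \<in> {0<..<L}")
      case True
      then have "x - real n * L \<notin> {0<..<L}" "x + real n * L \<notin> {0<..<L}"
        using nL unfolding greaterThanLessThan_iff by linarith+
      then show ?thesis using supp by (simp add: T_def)
    qed (use supp in simp)
    then have "inner_L2 f (T (real n * L) f) = 0" unfolding inner_L2_def
      by (simp only: Bochner_Integration.integral_zero)
    then have "complex_of_real (\<integral>l. trace n l \<partial>\<mu>) = 0" using c(2) by (simp add: integral_complex_of_real)
    moreover have "integrable \<mu> (trace n)" using i by (simp add: complex_of_real_integrable_eq)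
    ultimately show ?thesis using False by simp
  qed
  then show "integrable \<mu> (trace n)" "(\<integral>l. trace n l \<partial>\<mu>) = (if n = 0 then 2 * measure \<mu> (space \<mu>) else 0)"
    by auto
qed

text \<open>The functions \<open>trace n\<close> are orthogonal in \<open>L\<^sup>2(\<mu>)\<close>, so Bessel's inequality rules out atoms.\<close>

lemma no_atoms:
  assumes f: "sq_int f" and m: "spec_meas V f \<mu>" and supp: "\<And>x. x \<notin> {0<..<L} \<Longrightarrow> f x = 0"
  shows "measure \<mu> {l0} = 0"
proof (rule ccontr)
  assume "measure \<mu> {l0} \<noteq> 0"
  then have p: "0 < measure \<mu> {l0}" using measure_nonneg[of \<mu> "{l0}"] by linarith
  note s = spec_measD[OF f m]
  interpret finite_measure \<mu> by (rule s(2))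
  define M where "M = measure \<mu> (space \<mu>)"
  define p' where "p' = measure \<mu> {l0}"
  have mom: "integrable \<mu> (trace n)" "integral\<^sup>L \<mu> (trace n) = (if n = 0 then 2 * M else 0)" for n
    using trace_moments[OF f m supp] by (simp_all add: M_def)
  have prod: "trace i l * trace j l = trace (i + j) l + trace (max i j - min i j) l" for i j l
  proof (cases "i \<le> j")
    case True
    then show ?thesis using trace_product[of i l "j - i"] by (simp add: max_def min_def mult_2)
  next
    case False
    then show ?thesis using trace_product[of j l "i - j"]
      by (simp add: max_def min_def mult_2 mult.commute add.commute)
  qed
  have pi: "integrable \<mu> (\<lambda>l. trace i l * trace j l)" for i j
    unfolding prod by (intro Bochner_Integration.integrable_add mom(1))
  have pI: "(\<integral>l. trace i l * trace j l \<partial>\<mu>) = (if i = j then 2 * M else 0)" if "1 \<le> i" for i j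
  proof -
    have "(\<integral>l. trace i l * trace j l \<partial>\<mu>) = (\<integral>l. trace (i + j) l \<partial>\<mu>) + (\<integral>l. trace (max i j - min i j) l \<partial>\<mu>)"
      unfolding prod by (rule Bochner_Integration.integral_add[OF mom(1) mom(1)])
    then show ?thesis using that by (auto simp: mom(2) max_def min_def)
  qed
  \<comment> \<open>\<open>S N\<close> is built so that its value at \<open>l0\<close> is
    \<open>A N\<close>; an atom of mass \<open>p'\<close> then contributes
    \<open>p' * (A N)\<^sup>2\<close> to its square integral \<open>2 * M * A N\<close>. Sums start
    at 1 because \<open>trace 0 = 2\<close> has square integral \<open>4 * M\<close>.\<close>
  define A where "A N = (\<Sum>n\<in>{1..N}. (trace n l0)\<^sup>2)" for N
  define S where "S N l = (\<Sum>n\<in>{1..N}. trace n l0 * trace n l)" for N l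
  have bessel: "p' * (A N)\<^sup>2 \<le> 2 * M * A N" for N
  proof -
    have Sq: "(S N l)\<^sup>2 = (\<Sum>i\<in>{1..N}. \<Sum>j\<in>{1..N}. (trace i l0 * trace j l0) * (trace i l * trace j l))" for l
      unfolding S_def power2_eq_square sum_product by (simp add: mult_ac)
    have Si: "integrable \<mu> (\<lambda>l. (S N l)\<^sup>2)"
      unfolding Sq by (intro Bochner_Integration.integrable_sum integrable_mult_right pi)
    have "(\<integral>l. (S N l)\<^sup>2 \<partial>\<mu>) = (\<Sum>i\<in>{1..N}. \<Sum>j\<in>{1..N}. (trace i l0 * trace j l0) * (\<integral>l. trace i l
      * trace j l \<partial>\<mu>))"
      unfolding Sq by (simp add: Bochner_Integration.integral_sum integrable_mult_right pi)
    also have "\<dots> = (\<Sum>i\<in>{1..N}. \<Sum>j\<in>{1..N}. if i = j then (trace i l0)\<^sup>2 * (2 * M) else 0)"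
      by (intro sum.cong refl) (simp add: pI power2_eq_square)
    also have "\<dots> = 2 * M * A N" by (simp add: A_def sum_distrib_left mult.commute)
    finally have SI: "(\<integral>l. (S N l)\<^sup>2 \<partial>\<mu>) = 2 * M * A N" .
    have "S N l0 = A N" by (simp add: S_def A_def power2_eq_square)
    have l0: "{l0} \<in> sets \<mu>" using s(1) by simp
    have "p' * (A N)\<^sup>2 = (\<integral>l. indicator {l0} l * (A N)\<^sup>2 \<partial>\<mu>)"
      using l0 by (simp add: p'_def)
    also have "\<dots> \<le> (\<integral>l. (S N l)\<^sup>2 \<partial>\<mu>)"
    proof (rule integral_mono[OF _ Si])
      show "integrable \<mu> (\<lambda>l. indicator {l0} l * (A N)\<^sup>2)"
        by (intro integrable_mult_left integrable_real_indicator l0) (simp add: emeasure_eq_measure)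
      show "indicator {l0} l * (A N)\<^sup>2 \<le> (S N l)\<^sup>2" for l
        using \<open>S N l0 = A N\<close> by (cases "l = l0") auto
    qed
    finally show ?thesis unfolding SI .
  qed
  have A0: "0 \<le> A N" for N by (simp add: A_def sum_nonneg)
  have M0: "0 \<le> M" by (simp add: M_def)
  have pA: "p' * A N \<le> 2 * M" for N
  proof (cases "A N = 0")
    case False
    then have "0 < A N" using A0[of N] by linarith
    moreover have "(p' * A N) * A N \<le> (2 * M) * A N" using bessel[of N]
      by (simp add: power2_eq_square mult.assoc)
    ultimately show ?thesis by (simp add: mult_le_cancel_right)
  qed (use M0 in simp)
  \<comment> \<open>Since \<open>trace (2 * n) = (trace n)\<^sup>2 - 2\<close>, the two cannot both
    be small. Hence \<open>A\<close> grows at least linearly, against the bound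
    \<open>p' * A N \<le> 2 * M\<close>.\<close>
  have growth: "real N \<le> 2 * A (2 * N)" for N
  proof -
    have "1 \<le> (trace n l0)\<^sup>2 + (trace (2 * n) l0)\<^sup>2" for n
    proof -
      have e: "trace (2 * n) l0 = (trace n l0)\<^sup>2 - 2" using trace_product[of n l0 0] trace_0
        by (simp add: power2_eq_square)
      show ?thesis
      proof (cases "1 \<le> (trace n l0)\<^sup>2")
        case False
        then have "1 \<le> (2 - (trace n l0)\<^sup>2)\<^sup>2" using one_le_power[of "2 - (trace n l0)\<^sup>2" 2] by simp
        then show ?thesis unfolding e power2_commute[of _ 2] using zero_le_power2[of "trace n l0"]
          by linarith
      qed (use zero_le_power2[of "trace (2 * n) l0"] in linarith)
    qed
    then have "(\<Sum>n\<in>{1..N}. 1) \<le> (\<Sum>n\<in>{1..N}. (trace n l0)\<^sup>2 + (trace (2 * n) l0)\<^sup>2)" by (intro sum_mono)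
    also have "\<dots> = (\<Sum>n\<in>{1..N}. (trace n l0)\<^sup>2) + (\<Sum>n\<in>{1..N}. (trace (2 * n) l0)\<^sup>2)" by (rule sum.distrib)
    also have "\<dots> \<le> A (2 * N) + A (2 * N)"
    proof (rule add_mono)
      show "(\<Sum>n\<in>{1..N}. (trace n l0)\<^sup>2) \<le> A (2 * N)" unfolding A_def by (rule sum_mono2) auto
      have "(\<Sum>n\<in>{1..N}. (trace (2 * n) l0)\<^sup>2) = (\<Sum>n\<in>(\<lambda>n. 2 * n) ` {1..N}. (trace n l0)\<^sup>2)"
        by (subst sum.reindex) (auto simp: inj_on_def)
      also have "\<dots> \<le> A (2 * N)" unfolding A_def by (rule sum_mono2) auto
      finally show "(\<Sum>n\<in>{1..N}. (trace (2 * n) l0)\<^sup>2) \<le> A (2 * N)" .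
    qed
    finally show ?thesis by simp
  qed
  have p'0: "0 < p'" using p by (simp add: p'_def)
  obtain N where N: "4 * M < real N * p'" using reals_Archimedean3[OF p'0] by blast
  have "p' * real N \<le> p' * (2 * A (2 * N))" using growth p'0 by (intro mult_left_mono) auto
  then show False using N pA[of "2 * N"] by (simp add: mult.commute)
qed

text \<open>For \<open>g = D - F\<close> both calculi make \<open>CT \<mu> g\<close> vanish, so
  \<open>- g z * CT \<mu> 1 z\<close> equals an integral \<open>E z\<close> continuous up to the
  real axis. Where \<open>g \<noteq> 0\<close>, the transform of \<open>\<mu>\<close> extends
  continuously with real boundary values, so its imaginary part tends to 0 locally uniformly and
  \<open>null_by_small_balls\<close> applies.\<close>

lemma fcalc_determines_AE:
  assumes F: "fcalc_eq V F (T L)" and Fh: "F holomorphic_on UNIV"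
    and f: "sq_int f" and m: "spec_meas V f \<mu>"
  shows "AE l in \<mu>. discr V L (complex_of_real l) = F (complex_of_real l)"
proof -
  note s = spec_measD[OF f m]
  interpret finite_measure \<mu> by (rule s(2))
  have [measurable_cong]: "sets \<mu> = sets borel" by (rule s(1))
  define D where "D = discr V L"
  have Dh: "D holomorphic_on UNIV" unfolding D_def by (rule discr_holomorphic[OF lV])
  have fD: "fcalc_eq V D (T L)" unfolding D_def by (rule fcalc_periodic)
  have int: "integrable \<mu> (\<lambda>l. k (complex_of_real l))" "(\<lambda>l. k (complex_of_real l))
    \<in> borel_measurable borel"
    if k: "fcalc_eq V k (T L)" "k holomorphic_on UNIV" for k
  proof -
    show km: "(\<lambda>l. k (complex_of_real l)) \<in> borel_measurable borel"
      by (intro borel_measurable_continuous_onI continuous_on_compose2[OF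
        holomorphic_on_imp_continuous_on[OF k(2)]] continuous_intros) auto
    show "integrable \<mu> (\<lambda>l. k (complex_of_real l))"
    proof (rule integrable_of_square[OF s(2)])
      show "(\<lambda>l. k (complex_of_real l)) \<in> borel_measurable \<mu>" using km by measurable
      show "integrable \<mu> (\<lambda>l. (cmod (k (complex_of_real l)))\<^sup>2)" using k f m unfolding fcalc_eq_def by blast
    qed
  qed
  note iD = int[OF fD Dh] and iF = int[OF F Fh]
  define g where "g z = D z - F z" for z
  have gh: "g holomorphic_on UNIV" unfolding g_def by (intro holomorphic_intros Dh Fh)
  have gc: "continuous_on UNIV g" by (rule holomorphic_on_imp_continuous_on[OF gh])
  have gi: "integrable \<mu> (\<lambda>l. g (complex_of_real l))" unfolding g_def using iD iF by simp
  have gCT: "CT \<mu> (\<lambda>l. g (complex_of_real l)) z = 0" if z: "Im z \<noteq> 0" for z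
  proof -
    have "CT \<mu> (\<lambda>l. g (complex_of_real l)) z = CT \<mu> (\<lambda>l. D (complex_of_real l)) z
      - CT \<mu> (\<lambda>l. F (complex_of_real l)) z"
      unfolding CT_def g_def diff_divide_distrib
      by (rule Bochner_Integration.integral_diff[OF CT_integrable[OF s(1) iD(1) z] CT_integrable[OF s(1)
        iF(1) z]])
    then show ?thesis using fcalc_CT[OF fD iD(2) f m z] fcalc_CT[OF F iF(2) f m z] by simp
  qed
  define E where "E z = (\<integral>l. diff_quot g z (complex_of_real l) \<partial>\<mu>)" for z
  have Ec: "continuous_on UNIV E" unfolding E_def by (rule diff_quot_integral_continuous[OF s(1,2) gh gi])
  have Ee: "E z = - g z * CT \<mu> (\<lambda>_. 1) z" if "Im z \<noteq> 0" for z
    unfolding E_def diff_quot_integral_eq[OF s(1,2) gi that] gCT[OF that] by simp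
  define U where "U = {l. g (complex_of_real l) \<noteq> 0}"
  have "AE l in \<mu>. l \<notin> U"
  proof (rule null_by_small_balls[OF s(1,2)])
    show "open U" unfolding U_def
      by (intro open_Collect_neq continuous_intros continuous_on_compose2[OF gc]) auto
    fix x assume "x \<in> U"
    moreover have "open {z. g z \<noteq> 0}" by (intro open_Collect_neq continuous_intros gc)
    ultimately obtain \<rho> where \<rho>: "0 < \<rho>" "cball (complex_of_real x) \<rho> \<subseteq> {z. g z \<noteq> 0}"
      using open_contains_cball[of "{z. g z \<noteq> 0}"] unfolding U_def by blast
    define K where "K = cball (complex_of_real x) \<rho>"
    define h where "h z = - E z / g z" for z
    have hc: "continuous_on K h" unfolding h_def
      by (intro continuous_intros continuous_on_subset[OF Ec] continuous_on_subset[OF gc])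
        (use \<rho>(2) in \<open>auto simp: K_def\<close>)
    have he: "h z = CT \<mu> (\<lambda>_. 1) z" if "z \<in> K" "Im z \<noteq> 0" for z
      using Ee[OF that(2)] that(1) \<rho>(2) unfolding h_def K_def by auto
    \<comment> \<open>The transform takes conjugate values at conjugate points, while the continuous
      extension has the same limit from above and from below; so this limit is real.\<close>
    have hr: "Im (h (complex_of_real y)) = 0" if y: "\<bar>y - x\<bar> \<le> \<rho> / 2" for y
    proof -
      define e where "e n = (\<rho> / 2) / real (Suc n)" for n
      have e: "0 < e n" "e n \<le> \<rho> / 2" for n using \<rho>(1) by (auto simp: e_def divide_le_eq)
      have e0: "e \<longlonglongrightarrow> 0" unfolding e_def by (rule LIMSEQ_Suc[OF lim_const_over_n])
      define p where "p n = complex_of_real y + \<i> * complex_of_real (e n)" for n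
      define q where "q n = complex_of_real y - \<i> * complex_of_real (e n)" for n
      have yK: "complex_of_real y \<in> K"
        using y \<rho>(1) unfolding K_def mem_cball dist_norm of_real_diff[symmetric] norm_of_real
        by (simp add: abs_minus_commute)
      have pq: "p n \<in> K" "q n \<in> K" for n
      proof -
        have "cmod (complex_of_real x - p n) \<le> \<bar>y - x\<bar> + e n" "cmod (complex_of_real x - q n)
          \<le> \<bar>y - x\<bar> + e n"
          using cmod_le[of "complex_of_real x - p n"] cmod_le[of "complex_of_real x - q n"] e(1)[of n]
          by (simp_all add: p_def q_def abs_minus_commute)
        then show "p n \<in> K" "q n \<in> K" using y e(2)[of n] by (auto simp: K_def dist_norm)
      qed
      have pl: "p \<longlonglongrightarrow> complex_of_real y" and ql: "q \<longlonglongrightarrow> complex_of_real y"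
      proof -
        have "p \<longlonglongrightarrow> complex_of_real y + \<i> * complex_of_real 0" "q \<longlonglongrightarrow> complex_of_real y - \<i> * complex_of_real 0"
          unfolding p_def q_def by (intro tendsto_intros e0)+
        then show "p \<longlonglongrightarrow> complex_of_real y" "q \<longlonglongrightarrow> complex_of_real y" by simp_all
      qed
      have 1: "(\<lambda>n. h (p n)) \<longlonglongrightarrow> h (complex_of_real y)" "(\<lambda>n. h (q n)) \<longlonglongrightarrow> h (complex_of_real y)"
        using hc yK pq pl ql unfolding continuous_on_sequentially o_def by blast+
      have "h (q n) = cnj (h (p n))" for n
      proof -
        have n: "Im (p n) \<noteq> 0" "Im (q n) \<noteq> 0" using e(1)[of n] by (auto simp: p_def q_def)
        have "q n = cnj (p n)" by (simp add: p_def q_def)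
        then show ?thesis unfolding he[OF pq(1) n(1)] he[OF pq(2) n(2)] CT_def
          by (simp only: cnj_cauchy_transform)
      qed
      then have "(\<lambda>n. cnj (h (p n))) \<longlonglongrightarrow> h (complex_of_real y)" using 1(2) by simp
      moreover have "(\<lambda>n. cnj (h (p n))) \<longlonglongrightarrow> cnj (h (complex_of_real y))" by (intro tendsto_intros 1(1))
      ultimately have "cnj (h (complex_of_real y)) = h (complex_of_real y)" using LIMSEQ_unique by blast
      then show ?thesis by (simp add: complex_eq_iff)
    qed
    have unif: "uniformly_continuous_on K h"
      by (rule compact_uniformly_continuous[OF hc]) (simp add: K_def)
    have r: "0 < \<rho> / 2" using \<rho>(1) by simp
    show "\<exists>r>0. \<forall>\<eta>>0. \<exists>d>0. \<forall>e E. 0 < e \<longrightarrow> e < d \<longrightarrow> \<bar>E - x\<bar> \<le> r \<longrightarrow> measure \<mu> (cball E e) \<le> \<eta> * e"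
    proof (rule exI[of _ "\<rho> / 2"], rule conjI[OF r], intro allI impI)
      fix \<eta> :: real assume "0 < \<eta>"
      then have eta: "0 < \<eta> / 2" by simp
      obtain d where d: "0 < d" "\<And>z w. z \<in> K \<Longrightarrow> w \<in> K \<Longrightarrow> dist w z < d \<Longrightarrow> dist (h w) (h z) < \<eta> / 2"
        using unif eta unfolding uniformly_continuous_on_def by meson
      show "\<exists>d>0. \<forall>e E. 0 < e \<longrightarrow> e < d \<longrightarrow> \<bar>E - x\<bar> \<le> \<rho> / 2 \<longrightarrow> measure \<mu> (cball E e) \<le> \<eta> * e"
      proof (intro exI[of _ "min d (\<rho> / 2)"] conjI allI impI)
        show "0 < min d (\<rho> / 2)" using d \<rho> by simp
        fix e y :: real assume e: "0 < e" "e < min d (\<rho> / 2)" "\<bar>y - x\<bar> \<le> \<rho> / 2"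
        define z where "z = Complex y e"
        have z: "Im z \<noteq> 0" using e by (simp add: z_def)
        have yK: "complex_of_real y \<in> K"
          using e(3) \<rho>(1) unfolding K_def mem_cball dist_norm of_real_diff[symmetric] norm_of_real
          by (simp add: abs_minus_commute)
        have "cmod (complex_of_real x - z) \<le> \<bar>y - x\<bar> + e"
          using cmod_le[of "complex_of_real x - z"] e(1) by (simp add: z_def abs_minus_commute)
        then have zK: "z \<in> K" using e by (auto simp: K_def dist_norm)
        have "z - complex_of_real y = \<i> * complex_of_real e" by (simp add: z_def complex_eq_iff)
        then have "dist z (complex_of_real y) = e" using e(1) by (simp add: dist_norm norm_mult)
        then have "dist (h z) (h (complex_of_real y)) < \<eta> / 2" using d(2)[OF yK zK] e by simp
        then have "\<bar>Im (h z - h (complex_of_real y))\<bar> < \<eta> / 2"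
          using abs_Im_le_cmod[of "h z - h (complex_of_real y)"] unfolding dist_norm by linarith
        then have "Im (h z) \<le> \<eta> / 2" using hr[OF e(3)] by simp
        then have "2 * e * Im (CT \<mu> (\<lambda>_. 1) z) \<le> 2 * e * (\<eta> / 2)"
          unfolding he[OF zK z] using e(1) by (intro mult_left_mono) auto
        then show "measure \<mu> (cball y e) \<le> \<eta> * e"
          using Im_CT_ball[OF s(1,2) e(1), of y] unfolding z_def by (simp add: mult.commute)
      qed
    qed
  qed
  then show ?thesis by eventually_elim (simp add: U_def g_def D_def)
qed

text \<open>Distinct entire functions agree on a countable set only. Having full measure without
  atoms, that set would make the spectral measure of the nonzero vector \<open>c\<close>
  trivial.\<close>

theorem fcalc_determines:
  assumes F: "fcalc_eq V F (T L)" and Fh: "F holomorphic_on UNIV"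
  shows "discr V L = F"
proof (rule ccontr)
  assume ne: "discr V L \<noteq> F"
  have Dh: "discr V L holomorphic_on UNIV" by (rule discr_holomorphic[OF lV])
  have Z: "countable {z. discr V L z = F z}"
    using holomorphic_countable_equal_UNIV[OF Dh Fh] ne by blast
  have L2: "0 < L / 2" using L by simp
  \<comment> \<open>Centre and radius \<open>L / 2\<close>: the cutoff lives in the open interval
    \<open>{0<..<L}\<close>, as \<open>no_atoms\<close> requires.\<close>
  obtain c c' c'' where c: "acd c c'" "acd c' c''" and c0: "\<And>x. \<bar>x - L/2\<bar> < L/2 \<Longrightarrow> c x \<noteq> (0::complex)"
    and c1: "\<And>x. L/2 \<le> \<bar>x - L/2\<bar> \<Longrightarrow> c x = 0 \<and> c' x = 0 \<and> c'' x = 0"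
    using cutoff_exists[OF L2, of "L/2"] by metis
  have supp: "c x = 0" if "x \<notin> {0<..<L}" for x 
    using that unfolding greaterThanLessThan_iff by (intro c1[THEN conjunct1]) linarith
  have cc: "continuous_on UNIV c" by (rule acd_continuous[OF c(1)])
  have f: "sq_int c" by (rule sq_int_compact_support[OF cc, of 0 L]) (use supp in auto)
  obtain \<mu> where m: "spec_meas V c \<mu>" using spec_meas_exists[OF f] by blast
  note s = spec_measD[OF f m]
  interpret finite_measure \<mu> by (rule s(2))
  define N where "N = {l. discr V L (complex_of_real l) = F (complex_of_real l)}"
  have cN: "countable N"
  proof -
    have "complex_of_real ` N \<subseteq> {z. discr V L z = F z}" by (auto simp: N_def)
    then have "countable (complex_of_real ` N)" using Z countable_subset by blast
    then show ?thesis by (rule countable_image_inj_on) (simp add: inj_on_def)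
  qed
  have "(\<Union>l\<in>N. {l}) \<in> null_sets \<mu>"
  proof (rule null_sets_UN'[OF cN])
    fix l
    have "{l} \<in> sets \<mu>" using s(1) by simp
    moreover have "emeasure \<mu> {l} = 0" using no_atoms[OF f m supp, of l] by (simp add: emeasure_eq_measure)
    ultimately show "{l} \<in> null_sets \<mu>" by auto
  qed
  then have "AE l in \<mu>. l \<notin> N" by (intro AE_not_in) simp
  moreover have "AE l in \<mu>. l \<in> N"
    using fcalc_determines_AE[OF F Fh f m] by (simp add: N_def)
  ultimately have AE0: "AE l in \<mu>. False" by eventually_elim simp
  \<comment> \<open>A trivial spectral measure kills all the diagonal resolvent elements of
    \<open>c\<close>, and \<open>R_weak\<close> then gives \<open>inner_L2 c c = 0\<close>.\<close>
  have "CT \<mu> (\<lambda>_. 1) z = 0" for z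
    unfolding CT_def by (rule integral_eq_zero_AE) (use AE0 in eventually_elim, simp)
  then have "inner_L2 c (R z c) = 0" if "Im z \<noteq> 0" for z using s(3)[OF that] by simp
  then have "inner_L2 c (R (\<i> * complex_of_real (real (Suc n))) c) = 0" for n by simp
  then have "(\<lambda>n::nat. 0) \<longlonglongrightarrow> inner_L2 c c" using R_weak[OF f f] by (simp only: mult_zero_right)
  then have "inner_L2 c c = 0" using LIMSEQ_unique tendsto_const by blast
  then have "nrm2 c = 0" by (simp add: inner_L2_self)
  then have "c = (\<lambda>_. 0)" by (rule nrm2_eq_0_continuous[OF f _ cc])
  then show False using c0[of "L/2"] L by simp
qed

end

theorem theorem5p1:
  fixes V0 V :: "real \<Rightarrow> real" and L :: real
  assumes "L > 0"
    and "loc_int V0"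
    and "\<forall>x. V0 (x + L) = V0 x"
    and "L1_loc_unif V"
  shows "fcalc_eq V (discr V0 L) (\<lambda>f x. shift L f x + shift (-L) f x) \<longleftrightarrow> V \<in> iso_torus V0 L"
proof -
  have T: "(\<lambda>f x. shift L f x + shift (-L) f x) = T L" by (rule ext) (rule T_shift)
  have l0: "locint V0" using assms(2) by (simp add: loc_int_iff)
  have lV: "locint V" using assms(4) by (simp add: L1_loc_unif_def loc_int_iff)
  interpret schroedinger V by unfold_locales (rule assms(4))
  show ?thesis unfolding T
  proof
    assume F: "fcalc_eq V (discr V0 L) (T L)"
    have "R \<i> (T L f) = T L (R \<i> f)" if "sq_int f" for f
      by (rule T_commutes_R[OF F discr_measurable[OF l0] discr_real[OF l0] that]) simp
    then have per: "AE x in lebesgue. V (x + L) = V x" by (rule commuting_imp_periodic[OF _ assms(1)])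
    \<comment> \<open>Only with periodicity established does the analysis of periodic potentials
      become available for \<open>V\<close>.\<close>
    interpret periodic_schroedinger V L by unfold_locales (rule lV, rule per, rule assms(1))
    have "discr V L = discr V0 L" by (rule fcalc_determines[OF F discr_holomorphic[OF l0]])
    then show "V \<in> iso_torus V0 L" using lV per by (simp add: iso_torus_def loc_int_iff)
  next
    assume "V \<in> iso_torus V0 L"
    then have per: "AE x in lebesgue. V (x + L) = V x" and D: "discr V L = discr V0 L"
      by (auto simp: iso_torus_def)
    interpret periodic_schroedinger V L by unfold_locales (rule lV, rule per, rule assms(1))
    show "fcalc_eq V (discr V0 L) (T L)" using fcalc_periodic unfolding D .
  qed
qed

end
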